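(* Suppose $d=2n=4$, $6$, or $10$. Let $\mathfrak t$ be the minimal supertranslation algebra in dimension $d$ (that is, $\mathcal N=1$ for $d=4$, and $\mathcal N=(1,0)$ for $d=6,10$), let $Q$ be a holomorphic supercharge in $\mathfrak t$, which identifies $\mathbb R^{2n}$ with $\mathbb C^n$, and let $A_Q$ be the $Q$-twisted tautological filtered cdgsa of $\mathfrak t$. Then there is a $GL(n;\mathbb C)$-equivariant quasi-isomorphism of filtered local cdgsa's on $\mathbb C^n$ $$\Phi\colon (u)^{-1}\mathrm{Dol}(\mathbb C^n)\xrightarrow{\ \simeq\ }(u)^{-1}A_Q .$$
   Context: **Conventions.** A cgsa is an algebra that is graded-commutative with respect to a bigrading by $\mathbb Z\times\mathbb Z/2$ (signs are governed by the total parity: integer degree plus $\mathbb Z/2$-parity, mod 2). A cdgsa is a cgsa with a square-zero derivation of bidegree $(1,+)$. It is *local* on a manifold if it is the space of sections of a bigraded vector bundle, with differential a differential operator and product a bidifferential operator. It is *filtered* if it carries a decreasing multiplicative filtration preserved by the differential. All algebras are over $\mathbb C$ and functions are complex valued. **Supertranslation algebras.** $\mathfrak t=\mathfrak t_1\oplus\mathfrak t_2$ is a graded Lie algebra with odd part $\mathfrak t_1$ in degree 1 and $\mathfrak t_2=V=\mathbb C^{d}$, the vector representation of $\mathfrak{so}(d,\mathbb C)$, in degree 2; $V$ is the complexification of $\mathbb R^d$. The only bracket is a symmetric map $\mathfrak t_1\otimes\mathfrak t_1\to V$. - $d=4$: $\mathfrak t_1=S_+\oplus S_-$ (the two chiral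 spin representations), with bracket given by the equivariant isomorphism $S_+\otimes S_-\cong V$ extended by zero. - $d=6$: $\mathfrak t_1=S_+\otimes R$, with $S_+$ the 4-dimensional semi-spin representation and $(R,\omega_R)$ a 2-dimensional symplectic vector space; the bracket is the tensor product of the isomorphism $\wedge^2S_+\cong V$ with $\omega_R$. - $d=10$: $\mathfrak t_1=S_+$ (the 16-dimensional chiral spin representation), with bracket the unique (up to scale) equivariant projection $\mathrm{Sym}^2S_+\to V$. **Nilpotence variety.** $Y=\{q\in\mathfrak t_1: [q,q]=0\}$, with coordinate ring $\mathcal O_Y=\mathrm{Sym}(\mathfrak t_1^\vee)/I$, where $I$ is generated by the components of $[\lambda,\lambda]\in V$, $\lambda$ being the tautological element. Choose a basis $e_a$ of $\mathfrak t_1$ with dual coordinates $\lambda^a$, and write $[e_a,e_b]=\Gamma^\mu_{ab}P_\mu$. **Tautological cdgsa.** Let $T$ be the super Lie group of $\mathfrak t$, with even part $T_+=\mathbb R^d$. Then $C^\infty(T)=C^\infty(\mathbb R^d)\otimes\wedge^\bullet(\mathfrak t_1^\vee)$ with odd coordinates $\theta^a$. Put $A=C^\infty(T)\otimes_{\mathbb C}\mathcal O_Y$, with $\theta^a$ in bidegree $(0,-)$ and $\lambda^a$ in bidegree $(1,-)$. Let $R,L\colon\mathfrak t\to\mathrm{Vect}(T)$ be the two commuting actions of $\mathfrak t$ by vector fields on the right and on the left; up to normalization of coordinates, $R(e_a)=\partial_{\theta^a}-\tfrac12\Gamma^\mu_{ab}\theta^b\partial_\mu$ and $L(e_a)=\partial_{\theta^a}+\tfrac12\Gamma^\mu_{ab}\theta^b\partial_\mu$.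 The differential on $A$ is $\mathcal D=\sum_a\lambda^aR(e_a)$. **Twist.** For $Q\in Y$ put $\mathcal Q=L(Q)$ and $A_Q=(A[u],\mathcal D+u\mathcal Q)$, with $u$ of bidegree $(1,-)$. The filtration $F^kA_Q$ is spanned by elements of weight $\ge k$, where $\lambda^a,\theta^a,u$ have weight 1 and functions on $\mathbb R^d$ have weight 0. The notation $(u)^{-1}(-)$ means inverting $u$. **Holomorphic supercharge.** $Q$ is a nonzero element of $S_+$ for $d=4$, a nonzero element of $Y$ (i.e. a nonzero rank-one tensor) for $d=6$, and a nonzero element of $Y$ (a pure spinor) for $d=10$. Then $L=[Q,\mathfrak t_1]\subset V$ is a maximal isotropic ($n$-dimensional) subspace, and $\mathbb R^{2n}$ is identified with $\mathbb C^n$ so that the vector fields $\partial/\partial\bar z_i$ span $L$. **Dolbeault family.** $\mathrm{Dol}(\mathbb C^n)=(\Omega^{0,\bullet}(\mathbb C^n)[u],\,u\bar\partial)$, with $u$ of bidegree $(1,-)$ and $d\bar z_i$ of bidegree $(0,-)$. Its filtration is by weight, with $u$ and $d\bar z_i$ of weight 1 and functions of weight 0. **Equivariance.** $\mathrm{Dol}(\mathbb C^n)$ is equivariant in the obvious fashion for the linear action of $\mathfrak{gl}(n)$ on $\mathbb C^n$. On the other side, $\mathfrak{gl}(n)=\mathfrak{gl}(L)\subset\mathfrak{so}(V)$ is the stabilizer of the decomposition $V=L\oplus L^\vee$, and the spin representations are identified with the even and odd parts of $\wedge^\bullet L^\vee$. The twist of these by a square root of the determinant line of $L$ (the square root of the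 canonical bundle) is trivialized and ignored.
   Formalization: GL(n;C)-equivariance is proved for the Lie algebra gl(n) inside so(V), and the square root of the determinant is kept instead of ignored: u has weight -trace/2 and each dz̄_i is twisted by +trace/2; on sl(n) the action is the obvious one. *)

theory Defs
  imports "HOL-Analysis.Analysis" "HOL-Algebra.QuotRing"
begin

definition pd :: "'x::euclidean_space \<Rightarrow> ('x \<Rightarrow> complex) \<Rightarrow> 'x \<Rightarrow> complex" where
  "pd v f x = frechet_derivative f (at x) v"

definition smooth :: "('x::euclidean_space \<Rightarrow> complex) \<Rightarrow> bool" where
  "smooth f \<longleftrightarrow> (\<forall>vs. foldr pd vs f differentiable_on UNIV)"

text \<open>
  The data of a filtered local cdgsa over the functions on \<open>'x\<close>, with a distinguished
  parameter \<open>u\<close>. The field \<open>fn\<close> is the inclusion of smooth functions (on constants it is the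
  structure map of the algebra over the complex numbers). In \<open>bideg R i s\<close>, \<open>i\<close> is the integer
  degree and \<open>s\<close> is the parity, \<open>True\<close> being the odd one.
\<close>

record ('x, 'a) cdgsa = "'a ring" +
  fn :: "('x \<Rightarrow> complex) \<Rightarrow> 'a"
  par :: 'a
  dif :: "'a \<Rightarrow> 'a"
  bideg :: "int \<Rightarrow> bool \<Rightarrow> 'a set"
  filt :: "int \<Rightarrow> 'a set"

text \<open>
  Grothendieck's differential operators of order at most \<open>k\<close>, between modules over the
  functions on two manifolds that are identified by the pullback of functions \<open>\<zeta>\<close>.
\<close>

primrec diff_op ::
  "(('x::euclidean_space \<Rightarrow> complex) \<Rightarrow> 'y \<Rightarrow> complex) \<Rightarrow> ('x, 'a, 'm) cdgsa_scheme \<Rightarrow>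
   ('y, 'b, 'k) cdgsa_scheme \<Rightarrow> nat \<Rightarrow> ('a \<Rightarrow> 'b) \<Rightarrow> bool" where
  "diff_op \<zeta> R S 0 T \<longleftrightarrow>
     (\<forall>g. smooth g \<longrightarrow> (\<forall>x\<in>carrier R. T (fn R g \<otimes>\<^bsub>R\<^esub> x) = fn S (\<zeta> g) \<otimes>\<^bsub>S\<^esub> T x))"
| "diff_op \<zeta> R S (Suc k) T \<longleftrightarrow>
     (\<forall>g. smooth g \<longrightarrow>
        diff_op \<zeta> R S k (\<lambda>x. (fn S (\<zeta> g) \<otimes>\<^bsub>S\<^esub> T x) \<ominus>\<^bsub>S\<^esub> T (fn R g \<otimes>\<^bsub>R\<^esub> x)))"

definition filtered_local_cdgsa_hom ::
  "(('x::euclidean_space \<Rightarrow> complex) \<Rightarrow> 'y \<Rightarrow> complex) \<Rightarrow> ('x, 'a, 'm) cdgsa_scheme \<Rightarrow>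
   ('y, 'b, 'k) cdgsa_scheme \<Rightarrow> ('a \<Rightarrow> 'b) \<Rightarrow> bool" where
  "filtered_local_cdgsa_hom \<zeta> R S \<Phi> \<longleftrightarrow>
     \<Phi> \<in> ring_hom R S \<and>
     (\<forall>c. \<Phi> (fn R (\<lambda>_. c)) = fn S (\<lambda>_. c)) \<and>
     \<Phi> (par R) = par S \<and>
     (\<forall>x\<in>carrier R. \<Phi> (dif R x) = dif S (\<Phi> x)) \<and>
     (\<forall>i s. \<Phi> ` bideg R i s \<subseteq> bideg S i s) \<and>
     (\<forall>k. \<Phi> ` filt R k \<subseteq> filt S k) \<and>
     (\<exists>k. diff_op \<zeta> R S k \<Phi>)"

text \<open>
  Cohomology of the quotient complex \<open>C / C\<^sub>0\<close>, for subcomplexes \<open>C\<^sub>0 \<subseteq> C\<close> of \<open>R\<close>.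
\<close>

definition cocycles :: "('x, 'a, 'm) cdgsa_scheme \<Rightarrow> 'a set \<Rightarrow> 'a set \<Rightarrow> 'a set" where
  "cocycles R C C\<^sub>0 = {x \<in> C. dif R x \<in> C\<^sub>0}"

definition coboundaries :: "('x, 'a, 'm) cdgsa_scheme \<Rightarrow> 'a set \<Rightarrow> 'a set \<Rightarrow> 'a set" where
  "coboundaries R C C\<^sub>0 = dif R ` C <+>\<^bsub>R\<^esub> C\<^sub>0"

definition cohomology :: "('x, 'a, 'm) cdgsa_scheme \<Rightarrow> 'a set \<Rightarrow> 'a set \<Rightarrow> 'a set set" where
  "cohomology R C C\<^sub>0 = (\<lambda>x. coboundaries R C C\<^sub>0 +>\<^bsub>R\<^esub> x) ` cocycles R C C\<^sub>0"

definition cohomology_iso ::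
  "('x, 'a, 'm) cdgsa_scheme \<Rightarrow> 'a set \<Rightarrow> 'a set \<Rightarrow>
   ('y, 'b, 'k) cdgsa_scheme \<Rightarrow> 'b set \<Rightarrow> 'b set \<Rightarrow> ('a \<Rightarrow> 'b) \<Rightarrow> bool" where
  "cohomology_iso R C C\<^sub>0 S E E\<^sub>0 \<Phi> \<longleftrightarrow>
     bij_betw (\<lambda>c. coboundaries S E E\<^sub>0 <+>\<^bsub>S\<^esub> \<Phi> ` c) (cohomology R C C\<^sub>0) (cohomology S E E\<^sub>0)"

text \<open>
  The second condition is a quasi-isomorphism of the underlying complexes, the third one a
  quasi-isomorphism of the associated graded complexes.
\<close>

definition filtered_local_quasi_iso ::
  "(('x::euclidean_space \<Rightarrow> complex) \<Rightarrow> 'y \<Rightarrow> complex) \<Rightarrow> ('x, 'a, 'm) cdgsa_scheme \<Rightarrow>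
   ('y, 'b, 'k) cdgsa_scheme \<Rightarrow> ('a \<Rightarrow> 'b) \<Rightarrow> bool" where
  "filtered_local_quasi_iso \<zeta> R S \<Phi> \<longleftrightarrow>
     filtered_local_cdgsa_hom \<zeta> R S \<Phi> \<and>
     cohomology_iso R (carrier R) {\<zero>\<^bsub>R\<^esub>} S (carrier S) {\<zero>\<^bsub>S\<^esub>} \<Phi> \<and>
     (\<forall>k. cohomology_iso R (filt R k) (filt R (k + 1)) S (filt S k) (filt S (k + 1)) \<Phi>)"

text \<open>
  The map that an endomorphism \<open>F\<close> preserving the ideal \<open>N\<close> induces on cosets of \<open>N\<close>.
\<close>

definition on_cosets :: "('a, 'm) ring_scheme \<Rightarrow> 'a set \<Rightarrow> ('a \<Rightarrow> 'a) \<Rightarrow> 'a set \<Rightarrow> 'a set" where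
  "on_cosets R N F c = (\<Union>x\<in>c. N +>\<^bsub>R\<^esub> F x)"

definition quotient_cdgsa :: "('x, 'a, 'm) cdgsa_scheme \<Rightarrow> 'a set \<Rightarrow> ('x, 'a set) cdgsa" where
  "quotient_cdgsa R N = ring.extend (R Quot N)
     (cdgsa.fields
        (\<lambda>f. N +>\<^bsub>R\<^esub> fn R f)
        (N +>\<^bsub>R\<^esub> par R)
        (on_cosets R N (dif R))
        (\<lambda>i s. (\<lambda>x. N +>\<^bsub>R\<^esub> x) ` bideg R i s)
        (\<lambda>k. (\<lambda>x. N +>\<^bsub>R\<^esub> x) ` filt R k))"

text \<open>
  An element is a finite sum of terms \<open>f \<cdot> \<xi>\<^sub>J \<cdot> e\<close>, with \<open>f\<close> a smooth function, \<open>\<xi>\<^sub>J\<close> the product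
  (in the order of \<open>to_nat_on UNIV\<close>) of the anticommuting generators \<open>\<xi>\<^sub>a\<close> with \<open>a\<close> in \<open>J\<close>, and
  \<open>e\<close> a monomial in the commuting generators, written additively. Every \<open>\<xi>\<^sub>a\<close> has bidegree
  \<open>(0, -)\<close> and every commuting generator has bidegree \<open>(1, -)\<close>, so that the sign rule for the
  total parity only sees the \<open>\<xi>\<^sub>a\<close>; the function \<open>deg\<close> below is the degree of \<open>e\<close>.
\<close>

type_synonym ('x, 'o, 'e) superfield = "'o set \<Rightarrow> 'e \<Rightarrow> 'x \<Rightarrow> complex"

definition mono :: "'o set \<Rightarrow> 'e \<Rightarrow> ('x \<Rightarrow> complex) \<Rightarrow> ('x, 'o, 'e) superfield" where
  "mono J e f = (\<lambda>J' e'. if J' = J \<and> e' = e then f else (\<lambda>_. 0))"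

definition sf_supp :: "('x, 'o, 'e) superfield \<Rightarrow> ('o set \<times> 'e) set" where
  "sf_supp f = {(J, e). f J e \<noteq> (\<lambda>_. 0)}"

definition shuffle_sign :: "'o::finite set \<Rightarrow> 'o set \<Rightarrow> complex" where
  "shuffle_sign J J' =
     (-1) ^ card {(a, b). a \<in> J \<and> b \<in> J' \<and> to_nat_on (UNIV :: 'o set) b < to_nat_on (UNIV :: 'o set) a}"

definition sf_mult :: "('x, 'o::finite, 'e::comm_monoid_add) superfield \<Rightarrow>
    ('x, 'o, 'e) superfield \<Rightarrow> ('x, 'o, 'e) superfield" where
  "sf_mult f g = (\<lambda>K e x. \<Sum>(J, p)\<in>sf_supp f. \<Sum>(J', q)\<in>sf_supp g.
     if J \<inter> J' = {} \<and> J \<union> J' = K \<and> p + q = e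
     then shuffle_sign J J' * f J p x * g J' q x else 0)"

definition sf_odd_deriv :: "'o::finite \<Rightarrow> ('x, 'o, 'e) superfield \<Rightarrow> ('x, 'o, 'e) superfield" where
  "sf_odd_deriv a f = (\<lambda>J e x. if a \<in> J then 0 else shuffle_sign {a} J * f (insert a J) e x)"

definition superfields ::
  "('e \<Rightarrow> int) \<Rightarrow> 'e \<Rightarrow>
   (('x::euclidean_space, 'o::finite, 'e::comm_monoid_add) superfield \<Rightarrow> ('x, 'o, 'e) superfield) \<Rightarrow>
   ('x, ('x, 'o, 'e) superfield) cdgsa" where
  "superfields deg u d =
    (let X = {f. (\<forall>J e. smooth (f J e)) \<and> finite (sf_supp f)} in
     \<lparr>carrier = X,
      monoid.mult = sf_mult,
      one = mono {} 0 (\<lambda>_. 1),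
      zero = (\<lambda>_ _ _. 0),
      add = (\<lambda>f g J e x. f J e x + g J e x),
      fn = mono {} 0,
      par = mono {} u (\<lambda>_. 1),
      dif = d,
      bideg = (\<lambda>i s. {f \<in> X. \<forall>(J, e)\<in>sf_supp f. deg e = i \<and> odd (int (card J) + deg e) = s}),
      filt = (\<lambda>k. {f \<in> X. \<forall>(J, e)\<in>sf_supp f. int (card J) + deg e \<ge> k})\<rparr>)"

definition d_zbar :: "'n \<Rightarrow> (complex^'n \<Rightarrow> complex) \<Rightarrow> complex^'n \<Rightarrow> complex" where
  "d_zbar i f z = (pd (axis i 1) f z + \<i> * pd (axis i \<i>) f z) / 2"

definition d_z :: "'n \<Rightarrow> (complex^'n \<Rightarrow> complex) \<Rightarrow> complex^'n \<Rightarrow> complex" where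
  "d_z i f z = (pd (axis i 1) f z - \<i> * pd (axis i \<i>) f z) / 2"

text \<open>
  The anticommuting generators are the differentials of the conjugates of the coordinates; the
  monomials in the commuting generator are the powers of \<open>u\<close> with integral exponent.
\<close>

type_synonym 'n dol = "(complex^'n, 'n, int) superfield"

definition dol_dif :: "'n::finite dol \<Rightarrow> 'n dol" where
  "dol_dif f = (\<lambda>J k z. \<Sum>i\<in>UNIV.
     sf_mult (mono {i} 1 (\<lambda>_. 1)) (\<lambda>J' k'. d_zbar i (f J' k')) J k z)"

definition dol_loc :: "(complex^'n::finite, 'n dol) cdgsa" where
  "dol_loc = superfields id 1 dol_dif"

text \<open>
  The Lie bracket of \<open>\<tt>\<^sub>1\<close>, with basis \<open>e\<^sub>a\<close>, is given by its structure constants \<open>\<Gamma> a b\<close>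
  in \<open>V\<close>, the space of complex \<open>d\<close>-vectors.
\<close>

definition bracket ::
  "('s::finite \<Rightarrow> 's \<Rightarrow> complex^'d) \<Rightarrow> complex^'s \<Rightarrow> complex^'s \<Rightarrow> complex^'d" where
  "bracket \<Gamma> s t = (\<Sum>a\<in>UNIV. \<Sum>b\<in>UNIV. (s $ a * t $ b) *s \<Gamma> a b)"

definition nilpotence_variety :: "('s::finite \<Rightarrow> 's \<Rightarrow> complex^'d) \<Rightarrow> (complex^'s) set" where
  "nilpotence_variety \<Gamma> = {q. bracket \<Gamma> q q = 0}"

text \<open>
  The anticommuting generators are the \<open>\<theta>\<^sup>a\<close>. The commuting monomial \<open>(m, k)\<close> is
  \<open>\<lambda>\<^sup>m u\<^sup>k\<close>, with \<open>m\<close> a multi-index and \<open>k\<close> an integer.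
\<close>

type_synonym ('d, 's) tsf = "(real^'d, 's, (nat^'s) \<times> int) superfield"

definition th :: "'s \<Rightarrow> ('d, 's::finite) tsf" where
  "th a = mono {a} 0 (\<lambda>_. 1)"

definition lam :: "'s \<Rightarrow> ('d, 's::finite) tsf" where
  "lam a = mono {} (axis a 1, 0) (\<lambda>_. 1)"

definition uu :: "('d, 's::finite) tsf" where
  "uu = mono {} (0, 1) (\<lambda>_. 1)"

definition tsf_pd :: "'d \<Rightarrow> ('d::finite, 's::finite) tsf \<Rightarrow> ('d, 's) tsf" where
  "tsf_pd \<mu> f = (\<lambda>J e. pd (axis \<mu> 1) (f J e))"

definition vf_R :: "('s \<Rightarrow> 's \<Rightarrow> complex^'d) \<Rightarrow> 's \<Rightarrow> ('d::finite, 's::finite) tsf \<Rightarrow> ('d, 's) tsf" where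
  "vf_R \<Gamma> a f = (\<lambda>J e x. sf_odd_deriv a f J e x
     - (\<Sum>b\<in>UNIV. \<Sum>\<mu>\<in>UNIV. \<Gamma> a b $ \<mu> * sf_mult (th b) (tsf_pd \<mu> f) J e x) / 2)"

definition vf_L :: "('s \<Rightarrow> 's \<Rightarrow> complex^'d) \<Rightarrow> 's \<Rightarrow> ('d::finite, 's::finite) tsf \<Rightarrow> ('d, 's) tsf" where
  "vf_L \<Gamma> a f = (\<lambda>J e x. sf_odd_deriv a f J e x
     + (\<Sum>b\<in>UNIV. \<Sum>\<mu>\<in>UNIV. \<Gamma> a b $ \<mu> * sf_mult (th b) (tsf_pd \<mu> f) J e x) / 2)"

definition tsf_dif ::
  "('s \<Rightarrow> 's \<Rightarrow> complex^'d) \<Rightarrow> complex^'s \<Rightarrow> ('d::finite, 's::finite) tsf \<Rightarrow> ('d, 's) tsf" where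
  "tsf_dif \<Gamma> Q f = (\<lambda>J e x.
     (\<Sum>a\<in>UNIV. sf_mult (lam a) (vf_R \<Gamma> a f) J e x) +
     (\<Sum>a\<in>UNIV. Q $ a * sf_mult uu (vf_L \<Gamma> a f) J e x))"

definition tsf ::
  "('s \<Rightarrow> 's \<Rightarrow> complex^'d) \<Rightarrow> complex^'s \<Rightarrow>
   (real^'d::finite, ('d, 's::finite) tsf) cdgsa" where
  "tsf \<Gamma> Q = superfields (\<lambda>(m, k). int (\<Sum>a\<in>UNIV. m $ a) + k) (0, 1) (tsf_dif \<Gamma> Q)"

text \<open>
  The relations are the components of \<open>[\<lambda>, \<lambda>]\<close>. Dividing the free object by the ideal that
  they generate replaces the polynomial algebra in the \<open>\<lambda>\<^sup>a\<close> by the coordinate ring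
  of the nilpotence variety.
\<close>

definition pure_rel :: "('s \<Rightarrow> 's \<Rightarrow> complex^'d) \<Rightarrow> 'd \<Rightarrow> ('d::finite, 's::finite) tsf" where
  "pure_rel \<Gamma> \<mu> = (\<lambda>J e x. \<Sum>a\<in>UNIV. \<Sum>b\<in>UNIV. \<Gamma> a b $ \<mu> * sf_mult (lam a) (lam b) J e x)"

definition pure_ideal ::
  "('s \<Rightarrow> 's \<Rightarrow> complex^'d) \<Rightarrow> complex^'s \<Rightarrow> ('d::finite, 's::finite) tsf set" where
  "pure_ideal \<Gamma> Q = Idl\<^bsub>tsf \<Gamma> Q\<^esub> (range (pure_rel \<Gamma>))"

definition taut_loc ::
  "('s \<Rightarrow> 's \<Rightarrow> complex^'d) \<Rightarrow> complex^'s \<Rightarrow>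
   (real^'d::finite, ('d, 's::finite) tsf set) cdgsa" where
  "taut_loc \<Gamma> Q = quotient_cdgsa (tsf \<Gamma> Q) (pure_ideal \<Gamma> Q)"

definition so :: "(complex^'d^'d) set" where
  "so = {X. transpose X = - X}"

text \<open>
  An irreducible graded Clifford module \<open>S\<^sub>+ \<oplus> S\<^sub>-\<close> over \<open>V\<close>: \<open>\<gamma>p \<mu> : S\<^sub>+ \<rightarrow> S\<^sub>-\<close> and
  \<open>\<gamma>m \<mu> : S\<^sub>- \<rightarrow> S\<^sub>+\<close> are the actions of the basis vectors of \<open>V\<close>. The dimension condition
  is irreducibility; the even part and the odd part are then the two chiral spin
  representations of \<open>so\<close>.
\<close>

definition weyl_matrices ::
  "('d::finite \<Rightarrow> complex^'p^'m) \<Rightarrow> ('d \<Rightarrow> complex^'m::finite^'p::finite) \<Rightarrow> bool" where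
  "weyl_matrices \<gamma>p \<gamma>m \<longleftrightarrow>
     even CARD('d) \<and>
     CARD('p) = 2 ^ (CARD('d) div 2 - 1) \<and> CARD('m) = 2 ^ (CARD('d) div 2 - 1) \<and>
     (\<forall>\<mu> \<nu>. \<gamma>m \<mu> ** \<gamma>p \<nu> + \<gamma>m \<nu> ** \<gamma>p \<mu> = mat (if \<mu> = \<nu> then 2 else 0)) \<and>
     (\<forall>\<mu> \<nu>. \<gamma>p \<mu> ** \<gamma>m \<nu> + \<gamma>p \<nu> ** \<gamma>m \<mu> = mat (if \<mu> = \<nu> then 2 else 0))"

text \<open>
  \<open>spin \<gamma>m \<gamma>p\<close> is the representation of \<open>so\<close> on \<open>S\<^sub>+\<close>, and \<open>spin \<gamma>p \<gamma>m\<close> the one on \<open>S\<^sub>-\<close>.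
\<close>

definition spin ::
  "('d::finite \<Rightarrow> complex^'m^'p) \<Rightarrow> ('d \<Rightarrow> complex^'p^'m) \<Rightarrow> complex^'d^'d \<Rightarrow>
   complex^'p::finite^'p" where
  "spin g g' X = (\<chi> i j. (\<Sum>\<mu>\<in>UNIV. \<Sum>\<nu>\<in>UNIV. X $ \<mu> $ \<nu> * (g \<mu> ** g' \<nu>) $ i $ j) / 4)"

text \<open>
  An \<open>so\<close>-equivariant surjective linear map from a tensor product of two representations to \<open>V\<close>,
  given by the images of the basis vectors.
\<close>

definition equivariant_onto ::
  "(complex^'d^'d \<Rightarrow> complex^'p^'p) \<Rightarrow> (complex^'d^'d \<Rightarrow> complex^'q^'q) \<Rightarrow>
   ('p::finite \<Rightarrow> 'q::finite \<Rightarrow> complex^'d::finite) \<Rightarrow> bool" where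
  "equivariant_onto \<rho> \<rho>' G \<longleftrightarrow>
     (\<forall>X\<in>so. \<forall>a b. X *v G a b =
        (\<Sum>c\<in>UNIV. (\<rho> X $ c $ a) *s G c b) + (\<Sum>c\<in>UNIV. (\<rho>' X $ c $ b) *s G a c)) \<and>
     vec.span {G a b |a b. True} = UNIV"

text \<open>
  In dimensions 4 and 6 the map \<open>G\<close> is an isomorphism from the tensor product of \<open>S\<^sub>+\<close> and
  \<open>S\<^sub>-\<close>, respectively from the exterior square of \<open>S\<^sub>+\<close>, because the dimensions agree.
\<close>

definition susy4 ::
  "('d::finite \<Rightarrow> complex^'p^'m) \<Rightarrow> ('d \<Rightarrow> complex^'m::finite^'p::finite) \<Rightarrow>
   ('p + 'm \<Rightarrow> 'p + 'm \<Rightarrow> complex^'d) \<Rightarrow> bool" where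
  "susy4 \<gamma>p \<gamma>m \<Gamma> \<longleftrightarrow> CARD('d) = 4 \<and> weyl_matrices \<gamma>p \<gamma>m \<and>
     (\<exists>G. equivariant_onto (spin \<gamma>m \<gamma>p) (spin \<gamma>p \<gamma>m) G \<and>
        (\<forall>a b. \<Gamma> (Inl a) (Inr b) = G a b \<and> \<Gamma> (Inr b) (Inl a) = G a b) \<and>
        (\<forall>a b. \<Gamma> (Inl a) (Inl b) = 0) \<and> (\<forall>a b. \<Gamma> (Inr a) (Inr b) = 0))"

definition susy6 ::
  "('d::finite \<Rightarrow> complex^'p^'m) \<Rightarrow> ('d \<Rightarrow> complex^'m::finite^'p::finite) \<Rightarrow>
   ('p \<times> 2 \<Rightarrow> 'p \<times> 2 \<Rightarrow> complex^'d) \<Rightarrow> bool" where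
  "susy6 \<gamma>p \<gamma>m \<Gamma> \<longleftrightarrow> CARD('d) = 6 \<and> weyl_matrices \<gamma>p \<gamma>m \<and>
     (\<exists>G (\<omega> :: complex^2^2). equivariant_onto (spin \<gamma>m \<gamma>p) (spin \<gamma>m \<gamma>p) G \<and>
        (\<forall>a b. G a b = - G b a) \<and> transpose \<omega> = - \<omega> \<and> invertible \<omega> \<and>
        (\<forall>a i b j. \<Gamma> (a, i) (b, j) = (\<omega> $ i $ j) *s G a b))"

definition susy10 ::
  "('d::finite \<Rightarrow> complex^'p^'m) \<Rightarrow> ('d \<Rightarrow> complex^'m::finite^'p::finite) \<Rightarrow>
   ('p \<Rightarrow> 'p \<Rightarrow> complex^'d) \<Rightarrow> bool" where
  "susy10 \<gamma>p \<gamma>m \<Gamma> \<longleftrightarrow> CARD('d) = 10 \<and> weyl_matrices \<gamma>p \<gamma>m \<and>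
     equivariant_onto (spin \<gamma>m \<gamma>p) (spin \<gamma>m \<gamma>p) \<Gamma> \<and> (\<forall>a b. \<Gamma> a b = \<Gamma> b a)"

definition rep4 ::
  "('d::finite \<Rightarrow> complex^'p^'m) \<Rightarrow> ('d \<Rightarrow> complex^'m::finite^'p::finite) \<Rightarrow>
   complex^'d^'d \<Rightarrow> complex^('p + 'm)^('p + 'm)" where
  "rep4 \<gamma>p \<gamma>m X = (\<chi> i j. case (i, j) of
      (Inl a, Inl b) \<Rightarrow> spin \<gamma>m \<gamma>p X $ a $ b
    | (Inr a, Inr b) \<Rightarrow> spin \<gamma>p \<gamma>m X $ a $ b
    | _ \<Rightarrow> 0)"

definition rep6 ::
  "('d::finite \<Rightarrow> complex^'p^'m) \<Rightarrow> ('d \<Rightarrow> complex^'m::finite^'p::finite) \<Rightarrow>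
   complex^'d^'d \<Rightarrow> complex^('p \<times> 2)^('p \<times> 2)" where
  "rep6 \<gamma>p \<gamma>m X = (\<chi> i j. if snd i = snd j then spin \<gamma>m \<gamma>p X $ fst i $ fst j else 0)"

definition rep10 ::
  "('d::finite \<Rightarrow> complex^'p^'m) \<Rightarrow> ('d \<Rightarrow> complex^'m::finite^'p::finite) \<Rightarrow>
   complex^'d^'d \<Rightarrow> complex^'p^'p" where
  "rep10 \<gamma>p \<gamma>m = spin \<gamma>m \<gamma>p"

definition holomorphic4 :: "complex^('p::finite + 'm::finite) \<Rightarrow> bool" where
  "holomorphic4 Q \<longleftrightarrow> Q \<noteq> 0 \<and> (\<forall>b. Q $ Inr b = 0)"

definition holomorphic :: "('s::finite \<Rightarrow> 's \<Rightarrow> complex^'d) \<Rightarrow> complex^'s \<Rightarrow> bool" where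
  "holomorphic \<Gamma> Q \<longleftrightarrow> Q \<noteq> 0 \<and> Q \<in> nilpotence_variety \<Gamma>"

text \<open>
  The elements of \<open>V\<close> that correspond to the coordinate vector fields on complex \<open>n\<close>-space
  under a linear identification \<open>Z\<close>.
\<close>

definition vec_zbar :: "(real^'d \<Rightarrow> complex^'n) \<Rightarrow> 'n \<Rightarrow> complex^'d" where
  "vec_zbar Z i = (\<chi> \<mu>. (of_real (inv_into UNIV Z (axis i 1) $ \<mu>) + \<i> * of_real (inv_into UNIV Z (axis i \<i>) $ \<mu>)) / 2)"

definition vec_z :: "(real^'d \<Rightarrow> complex^'n) \<Rightarrow> 'n \<Rightarrow> complex^'d" where
  "vec_z Z i = (\<chi> \<mu>. (of_real (inv_into UNIV Z (axis i 1) $ \<mu>) - \<i> * of_real (inv_into UNIV Z (axis i \<i>) $ \<mu>)) / 2)"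

definition holomorphic_coordinates ::
  "('s::finite \<Rightarrow> 's \<Rightarrow> complex^'d) \<Rightarrow> complex^'s \<Rightarrow> (real^'d::finite \<Rightarrow> complex^'n::finite) \<Rightarrow> bool" where
  "holomorphic_coordinates \<Gamma> Q Z \<longleftrightarrow>
     linear Z \<and> bij Z \<and> vec.span (range (vec_zbar Z)) = range (bracket \<Gamma> Q)"

text \<open>
  The stabilizer in \<open>so\<close> of the decomposition of \<open>V\<close> into \<open>L\<close> and its complement, which are spanned
  by the \<open>vec_zbar Z i\<close> and by the \<open>vec_z Z i\<close>; \<open>a\<close> and \<open>b\<close> are the matrices of
  \<open>X\<close> on the two summands. The map from \<open>X\<close> to \<open>a\<close> identifies the stabilizer with \<open>gl(n)\<close>.
\<close>

definition gl_stab ::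
  "(real^'d \<Rightarrow> complex^'n) \<Rightarrow> complex^'d^'d \<Rightarrow> complex^'n^'n \<Rightarrow> complex^'n^'n \<Rightarrow> bool" where
  "gl_stab Z X a b \<longleftrightarrow> X \<in> so \<and>
     (\<forall>j. X *v vec_zbar Z j = (\<Sum>i\<in>UNIV. (a $ i $ j) *s vec_zbar Z i)) \<and>
     (\<forall>j. X *v vec_z Z j = (\<Sum>i\<in>UNIV. (b $ i $ j) *s vec_z Z i))"

text \<open>
  The spin representations involve a square root of the determinant of \<open>L\<close>: the line spanned
  by \<open>Q\<close> is such a square root, so \<open>X\<close> acts on \<open>Q\<close> as \<open>trace a / 2\<close>, and \<open>u\<close>, which is
  dual to \<open>Q\<close>, has weight \<open>- trace a / 2\<close>. On the Dolbeault side \<open>u\<close> has the same weight, the opposite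
  twist is put on the odd generators, and \<open>u\<close> times an odd generator is a \<open>(0, 1)\<close>-form with
  its usual action. All twists vanish on \<open>sl(n)\<close>.
\<close>

definition dol_act :: "complex^'n^'n \<Rightarrow> complex^'n^'n \<Rightarrow> 'n::finite dol \<Rightarrow> 'n dol" where
  "dol_act a b f = (\<lambda>J k z.
     - (\<Sum>i\<in>UNIV. \<Sum>j\<in>UNIV. a $ i $ j * cnj (z $ j) * d_zbar i (f J k) z)
     - (\<Sum>i\<in>UNIV. \<Sum>j\<in>UNIV. b $ i $ j * z $ j * d_z i (f J k) z)
     - (\<Sum>i\<in>UNIV. \<Sum>j\<in>UNIV. a $ i $ j * sf_mult (mono {j} 0 (\<lambda>_. 1)) (sf_odd_deriv i f) J k z)
     + trace a / 2 * (of_nat (card J) - of_int k) * f J k z)"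

text \<open>
  \<open>r\<close> is the matrix of \<open>X\<close> on \<open>\<tt>\<^sub>1\<close>; the coordinates \<open>\<theta>\<^sup>a\<close> and \<open>\<lambda>\<^sup>a\<close> transform in the
  dual representation.
\<close>

definition lam_deriv :: "'s \<Rightarrow> ('d, 's::finite) tsf \<Rightarrow> ('d, 's) tsf" where
  "lam_deriv a f = (\<lambda>J (m, k) x. of_nat (m $ a + 1) * f J (m + axis a 1, k) x)"

definition tsf_act ::
  "complex^'d^'d \<Rightarrow> complex^'s^'s \<Rightarrow> complex \<Rightarrow> ('d::finite, 's::finite) tsf \<Rightarrow> ('d, 's) tsf" where
  "tsf_act X r w f = (\<lambda>J e x.
     - (\<Sum>\<mu>\<in>UNIV. \<Sum>\<nu>\<in>UNIV. X $ \<mu> $ \<nu> * of_real (x $ \<nu>) * tsf_pd \<mu> f J e x)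
     - (\<Sum>a\<in>UNIV. \<Sum>c\<in>UNIV. r $ a $ c * sf_mult (th c) (sf_odd_deriv a f) J e x)
     - (\<Sum>a\<in>UNIV. \<Sum>c\<in>UNIV. r $ a $ c * sf_mult (lam c) (lam_deriv a f) J e x)
     + w * of_int (snd e) * f J e x)"

definition gl_equivariant ::
  "('s::finite \<Rightarrow> 's \<Rightarrow> complex^'d::finite) \<Rightarrow> (complex^'d^'d \<Rightarrow> complex^'s^'s) \<Rightarrow> complex^'s \<Rightarrow>
   (real^'d \<Rightarrow> complex^'n::finite) \<Rightarrow> ('n dol \<Rightarrow> ('d, 's) tsf set) \<Rightarrow> bool" where
  "gl_equivariant \<Gamma> \<rho> Q Z \<Phi> \<longleftrightarrow>
     (\<forall>X a b. gl_stab Z X a b \<longrightarrow>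
        (\<forall>f\<in>carrier dol_loc. \<Phi> (dol_act a b f) =
           on_cosets (tsf \<Gamma> Q) (pure_ideal \<Gamma> Q) (tsf_act X (\<rho> X) (- trace a / 2)) (\<Phi> f)))"

end

(*
On the nilpotence variety the coordinate dual to Q is inverted together with u: the relations then express the coordinates
of the third summand of t_1 through those of the second, so that the Koszul part of the complex, given by the lambda, theta
and their coordinates, contracts onto the classes eta_j = theta_j + (quadratic corrections) / u. These classes generate a copy of
the antiholomorphic forms on which the differential is not yet u times the Dolbeault operator: the remaining terms are
derivatives along nilpotent elements. They are removed by conjugation with the exponential of a nilpotent operator N of
exterior degree 2 and differential order 1, and Phi is eta followed by this exponential. Its one-sided inverse r puts the
middle coordinates to 0; a filtration argument shows that x - Phi (r x) is exact for a cocycle x. The algebraic input (a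
splitting of t_1 with a cubic identity) is read off from the weights of the central element of gl(n) on the Fock space that is
generated by Q.
*)
theory Submission
 imports Defs "HOL-Library.Poly_Mapping"
begin

text \<open>No basis or resolution of the coordinate ring of the variety is used, so there are no
  normal forms modulo the relations: every identity is proved in the free algebra up to the ideal I.
  A Cartan formula takes their place: the anticommutator of the Koszul part K with the contraction
  \<open>ctr\<close> is l0 times an Euler field, with l0 the coordinate dual to Q. As K th0 = l0 +
  u, also u times the Euler field is zero on cohomology, and u is invertible, so only weight 0
  survives. The class th0 disappears because l0 + u is not a zero divisor. That \<open>ctr\<close>
  preserves the ideal, and that the unwanted derivative terms are K-exact, both come down to one
  cubic identity. The descent along the filtration ends since the exterior degree is bounded and the
  bound on the polynomial degree of the remainder never grows. The Clifford module is given only by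
  matrices, so its Fock structure has to be built: irreducibility comes from halving the dimension
  of stable subspaces, the levels from creation operators applied to Q.\<close>

abbreviation (input) usum :: "('i => 'b::comm_monoid_add) => 'b" (binder "SU " 10) where
 "usum f == sum f UNIV"

subsection \<open>Smooth functions\<close>

lemma smooth_imp_differentiable: "smooth f ==> f differentiable (at x)"
 unfolding smooth_def by (drule spec[of _ "[]"]) (simp add: differentiable_on_def)

lemma smooth_has_derivative: "smooth f ==> (f has_derivative (%v. pd v f x)) (at x)"
 using smooth_imp_differentiable[of f x] by (simp add: pd_def frechet_derivative_works[symmetric])

lemma has_derivative_pd: "(f has_derivative f') (at x) ==> pd v f x = f' v"
 by (metis pd_def frechet_derivative_at)

text \<open>\<open>smooth\<close> speaks of all iterated derivatives, so a class of differentiable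
  functions closed under every \<open>pd\<close> consists of smooth functions.\<close>

lemma smooth_coinduct:
 assumes "P f" and step: "!!f. P f ==> f differentiable_on UNIV \<and> (\<forall>v. P (pd v f))"
 shows "smooth f"
proof -
 have "P (foldr pd vs f)" for vs
  by (induction vs) (use assms in auto)
 thus ?thesis unfolding smooth_def using step by blast
qed

lemma smooth_pd: assumes "smooth f" shows "smooth (pd v f)"
proof -
 have "foldr pd vs (pd v f) = foldr pd (vs @ [v]) f" for vs by simp
 thus ?thesis using assms unfolding smooth_def by metis
qed

lemma smooth_differentiable_on: "smooth f ==> f differentiable_on UNIV"
 using smooth_imp_differentiable by (auto simp: differentiable_on_def)

lemma pd_const: "pd v (%_. c) = (%_. 0)"
 by (rule ext) (rule has_derivative_pd[where f' = "%_. 0"], simp)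

lemma smooth_const: "smooth (%_. c)"
 by (rule smooth_coinduct[where P = "%f. \<exists>c. f = (%_. c)"]) (auto simp: pd_const)

lemma pd_add: "smooth f ==> smooth g ==> pd v (%x. f x + g x) = (%x. pd v f x + pd v g x)"
 by (rule ext, rule has_derivative_pd) (auto intro!: derivative_intros smooth_has_derivative)

lemma pd_mult: "smooth f ==> smooth g ==> pd v (%x. f x * g x) = (%x. pd v f x * g x + f x * pd v g x)"
proof (rule ext, goal_cases)
 case (1 x)
 have "((%x. f x * g x) has_derivative (%h. f x * pd h g x + pd h f x * g x)) (at x)"
  by (rule has_derivative_mult) (auto intro!: 1 smooth_has_derivative)
 from has_derivative_pd[OF this, of v] show ?case by simp
qed

lemma smooth_add: assumes "smooth f" "smooth g" shows "smooth (%x. f x + g x)"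
proof (rule smooth_coinduct[where P = "%h. \<exists>f g. smooth f \<and> smooth g \<and> h = (%x. f x + g x)"])
 fix h assume "\<exists>f g. smooth f \<and> smooth g \<and> h = (%x. f x + g x :: complex)"
 then obtain f g where "smooth f" "smooth g" "h = (%x. f x + g x)" by auto
 thus "h differentiable_on UNIV \<and> (\<forall>v. \<exists>f g. smooth f \<and> smooth g \<and> pd v h = (%x. f x + g x))"
  using pd_add smooth_pd smooth_differentiable_on differentiable_on_add by metis
qed (use assms in auto)

text \<open>The derivative of a product is a sum of two products, so products alone are not closed
  under \<open>pd\<close>; with sums added the class is a coinduction invariant.\<close>

inductive mult_closure :: "('x::euclidean_space => complex) => bool" where
 prod: "smooth f ==> smooth g ==> mult_closure (%x. f x * g x)"
| add: "mult_closure f ==> mult_closure g ==> mult_closure (%x. f x + g x)"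

lemma smooth_mult: assumes "smooth f" "smooth g" shows "smooth (%x. f x * g x)"
proof (rule smooth_coinduct[where P = mult_closure])
 show "mult_closure (%x. f x * g x)" by (rule prod) fact+
 fix h :: "'a => complex" assume "mult_closure h"
 thus "h differentiable_on UNIV \<and> (\<forall>v. mult_closure (pd v h))"
 proof induction
  case (prod f g)
  have "pd v (%x. f x * g x) = (%x. pd v f x * g x + f x * pd v g x)" for v
   by (rule pd_mult) fact+
  moreover have "mult_closure (%x. pd v f x * g x + f x * pd v g x)" for v
   by (intro mult_closure.intros smooth_pd prod)
  ultimately show ?case
   using differentiable_on_mult[OF smooth_differentiable_on[OF prod(1)] smooth_differentiable_on[OF prod(2)]] by simp
 next
  case (add f g)
  have "pd v (%x. f x + g x) = (%x. pd v f x + pd v g x)" for v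
  proof (rule ext, rule has_derivative_pd)
   fix x
   have "f differentiable (at x)" "g differentiable (at x)" using add by (auto simp: differentiable_on_def)
   hence "(f has_derivative (%v. pd v f x)) (at x)" "(g has_derivative (%v. pd v g x)) (at x)"
    by (simp_all add: pd_def frechet_derivative_works[symmetric])
   thus "((%x. f x + g x) has_derivative (%v. pd v f x + pd v g x)) (at x)" by (rule has_derivative_add)
  qed
  moreover have "mult_closure (%x. pd v f x + pd v g x)" for v using add by (auto intro: mult_closure.intros)
  ultimately show ?case using add differentiable_on_add by auto
 qed
qed

lemma smooth_uminus: "smooth f ==> smooth (%x. - f x)"
 using smooth_mult[OF smooth_const[of "-1"], of f] by simp

lemma smooth_diff: "smooth f ==> smooth g ==> smooth (%x. f x - g x)"
 using smooth_add[OF _ smooth_uminus, of f g] by simp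

lemma pd_bounded_linear: "bounded_linear f ==> pd v f = (%_. f v)"
 by (rule ext) (rule has_derivative_pd, rule bounded_linear_imp_has_derivative)

lemma smooth_bounded_linear: assumes "bounded_linear f" shows "smooth f"
proof (rule smooth_coinduct[where P = "%h. h = f \<or> (\<exists>c. h = (%_. c))"])
 fix h assume "h = f \<or> (\<exists>c. h = (%_. c))"
 thus "h differentiable_on UNIV \<and> (\<forall>v. pd v h = f \<or> (\<exists>c. pd v h = (%_. c)))"
 proof
  assume "h = f"
  thus ?thesis using pd_bounded_linear[OF assms] bounded_linear_imp_differentiable_on[OF assms] by auto
 qed (auto simp: pd_const)
qed simp

lemma pd_compose_linear:
 assumes "linear Z" "smooth f" shows "pd v (f \<circ> Z) = pd (Z v) f \<circ> Z"
proof (rule ext)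
 fix x
 have "(Z has_derivative Z) (at x)" using assms(1) by (simp add: linear_conv_bounded_linear bounded_linear_imp_has_derivative)
 hence "((%x. f (Z x)) has_derivative (%v. pd (Z v) f (Z x))) (at x)"
  using has_derivative_compose[OF _ smooth_has_derivative[OF assms(2)], of Z Z x UNIV] by simp
 from has_derivative_pd[OF this, of v] show "pd v (f \<circ> Z) x = (pd (Z v) f \<circ> Z) x" by (simp add: o_def)
qed

lemma smooth_compose_linear:
 assumes "linear Z" "smooth f" shows "smooth (f \<circ> Z)"
proof (rule smooth_coinduct[where P = "%h. \<exists>f. smooth f \<and> h = f \<circ> Z"])
 fix h assume "\<exists>f. smooth f \<and> h = f \<circ> Z"
 then obtain f where f: "smooth f" "h = f \<circ> Z" by auto
 have "h differentiable (at x)" for x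
 proof -
  have "(Z has_derivative Z) (at x)" using assms(1) by (simp add: linear_conv_bounded_linear bounded_linear_imp_has_derivative)
  hence "((%x. f (Z x)) has_derivative (%v. pd (Z v) f (Z x))) (at x)"
   using has_derivative_compose[OF _ smooth_has_derivative[OF f(1)], of Z Z x UNIV] by simp
  thus ?thesis unfolding f(2) o_def differentiable_def by blast
 qed
 thus "h differentiable_on UNIV \<and> (\<forall>v. \<exists>f. smooth f \<and> pd v h = f \<circ> Z)"
  using pd_compose_linear[OF assms(1) f(1)] smooth_pd[OF f(1)] unfolding f(2) differentiable_on_def by auto
qed (use assms in auto)

section \<open>Symmetry of second derivatives\<close>

lemma pd_linear:
 assumes "smooth f" shows "linear (%v. pd v f x)"
 using smooth_has_derivative[OF assms, of x] has_derivative_linear by blast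

lemma pd_along_line:
 assumes "smooth f"
 shows "((%s::real. Re (f (y + s *\<^sub>R v))) has_real_derivative Re (pd v f (y + s *\<^sub>R v))) (at s)"
proof -
 have "((%s. y + s *\<^sub>R v) has_derivative (%h. h *\<^sub>R v)) (at s)"
  by (auto intro!: derivative_eq_intros)
 hence "((%s. f (y + s *\<^sub>R v)) has_derivative (%h. pd (h *\<^sub>R v) f (y + s *\<^sub>R v))) (at s)"
  using has_derivative_compose[OF _ smooth_has_derivative[OF assms]] by fastforce
 hence "((%s. Re (f (y + s *\<^sub>R v))) has_derivative (%h. Re (pd (h *\<^sub>R v) f (y + s *\<^sub>R v)))) (at s)"
  by (rule bounded_linear.has_derivative[OF bounded_linear_Re])
 moreover have "Re (pd (h *\<^sub>R v) f z) = Re (pd v f z) * h" for h z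
  using linear_cmul[OF pd_linear[OF assms, of z]] by simp
 ultimately show ?thesis by (simp add: has_field_derivative_def)
qed

text \<open>Two applications of the mean value theorem: along v to the difference of two translates,
  then along w to the derivative found. Real parts are taken because the theorem fails for complex
  values.\<close>

lemma second_difference:
 assumes "smooth f" "h > 0"
 shows "\<exists>\<xi> \<eta>. 0 < \<xi> \<and> \<xi> < h \<and> 0 < \<eta> \<and> \<eta> < h \<and>
  Re (f (x + h *\<^sub>R v + h *\<^sub>R w)) - Re (f (x + h *\<^sub>R v)) - Re (f (x + h *\<^sub>R w)) + Re (f x)
   = h * h * Re (pd w (pd v f) (x + \<xi> *\<^sub>R v + \<eta> *\<^sub>R w))"
proof -
 let ?\<psi> = "%s. Re (f ((x + h *\<^sub>R w) + s *\<^sub>R v)) - Re (f (x + s *\<^sub>R v))"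
 have "\<exists>\<xi>. 0 < \<xi> \<and> \<xi> < h \<and> ?\<psi> h - ?\<psi> 0 = (h - 0) * (Re (pd v f ((x + h *\<^sub>R w) + \<xi> *\<^sub>R v)) - Re (pd v f (x + \<xi> *\<^sub>R v)))"
  by (rule MVT2[OF assms(2)]) (intro DERIV_diff pd_along_line assms)
 then obtain \<xi> where \<xi>: "0 < \<xi>" "\<xi> < h"
  "?\<psi> h - ?\<psi> 0 = h * (Re (pd v f ((x + h *\<^sub>R w) + \<xi> *\<^sub>R v)) - Re (pd v f (x + \<xi> *\<^sub>R v)))" by auto
 let ?\<phi> = "%t. Re (pd v f ((x + \<xi> *\<^sub>R v) + t *\<^sub>R w))"
 have "\<exists>\<eta>. 0 < \<eta> \<and> \<eta> < h \<and> ?\<phi> h - ?\<phi> 0 = (h - 0) * Re (pd w (pd v f) ((x + \<xi> *\<^sub>R v) + \<eta> *\<^sub>R w))"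
  by (rule MVT2[OF assms(2)]) (intro pd_along_line smooth_pd assms)
 then obtain \<eta> where \<eta>: "0 < \<eta>" "\<eta> < h"
  "?\<phi> h - ?\<phi> 0 = h * Re (pd w (pd v f) ((x + \<xi> *\<^sub>R v) + \<eta> *\<^sub>R w))" by auto
 have "?\<psi> h - ?\<psi> 0 = h * (?\<phi> h - ?\<phi> 0)" unfolding \<xi>(3) by (simp add: add_ac)
 hence "?\<psi> h - ?\<psi> 0 = h * h * Re (pd w (pd v f) (x + \<xi> *\<^sub>R v + \<eta> *\<^sub>R w))" unfolding \<eta>(3) by simp
 thus ?thesis using \<xi>(1,2) \<eta>(1,2) by (intro exI[of _ \<xi>] exI[of _ \<eta>]) (simp add: add_ac)
qed

text \<open>The second difference is symmetric in v and w, so both mixed derivatives take a common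
  value at points arbitrarily close to x; continuity excludes a gap between them at x.\<close>

lemma Re_pd_commute:
 assumes "smooth f" shows "Re (pd v (pd w f) x) = Re (pd w (pd v f) x)"
proof (rule ccontr)
 let ?A = "%y. Re (pd w (pd v f) y)" and ?B = "%y. Re (pd v (pd w f) y)"
 assume "\<not> ?thesis"
 hence e: "\<bar>?A x - ?B x\<bar> / 2 > 0" (is "?e > 0") by simp
 have cont: "isCont (%y. Re (pd a (pd b f) y)) x" for a b
  using differentiable_imp_continuous_within[OF smooth_imp_differentiable[OF smooth_pd[OF smooth_pd[OF assms]]]]
  by (rule continuous_Re)
 obtain d where d: "d > 0" "!!y. dist y x < d ==> dist (?A y) (?A x) < ?e"
  using cont[of w v] e unfolding continuous_at_eps_delta by blast
 obtain d' where d': "d' > 0" "!!y. dist y x < d' ==> dist (?B y) (?B x) < ?e"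
  using cont[of v w] e unfolding continuous_at_eps_delta by blast
 \<comment> \<open>All intermediate points lie within h times the sum of the two norms; the summand
   1 keeps the denominator positive and the estimate strict.\<close>
 define h where "h = min d d' / (norm v + norm w + 1)"
 have pos: "norm v + norm w + 1 > 0" by (smt (verit) norm_ge_zero)
 have h: "h > 0" unfolding h_def using d d' pos by simp
 have hb: "h * (norm v + norm w) < min d d'"
 proof -
  have "h * (norm v + norm w + 1) = min d d'" unfolding h_def using pos by simp
  moreover have "h * (norm v + norm w + 1) = h * (norm v + norm w) + h" by (simp add: algebra_simps)
  ultimately show ?thesis using h by linarith
 qed
 have near: "dist (x + a *\<^sub>R v + b *\<^sub>R w) x < min d d'" if "0 < a" "a < h" "0 < b" "b < h" for a b
 proof -
  have "dist (x + a *\<^sub>R v + b *\<^sub>R w) x = norm (a *\<^sub>R v + b *\<^sub>R w)" by (simp add: dist_norm)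
  also have "\<dots> \<le> a * norm v + b * norm w" using norm_triangle_ineq[of "a *\<^sub>R v" "b *\<^sub>R w"] that by simp
  also have "\<dots> \<le> h * norm v + h * norm w" using that by (intro add_mono mult_right_mono) auto
  finally show ?thesis using hb by (simp add: algebra_simps)
 qed
 obtain a b where ab: "0 < a" "a < h" "0 < b" "b < h"
  "Re (f (x + h *\<^sub>R v + h *\<^sub>R w)) - Re (f (x + h *\<^sub>R v)) - Re (f (x + h *\<^sub>R w)) + Re (f x)
   = h * h * ?A (x + a *\<^sub>R v + b *\<^sub>R w)"
  using second_difference[OF assms h] by blast
 obtain a' b' where ab': "0 < a'" "a' < h" "0 < b'" "b' < h"
  "Re (f (x + h *\<^sub>R w + h *\<^sub>R v)) - Re (f (x + h *\<^sub>R w)) - Re (f (x + h *\<^sub>R v)) + Re (f x)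
   = h * h * ?B (x + a' *\<^sub>R w + b' *\<^sub>R v)"
  using second_difference[OF assms h, of x w v] by blast
 have "h * h * ?A (x + a *\<^sub>R v + b *\<^sub>R w) = h * h * ?B (x + a' *\<^sub>R w + b' *\<^sub>R v)"
  unfolding ab(5)[symmetric] ab'(5)[symmetric] by (simp add: add_ac)
 hence "?A (x + a *\<^sub>R v + b *\<^sub>R w) = ?B (x + b' *\<^sub>R v + a' *\<^sub>R w)" using h by (simp add: add_ac)
 moreover have "dist (?A (x + a *\<^sub>R v + b *\<^sub>R w)) (?A x) < ?e" using d(2) near[OF ab(1-4)] by auto
 moreover have "dist (?B (x + b' *\<^sub>R v + a' *\<^sub>R w)) (?B x) < ?e" using d'(2) near[OF ab'(3,4) ab'(1,2)] by auto
 ultimately show False by (auto simp: dist_real_def abs_if split: if_splits)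
qed

lemma pd_commute:
 assumes "smooth f" shows "pd v (pd w f) = pd w (pd v f)"
proof (rule ext)
 fix x
 \<comment> \<open>Multiplication by - \<i> turns the imaginary part into a real part.\<close>
 define c where "c = - \<i>"
 have sm: "smooth (%x. c * f x)" by (intro smooth_mult smooth_const assms)
 have *: "pd v (%x. c * g x) = (%x. c * pd v g x)" if "smooth g" for g :: "'a => complex" and v
  using pd_mult[OF smooth_const that, of v c] by (simp add: pd_const)
 have "Re (c * z) = Im z" for z by (simp add: c_def)
 hence "Im (pd v (pd w f) x) = Im (pd w (pd v f) x)"
  using Re_pd_commute[OF sm, of v w x] by (simp add: * assms smooth_pd)
 thus "pd v (pd w f) x = pd w (pd v f) x" using Re_pd_commute[OF assms, of v w x] by (simp add: complex_eq_iff)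
qed

text \<open>A type rather than a set, so that smooth functions form a \<open>comm_ring_1\<close> and
  can be coefficients of polynomials and exterior algebras.\<close>

typedef (overloaded) ('x::euclidean_space) sfun = "{f::'x => complex. smooth f}"
 morphisms fun_of Sfun
 using smooth_const by auto

setup_lifting type_definition_sfun

instantiation sfun :: (euclidean_space) comm_ring_1
begin
lift_definition zero_sfun :: "'a sfun" is "%_. 0" by (rule smooth_const)
lift_definition one_sfun :: "'a sfun" is "%_. 1" by (rule smooth_const)
lift_definition plus_sfun :: "'a sfun => 'a sfun => 'a sfun" is "%f g x. f x + g x" by (rule smooth_add)
lift_definition minus_sfun :: "'a sfun => 'a sfun => 'a sfun" is "%f g x. f x - g x" by (rule smooth_diff)
lift_definition uminus_sfun :: "'a sfun => 'a sfun" is "%f x. - f x" by (rule smooth_uminus)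
lift_definition times_sfun :: "'a sfun => 'a sfun => 'a sfun" is "%f g x. f x * g x" by (rule smooth_mult)
instance by standard (transfer; simp add: algebra_simps fun_eq_iff)+
end

lift_definition cfun :: "complex => 'x::euclidean_space sfun" is "%c _. c" by (rule smooth_const)
lift_definition pds :: "'x::euclidean_space => 'x sfun => 'x sfun" is pd by (rule smooth_pd)

lemma cfun_simps [simp]: "cfun 0 = 0" "cfun 1 = 1"
 by (transfer, simp)+

lemma cfun_add: "cfun (a + b) = cfun a + cfun b" by transfer simp
lemma cfun_mult: "cfun (a * b) = cfun a * cfun b" by transfer simp
lemma cfun_minus: "cfun (- a) = - cfun a" by transfer simp
lemma cfun_diff: "cfun (a - b) = cfun a - cfun b" by transfer simp

lemma pds_add: "pds v (f + g) = pds v f + pds v g" by transfer (rule pd_add)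
lemma pds_mult: "pds v (f * g) = pds v f * g + f * pds v g" by transfer (rule pd_mult)
lemma pds_cfun [simp]: "pds v (cfun c) = 0" by transfer (rule pd_const)
lemma pds_commute: "pds v (pds w f) = pds w (pds v f)" by transfer (rule pd_commute)

lemma pds_plus: "pds (v + w) f = pds v f + pds w f"
 by transfer (simp add: fun_eq_iff linear_add[OF pd_linear])
lemma pds_scale: "pds (c *\<^sub>R v) f = cfun (of_real c) * pds v f"
 by transfer (simp add: fun_eq_iff linear_cmul[OF pd_linear] scaleR_conv_of_real)

lemma fun_of_zero: "fun_of 0 = (%_. 0)" by transfer simp

lemma fun_of_sum: "fun_of (sum f A) x = (\<Sum>i\<in>A. fun_of (f i) x)"
 by (induction A rule: infinite_finite_induct) (simp_all add: zero_sfun.rep_eq plus_sfun.rep_eq)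

lemma smooth_fun_of [simp]: "smooth (fun_of f)" using fun_of by auto

subsection \<open>Exterior algebras\<close>

definition inversions :: "'o::finite set => 'o set => ('o \<times> 'o) set" where
 "inversions J J' = {(a, b). a : J \<and> b : J' \<and> to_nat_on (UNIV :: 'o set) b < to_nat_on (UNIV :: 'o set) a}"

text \<open>The sign \<open>shuffle_sign\<close> with values in an arbitrary commutative ring of
  coefficients.\<close>

definition ssign :: "'o::finite set => 'o set => 'r::comm_ring_1" where
 "ssign J J' = (-1) ^ card (inversions J J')"

lemma ssign_Un_left: "A \<inter> B = {} ==> ssign (A \<union> B) C = ssign A C * ssign B C"
proof -
 assume "A \<inter> B = {}"
 moreover have "inversions (A \<union> B) C = inversions A C \<union> inversions B C" by (auto simp: inversions_def)
 moreover have "inversions A C \<inter> inversions B C = {}" using calculation(1) by (auto simp: inversions_def)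
 ultimately show ?thesis by (simp add: ssign_def card_Un_disjoint power_add)
qed

lemma ssign_Un_right: "B \<inter> C = {} ==> ssign A (B \<union> C) = ssign A B * ssign A C"
proof -
 assume "B \<inter> C = {}"
 moreover have "inversions A (B \<union> C) = inversions A B \<union> inversions A C" by (auto simp: inversions_def)
 moreover have "inversions A B \<inter> inversions A C = {}" using calculation(1) by (auto simp: inversions_def)
 ultimately show ?thesis by (simp add: ssign_def card_Un_disjoint power_add)
qed

lemma ssign_empty [simp]: "ssign {} A = 1" "ssign A {} = 1"
 by (simp_all add: ssign_def inversions_def)

lemma ssign_square: "ssign A B * ssign A B = 1"
 by (simp add: ssign_def power_add[symmetric] mult_2[symmetric] power_mult)

lemma ssign_square_left: "ssign A B * (ssign A B * c) = c"
 using ssign_square[of A B] by (metis mult.assoc mult_1)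

lemma ssign_singletons:
 assumes "a ~= b" shows "ssign {a} {b} = - ssign {b} {a}"
proof -
 have "to_nat_on UNIV a ~= to_nat_on UNIV b"
  using inj_on_to_nat_on[OF countable_finite[OF finite], of UNIV] assms by (auto simp: inj_on_def)
 hence "inversions {a} {b} = {(a, b)} \<and> inversions {b} {a} = {} \<or> inversions {a} {b} = {} \<and> inversions {b} {a} = {(b, a)}"
  unfolding neq_iff by (auto simp: inversions_def)
 thus ?thesis by (auto simp: ssign_def)
qed

lemma ssign_insert_right: "b \<notin> J ==> ssign A (insert b J) = ssign A {b} * ssign A J"
 using ssign_Un_right[of "{b}" J A] by simp

text \<open>The exterior algebra on the generators 'o over 'r, stored by its coefficients at the
  ordered monomials. As an instance of \<open>ring_1\<close> it admits calculation with equations,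
  which the record \<open>superfields\<close> does not offer directly.\<close>

typedef ('o, 'r) ext = "UNIV :: ('o set => 'r) set" morphisms coef Ext by simp

lemma ext_eqI: "(!!J. coef x J = coef y J) ==> x = y"
 by (simp add: coef_inject[symmetric] fun_eq_iff)

lemma coef_Ext [simp]: "coef (Ext f) = f" by (simp add: Ext_inverse)

instantiation ext :: (finite, comm_ring_1) ring_1
begin
definition "0 = Ext (%_. 0)"
definition "1 = Ext (%J. if J = {} then 1 else 0)"
definition "x + y = Ext (%J. coef x J + coef y J)"
definition "x - y = Ext (%J. coef x J - coef y J)"
definition "- x = Ext (%J. - coef x J)"
definition "x * y = Ext (%K. \<Sum>J\<in>Pow K. ssign J (K - J) * coef x J * coef y (K - J))"

lemma coef_simps [simp]:
 "coef 0 J = 0" "coef 1 J = (if J = {} then 1 else 0)" "coef (x + y) J = coef x J + coef y J"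
 "coef (x - y) J = coef x J - coef y J" "coef (- x) J = - coef x J"
 by (simp_all add: zero_ext_def one_ext_def plus_ext_def minus_ext_def uminus_ext_def)

lemma coef_times: "coef (x * y) K = (\<Sum>J\<in>Pow K. ssign J (K - J) * coef x J * coef y (K - J))"
 by (simp add: times_ext_def)

instance
proof
 fix x y z :: "('a, 'b) ext"
 show "x * y * z = x * (y * z)"
 proof (rule ext_eqI)
  fix K
  have "coef (x * y * z) K = (\<Sum>J\<in>Pow K. \<Sum>A\<in>Pow J.
    ssign J (K - J) * (ssign A (J - A) * coef x A * coef y (J - A)) * coef z (K - J))"
   by (simp add: coef_times sum_distrib_left sum_distrib_right)
  also have "\<dots> = (\<Sum>(J, A)\<in>(SIGMA J:Pow K. Pow J).
    ssign J (K - J) * (ssign A (J - A) * coef x A * coef y (J - A)) * coef z (K - J))"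
   by (rule sum.Sigma) auto
  \<comment> \<open>Both sums run over the ordered partitions of K into three blocks A, B, C: the
    pair (J, A) records the union of the first two blocks and the first one, the pair (A, B) the
    first two. The signs agree because \<open>ssign\<close> is multiplicative in each
    argument.\<close>
  also have "\<dots> = (\<Sum>(A, B)\<in>(SIGMA A:Pow K. Pow (K - A)).
    ssign A (K - A) * coef x A * (ssign B (K - A - B) * coef y B * coef z (K - A - B)))"
  proof (rule sum.reindex_bij_witness[of _ "%(A, B). (A \<union> B, A)" "%(J, A). (A, J - A)"], goal_cases)
   case (5 p)
   then obtain J A where p: "p = (J, A)" "A \<subseteq> J" "J \<subseteq> K" by auto
   define B C where "B = J - A" and "C = K - J"
   have J: "J = A \<union> B" "A \<inter> B = {}" using p by (auto simp: B_def)
   have C: "K - A = B \<union> C" "B \<inter> C = {}" "K - A - B = C" using p by (auto simp: B_def C_def)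
   have BC: "B \<union> C - B = C" using C(2) by auto
   show ?case unfolding p prod.case
    unfolding C_def[symmetric] B_def[symmetric] C(3) C(1) ssign_Un_right[OF C(2)]
    by (subst J(1), subst ssign_Un_left[OF J(2)]) (simp add: mult_ac BC)
  qed auto
  also have "\<dots> = (\<Sum>A\<in>Pow K. \<Sum>B\<in>Pow (K - A).
    ssign A (K - A) * coef x A * (ssign B (K - A - B) * coef y B * coef z (K - A - B)))"
   by (rule sum.Sigma[symmetric]) auto
  also have "\<dots> = coef (x * (y * z)) K"
   by (simp add: coef_times sum_distrib_left)
  finally show "coef (x * y * z) K = coef (x * (y * z)) K" .
 qed
 show "1 * x = x"
 proof (rule ext_eqI)
  fix K
  have "coef (1 * x) K = (\<Sum>J\<in>Pow K. if J = {} then coef x K else 0)"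
   unfolding coef_times by (rule sum.cong) auto
  thus "coef (1 * x) K = coef x K" by (simp add: sum.delta)
 qed
 show "x * 1 = x"
 proof (rule ext_eqI)
  fix K
  have "coef (x * 1) K = (\<Sum>J\<in>Pow K. if J = K then coef x K else 0)"
   unfolding coef_times by (rule sum.cong) auto
  thus "coef (x * 1) K = coef x K" by (simp add: sum.delta)
 qed
 show "(x + y) * z = x * z + y * z" "x * (y + z) = x * y + x * z"
  by (rule ext_eqI; simp add: coef_times algebra_simps sum.distrib)+
 show "(0::('a, 'b) ext) ~= 1"
 proof
  assume "(0::('a, 'b) ext) = 1"
  hence "coef (0::('a, 'b) ext) {} = coef 1 {}" by simp
  thus False by simp
 qed
qed (rule ext_eqI; simp add: algebra_simps)+
end

lemma coef_sum: "coef (sum f A) J = (\<Sum>i\<in>A. coef (f i) J)"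
 by (induction A rule: infinite_finite_induct) simp_all

definition scal :: "'r::comm_ring_1 => ('o::finite, 'r) ext => ('o, 'r) ext" (infixr "\<odot>" 75) where
 "c \<odot> x = Ext (%J. c * coef x J)"

definition emono :: "'o::finite set => ('o, 'r::comm_ring_1) ext" where
 "emono J = Ext (%J'. if J' = J then 1 else 0)"

abbreviation gen :: "'o::finite => ('o, 'r::comm_ring_1) ext" where
 "gen a \<equiv> emono {a}"

lemma coef_scal [simp]: "coef (c \<odot> x) J = c * coef x J" by (simp add: scal_def)
lemma coef_emono [simp]: "coef (emono J) J' = (if J' = J then 1 else 0)" by (simp add: emono_def)

lemma scal_simps:
 "c \<odot> (x + y) = c \<odot> x + c \<odot> y" "(c + d) \<odot> x = c \<odot> x + d \<odot> x" "c \<odot> (x - y) = c \<odot> x - c \<odot> y"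
 "(c - d) \<odot> x = c \<odot> x - d \<odot> x" "c \<odot> (- x) = - (c \<odot> x)" "(- c) \<odot> x = - (c \<odot> x)"
 "c \<odot> d \<odot> x = (c * d) \<odot> x" 
 by (rule ext_eqI; simp add: algebra_simps)+

lemma scal_trivial [simp]: "0 \<odot> x = 0" "c \<odot> 0 = 0" "1 \<odot> x = x"
 by (rule ext_eqI; simp)+

lemma scal_left_commute: "c \<odot> d \<odot> x = d \<odot> c \<odot> x"
 by (rule ext_eqI) (simp add: algebra_simps)

lemma scal_mult_left: "(c \<odot> x) * y = c \<odot> (x * y)"
 by (rule ext_eqI) (simp add: coef_times sum_distrib_left algebra_simps)

lemma scal_mult_right: "x * (c \<odot> y) = c \<odot> (x * y)"
 by (rule ext_eqI) (simp add: coef_times sum_distrib_left algebra_simps)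

lemma scal_sum: "c \<odot> sum f A = (\<Sum>i\<in>A. c \<odot> f i)"
 by (rule ext_eqI) (simp add: coef_sum sum_distrib_left)

lemma sum_scal: "sum f A \<odot> x = (\<Sum>i\<in>A. f i \<odot> x)"
 by (rule ext_eqI) (simp add: coef_sum sum_distrib_right)

lemma emono_empty [simp]: "emono {} = 1" by (rule ext_eqI) simp

lemma emono_mult: "emono J * emono J' = (if J \<inter> J' = {} then ssign J J' \<odot> emono (J \<union> J') else 0)"
proof (rule ext_eqI)
 fix K
 have "coef (emono J * emono J' :: ('a, 'b) ext) K =
  (\<Sum>A\<in>Pow K. if A = J then ssign J (K - J) * (if K - J = J' then 1 else 0) else (0::'b))"
  unfolding coef_times by (rule sum.cong) auto
 also have "\<dots> = (if J \<subseteq> K \<and> K - J = J' then ssign J J' else 0)" by (auto simp: sum.delta)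
 also have "J \<subseteq> K \<and> K - J = J' \<longleftrightarrow> J \<inter> J' = {} \<and> K = J \<union> J'" by auto
 finally show "coef (emono J * emono J' :: ('a, 'b) ext) K = coef (if J \<inter> J' = {} then ssign J J' \<odot> emono (J \<union> J') else 0) K"
  by auto
qed

lemma gen_mult_emono: "gen a * emono J = (if a : J then 0 else ssign {a} J \<odot> emono (insert a J))"
 by (auto simp: emono_mult)

lemma gen_anticommute: "gen a * gen b = - (gen b * gen a)"
 by (cases "a = b") (auto simp: emono_mult ssign_singletons[of a b] scal_simps insert_commute)

lemma ext_expand: "x = (SU J. coef x J \<odot> emono J)"
proof (rule ext_eqI)
 fix K
 have "coef (SU J. coef x J \<odot> emono J) K = (SU J. if J = K then coef x K else 0)"
  unfolding coef_sum by (rule sum.cong) auto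
 thus "coef x K = coef (SU J. coef x J \<odot> emono J) K" by simp
qed

lemma ext_induct [case_names scalar gen add]:
 fixes x :: "('o::finite, 'r::comm_ring_1) ext"
 assumes scalar: "!!c. P (c \<odot> 1)" and gen: "!!a x. P x ==> P (gen a * x)" and add: "!!x y. P x ==> P y ==> P (x + y)"
 shows "P x"
proof -
 have mono: "P (c \<odot> emono J)" for c J
 proof (induction J arbitrary: c rule: finite_induct[OF finite])
  case 1 show ?case using scalar by simp
 next
  case (2 a J)
  have "c \<odot> emono (insert a J) = gen a * ((c * ssign {a} J) \<odot> emono J)"
   using 2 by (simp add: gen_mult_emono scal_mult_right scal_simps mult.assoc ssign_square)
  thus ?case using gen[OF 2(3)] by simp
 qed
 have "P (\<Sum>J\<in>A. coef x J \<odot> emono J)" if "finite A" for A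
  using that
 proof induction
  case empty show ?case using scalar[of 0] by simp
 qed (auto intro: add mono)
 thus ?thesis by (subst ext_expand) auto
qed

subsection \<open>Derivations of exterior algebras\<close>

definition odd_deriv :: "'o::finite => ('o, 'r::comm_ring_1) ext => ('o, 'r) ext" where
 "odd_deriv a x = Ext (%J. if a : J then 0 else ssign {a} J * coef x (insert a J))"

definition parity :: "('o::finite, 'r::comm_ring_1) ext => ('o, 'r) ext" where
 "parity x = Ext (%J. (-1) ^ card J * coef x J)"

definition coefwise :: "('r::comm_ring_1 => 'r) => ('o::finite, 'r) ext => ('o, 'r) ext" where
 "coefwise d x = Ext (%J. d (coef x J))"

lemma coef_coefwise [simp]: "coef (coefwise d x) J = d (coef x J)" by (simp add: coefwise_def)
lemma coef_parity [simp]: "coef (parity x) J = (-1) ^ card J * coef x J" by (simp add: parity_def)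
lemma coef_odd_deriv: "coef (odd_deriv a x) J = (if a : J then 0 else ssign {a} J * coef x (insert a J))"
 by (simp add: odd_deriv_def)

lemma odd_deriv_add [simp]: "odd_deriv a (x + y) = odd_deriv a x + odd_deriv a y"
 and odd_deriv_scal [simp]: "odd_deriv a (c \<odot> x) = c \<odot> odd_deriv a x"
 by (rule ext_eqI; simp add: coef_odd_deriv algebra_simps)+

lemma odd_deriv_one [simp]: "odd_deriv a 1 = 0" by (rule ext_eqI) (simp add: coef_odd_deriv)

lemma minus_one_power_cancel: "(-1) ^ n * ((-1) ^ n * c) = (c :: 'r::comm_ring_1)"
 by (cases "even n") auto

lemma parity_simps [simp]: "parity (x + y) = parity x + parity y" "parity (c \<odot> x) = c \<odot> parity x"
 "parity 1 = 1" "parity (gen a) = - gen a" "parity (parity x) = x"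
 by (rule ext_eqI; simp add: algebra_simps minus_one_power_cancel)+

text \<open>The canonical anticommutation relation. It is checked on monomials, by cases on a = b
  and on membership of a and b in J, and extended linearly.\<close>

lemma odd_deriv_gen_mult: "odd_deriv a (gen b * x) = (if a = b then x else 0) - gen b * odd_deriv a x"
proof -
 have *: "odd_deriv a (emono J) = (if a : J then ssign {a} (J - {a}) \<odot> emono (J - {a}) else 0)" for a and J :: "'a set"
  by (rule ext_eqI) (auto simp: coef_odd_deriv insert_Diff_if)
 have "odd_deriv a (gen b * emono J) = (if a = b then emono J else 0) - gen b * odd_deriv a (emono J :: ('a, 'b) ext)" for J
 proof (cases "b : J")
  case True
  show ?thesis
  proof (cases "a = b")
   case True
   thus ?thesis using \<open>b : J\<close>
    by (simp add: gen_mult_emono * scal_mult_right scal_simps ssign_square insert_absorb)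
     (rule ext_eqI, simp add: coef_odd_deriv)
  next
   case False
   thus ?thesis using \<open>b : J\<close>
    by (simp add: gen_mult_emono * scal_mult_right) (rule ext_eqI, simp add: coef_odd_deriv)
  qed
 next
  case False
  show ?thesis
  proof (cases "a = b")
   case True
   thus ?thesis using False by (simp add: gen_mult_emono * scal_simps ssign_square)
  next
   case ab: False
   show ?thesis
   proof (cases "a : J")
    case True
    have 1: "insert b J - {a} = insert b (J - {a})" "b \<notin> J - {a}" using ab False by auto
    have 2: "ssign {b} J = (ssign {b} {a} * ssign {b} (J - {a}) :: 'b)"
     using ssign_insert_right[of a "J - {a}" "{b}"] True by (simp add: insert_absorb)
    show ?thesis using ab False True
     by (simp add: gen_mult_emono * scal_mult_right scal_simps 1 2 ssign_insert_right[OF 1(2)] ssign_singletons[of a b])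
      (simp add: mult_ac ssign_square_left)
   next
    case F: False
    thus ?thesis using ab False by (simp add: gen_mult_emono *)
   qed
  qed
 qed
 note base = this
 have sumD: "odd_deriv a (sum f A) = (\<Sum>i\<in>A. odd_deriv a (f i))" for f :: "'a set => ('a, 'b) ext" and A
  by (induction A rule: infinite_finite_induct) (simp_all, (rule ext_eqI, simp add: coef_odd_deriv)+)
 have "odd_deriv a (gen b * x) = (SU J. coef x J \<odot> odd_deriv a (gen b * emono J))"
  by (subst ext_expand[of x]) (simp add: sum_distrib_left scal_mult_right sumD)
 also have "\<dots> = (if a = b then (SU J. coef x J \<odot> emono J) else 0) - gen b * odd_deriv a (SU J. coef x J \<odot> emono J)"
  by (simp add: base sumD sum_distrib_left scal_mult_right scal_simps sum_subtractf)
 finally show ?thesis unfolding ext_expand[symmetric] .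
qed

lemma parity_sum: "parity (sum f A) = (\<Sum>i\<in>A. parity (f i))"
 by (rule ext_eqI) (simp add: coef_sum sum_distrib_left)

lemma parity_gen_mult: "parity (gen a * x) = - gen a * parity x"
proof -
 have "parity (gen a * emono J) = - gen a * (parity (emono J) :: ('a, 'b) ext)" for J
 proof -
  have "parity (emono J) = (-1) ^ card J \<odot> (emono J :: ('a, 'b) ext)" for J by (rule ext_eqI) simp
  thus ?thesis by (simp add: gen_mult_emono scal_mult_right scal_simps)
   (rule conjI, (rule impI, rule ext_eqI, simp), (rule impI, rule ext_eqI, simp add: mult_ac))
 qed
 note base = this
 have "parity (gen a * x) = (SU J. coef x J \<odot> parity (gen a * emono J))"
  by (subst ext_expand[of x]) (simp add: sum_distrib_left scal_mult_right parity_sum)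
 also have "\<dots> = - gen a * parity (SU J. coef x J \<odot> emono J)"
  unfolding base by (simp add: parity_sum sum_distrib_left scal_mult_right scal_simps sum_negf)
 finally show ?thesis unfolding ext_expand[symmetric] .
qed

lemma parity_mult [simp]: "parity (x * y) = parity x * parity y"
 by (induction x rule: ext_induct) (simp_all add: scal_mult_left parity_gen_mult mult.assoc distrib_right)

lemma odd_deriv_mult: "odd_deriv a (x * y) = odd_deriv a x * y + parity x * odd_deriv a y"
proof (induction x rule: ext_induct)
 case (gen b x)
 thus ?case by (simp add: mult.assoc odd_deriv_gen_mult parity_gen_mult algebra_simps)
qed (simp_all add: scal_mult_left algebra_simps)

lemma coefwise_mult:
 assumes "!!c c'. d (c + c') = d c + d c'" "!!c c'. d (c * c') = d c * c' + c * d c'"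
 shows "coefwise d (x * y) = coefwise d x * y + x * coefwise d y"
proof (rule ext_eqI)
 fix K
 have d0: "d 0 = 0" using assms(1)[of 0 0] by simp
 have d1: "d 1 = 0" using assms(2)[of 1 1] by simp
 have dm1: "d (- c) = - d c" for c using assms(1)[of c "-c"] by (simp add: d0 add_eq_0_iff)
 \<comment> \<open>The signs are 1 or -1, hence constants for d.\<close>
 have ds: "d (ssign A B) = 0" for A B :: "'b set"
  by (cases "even (card (inversions A B))") (simp_all add: ssign_def d1 dm1)
 have dsum: "d (sum f A) = (\<Sum>i\<in>A. d (f i))" for f :: "'b set => 'a" and A
  by (induction A rule: infinite_finite_induct) (simp_all add: d0 assms(1))
 show "coef (coefwise d (x * y)) K = coef (coefwise d x * y + x * coefwise d y) K"
  by (simp add: coef_times dsum assms(2) ds sum.distrib[symmetric] algebra_simps)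
qed

subsection \<open>Polynomials with smooth coefficients\<close>

abbreviation lookup where "lookup \<equiv> Poly_Mapping.lookup"
abbreviation keys where "keys \<equiv> Poly_Mapping.keys"
abbreviation single where "single \<equiv> Poly_Mapping.single"

lemma pm_expand:
 fixes c :: "'e \<Rightarrow>\<^sub>0 'a::comm_ring_1"
 shows "c = (\<Sum>k\<in>keys c. single k (lookup c k))"
proof (rule poly_mapping_eqI)
 fix k
 have "lookup (\<Sum>k\<in>keys c. single k (lookup c k)) k =
  (\<Sum>l\<in>keys c. if l = k then lookup c k else 0)"
  unfolding lookup_sum by (rule sum.cong) (auto simp: lookup_single)
 also have "\<dots> = lookup c k" by (simp add: in_keys_iff)
 finally show "lookup c k = lookup (\<Sum>k\<in>keys c. single k (lookup c k)) k" by simp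
qed

lemma pm_induct [case_names single add]:
 fixes c :: "'e \<Rightarrow>\<^sub>0 'a::comm_ring_1"
 assumes single: "!!k v. P (single k v)" and add: "!!c d. P c ==> P d ==> P (c + d)"
 shows "P c"
proof -
 have "P (\<Sum>k\<in>A. single k (lookup c k))" if "finite A" for A
  using that
 proof induction
  case empty show ?case using single[of undefined 0] by simp
 qed (auto intro: assms)
 thus ?thesis by (subst pm_expand) auto
qed

lemma lookup_mult_sum:
 fixes c :: "'e::comm_monoid_add \<Rightarrow>\<^sub>0 'a::comm_ring_1"
 shows "lookup (c * d) e = (\<Sum>p\<in>keys c. \<Sum>q\<in>keys d. if p + q = e then lookup c p * lookup d q else 0)"
proof -
 have "c * d = (\<Sum>p\<in>keys c. \<Sum>q\<in>keys d. single (p + q) (lookup c p * lookup d q))"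
  by (subst pm_expand[of c], subst pm_expand[of d]) (simp add: sum_product mult_single)
 thus ?thesis by (simp add: lookup_sum lookup_single when_def)
qed

definition dpol :: "'x => ('e \<Rightarrow>\<^sub>0 ('x::euclidean_space) sfun) => ('e \<Rightarrow>\<^sub>0 'x sfun)" where
 "dpol v = Poly_Mapping.map (pds v)"

lemma pds_zero [simp]: "pds v 0 = 0" using pds_cfun[of v 0] by simp

lemma lookup_dpol [simp]: "lookup (dpol v c) e = pds v (lookup c e)"
 by (simp add: dpol_def Poly_Mapping.map.rep_eq when_def)

lemma dpol_single [simp]: "dpol v (single e f) = single e (pds v f)"
 by (rule poly_mapping_eqI) (simp add: lookup_single when_def)

lemma dpol_add: "dpol v (c + d) = dpol v c + dpol v d"
 by (rule poly_mapping_eqI) (simp add: lookup_add pds_add)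

lemma dpol_mult: "dpol v (c * d) = dpol v c * d + c * dpol v d"
proof (induction c rule: pm_induct)
 case (single k f)
 show ?case
  by (induction d rule: pm_induct) (simp_all add: mult_single pds_mult single_add dpol_add algebra_simps)
qed (simp add: dpol_add algebra_simps)

lemma dpol_commute: "dpol v (dpol w c) = dpol w (dpol v c)"
 by (rule poly_mapping_eqI) (simp add: pds_commute)

text \<open>A ring homomorphism that sends the monomial e to a scalar multiple of the monomial
  \<open>h e\<close> and applies g to the coefficients. The scalar \<open>w e\<close> is what lets
  \<open>jR\<close> below evaluate the coordinates \<lambda> at a multiple of Q.\<close>

definition pol_hom :: "('e => 'f) => ('e => 'b) => ('a => 'b) => ('e::comm_monoid_add \<Rightarrow>\<^sub>0 'a::comm_ring_1) => ('f::comm_monoid_add \<Rightarrow>\<^sub>0 'b::comm_ring_1)" where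
 "pol_hom h w g c = (\<Sum>e\<in>keys c. single (h e) (w e * g (lookup c e)))"

locale pol_hom_data =
 fixes h :: "'e::comm_monoid_add => 'f::comm_monoid_add" and w :: "'e => 'b::comm_ring_1" and g :: "'a::comm_ring_1 => 'b"
 assumes h: "h 0 = 0" "!!e e'. h (e + e') = h e + h e'"
  and w: "w 0 = 1" "!!e e'. w (e + e') = w e * w e'"
  and g: "g 1 = 1" "!!a b. g (a + b) = g a + g b" "!!a b. g (a * b) = g a * g b"
begin

lemma g_zero: "g 0 = 0" using g(2)[of 0 0] by simp

lemma hom_superset:
 assumes "finite A" "keys c \<subseteq> A"
 shows "pol_hom h w g c = (\<Sum>e\<in>A. single (h e) (w e * g (lookup c e)))"
 unfolding pol_hom_def by (rule sum.mono_neutral_left) (use assms in \<open>auto simp: in_keys_iff g_zero\<close>)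

lemma hom_add: "pol_hom h w g (c + d) = pol_hom h w g c + pol_hom h w g d"
proof -
 let ?A = "keys c \<union> keys d"
 show ?thesis
  using hom_superset[of ?A c] hom_superset[of ?A d] hom_superset[of ?A "c + d"] keys_add[of c d]
  by (simp add: lookup_add g single_add algebra_simps sum.distrib)
qed

lemma hom_single: "pol_hom h w g (single e f) = single (h e) (w e * g f)"
 using hom_superset[of "{e}" "single e f"] by auto

lemma hom_one: "pol_hom h w g 1 = 1"
 using hom_single[of 0 1] by (simp add: h w g)

lemma hom_mult: "pol_hom h w g (c * d) = pol_hom h w g c * pol_hom h w g d"
proof (induction c rule: pm_induct)
 case (single k f)
 show ?case
  by (induction d rule: pm_induct) (simp_all add: mult_single hom_single h w g hom_add algebra_simps)
qed (simp add: hom_add algebra_simps)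

end

subsection \<open>Homomorphisms out of exterior algebras\<close>

definition position :: "'o::finite => nat" where "position = to_nat_on UNIV"

lemma position_inj: "position a = position b \<longleftrightarrow> a = b"
 unfolding position_def by (simp add: countable_finite)

text \<open>The factors are taken in the order of \<open>to_nat_on\<close>, the order in which
  \<open>emono J\<close> is the product of its generators.\<close>

definition epow :: "('n::finite => 'b::ring_1) => 'n set => 'b" where
 "epow \<eta> J = prod_list (map (%k. \<eta> (inv_into UNIV position k)) (sorted_list_of_set (position ` J)))"

lemma inv_position [simp]: "inv_into UNIV position (position a) = a"
 by (rule inv_f_f) (simp add: inj_def position_inj)

lemma epow_empty [simp]: "epow \<eta> {} = 1" by (simp add: epow_def)

lemma epow_min:
 assumes "!!j. j : J ==> position m < position j" shows "epow \<eta> (insert m J) = \<eta> m * epow \<eta> J"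
proof -
 have "Min (position ` insert m J) = position m"
  using assms by (intro Min_eqI) (auto intro: less_imp_le)
 moreover have "position ` insert m J - {position m} = position ` J" using assms[of m] by (auto simp: position_inj)
 ultimately have "sorted_list_of_set (position ` insert m J) = position m # sorted_list_of_set (position ` J)"
  using sorted_list_of_set_nonempty[of "position ` insert m J"] by simp
 thus ?thesis by (simp add: epow_def)
qed

lemma ssign_position:
 "(!!j. j : J ==> position i < position j) ==> ssign {i} J = 1"
 "position m < position i ==> ssign {i} {m} = -1"
proof -
 assume "!!j. j : J ==> position i < position j"
 hence "inversions {i} J = {}" by (fastforce simp: inversions_def position_def)
 thus "ssign {i} J = 1" by (simp add: ssign_def)
next
 assume "position m < position i"
 hence "inversions {i} {m} = {(i, m)}" by (auto simp: inversions_def position_def)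
 thus "ssign {i} {m} = -1" by (simp add: ssign_def)
qed

definition ext_hom :: "('q => 'r) => ('n => ('o::finite, 'r::comm_ring_1) ext) => ('n::finite, 'q::comm_ring_1) ext => ('o, 'r) ext" where
 "ext_hom j \<eta> x = (SU J. j (coef x J) \<odot> epow \<eta> J)"

locale ext_hom_data =
 fixes j :: "'q::comm_ring_1 => 'r::comm_ring_1" and \<eta> :: "'n::finite => ('o::finite, 'r) ext"
 assumes j: "j 1 = 1" "!!a b. j (a + b) = j a + j b" "!!a b. j (a * b) = j a * j b"
  and anti: "!!a b. \<eta> a * \<eta> b = - (\<eta> b * \<eta> a)" "!!a. \<eta> a * \<eta> a = 0"
begin

text \<open>Insertion sort: moving past the smallest element m of J costs one transposition, which
  is exactly the change of \<open>ssign\<close> when m is removed.\<close>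

lemma epow_insert: "i \<notin> J ==> \<eta> i * epow \<eta> J = ssign {i} J \<odot> epow \<eta> (insert i J)"
proof (induction "card J" arbitrary: J)
 case 0
 thus ?case using epow_min[of "{}" i \<eta>] by simp
next
 case (Suc n)
 define m where "m = arg_min_on position J"
 have ne: "J ~= {}" using Suc by auto
 have m: "m : J" "!!j. j : J ==> position m \<le> position j"
  unfolding m_def using arg_min_if_finite(1)[of J position] arg_min_least[of J _ position] ne by auto
 define J' where "J' = J - {m}"
 have J': "J = insert m J'" "m \<notin> J'" "card J' = n" "i \<notin> J'" "i ~= m" using m Suc by (auto simp: J'_def)
 have less: "!!j. j : J' ==> position m < position j" using m(2) J' by (metis insertCI le_neq_implies_less position_inj)
 have eJ: "epow \<eta> J = \<eta> m * epow \<eta> J'" using epow_min[OF less] J' by simp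
 show ?case
 proof (cases "position i < position m")
  case True
  have "!!j. j : J ==> position i < position j" using True m(2) by force
  thus ?thesis using epow_min[of J i \<eta>] ssign_position(1)[of J i, where ?'b = 'r] by simp
 next
  case False
  hence mi: "position m < position i" using J'(5) position_inj[of i m] by linarith
  have "\<eta> i * epow \<eta> J = - (\<eta> m * (\<eta> i * epow \<eta> J'))"
   unfolding eJ mult.assoc[symmetric] anti(1)[of i m] by simp
  also have "\<dots> = - (\<eta> m * (ssign {i} J' \<odot> epow \<eta> (insert i J')))"
   using Suc(1)[of J'] J' by simp
  also have "\<dots> = - (ssign {i} J' \<odot> epow \<eta> (insert m (insert i J')))"
  proof -
   have "epow \<eta> (insert m (insert i J')) = \<eta> m * epow \<eta> (insert i J')"
    by (rule epow_min) (use less mi in auto)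
   thus ?thesis by (simp add: scal_mult_right)
  qed
  also have "\<dots> = ssign {i} J \<odot> epow \<eta> (insert i J)"
  proof -
   have "ssign {i} J = - (ssign {i} J' :: 'r)"
    unfolding J'(1) ssign_insert_right[OF J'(2)] ssign_position(2)[OF mi] by simp
   moreover have "insert m (insert i J') = insert i J" unfolding J'(1) by auto
   ultimately show ?thesis by (simp add: scal_simps(6))
  qed
  finally show ?thesis .
 qed
qed

lemma epow_insert_in: assumes "i : J" shows "\<eta> i * epow \<eta> J = 0"
proof -
 obtain J' where J': "J = insert i J'" "i \<notin> J'" using assms by (meson Set.set_insert)
 have "\<eta> i * (ssign {i} J' \<odot> epow \<eta> J) = \<eta> i * \<eta> i * epow \<eta> J'"
  unfolding J'(1) epow_insert[OF J'(2), symmetric] by (simp add: mult.assoc)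
 hence "ssign {i} J' \<odot> (ssign {i} J' \<odot> (\<eta> i * epow \<eta> J)) = 0" by (simp add: anti(2) scal_mult_right)
 thus ?thesis by (simp add: scal_simps ssign_square)
qed

lemma j_zero: "j 0 = 0" using j(2)[of 0 0] by simp
lemma j_minus: "j (- a) = - j a" using j(2)[of a "-a"] by (simp add: j_zero add_eq_0_iff)

lemma ext_hom_add: "ext_hom j \<eta> (x + y) = ext_hom j \<eta> x + ext_hom j \<eta> y"
 by (simp add: ext_hom_def j scal_simps sum.distrib)

lemma ext_hom_scal: "ext_hom j \<eta> (c \<odot> x) = j c \<odot> ext_hom j \<eta> x"
 by (simp add: ext_hom_def j scal_sum scal_simps(7))

lemma ext_hom_emono: "ext_hom j \<eta> (emono J) = epow \<eta> J"
proof -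
 have "ext_hom j \<eta> (emono J) = (SU K. if K = J then epow \<eta> K else 0)"
  unfolding ext_hom_def by (rule sum.cong) (auto simp: j j_zero)
 thus ?thesis by simp
qed

lemma ext_hom_one: "ext_hom j \<eta> 1 = 1" using ext_hom_emono[of "{}"] by simp

lemma ext_hom_sum: "ext_hom j \<eta> (sum f A) = (\<Sum>i\<in>A. ext_hom j \<eta> (f i))"
 by (induction A rule: infinite_finite_induct) (simp_all add: ext_hom_add, simp_all add: ext_hom_def j_zero)

lemma j_ssign: "j (ssign A B) = ssign A B"
 by (cases "even (card (inversions A B))") (simp_all add: ssign_def j j_minus)

lemma ext_hom_gen_mult: "ext_hom j \<eta> (gen a * x) = \<eta> a * ext_hom j \<eta> x"
proof -
 have "ext_hom j \<eta> (gen a * emono J) = \<eta> a * epow \<eta> J" for J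
  by (cases "a : J") (auto simp: gen_mult_emono epow_insert_in epow_insert ext_hom_scal ext_hom_emono j_ssign,
   simp_all add: ext_hom_def j_zero)
 hence "ext_hom j \<eta> (gen a * (SU J. coef x J \<odot> emono J)) = \<eta> a * ext_hom j \<eta> (SU J. coef x J \<odot> emono J)"
  by (simp add: sum_distrib_left scal_mult_right ext_hom_sum ext_hom_scal ext_hom_emono)
 thus ?thesis unfolding ext_expand[symmetric] .
qed

lemma ext_hom_gen: "ext_hom j \<eta> (gen a) = \<eta> a"
 using ext_hom_gen_mult[of a 1] by (simp add: ext_hom_one)

lemma ext_hom_mult: "ext_hom j \<eta> (x * y) = ext_hom j \<eta> x * ext_hom j \<eta> y"
 by (induction x rule: ext_induct)
  (simp_all add: scal_mult_left ext_hom_scal ext_hom_one ext_hom_gen_mult ext_hom_add distrib_right mult.assoc)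

end

subsection \<open>Superfields\<close>

text \<open>The dictionary between the type in which the work is done and the functions of the
  statement; its range is the carrier of \<open>superfields\<close>.\<close>

definition raw :: "('o::finite, 'e::comm_monoid_add \<Rightarrow>\<^sub>0 'x::euclidean_space sfun) ext => ('x, 'o, 'e) superfield" where
 "raw x = (%J e. fun_of (lookup (coef x J) e))"

lemma inj_raw: "raw x = raw y ==> x = y"
 by (rule ext_eqI, rule poly_mapping_eqI) (metis raw_def fun_of_inject)

lemma sf_supp_raw: "sf_supp (raw x) = (SIGMA J:UNIV. keys (coef x J))"
 by (auto simp: sf_supp_def raw_def in_keys_iff fun_of_zero[symmetric] fun_of_inject)

lemma range_raw: "range raw = {f. (\<forall>J e. smooth (f J e)) \<and> finite (sf_supp f)}"
proof (intro equalityI subsetI)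
 fix f :: "('x::euclidean_space, 'o::finite, 'e::comm_monoid_add) superfield" assume "f : {f. (\<forall>J e. smooth (f J e)) \<and> finite (sf_supp f)}"
 hence sm: "smooth (f J e)" and fin: "finite (sf_supp f)" for J e by auto
 have zero: "Sfun (f J e) = 0 \<longleftrightarrow> f J e = (%_. 0)" for J e
  using Sfun_inject[of "f J e" "%_. 0"] sm smooth_const[of 0] by (simp add: zero_sfun_def)
 have "finite {e. Sfun (f J e) ~= 0}" for J
 proof -
  have "{e. Sfun (f J e) ~= 0} \<subseteq> snd ` sf_supp f" by (force simp: zero sf_supp_def)
  thus ?thesis using fin finite_surj by blast
 qed
 hence "raw (Ext (%J. Abs_poly_mapping (%e. Sfun (f J e)))) = f"
  by (intro ext) (simp add: raw_def Abs_poly_mapping_inverse Sfun_inverse sm)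
 thus "f : range raw" by (metis rangeI)
next
 fix f :: "('x::euclidean_space, 'o::finite, 'e::comm_monoid_add) superfield" assume "f : range raw"
 then obtain x where x: "f = raw x" by auto
 show "f : {f. (\<forall>J e. smooth (f J e)) \<and> finite (sf_supp f)}"
  unfolding x mem_Collect_eq sf_supp_raw by (simp add: raw_def finite_SigmaI)
qed

lemma raw_zero: "raw 0 = (%_ _ _. 0)" by (simp add: raw_def fun_of_zero)
lemma raw_add: "raw (x + y) = (%J e z. raw x J e z + raw y J e z)"
 by (simp add: raw_def lookup_add plus_sfun.rep_eq)
lemma raw_diff: "raw (x - y) = (%J e z. raw x J e z - raw y J e z)"
 by (simp add: raw_def lookup_minus minus_sfun.rep_eq)
lemma raw_uminus: "raw (- x) = (%J e z. - raw x J e z)"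
 by (simp add: raw_def uminus_sfun.rep_eq)
lemma raw_sum: "raw (sum f A) = (%J e z. \<Sum>i\<in>A. raw (f i) J e z)"
 by (simp add: raw_def coef_sum lookup_sum fun_of_sum fun_eq_iff)

lemma raw_mono: "raw (single e f \<odot> emono J) = mono J e (fun_of f)"
 by (auto simp: raw_def mono_def fun_eq_iff lookup_single when_def fun_of_zero)

lemma raw_mult: "raw (x * y) = sf_mult (raw x) (raw y)"
proof (intro ext)
 fix K e z
 have sg: "fun_of (lookup (ssign J J' * c) e) z = shuffle_sign J J' * fun_of (lookup c e) z"
  for J J' :: "'a set" and c :: "'b \<Rightarrow>\<^sub>0 'c sfun"
  by (cases "even (card (inversions J J'))")
   (simp_all add: ssign_def shuffle_sign_def inversions_def[symmetric] uminus_sfun.rep_eq)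
 let ?k = "%x J. keys (coef x J)"
 let ?s = "%J J' p q. if J \<inter> J' = {} \<and> J \<union> J' = K \<and> p + q = e then shuffle_sign J J' * raw x J p z * raw y J' q z else 0"
 have "sf_mult (raw x) (raw y) K e z = (SU J. \<Sum>p\<in>?k x J. SU J'. \<Sum>q\<in>?k y J'. ?s J J' p q)"
  unfolding sf_mult_def sf_supp_raw by (subst sum.Sigma, simp, simp)+ (simp add: case_prod_unfold)
 also have "\<dots> = (SU J J'. \<Sum>p\<in>?k x J. \<Sum>q\<in>?k y J'. ?s J J' p q)"
  by (rule sum.cong[OF refl], rule sum.swap)
 also have "\<dots> = (SU J J'. if J \<inter> J' = {} \<and> J \<union> J' = K then
   shuffle_sign J J' * fun_of (lookup (coef x J * coef y J') e) z else 0)"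
 proof (intro sum.cong refl)
  fix J J'
  show "(\<Sum>p\<in>?k x J. \<Sum>q\<in>?k y J'. ?s J J' p q) = (if J \<inter> J' = {} \<and> J \<union> J' = K then
   shuffle_sign J J' * fun_of (lookup (coef x J * coef y J') e) z else 0)"
  proof (cases "J \<inter> J' = {} \<and> J \<union> J' = K")
   case True
   have "?s J J' p q = shuffle_sign J J' * fun_of (if p + q = e then lookup (coef x J) p * lookup (coef y J') q else 0) z" for p q
    using True by (simp add: raw_def times_sfun.rep_eq fun_of_zero)
   thus ?thesis using True by (simp add: lookup_mult_sum fun_of_sum sum_distrib_left)
  next
   case False
   have "?s J J' p q = 0" for p q by (rule if_not_P) (use False in blast)
   thus ?thesis using False by (simp only: sum.neutral_const if_not_P if_False)
  qed
 qed
 also have "\<dots> = (SU J. if J \<subseteq> K then shuffle_sign J (K - J) * fun_of (lookup (coef x J * coef y (K - J)) e) z else 0)"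
 proof (intro sum.cong refl)
  fix J
  have "(SU J'. if J \<inter> J' = {} \<and> J \<union> J' = K then
   shuffle_sign J J' * fun_of (lookup (coef x J * coef y J') e) z else 0) =
   (SU J'. if J' = K - J then (if J \<subseteq> K then shuffle_sign J (K - J) * fun_of (lookup (coef x J * coef y (K - J)) e) z else 0) else 0)"
  proof (intro sum.cong refl)
   fix J'
   have "J \<inter> J' = {} \<and> J \<union> J' = K \<longleftrightarrow> J' = K - J \<and> J \<subseteq> K" by auto
   thus "(if J \<inter> J' = {} \<and> J \<union> J' = K then
   shuffle_sign J J' * fun_of (lookup (coef x J * coef y J') e) z else 0) = (if J' = K - J then (if J \<subseteq> K then shuffle_sign J (K - J) * fun_of (lookup (coef x J * coef y (K - J)) e) z else 0) else 0)"
    by auto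
  qed
  thus "(SU J'. if J \<inter> J' = {} \<and> J \<union> J' = K then
   shuffle_sign J J' * fun_of (lookup (coef x J * coef y J') e) z else 0) = (if J \<subseteq> K then shuffle_sign J (K - J) * fun_of (lookup (coef x J * coef y (K - J)) e) z else 0)"
   by simp
 qed
 also have "\<dots> = (\<Sum>J\<in>Pow K. shuffle_sign J (K - J) * fun_of (lookup (coef x J * coef y (K - J)) e) z)"
  by (rule sum.mono_neutral_cong_right) auto
 also have "\<dots> = raw (x * y) K e z"
  by (simp add: raw_def coef_times lookup_sum fun_of_sum mult.assoc sg)
 finally show "raw (x * y) K e z = sf_mult (raw x) (raw y) K e z" by simp
qed

lemma raw_odd_deriv: "raw (odd_deriv a x) = sf_odd_deriv a (raw x)"
proof (intro ext)
 fix J e z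
 have sg: "fun_of (lookup (ssign J J' * c) e) z = shuffle_sign J J' * fun_of (lookup c e) z"
  for J J' :: "'a set" and c :: "'b \<Rightarrow>\<^sub>0 'c sfun"
  by (cases "even (card (inversions J J'))")
   (simp_all add: ssign_def shuffle_sign_def inversions_def[symmetric] uminus_sfun.rep_eq)
 show "raw (odd_deriv a x) J e z = sf_odd_deriv a (raw x) J e z"
  by (simp add: raw_def coef_odd_deriv sf_odd_deriv_def sg fun_of_zero)
qed

abbreviation partial :: "'x::euclidean_space => ('o::finite, 'e::comm_monoid_add \<Rightarrow>\<^sub>0 'x sfun) ext => ('o, 'e \<Rightarrow>\<^sub>0 'x sfun) ext" where
 "partial v \<equiv> coefwise (dpol v)"

lemma raw_partial: "raw (partial v x) = (%J e. pd v (raw x J e))"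
 by (simp add: raw_def pds.rep_eq)

lemma partial_mult: "partial v (x * y) = partial v x * y + x * partial v y"
 by (rule coefwise_mult) (rule dpol_add dpol_mult)+

lemma partial_add: "partial v (x + y) = partial v x + partial v y"
 by (rule ext_eqI) (simp add: dpol_add)

lemma partial_commute: "partial v (partial w x) = partial w (partial v x)"
 by (rule ext_eqI) (simp add: dpol_commute)

subsection \<open>Super derivations\<close>

lemma mult_gen: "z * gen a = gen a * parity z"
proof (induction z rule: ext_induct)
 case (gen b x)
 have "gen b * x * gen a = gen b * gen a * parity x" by (simp add: mult.assoc gen)
 also have "\<dots> = - (gen a * gen b * parity x)" by (subst gen_anticommute) simp
 finally show ?case by (simp add: mult.assoc)
qed (simp_all add: scal_mult_left scal_mult_right distrib_left distrib_right)

lemma even_commute: "parity z = z ==> z * x = x * z"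
proof (induction x rule: ext_induct)
 case (gen a x)
 have "z * (gen a * x) = gen a * (z * x)"
  using mult_gen[of z a] gen(2) by (simp add: mult.assoc[symmetric])
 thus ?case using gen by (simp add: mult.assoc)
qed (simp_all add: scal_mult_left scal_mult_right distrib_left distrib_right)

lemma odd_commute: "parity z = - z ==> z * x = parity x * z"
proof (induction x rule: ext_induct)
 case (gen a x)
 have "z * (gen a * x) = - (gen a * (z * x))"
  using mult_gen[of z a] gen(2) by (simp add: mult.assoc[symmetric])
 thus ?case using gen by (simp add: parity_gen_mult mult.assoc)
qed (simp_all add: scal_mult_left scal_mult_right distrib_left distrib_right)

definition twist :: "bool => ('o::finite, 'r::comm_ring_1) ext => ('o, 'r) ext" where
 "twist s x = (if s then parity x else x)"

lemma twist_simps [simp]: "twist True x = parity x" "twist False x = x"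
 by (simp_all add: twist_def)

text \<open>Even (s = False) and odd (s = True) derivations together. They need not be linear over
  the coefficient ring, because the vector fields below act on the coordinates \<lambda>, which are
  coefficients.\<close>

locale sderiv =
 fixes s :: bool and \<delta> :: "('o::finite, 'r::comm_ring_1) ext => ('o, 'r) ext"
 assumes add: "\<delta> (x + y) = \<delta> x + \<delta> y" and mult: "\<delta> (x * y) = \<delta> x * y + twist s x * \<delta> y"
begin

lemma zero [simp]: "\<delta> 0 = 0" using add[of 0 0] by simp
lemma one [simp]: "\<delta> 1 = 0" using mult[of 1 1] by (cases s) simp_all
lemma minus: "\<delta> (- x) = - \<delta> x" using add[of x "-x"] by (simp add: add_eq_0_iff)
lemma diff: "\<delta> (x - y) = \<delta> x - \<delta> y" using add[of x "-y"] by (simp add: minus)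
lemma sum: "\<delta> (sum f A) = (\<Sum>i\<in>A. \<delta> (f i))"
 by (induction A rule: infinite_finite_induct) (simp_all add: add)
lemma scal: "\<delta> (c \<odot> x) = \<delta> (c \<odot> 1) * x + c \<odot> \<delta> x"
 using mult[of "c \<odot> 1" x] by (cases s) (simp_all add: scal_mult_left)

end

lemma sderiv_zero: "sderiv s (%_. 0)" by unfold_locales simp_all

lemma sderiv_add: "sderiv s \<delta> ==> sderiv s \<epsilon> ==> sderiv s (%x. \<delta> x + \<epsilon> x)"
 by (simp add: sderiv_def algebra_simps)

lemma sderiv_sum: "(!!i. i : A ==> sderiv s (f i)) ==> sderiv s (%x. \<Sum>i\<in>A. f i x)"
 by (induction A rule: infinite_finite_induct) (auto intro: sderiv_zero sderiv_add)

lemma sderiv_uminus: "sderiv s \<delta> ==> sderiv s (%x. - \<delta> x)"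
 by (simp add: sderiv_def algebra_simps)

lemma sderiv_scal: "sderiv s \<delta> ==> sderiv s (%x. c \<odot> \<delta> x)"
 by (simp add: sderiv_def scal_simps scal_mult_left scal_mult_right)

lemma sderiv_left_mult:
 assumes "sderiv s \<delta>" "parity z = (if p then - z else z)"
 shows "sderiv (s ~= p) (%x. z * \<delta> x)"
proof -
 interpret sderiv s \<delta> by fact
 have "z * twist s x = twist (s ~= p) x * z" for x
  using even_commute[of z x] even_commute[of z "parity x"] odd_commute[of z x] odd_commute[of z "parity x"] assms(2)
  by (cases s; cases p) auto
 thus ?thesis by unfold_locales (simp_all add: add mult distrib_left mult.assoc[symmetric])
qed

lemma sderiv_odd_deriv: "sderiv True (odd_deriv a)"
 by unfold_locales (simp_all add: odd_deriv_mult)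

definition derivation :: "('r::comm_ring_1 => 'r) => bool" where
 "derivation d \<longleftrightarrow> (\<forall>c c'. d (c + c') = d c + d c') \<and> (\<forall>c c'. d (c * c') = d c * c' + c * d c')"

lemma sderiv_coefwise: "derivation d ==> sderiv False (coefwise d)"
proof -
 assume d: "derivation d"
 hence "coefwise d (x + y) = coefwise d x + coefwise d y" for x y :: "('b, 'a) ext"
  by (intro ext_eqI) (simp add: derivation_def)
 thus ?thesis using d by unfold_locales (simp_all add: coefwise_mult derivation_def)
qed

lemma derivation_dpol: "derivation (dpol v)"
 unfolding derivation_def using dpol_add dpol_mult by blast

lemma derivation_zero: "derivation d ==> d 0 = 0" unfolding derivation_def by (metis add_cancel_right_right)
lemma derivation_one: "derivation d ==> d 1 = 0" unfolding derivation_def by (metis add_cancel_right_right mult_1 mult.right_neutral)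
lemma derivation_minus: "derivation d ==> d (- c) = - d c"
 using derivation_zero[of d] unfolding derivation_def by (metis add.right_inverse add_eq_0_iff)
lemma derivation_sum: "derivation d ==> d (sum f A) = (\<Sum>i\<in>A. d (f i))"
 by (induction A rule: infinite_finite_induct) (simp_all add: derivation_zero, simp add: derivation_def)

lemma coefwise_scal_one: "d 0 = 0 ==> coefwise d (c \<odot> 1) = d c \<odot> 1"
 by (rule ext_eqI) simp

lemma coefwise_scal: "derivation d ==> coefwise d (c \<odot> x) = d c \<odot> x + c \<odot> coefwise d x"
 by (rule ext_eqI) (simp add: derivation_def)

lemma coefwise_emono: "derivation d ==> coefwise d (emono J) = 0"
 by (rule ext_eqI) (simp add: derivation_zero derivation_one)

subsection \<open>Constants, polynomial variables and gradings\<close>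

definition cst :: "complex => ('e::comm_monoid_add \<Rightarrow>\<^sub>0 'x::euclidean_space sfun)" where
 "cst c = single 0 (cfun c)"

lemma cst_simps [simp]: "cst 0 = 0" "cst 1 = 1" by (simp_all add: cst_def)
lemma cst_add: "cst (a + b) = cst a + cst b" by (simp add: cst_def cfun_add single_add)
lemma cst_diff: "cst (a - b) = cst a - cst b" by (simp add: cst_def cfun_diff single_diff)
lemma cst_minus: "cst (- a) = - cst a" by (simp add: cst_def cfun_minus single_uminus)
lemma cst_mult: "cst (a * b) = cst a * cst b" by (simp add: cst_def cfun_mult mult_single)
lemma cst_sum: "cst (sum f A) = (\<Sum>i\<in>A. cst (f i))"
 by (induction A rule: infinite_finite_induct) (simp_all add: cst_add)
lemma cst_of_nat: "cst (of_nat n) = of_nat n"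
 by (induction n) (simp_all add: cst_add)
lemma cst_numeral: "cst (numeral n) = numeral n"
 using cst_of_nat[of "numeral n"] by simp
lemma dpol_cst [simp]: "dpol v (cst c) = 0" by (simp add: cst_def)
lemma fun_of_cfun [simp]: "fun_of (cfun c) = (%_. c)" by transfer simp

definition pproj :: "'e set => ('e \<Rightarrow>\<^sub>0 'a::comm_ring_1) => ('e \<Rightarrow>\<^sub>0 'a)" where
 "pproj S c = Poly_Mapping.mapp (%e v. if e : S then v else 0) c"

lemma lookup_pproj: "lookup (pproj S c) e = (if e : S then lookup c e else 0)"
 by (simp add: pproj_def lookup_mapp when_def in_keys_iff)

lemma keys_pproj: "keys (pproj S c) = keys c \<inter> S"
 by (auto simp: in_keys_iff lookup_pproj split: if_splits)

lemma pproj_add: "pproj S (c + d) = pproj S c + pproj S d"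
 by (rule poly_mapping_eqI) (simp add: lookup_pproj lookup_add)
lemma pproj_diff: "pproj S (c - d) = pproj S c - pproj S d"
 by (rule poly_mapping_eqI) (simp add: lookup_pproj lookup_minus)
lemma pproj_zero [simp]: "pproj S 0 = 0"
 by (rule poly_mapping_eqI) (simp add: lookup_pproj)
lemma pproj_sum: "pproj S (sum f A) = (\<Sum>i\<in>A. pproj S (f i))"
 by (induction A rule: infinite_finite_induct) (simp_all add: pproj_add)
lemma pproj_single: "pproj S (single e v) = (if e : S then single e v else 0)"
 by (rule poly_mapping_eqI) (simp add: lookup_pproj lookup_single when_def)

lemma pproj_single_mult:
 assumes "!!e. e0 + e : S \<longleftrightarrow> e : S'"
 shows "pproj S (single e0 v * c) = single e0 v * pproj S' c"
proof (induction c rule: pm_induct)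
 case (single k w)
 show ?case using assms[of k] by (simp add: mult_single pproj_single)
qed (simp add: pproj_add algebra_simps)

lemma pproj_id: "keys c \<subseteq> S ==> pproj S c = c"
 by (rule poly_mapping_eqI) (auto simp: lookup_pproj in_keys_iff)

text \<open>A is a set of pairs (exterior degree, degree in the commuting generators), so that one
  notion covers the bigrading, the filtration and the bounds used in inductions.\<close>

definition graded :: "('e => int) => (int \<times> int) set => ('o::finite, 'e \<Rightarrow>\<^sub>0 'a::comm_ring_1) ext set" where
 "graded deg A = {x. \<forall>J. \<forall>e\<in>keys (coef x J). (int (card J), deg e) : A}"

definition gproj :: "('e => int) => (int \<times> int) set => ('o::finite, 'e \<Rightarrow>\<^sub>0 'a::comm_ring_1) ext => ('o, 'e \<Rightarrow>\<^sub>0 'a) ext" where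
 "gproj deg A x = Ext (%J. pproj {e. (int (card J), deg e) : A} (coef x J))"

lemma coef_gproj [simp]: "coef (gproj deg A x) J = pproj {e. (int (card J), deg e) : A} (coef x J)"
 by (simp add: gproj_def)

lemma gproj_add: "gproj deg A (x + y) = gproj deg A x + gproj deg A y"
 by (rule ext_eqI) (simp add: pproj_add)
lemma gproj_diff: "gproj deg A (x - y) = gproj deg A x - gproj deg A y"
 by (rule ext_eqI) (simp add: pproj_diff)

lemma gproj_graded: "gproj deg A x : graded deg A"
 by (auto simp: graded_def keys_pproj)

lemma gproj_id: "x : graded deg A ==> gproj deg A x = x"
 by (rule ext_eqI) (simp, rule pproj_id, auto simp: graded_def)
lemma gproj_disjoint:
 assumes "x : graded deg B" "A \<inter> B = {}" shows "gproj deg A x = 0"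
proof (rule ext_eqI, rule poly_mapping_eqI)
 fix J e
 have "lookup (coef x J) e = 0" if "(int (card J), deg e) : A"
 proof (rule ccontr)
  assume "lookup (coef x J) e ~= 0"
  hence "(int (card J), deg e) : B" using assms(1) by (simp add: graded_def in_keys_iff)
  thus False using that assms(2) by blast
 qed
 thus "lookup (coef (gproj deg A x) J) e = lookup (coef 0 J) e" by (simp add: lookup_pproj)
qed

lemma gproj_compl: "x : graded deg B ==> x - gproj deg A x : graded deg (B - A)"
 by (auto simp: graded_def in_keys_iff lookup_minus lookup_pproj split: if_splits)

lemma graded_zero [simp]: "0 : graded deg A" by (simp add: graded_def)
lemma graded_add: "x : graded deg A ==> y : graded deg A ==> x + y : graded deg A"
 by (simp add: graded_def) (blast dest: subsetD[OF keys_add])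
lemma graded_uminus: "x : graded deg A ==> - x : graded deg A"
 by (simp add: graded_def)
lemma graded_diff: "x : graded deg A ==> y : graded deg A ==> x - y : graded deg A"
 using graded_add[OF _ graded_uminus] by fastforce
lemma graded_sum: "(!!i. i : B ==> f i : graded deg A) ==> sum f B : graded deg A"
 by (induction B rule: infinite_finite_induct) (auto intro: graded_add)
lemma graded_mono: "x : graded deg A ==> A \<subseteq> B ==> x : graded deg B"
 by (auto simp: graded_def)

lemma in_keys_sumD: "k : keys (sum f A) ==> \<exists>i\<in>A. k : keys (f i)"
 using keys_sum by fastforce

lemma graded_mult:
 fixes x :: "('o::finite, 'e::comm_monoid_add \<Rightarrow>\<^sub>0 'a::comm_ring_1) ext"
 assumes "x : graded deg A" "y : graded deg B" and deg: "!!e e'. deg (e + e') = deg e + deg e'"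
  and AB: "!!i j i' j'. (i, j) : A ==> (i', j') : B ==> (i + i', j + j') : C"
 shows "x * y : graded deg C"
 unfolding graded_def mem_Collect_eq
proof (intro allI ballI)
 fix K e assume "e : keys (coef (x * y) K)"
 hence "\<exists>J\<in>Pow K. e : keys (ssign J (K - J) * coef x J * coef y (K - J))"
  unfolding coef_times by (rule in_keys_sumD)
 then obtain J where J: "J \<subseteq> K" "e : keys (ssign J (K - J) * coef x J * coef y (K - J))" by auto
 have "keys (ssign J (K - J) * c) = keys c" for c :: "'e \<Rightarrow>\<^sub>0 'a"
  by (cases "even (card (inversions J (K - J)))") (simp_all add: ssign_def)
 hence "e : keys (coef x J * coef y (K - J))" using J by (simp add: mult.assoc)
 then obtain p q where pq: "p : keys (coef x J)" "q : keys (coef y (K - J))" "e = p + q"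
  using keys_mult by blast
 have "card K = card J + card (K - J)" using J(1) card_Un_disjoint[of J "K - J"]
  by (simp add: Un_absorb1)
 moreover have "(int (card J) + int (card (K - J)), deg p + deg q) : C"
  by (rule AB) (use assms(1,2) pq in \<open>auto simp: graded_def\<close>)
 ultimately show "(int (card K), deg e) : C" by (simp add: pq deg)
qed

lemma graded_scal:
 assumes "x : graded deg A" "!!e. e : keys c ==> deg e = k" and deg: "!!e e'. deg (e + e') = deg e + deg e'"
  and "!!i j. (i, j) : A ==> (i, k + j) : B"
 shows "c \<odot> x : graded deg B"
 unfolding graded_def mem_Collect_eq
proof (intro allI ballI)
 fix J e assume "e : keys (coef (c \<odot> x) J)"
 then obtain p q where "p : keys c" "q : keys (coef x J)" "e = p + q"
  using keys_mult by fastforce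
 thus "(int (card J), deg e) : B" using assms by (auto simp: graded_def)
qed

lemma graded_emono: "deg 0 = 0 ==> (int (card J), 0) : A ==> emono J : graded deg A"
 by (auto simp: graded_def split: if_splits)

lemma graded_coefwise:
 "(!!c. keys (d c) \<subseteq> keys c) ==> x : graded deg A ==> coefwise d x : graded deg A"
 by (fastforce simp: graded_def)

lemma keys_dpol: "keys (dpol v c) \<subseteq> keys c"
 by (auto simp: in_keys_iff)

lemma graded_partial: "x : graded deg A ==> partial v x : graded deg A"
 by (rule graded_coefwise[OF keys_dpol])

subsection \<open>Polynomials in the pure spinor variables\<close>

type_synonym ('d, 's) tpol = "((nat^'s) \<times> int) \<Rightarrow>\<^sub>0 (real^'d) sfun"
type_synonym ('d, 's) tfield = "('s, ('d, 's) tpol) ext"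
type_synonym 'n dpoly = "int \<Rightarrow>\<^sub>0 (complex^'n) sfun"
type_synonym 'n dfield = "('n, 'n dpoly) ext"

definition tdeg :: "(nat^'s::finite) \<times> int => int" where "tdeg = (%(m, k). int (SU a. m $ a) + k)"

lemma tdeg_add: "tdeg (e + e') = tdeg e + tdeg e'"
 by (cases e; cases e') (simp add: tdeg_def sum.distrib)
lemma tdeg_zero [simp]: "tdeg 0 = 0" by (simp add: tdeg_def zero_prod_def)

definition lamr :: "'s => ('d::finite, 's::finite) tpol" where "lamr a = single (axis a 1, 0) 1"
definition ur :: "('d::finite, 's::finite) tpol" where "ur = single (0, 1) 1"
definition ui :: "('d::finite, 's::finite) tpol" where "ui = single (0, -1) 1"

lemma sum_axis: "(SU b. axis a (1::nat) $ b) = 1"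
proof -
 have "(SU b. axis a (1::nat) $ b) = (SU b. if b = a then 1 else 0)"
  by (rule sum.cong) (auto simp: axis_def)
 thus ?thesis by simp
qed

lemma tdeg_lam: "tdeg (axis a 1, 0) = 1"
 using sum_axis[of a] by (simp add: tdeg_def of_nat_sum[symmetric] del: of_nat_sum)

lemma ur_ui [simp]: "ur * ui = 1" "ui * ur = 1" "ur * (ui * c) = c" "ui * (ur * c) = c"
proof -
 show *: "ur * ui = 1" "ui * ur = 1"
  by (simp_all add: ur_def ui_def mult_single zero_prod_def[symmetric])
 show "ur * (ui * c) = c" "ui * (ur * c) = c" by (simp_all add: mult.assoc[symmetric] *)
qed

lemma dpol_vars [simp]: "dpol v (lamr a) = 0" "dpol v ur = 0" "dpol v ui = 0"
 by (simp_all add: lamr_def ur_def ui_def, (metis cfun_simps(2) pds_cfun single_zero)+)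

text \<open>The partial derivative in \<lambda>^a. At exponent 0 the truncated subtraction yields a
  wrong monomial, but the factor \<open>of_nat 0\<close> removes it.\<close>

definition ldp :: "'s => ('d::finite, 's::finite) tpol => ('d, 's) tpol" where
 "ldp a c = (\<Sum>e\<in>keys c. single (fst e - axis a 1, snd e) (of_nat (fst e $ a) * lookup c e))"

lemma ldp_superset:
 "finite A ==> keys c \<subseteq> A ==> ldp a c = (\<Sum>e\<in>A. single (fst e - axis a 1, snd e) (of_nat (fst e $ a) * lookup c e))"
 unfolding ldp_def by (rule sum.mono_neutral_left) (auto simp: in_keys_iff)

lemma ldp_add: "ldp a (c + d) = ldp a c + ldp a d"
proof -
 let ?A = "keys c \<union> keys d"
 show ?thesis
  using ldp_superset[of ?A c a] ldp_superset[of ?A d a] ldp_superset[of ?A "c + d" a] keys_add[of c d]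
  by (simp add: lookup_add single_add distrib_left sum.distrib)
qed

lemma ldp_single: "ldp a (single (m, k) f) = single (m - axis a 1, k) (of_nat (m $ a) * f)"
 using ldp_superset[of "{(m, k)}" "single (m, k) f" a] by auto

lemma axis_shift: "m $ a > 0 ==> m - axis a 1 + m' = m + m' - axis a (1::nat)"
 by (auto simp: vec_eq_iff axis_def)

lemma ldp_mult: "ldp a (c * d) = ldp a c * d + c * ldp a d"
proof (induction c rule: pm_induct)
 case (single e f)
 obtain m k where e: "e = (m, k)" by (cases e)
 show ?case
 proof (induction d rule: pm_induct)
  case (single e' g)
  obtain m' k' where e': "e' = (m', k')" by (cases e')
  have 1: "single (m - axis a 1 + m', k + k') (of_nat (m $ a) * f * g) =
    single (m + m' - axis a 1, k + k') (of_nat (m $ a) * f * g)"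
   by (cases "m $ a > 0") (simp_all add: axis_shift[simplified])
  have 2: "single (m + (m' - axis a 1), k + k') (f * (of_nat (m' $ a) * g)) =
    single (m + m' - axis a 1, k + k') (f * (of_nat (m' $ a) * g))"
   by (cases "m' $ a > 0") (simp_all add: axis_shift[of m' a m, unfolded add.commute[of _ m], simplified] add.commute[of m'])
  show ?case
   by (simp only: e e' mult_single ldp_single add_Pair 1 2 single_add[symmetric])
    (simp add: algebra_simps)
 qed (simp add: ldp_add algebra_simps)
qed (simp add: ldp_add algebra_simps)

lemma derivation_ldp: "derivation (ldp a)"
 unfolding derivation_def using ldp_add ldp_mult by blast

lemma ldp_lamr: "ldp a (lamr b) = (if a = b then 1 else 0)"
 by (simp add: lamr_def ldp_single zero_prod_def[symmetric]) (simp add: axis_def zero_prod_def)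

lemma ldp_fn [simp]: "ldp a (single (0, k) f) = 0" by (simp add: ldp_single)
lemma ldp_simps [simp]: "ldp a ur = 0" "ldp a ui = 0" "ldp a (cst c) = 0" "ldp a 0 = 0"
 by (simp_all add: ur_def ui_def cst_def zero_prod_def ldp_def)

lemma lookup_ldp: "lookup (ldp a c) (m, k) = of_nat (m $ a + 1) * lookup c (m + axis a 1, k)"
proof (induction c rule: pm_induct)
 case (single e f)
 obtain m' k' where e: "e = (m', k')" by (cases e)
 show ?case
 proof (cases "m' $ a > 0")
  case True
  hence "m' - axis a 1 = m \<longleftrightarrow> m' = m + axis a 1" by (auto simp: vec_eq_iff axis_def) 
  moreover have "m' = m + axis a 1 ==> m' $ a = m $ a + 1" by (simp add: axis_def)
  ultimately show ?thesis unfolding e by (auto simp: ldp_single lookup_single when_def)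
 next
  case False
  moreover have "m' ~= m + axis a 1" using False by (auto simp: axis_def)
  ultimately show ?thesis unfolding e by (simp add: ldp_single lookup_single when_def)
 qed
qed (simp add: ldp_add lookup_add algebra_simps)

lemma tpol_induct [case_names fn lam add]:
 assumes fn: "!!k f. P (single (0, k) f)" and lam: "!!a c. P c ==> P (lamr a * c)"
  and add: "!!c d. P c ==> P d ==> P (c + d)"
 shows "P c"
proof (induction c rule: pm_induct)
 case (single e f)
 obtain m k where e: "e = (m, k)" by (cases e)
 have "P (single (m, k) f)"
 proof (induction "SU a. m $ a" arbitrary: m)
  case 0
  hence "m = 0" by (simp add: vec_eq_iff)
  thus ?case using fn by simp
 next
  case (Suc n)
  have "(SU a. m $ a) ~= 0" using Suc(2) by linarith
  then obtain a where a: "m $ a > 0" by (metis gr0I sum.neutral)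
  define m' where "m' = m - axis a 1"
  have m: "m = axis a 1 + m'" using a unfolding m'_def by (auto simp: vec_eq_iff axis_def)
  have "n = (SU a. m' $ a)" using Suc(2) sum_axis[of a] unfolding m by (simp add: sum.distrib)
  hence "P (lamr a * single (m', k) f)" using Suc(1) lam by blast
  thus ?case by (simp add: lamr_def mult_single m)
 qed
 thus ?case using e by simp
qed (rule add)

lemma tfield_induct [case_names fn lam theta add]:
 fixes x :: "('d::finite, 's::finite) tfield"
 assumes fn: "!!k f. P (single (0, k) f \<odot> 1)" and lam: "!!a x. P x ==> P (lamr a \<odot> x)"
  and theta: "!!a x. P x ==> P (gen a * x)" and add: "!!x y. P x ==> P y ==> P (x + y)"
 shows "P x"
proof (induction x rule: ext_induct)
 case (scalar c)
 show ?case
 proof (induction c rule: tpol_induct)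
  case (lam a c)
  thus ?case using assms(2)[of "c \<odot> 1" a] by (simp add: scal_simps)
 qed (use assms in \<open>auto simp: scal_simps\<close>)
qed (use assms in auto)

subsection \<open>Linear and bilinear forms in the generators\<close>

lemma parity_diff [simp]: "parity (x - y) = parity x - parity y"
 by (rule ext_eqI) (simp add: algebra_simps)
lemma parity_uminus [simp]: "parity (- x) = - parity x"
 by (rule ext_eqI) (simp add: algebra_simps)
lemma parity_zero [simp]: "parity 0 = 0"
 by (rule ext_eqI) simp

lemma scal_two: "2 \<odot> x = x + x"
 by (rule ext_eqI) simp

lemma eq_neg_self:
 fixes x :: "('o::finite, 'e::comm_monoid_add \<Rightarrow>\<^sub>0 'x::euclidean_space sfun) ext"
 assumes "x = - x" shows "x = 0"
proof -
 have "2 \<odot> x = 0" using assms by (simp only: scal_two eq_neg_iff_add_eq_0)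
 hence "cst (1/2) \<odot> 2 \<odot> x = 0" by simp
 moreover have "cst (1/2) * 2 = (1 :: 'e \<Rightarrow>\<^sub>0 'x sfun)" using cst_mult[of "1/2" 2] by (simp add: cst_numeral)
 ultimately show ?thesis by (simp add: scal_simps(7))
qed

definition linr :: "('s => complex) => ('d::finite, 's::finite) tpol" where
 "linr l = (SU a. cst (l a) * lamr a)"

definition Lin :: "('s => complex) => ('s => ('d::finite, 's::finite) tfield) => ('d, 's) tfield" where
 "Lin l X = (SU a. cst (l a) \<odot> X a)"

definition bil :: "('s => 's => complex) => ('s => ('d::finite, 's::finite) tpol) => ('s => ('d, 's) tfield) => ('d, 's) tfield" where
 "bil \<beta> C X = (SU a. C a \<odot> Lin (\<beta> a) X)"

definition bilr :: "('s => 's => complex) => ('d::finite, 's::finite) tpol" where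
 "bilr \<beta> = (SU a. lamr a * linr (\<beta> a))"

abbreviation lamT :: "'s => ('d::finite, 's::finite) tfield" where "lamT a \<equiv> lamr a \<odot> 1"

lemma Lin_lamT: "Lin l lamT = linr l \<odot> 1"
 by (simp add: Lin_def linr_def sum_scal scal_simps)

lemma bil_lamT: "bil \<beta> lamr lamT = bilr \<beta> \<odot> 1"
 by (simp add: bil_def bilr_def Lin_lamT sum_scal scal_simps)

text \<open>A vector field in the directions \<lambda> and \<theta>, given by its values X and Y on
  these coordinates; functions on space and u are constants for it.\<close>

definition vfield :: "('s => ('d::finite, 's::finite) tfield) => ('s => ('d, 's) tfield) => ('d, 's) tfield => ('d, 's) tfield" where
 "vfield X Y x = (SU a. X a * coefwise (ldp a) x) + (SU a. Y a * odd_deriv a x)"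

lemma sderiv_vfield:
 assumes "!!a. parity (X a) = (if s then - X a else X a)" "!!a. parity (Y a) = (if s then Y a else - Y a)"
 shows "sderiv s (vfield X Y)"
proof -
 have 1: "sderiv s (%x. X a * coefwise (ldp a) x)" for a
  using sderiv_left_mult[OF sderiv_coefwise[OF derivation_ldp] assms(1)] by simp
 have 2: "sderiv s (%x. Y a * odd_deriv a x)" for a
  using sderiv_left_mult[OF sderiv_odd_deriv, of "Y a" "\<not> s" a] assms(2)[of a] by simp
 show ?thesis unfolding vfield_def by (intro sderiv_add sderiv_sum 1 2)
qed

lemma odd_deriv_scal_one [simp]: "odd_deriv a (c \<odot> 1) = 0" by simp

lemma vfield_scalar: "vfield X Y (c \<odot> 1) = (SU a. ldp a c \<odot> X a)"
 by (simp add: vfield_def coefwise_scal_one scal_mult_right)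

lemma odd_deriv_gen: "odd_deriv a (gen b) = (if a = b then 1 else 0)"
 using odd_deriv_gen_mult[of a b 1] by simp

lemma vfield_gen: "vfield X Y (gen b) = Y b"
proof -
 have "(SU a. Y a * odd_deriv a (gen b)) = (SU a. if a = b then Y b else 0)"
  by (rule sum.cong) (auto simp: odd_deriv_gen)
 thus ?thesis by (simp add: vfield_def coefwise_emono[OF derivation_ldp])
qed

lemma vfield_lamT: "vfield X Y (lamT b) = X b"
proof -
 have "(SU a. ldp a (lamr b) \<odot> X a) = (SU a. if a = b then X b else 0)"
  by (rule sum.cong) (auto simp: ldp_lamr)
 thus ?thesis by (simp add: vfield_scalar)
qed

lemma vfield_linr:
 fixes X :: "'s::finite => ('d::finite, 's) tfield"
 shows "vfield X Y (linr l \<odot> 1) = Lin l X"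
proof -
 have "ldp a (linr l) = (cst (l a) :: ('d, 's) tpol)" for a
 proof -
  have "ldp a (linr l) = (SU b. if b = a then cst (l a) else (0 :: ('d, 's) tpol))"
   unfolding linr_def derivation_sum[OF derivation_ldp]
   by (rule sum.cong) (auto simp: ldp_mult ldp_lamr)
  thus ?thesis by simp
 qed
 thus ?thesis by (simp add: vfield_scalar Lin_def)
qed

lemma vfield_const: "(!!a. ldp a c = 0) ==> vfield X Y (c \<odot> x) = c \<odot> vfield X Y x"
 by (simp add: vfield_def coefwise_scal[OF derivation_ldp] scal_mult_right scal_sum scal_simps(1))

lemma vfield_Lin: assumes "sderiv s (vfield X Y)" shows "vfield X Y (Lin l W) = Lin l (%a. vfield X Y (W a))"
 by (simp add: Lin_def sderiv.sum[OF assms] vfield_const)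

lemma vfield_bil: assumes "sderiv s (vfield X Y)"
 shows "vfield X Y (bil \<beta> lamr W) = (SU b. Lin (%a. \<beta> a b) X * W b) + bil \<beta> lamr (%a. vfield X Y (W a))"
proof -
 have "vfield X Y (bil \<beta> lamr W) = (SU a. X a * Lin (\<beta> a) W + lamr a \<odot> Lin (\<beta> a) (%a. vfield X Y (W a)))"
  by (simp add: bil_def sderiv.sum[OF assms] sderiv.scal[OF assms, of "lamr a" for a] vfield_lamT vfield_Lin[OF assms])
 also have "(SU a. X a * Lin (\<beta> a) W) = (SU b. Lin (%a. \<beta> a b) X * W b)"
  unfolding Lin_def sum_distrib_left sum_distrib_right scal_mult_right scal_mult_left by (rule sum.swap)
 ultimately show ?thesis by (simp add: sum.distrib bil_def)
qed

lemma Lin_scal: "Lin l (%a. c \<odot> X a) = c \<odot> Lin l X"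
 by (simp add: Lin_def scal_sum scal_left_commute[of c])
lemma Lin_zero [simp]: "Lin l (%a. 0) = 0" by (simp add: Lin_def)
lemma Lin_add: "Lin l (%a. X a + Y a) = Lin l X + Lin l Y"
 by (simp add: Lin_def scal_simps(1) sum.distrib)
lemma Lin_sum: "Lin l (%a. \<Sum>j\<in>A. X j a) = (\<Sum>j\<in>A. Lin l (X j))"
 unfolding Lin_def scal_sum by (rule sum.swap)
lemma Lin_vec: "Lin l (%a. cst (q a) \<odot> y) = cst (SU a. l a * q a) \<odot> y"
 by (simp add: Lin_def cst_sum cst_mult sum_scal scal_simps)

lemma parity_Lin: "parity (Lin l X) = Lin l (%a. parity (X a))"
 by (simp add: Lin_def parity_sum)
lemma parity_bil: "parity (bil \<beta> C X) = bil \<beta> C (%a. parity (X a))"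
 by (simp add: bil_def parity_sum parity_Lin)
lemma Lin_uminus: "Lin l (%a. - X a) = - Lin l X"
 by (simp add: Lin_def scal_simps(5) sum_negf)
lemma bil_uminus: "bil \<beta> C (%a. - X a) = - bil \<beta> C X"
 by (simp add: bil_def Lin_uminus scal_simps(5) sum_negf)

subsection \<open>Supersymmetry algebras adapted to a holomorphic supercharge\<close>

text \<open>
  Coordinates adapted to a splitting of \<open>\<tt>\<^sub>1\<close> into the line of \<open>Q\<close>, a subspace on which \<open>[Q, -]\<close>
  vanishes, and a subspace, with basis \<open>t\<^sub>j\<close>, that \<open>[Q, -]\<close> maps isomorphically to \<open>L\<close>:
  \<open>\<kappa>\<close> and \<open>\<tau>\<^sub>j\<close> are the coordinates on the first and the third summand. In this form
  the bracket is determined by the coordinate forms, by a symmetric form \<open>\<beta>\<close> on the middle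
  summand, and by a pairing \<open>M\<close> of the last two summands. The identity \<open>cyclic\<close> is what remains of
  the Fierz identity.
\<close>

locale adapted =
 fixes \<Gamma> :: "'s::finite => 's => complex^'d::finite" and Q :: "complex^'s"
  and \<zeta> \<xi> :: "'n::finite => complex^'d" and \<phi> \<psi> :: "'n => 'd => complex"
  and \<kappa> :: "'s => complex" and \<tau> :: "'n => 's => complex" and t :: "'n => 's => complex"
  and \<beta> :: "'n => 's => 's => complex" and M :: "'n => 'n => 's => complex"
 assumes complete: "!!\<mu> \<nu>. (SU i. \<zeta> i $ \<mu> * \<phi> i \<nu> + \<xi> i $ \<mu> * \<psi> i \<nu>) = (if \<mu> = \<nu> then 1 else 0)"
  and \<phi>_bracket: "!!i a b. (SU \<mu>. \<phi> i \<mu> * \<Gamma> a b $ \<mu>) = \<kappa> a * \<tau> i b + \<tau> i a * \<kappa> b - 2 * \<beta> i a b"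
  and \<psi>_bracket: "!!i a b. (SU \<mu>. \<psi> i \<mu> * \<Gamma> a b $ \<mu>) = (SU j. M i j a * \<tau> j b + \<tau> j a * M i j b)"
  and \<kappa>Q: "(SU a. \<kappa> a * Q $ a) = 1" and \<kappa>t: "!!j. (SU a. \<kappa> a * t j a) = 0"
  and \<tau>Q: "!!i. (SU a. \<tau> i a * Q $ a) = 0" and \<tau>t: "!!i j. (SU a. \<tau> i a * t j a) = (if i = j then 1 else 0)"
  and \<beta>_sym: "!!j a b. \<beta> j a b = \<beta> j b a"
  and \<beta>Q: "!!j a. (SU b. \<beta> j a b * Q $ b) = 0" and \<beta>t: "!!i j a. (SU b. \<beta> j a b * t i b) = 0"
  and MQ: "!!i j. (SU a. M i j a * Q $ a) = 0" and Mt: "!!i j k. (SU a. M i j a * t k a) = 0"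
  and cyclic: "!!i a b c. (SU j. M i j a * \<beta> j b c + M i j b * \<beta> j c a + M i j c * \<beta> j a b) = 0"
begin

section \<open>Adapted coordinates and vector fields\<close>

definition "l0 = (linr \<kappa> :: ('d, 's) tpol)"
definition "l2 j = (linr (\<tau> j) :: ('d, 's) tpol)"
definition "mL i j = (linr (M i j) :: ('d, 's) tpol)"
definition "bLL j = (bilr (\<beta> j) :: ('d, 's) tpol)"
definition "th0 = (Lin \<kappa> gen :: ('d, 's) tfield)"
definition "th2 j = (Lin (\<tau> j) gen :: ('d, 's) tfield)"
definition "mT i j = (Lin (M i j) gen :: ('d, 's) tfield)"
definition "bLT j = (bil (\<beta> j) lamr gen :: ('d, 's) tfield)"
text \<open>The correction is the one for which K (\<eta> j) becomes a multiple of the relation l0 *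
  l2 j - bLL j, so that \<eta> j is a cycle modulo I.\<close>

definition "\<eta> j = th2 j + ui \<odot> (bLT j - l2 j \<odot> th0)"
definition "V a = (lamr a + cst (Q $ a) * ur) \<odot> (1 :: ('d, 's) tfield)"
text \<open>The part of the differential without derivatives on space: the Koszul differential for
  the shifted coordinates \<lambda> + u Q.\<close>

definition "K = vfield (%_. 0) V"

text \<open>Components of a vector field in the adapted frame: c times W, then y along Q and z j
  along t j. Only \<kappa> sees y, only \<tau> sees z, and M and \<beta> see neither.\<close>

definition comb :: "('d, 's) tpol => ('s => ('d, 's) tfield) => ('d, 's) tfield => ('n => ('d, 's) tfield) => 's => ('d, 's) tfield" where
 "comb c W y z = (%a. c \<odot> W a + cst (Q $ a) \<odot> y + (SU j. cst (t j a) \<odot> z j))"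

text \<open>
  Away from the cone point the variety is parametrized by the first two summands, with
  \<open>\<lambda>\<^sub>0 \<lambda>\<^sub>2 = \<beta>(\<lambda>, \<lambda>)\<close>. The vector field \<open>eul\<close> is the Euler field of the middle summand, for which
  the classes \<open>\<eta>\<close> have weight 0, and \<open>ctr\<close> is the contraction with \<open>\<lambda>\<^sub>0\<close> times this field.
\<close>

definition "ctr = vfield (comb l0 gen (- (l0 \<odot> th0)) (%j. 2 \<odot> bLT j - l0 \<odot> th2 j))
 (comb 0 gen 0 (%j. - ((2 * ui) \<odot> (th0 * bLT j))))"

definition "eul = vfield (comb 1 lamT (- (l0 \<odot> 1)) (%j. l2 j \<odot> 1)) (comb 1 gen (- th0) (%j. th2 j - 2 \<odot> \<eta> j))"

lemma Lin_comb: "Lin l (comb c W y z) = c \<odot> Lin l W + cst (SU a. l a * Q $ a) \<odot> y + (SU j. cst (SU a. l a * t j a) \<odot> z j)"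
 by (simp add: comb_def Lin_add Lin_sum Lin_scal Lin_vec)

lemma Lin_comb_simps [simp]:
 "Lin \<kappa> (comb c W y z) = c \<odot> Lin \<kappa> W + y"
 "Lin (\<tau> i) (comb c W y z) = c \<odot> Lin (\<tau> i) W + z i"
 "Lin (M i j) (comb c W y z) = c \<odot> Lin (M i j) W"
 "Lin (\<beta> j a) (comb c W y z) = c \<odot> Lin (\<beta> j a) W"
proof -
 have "(SU j. cst (if i = j then 1 else 0) \<odot> z j) = (SU j. if j = i then z i else 0)"
  by (rule sum.cong) auto
 thus "Lin (\<tau> i) (comb c W y z) = c \<odot> Lin (\<tau> i) W + z i" by (simp add: Lin_comb \<tau>Q \<tau>t)
qed (simp_all add: Lin_comb \<kappa>Q \<kappa>t MQ Mt \<beta>Q \<beta>t)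

lemma \<beta>_swap: "(%a. \<beta> j a b) = \<beta> j b" using \<beta>_sym by (simp add: fun_eq_iff)

lemma parity_lin [simp]: "parity th0 = - th0" "parity (th2 j) = - th2 j" "parity (mT i j) = - mT i j" "parity (bLT j) = - bLT j"
 by (simp_all add: th0_def th2_def mT_def bLT_def parity_Lin parity_bil Lin_uminus bil_uminus)

lemma parity_eta [simp]: "parity (\<eta> j) = - \<eta> j"
 by (simp add: \<eta>_def scal_simps)

lemma parity_comb: "parity (comb c W y z a) = comb c (%a. parity (W a)) (parity y) (%j. parity (z j)) a"
 by (simp add: comb_def parity_sum)

lemma comb_uminus: "comb c (%a. - W a) (- y) (%j. - z j) a = - comb c W y z a"
 by (simp add: comb_def scal_simps sum_negf)

sublocale K: sderiv True K
 unfolding K_def by (rule sderiv_vfield) (simp_all add: V_def)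

sublocale ctr: sderiv True ctr
 unfolding ctr_def
proof (rule sderiv_vfield)
 fix a
 show "parity (comb l0 gen (- (l0 \<odot> th0)) (%j. 2 \<odot> bLT j - l0 \<odot> th2 j) a) = (if True then - comb l0 gen (- (l0 \<odot> th0)) (%j. 2 \<odot> bLT j - l0 \<odot> th2 j) a else comb l0 gen (- (l0 \<odot> th0)) (%j. 2 \<odot> bLT j - l0 \<odot> th2 j) a)"
  unfolding parity_comb if_True comb_uminus[symmetric] by (simp add: scal_simps)
 show "parity (comb 0 gen 0 (%j. - ((2 * ui) \<odot> (th0 * bLT j))) a) = (if True then comb 0 gen 0 (%j. - ((2 * ui) \<odot> (th0 * bLT j))) a else - comb 0 gen 0 (%j. - ((2 * ui) \<odot> (th0 * bLT j))) a)"
  unfolding parity_comb if_True by (simp add: comb_def scal_simps)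
qed

sublocale eul: sderiv False eul
 unfolding eul_def
proof (rule sderiv_vfield)
 fix a
 show "parity (comb 1 lamT (- (l0 \<odot> 1)) (%j. l2 j \<odot> 1) a) = (if False then - comb 1 lamT (- (l0 \<odot> 1)) (%j. l2 j \<odot> 1) a else comb 1 lamT (- (l0 \<odot> 1)) (%j. l2 j \<odot> 1) a)"
  unfolding parity_comb by simp
 show "parity (comb 1 gen (- th0) (%j. th2 j - 2 \<odot> \<eta> j) a) = (if False then comb 1 gen (- th0) (%j. th2 j - 2 \<odot> \<eta> j) a else - comb 1 gen (- th0) (%j. th2 j - 2 \<odot> \<eta> j) a)"
  unfolding parity_comb if_False comb_uminus[symmetric] by (simp add: scal_simps)
qed

lemma K_scal: "K (c \<odot> x) = c \<odot> K x"
 by (simp add: K_def vfield_def scal_mult_right scal_sum)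

lemma K_gen: "K (gen a) = V a" by (simp add: K_def vfield_gen)

lemma K_Lin: "K (Lin l X) = Lin l (%a. K (X a))"
 unfolding Lin_def by (simp add: K.sum K_scal)

lemma Lin_V: "Lin l V = (linr l + cst (SU a. l a * Q $ a) * ur) \<odot> 1"
proof -
 have "V = (%a. lamT a + ur \<odot> (cst (Q $ a) \<odot> 1))"
  by (rule ext) (simp add: V_def scal_simps mult.commute)
 thus ?thesis by (simp only: Lin_add Lin_scal Lin_vec Lin_lamT) (simp add: scal_simps mult.commute)
qed

lemma K_lin [simp]:
 "K th0 = (l0 + ur) \<odot> 1" "K (th2 j) = l2 j \<odot> 1" "K (mT i j) = mL i j \<odot> 1"
 by (simp_all add: th0_def th2_def mT_def l0_def l2_def mL_def K_Lin K_gen Lin_V \<kappa>Q \<tau>Q MQ)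

lemma K_bLT [simp]: "K (bLT j) = bLL j \<odot> 1"
 by (simp add: bLT_def bLL_def bil_def bilr_def K.sum K_scal K_Lin K_gen Lin_V \<beta>Q sum_scal scal_simps)

lemma K_eta: "K (\<eta> j) = (ui * (bLL j - l0 * l2 j)) \<odot> 1"
 unfolding \<eta>_def K.add K_scal K.diff K_lin K_bLT by (simp add: scal_simps) (simp add: algebra_simps scal_simps)

subsection \<open>The ideal of the nilpotence variety\<close>

definition rel :: "'d => ('d, 's) tpol" where
 "rel \<mu> = bilr (%a b. \<Gamma> a b $ \<mu>)"

definition Ir :: "('d, 's) tpol set" where "Ir = {c. \<exists>g. c = (SU \<mu>. rel \<mu> * g \<mu>)}"

text \<open>The relations do not involve \<theta>, so the ideal they generate in the exterior
  algebra can be described coefficientwise; \<open>pure_ideal_eq\<close> below identifies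
  it.\<close>

definition I :: "('d, 's) tfield set" where "I = {x. \<forall>J. coef x J : Ir}"

lemma Ir_zero [simp]: "0 : Ir" unfolding Ir_def by (auto intro!: exI[of _ "%_. 0"])
lemma Ir_add: "c : Ir ==> d : Ir ==> c + d : Ir"
proof -
 assume "c : Ir" "d : Ir"
 then obtain g h where "c = (SU \<mu>. rel \<mu> * g \<mu>)" "d = (SU \<mu>. rel \<mu> * h \<mu>)" unfolding Ir_def by auto
 hence "c + d = (SU \<mu>. rel \<mu> * (g \<mu> + h \<mu>))" by (simp add: sum.distrib distrib_left)
 thus ?thesis unfolding Ir_def by (intro CollectI exI)
qed
lemma Ir_mult: "c : Ir ==> d * c : Ir"
proof -
 assume "c : Ir"
 then obtain g where "c = (SU \<mu>. rel \<mu> * g \<mu>)" unfolding Ir_def by auto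
 hence "d * c = (SU \<mu>. rel \<mu> * (d * g \<mu>))" by (simp add: sum_distrib_left mult_ac)
 thus ?thesis unfolding Ir_def by (intro CollectI exI)
qed
lemma Ir_uminus: "c : Ir ==> - c : Ir" using Ir_mult[of c "-1"] by simp
lemma Ir_sum: "(!!i. i : A ==> f i : Ir) ==> sum f A : Ir"
 by (induction A rule: infinite_finite_induct) (auto intro: Ir_add)
lemma Ir_rel: "rel \<mu> : Ir"
proof -
 have "(SU \<nu>. rel \<nu> * (if \<nu> = \<mu> then 1 else 0)) = (SU \<nu>. if \<nu> = \<mu> then rel \<mu> else 0)"
  by (rule sum.cong) auto
 hence "rel \<mu> = (SU \<nu>. rel \<nu> * (if \<nu> = \<mu> then 1 else 0))" by simp
 thus ?thesis unfolding Ir_def by (intro CollectI exI)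
qed

lemma I_zero [simp]: "0 : I" by (simp add: I_def)
lemma I_add: "x : I ==> y : I ==> x + y : I" by (simp add: I_def Ir_add)
lemma I_uminus: "x : I ==> - x : I" by (simp add: I_def Ir_uminus)
lemma I_diff: "x : I ==> y : I ==> x - y : I" using I_add[of x "-y"] I_uminus[of y] by simp
lemma I_sum: "(!!i. i : A ==> f i : I) ==> sum f A : I"
 by (induction A rule: infinite_finite_induct) (auto intro: I_add)
lemma I_left: "x : I ==> y * x : I"
 unfolding I_def by (auto simp: coef_times intro!: Ir_sum Ir_mult)
lemma I_right: "x : I ==> x * y : I"
 unfolding I_def
proof (clarsimp simp: coef_times, intro Ir_sum)
 fix J A assume x: "\<forall>J. coef x J : Ir"
 have "coef y (J - A) * (ssign A (J - A) * coef x A) : Ir" by (intro Ir_mult) (use x in blast)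
 thus "ssign A (J - A) * coef x A * coef y (J - A) : Ir" by (simp add: mult_ac)
qed
lemma I_scal: "x : I ==> c \<odot> x : I" by (simp add: I_def Ir_mult)
lemma I_Ir: "c : Ir ==> c \<odot> x : I"
 unfolding I_def by (auto simp: mult.commute[of c] intro: Ir_mult)

lemma I_expand: "x : I \<longleftrightarrow> (\<exists>g. x = (SU \<mu>. rel \<mu> \<odot> g \<mu>))"
proof
 assume "x : I"
 then obtain h where h: "coef x J = (SU \<mu>. rel \<mu> * h J \<mu>)" for J
  unfolding I_def Ir_def by simp metis
 have "x = (SU \<mu>. rel \<mu> \<odot> Ext (%J. h J \<mu>))" by (rule ext_eqI) (simp add: coef_sum h)
 thus "\<exists>g. x = (SU \<mu>. rel \<mu> \<odot> g \<mu>)" by (intro exI)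
qed (auto intro!: I_sum I_Ir Ir_rel)

lemma linr_sum: "(\<Sum>i\<in>A. cst (f i) * linr (l i)) = linr (%a. \<Sum>i\<in>A. f i * l i a)"
proof -
 have "(\<Sum>i\<in>A. cst (f i) * linr (l i)) = (\<Sum>i\<in>A. SU a. cst (f i * l i a) * lamr a)"
  by (simp add: linr_def sum_distrib_left cst_mult mult.assoc)
 also have "\<dots> = linr (%a. \<Sum>i\<in>A. f i * l i a)"
  unfolding linr_def cst_sum sum_distrib_right by (rule sum.swap)
 finally show ?thesis .
qed

lemma bilr_sum: "(\<Sum>i\<in>A. cst (f i) * bilr (l i)) = bilr (%a b. \<Sum>i\<in>A. f i * l i a b)"
proof -
 have "(\<Sum>i\<in>A. cst (f i) * bilr (l i)) = (\<Sum>i\<in>A. SU a. lamr a * (cst (f i) * linr (l i a)))"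
  by (simp add: bilr_def sum_distrib_left mult.left_commute)
 also have "\<dots> = (SU a. lamr a * (\<Sum>i\<in>A. cst (f i) * linr (l i a)))"
  unfolding sum_distrib_left by (rule sum.swap)
 finally show ?thesis by (simp add: linr_sum bilr_def)
qed

lemma bilr_add: "bilr (%a b. f a b + g a b) = bilr f + bilr g"
 by (simp add: bilr_def linr_def cst_add distrib_left distrib_right sum.distrib)
lemma bilr_diff: "bilr (%a b. f a b - g a b) = bilr f - bilr g"
 by (simp add: bilr_def linr_def cst_diff right_diff_distrib left_diff_distrib sum_subtractf)
lemma bilr_scale: "bilr (%a b. c * f a b) = cst c * bilr f"
 by (simp add: bilr_def linr_def cst_mult sum_distrib_left mult_ac)
lemma bilr_prod: "bilr (%a b. f a * g b) = (linr f * linr g :: ('d, 's) tpol)" "bilr (%a b. f b * g a) = (linr f * linr g :: ('d, 's) tpol)"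
proof -
 have *: "bilr (%a b. f a * g b) = (linr f * linr g :: ('d, 's) tpol)" for f g
 proof -
  have *: "(linr f * linr g :: ('d, 's) tpol) = (SU a b. (cst (f a) * lamr a) * (cst (g b) * lamr b))"
   unfolding linr_def by (rule sum_product)
  show ?thesis unfolding * by (simp add: bilr_def linr_def cst_mult sum_distrib_left mult_ac)
 qed
 show "bilr (%a b. f a * g b) = (linr f * linr g :: ('d, 's) tpol)" by (rule *)
 show "bilr (%a b. f b * g a) = (linr f * linr g :: ('d, 's) tpol)"
  using *[of g f] by (simp add: mult.commute)
qed
lemma bilr_sums: "bilr (%a b. \<Sum>i\<in>A. l i a b) = (\<Sum>i\<in>A. bilr (l i))"
 by (rule bilr_sum[of "%_. 1", simplified, symmetric])

lemma \<phi>_rel: "(SU \<mu>. cst (\<phi> i \<mu>) * rel \<mu>) = 2 * (l0 * l2 i - bLL i)"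
 by (simp add: rel_def bilr_sum \<phi>_bracket bilr_diff bilr_add bilr_prod bilr_scale l0_def l2_def bLL_def cst_numeral algebra_simps)

lemma \<psi>_rel: "(SU \<mu>. cst (\<psi> i \<mu>) * rel \<mu>) = 2 * (SU j. mL i j * l2 j)"
 by (simp add: rel_def bilr_sum \<psi>_bracket bilr_sums bilr_add bilr_prod mL_def l2_def sum_distrib_left algebra_simps)

lemma Ir_half: assumes "2 * c : Ir" shows "c : Ir"
proof -
 have "cst (1/2) * (2 * c) = (cst (1/2 * 2) * c)" unfolding cst_mult by (simp add: cst_numeral)
 thus ?thesis using Ir_mult[OF assms, of "cst (1/2)"] by simp
qed

text \<open>The components of [\<lambda>, \<lambda>] along the basis \<zeta> of L are twice these
  elements, those along \<xi> are twice the elements of \<open>rel2\<close>; by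
  \<open>rel_complete\<close> the two families generate all relations.\<close>

lemma rel1: "l0 * l2 i - bLL i : Ir"
 by (rule Ir_half, subst \<phi>_rel[symmetric]) (intro Ir_sum Ir_mult Ir_rel)

lemma rel2: "(SU j. mL i j * l2 j) : Ir"
 by (rule Ir_half, subst \<psi>_rel[symmetric]) (intro Ir_sum Ir_mult Ir_rel)

lemma rel_complete: "rel \<mu> = (SU i. cst (\<zeta> i $ \<mu>) * (2 * (l0 * l2 i - bLL i)) + cst (\<xi> i $ \<mu>) * (2 * (SU j. mL i j * l2 j)))"
proof -
 have "(SU i. cst (\<zeta> i $ \<mu>) * (SU \<nu>. cst (\<phi> i \<nu>) * rel \<nu>) + cst (\<xi> i $ \<mu>) * (SU \<nu>. cst (\<psi> i \<nu>) * rel \<nu>))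
  = (SU i \<nu>. cst (\<zeta> i $ \<mu> * \<phi> i \<nu> + \<xi> i $ \<mu> * \<psi> i \<nu>) * rel \<nu>)"
  by (simp add: sum_distrib_left cst_add cst_mult sum.distrib algebra_simps)
 also have "\<dots> = (SU \<nu>. cst (SU i. \<zeta> i $ \<mu> * \<phi> i \<nu> + \<xi> i $ \<mu> * \<psi> i \<nu>) * rel \<nu>)"
  unfolding cst_sum sum_distrib_right by (rule sum.swap)
 also have "\<dots> = (SU \<nu>. if \<nu> = \<mu> then rel \<mu> else 0)"
  unfolding complete by (rule sum.cong) auto
 finally show ?thesis unfolding \<phi>_rel \<psi>_rel by simp
qed

text \<open>Although a derivation is not linear over the coefficients, the extra term in the Leibniz
  rule is again a multiple of a relation, so generators suffice.\<close>

lemma sderiv_I: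
 assumes "sderiv s \<delta>" "!!\<mu>. \<delta> (rel \<mu> \<odot> 1) : I" "x : I" shows "\<delta> x : I"
proof -
 obtain g where g: "x = (SU \<mu>. rel \<mu> \<odot> g \<mu>)" using assms(3) I_expand by blast
 show ?thesis unfolding g sderiv.sum[OF assms(1)]
  by (subst sderiv.scal[OF assms(1)]) (intro I_sum I_add I_right assms(2) I_Ir Ir_rel)
qed

lemma sderiv_rel:
 assumes \<delta>: "sderiv s \<delta>" and lin: "!!c x. \<delta> (cst c \<odot> x) = cst c \<odot> \<delta> x"
  and 1: "!!i. \<delta> ((l0 * l2 i - bLL i) \<odot> 1) : I" and 2: "!!i. \<delta> ((SU j. mL i j * l2 j) \<odot> 1) : I"
 shows "\<delta> (rel \<mu> \<odot> 1) : I"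
proof -
 have e: "rel \<mu> \<odot> 1 = (SU i. cst (\<zeta> i $ \<mu>) \<odot> cst 2 \<odot> ((l0 * l2 i - bLL i) \<odot> 1) + cst (\<xi> i $ \<mu>) \<odot> cst 2 \<odot> ((SU j. mL i j * l2 j) \<odot> 1))"
  by (subst rel_complete, subst sum_scal) (simp only: scal_simps(2,7) cst_numeral)
 show ?thesis unfolding e sderiv.sum[OF \<delta>] sderiv.add[OF \<delta>] lin
  by (intro I_sum I_add I_scal 1 2)
qed

lemma K_I: "x : I ==> K x : I"
 by (rule sderiv_I[OF K.sderiv_axioms]) (simp_all add: K_scal)

lemma vfield_I_rel: "vfield X Y (cst c \<odot> x) = cst c \<odot> vfield X Y x"
 by (rule vfield_const) simp

text \<open>The value on l2 is forced by the relation l0 l2 = \<beta>(\<lambda>, \<lambda>): if the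
  middle coordinates move by l0 \<theta> and l0 is fixed, the right-hand side changes by 2 l0
  \<beta>(\<lambda>, \<theta>).\<close>

lemma ctr_simps:
 "ctr (l0 \<odot> 1) = 0" "ctr (l2 i \<odot> 1) = 2 \<odot> bLT i" "ctr (mL i j \<odot> 1) = l0 \<odot> mT i j" "ctr (bLL j \<odot> 1) = (2 * l0) \<odot> bLT j"
 "ctr (bLT j) = 0"
proof -
 have lin: "ctr (Lin l W) = Lin l (%a. ctr (W a))" for l W
  using ctr.sderiv_axioms unfolding ctr_def by (rule vfield_Lin)
 show "ctr (l0 \<odot> 1) = 0" "ctr (l2 i \<odot> 1) = 2 \<odot> bLT i" "ctr (mL i j \<odot> 1) = l0 \<odot> mT i j"
  unfolding ctr_def l0_def l2_def mL_def vfield_linr by (simp_all add: th0_def th2_def mT_def)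
 have s: "(SU b. Lin (%a. \<beta> j a b) gen * lamT b) = bLT j"
  by (simp add: bLT_def bil_def \<beta>_swap scal_mult_right)
 have b: "bil (\<beta> j) lamr (comb c W y z) = c \<odot> bil (\<beta> j) lamr W" for c W y z
  by (simp add: bil_def scal_sum scal_left_commute[of c])
 have "ctr (bLL j \<odot> 1) = l0 \<odot> (SU b. Lin (%a. \<beta> j a b) gen * lamT b) + l0 \<odot> bLT j"
  unfolding bLL_def bil_lamT[symmetric] ctr_def vfield_bil[OF ctr.sderiv_axioms[unfolded ctr_def]]
  by (simp add: vfield_lamT b \<beta>_swap bLT_def scal_mult_left scal_sum)
 thus "ctr (bLL j \<odot> 1) = (2 * l0) \<odot> bLT j" unfolding s by (simp add: scal_simps(2)[symmetric])
 \<comment> \<open>A symmetric form vanishes on the anticommuting \<theta>.\<close>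
 have "(SU b. Lin (\<beta> j b) gen * gen b) = (0::('d, 's) tfield)" (is "?S = 0")
 proof -
  have "?S = (SU b a. cst (\<beta> j b a) \<odot> (gen a * gen b))"
   by (simp add: Lin_def sum_distrib_right scal_mult_left)
  also have "\<dots> = (SU a b. cst (\<beta> j b a) \<odot> (gen a * gen b))" by (rule sum.swap)
  also have "\<dots> = - ?S"
   unfolding Lin_def sum_distrib_right scal_mult_left sum_negf[symmetric]
   by (intro sum.cong refl, subst gen_anticommute) (simp add: \<beta>_sym[of j] scal_simps(5))
  finally show ?thesis by (rule eq_neg_self)
 qed
 moreover have "ctr (bil (\<beta> j) lamr gen) = l0 \<odot> (SU b. Lin (\<beta> j b) gen * gen b)"
  unfolding ctr_def vfield_bil[OF ctr.sderiv_axioms[unfolded ctr_def]]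
  by (simp add: vfield_gen b \<beta>_swap scal_mult_left scal_sum)
 ultimately show "ctr (bLT j) = 0" by (simp add: bLT_def)
qed

end

context adapted
begin

lemma scalar_mult: "(c * d) \<odot> (1 :: ('d, 's) tfield) = (c \<odot> 1) * (d \<odot> 1)"
 by (simp add: scal_mult_left scal_simps(7))

lemma scalar_diff: "(c - d) \<odot> (x :: ('d, 's) tfield) = c \<odot> x - d \<odot> x" by (rule scal_simps)

text \<open>Quadratic in \<lambda> and linear in \<theta>: the common form in which the products of
  M and \<beta> can be compared coefficient by coefficient.\<close>

definition cubic :: "('s => 's => 's => complex) => ('d, 's) tfield" where
 "cubic f = (SU a b c. (cst (f a b c) * (lamr a * lamr b)) \<odot> gen c)"

lemma cubic_swap: "cubic (%a b c. f b a c) = cubic f"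
 unfolding cubic_def by (subst sum.swap) (simp add: mult.commute)

lemma cubic_add: "cubic (%a b c. f a b c + g a b c) = cubic f + cubic g"
 by (simp add: cubic_def cst_add distrib_right scal_simps(2) sum.distrib)

lemma cubic_zero: "cubic (%a b c. 0) = 0" by (simp add: cubic_def)

lemma cubic_sum: "cubic (%a b c. \<Sum>j\<in>A. f j a b c) = (\<Sum>j\<in>A. cubic (f j))"
 by (induction A rule: infinite_finite_induct) (simp_all add: cubic_zero cubic_add)

lemma mL_bLT: "mL i j \<odot> bLT k = cubic (%a b c. M i j a * \<beta> k b c)"
proof -
 have b: "bLT k = (SU b c. (lamr b * cst (\<beta> k b c)) \<odot> gen c)"
  unfolding bLT_def bil_def Lin_def scal_sum scal_simps(7) ..
 have "mL i j \<odot> bLT k = (SU a. (cst (M i j a) * lamr a) \<odot> bLT k)"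
  unfolding mL_def linr_def sum_scal ..
 thus ?thesis unfolding b scal_sum scal_simps(7) cubic_def cst_mult by (simp only: mult_ac)
qed

lemma bLL_mT: "bLL k \<odot> mT i j = cubic (%a b c. \<beta> k a b * M i j c)"
proof -
 have "bLL k \<odot> mT i j = (SU a b. (lamr a * (cst (\<beta> k a b) * lamr b)) \<odot> mT i j)"
  unfolding bLL_def bilr_def linr_def sum_distrib_left sum_scal ..
 thus ?thesis unfolding mT_def Lin_def scal_sum scal_simps(7) cubic_def cst_mult by (simp only: mult_ac)
qed

text \<open>The identity \<open>cyclic\<close> with two arguments \<lambda> and one argument
  \<theta>; the factor 2 comes from the two terms in which M is evaluated at a \<lambda>.\<close>

lemma cyclic_fields: "(SU j. 2 \<odot> mL i j \<odot> bLT j + bLL j \<odot> mT i j) = 0"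
proof -
 have "2 \<odot> mL i j \<odot> bLT j = cubic (%a b c. M i j a * \<beta> j b c) + cubic (%a b c. M i j b * \<beta> j a c)" for j
  unfolding scal_two mL_bLT by (subst cubic_swap) simp
 hence "(SU j. 2 \<odot> mL i j \<odot> bLT j + bLL j \<odot> mT i j)
   = cubic (%a b c. SU j. M i j a * \<beta> j b c + M i j b * \<beta> j a c + \<beta> j a b * M i j c)"
  by (simp only: bLL_mT cubic_sum cubic_add)
 also have "\<dots> = cubic (%a b c. 0)"
 proof -
  have "(SU j. M i j a * \<beta> j b c + M i j b * \<beta> j a c + \<beta> j a b * M i j c) = 0" for a b c
   using cyclic[of i a b c] \<beta>_sym by (simp add: mult.commute)
  thus ?thesis by simp
 qed
 finally show ?thesis by (simp add: cubic_zero)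
qed

lemma ctr_const: "ctr (cst c \<odot> x) = cst c \<odot> ctr x" unfolding ctr_def by (rule vfield_I_rel)
lemma eul_const: "eul (cst c \<odot> x) = cst c \<odot> eul x" unfolding eul_def by (rule vfield_I_rel)

lemma ctr_u [simp]: "ctr (ur \<odot> x) = ur \<odot> ctr x" "ctr (ui \<odot> x) = ui \<odot> ctr x"
 unfolding ctr_def by (intro vfield_const; simp)+

lemma eul_u [simp]: "eul (ur \<odot> x) = ur \<odot> eul x" "eul (ui \<odot> x) = ui \<odot> eul x"
 unfolding eul_def by (intro vfield_const; simp)+

lemma ctr_I: "x : I ==> ctr x : I"
proof (erule sderiv_I[OF ctr.sderiv_axioms, rotated], rule sderiv_rel[OF ctr.sderiv_axioms ctr_const])
 fix i
 have "ctr ((l0 * l2 i - bLL i) \<odot> 1) = 0"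
  unfolding scalar_diff scalar_mult ctr.diff ctr.mult ctr_simps by (simp add: scal_mult_left scal_simps(7) mult_ac)
 thus "ctr ((l0 * l2 i - bLL i) \<odot> 1) : I" by simp
 have "ctr ((SU j. mL i j * l2 j) \<odot> 1) = (SU j. (l0 * l2 j) \<odot> mT i j + 2 \<odot> mL i j \<odot> bLT j)"
  unfolding sum_scal scalar_mult ctr.sum ctr.mult ctr_simps by (simp add: scal_mult_left scal_mult_right scal_simps(7) mult_ac)
 \<comment> \<open>Modulo the first relations l0 l2 may be replaced by bLL, and what then remains is
   the cubic identity.\<close>
 also have "\<dots> = (SU j. (l0 * l2 j - bLL j) \<odot> mT i j) + (SU j. 2 \<odot> mL i j \<odot> bLT j + bLL j \<odot> mT i j)"
  by (simp add: scalar_diff sum.distrib[symmetric] algebra_simps)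
 also have "\<dots> : I" unfolding cyclic_fields by (intro I_add I_sum I_Ir rel1) simp
 finally show "ctr ((SU j. mL i j * l2 j) \<odot> 1) : I" .
qed

text \<open>The summands of \<tt>\<one> get the weights 0, 1, 2, for which the two families of
  relations are homogeneous of weights 2 and 3. Only th2 deviates, in order that \<eta> has weight
  0.\<close>

lemma eul_simps:
 "eul (l0 \<odot> 1) = 0" "eul (l2 i \<odot> 1) = 2 \<odot> l2 i \<odot> 1" "eul (mL i j \<odot> 1) = mL i j \<odot> 1" "eul (bLL j \<odot> 1) = 2 \<odot> bLL j \<odot> 1"
 "eul th0 = 0" "eul (th2 i) = 2 \<odot> th2 i - 2 \<odot> \<eta> i" "eul (mT i j) = mT i j" "eul (bLT j) = 2 \<odot> bLT j"
proof -
 note E = eul.sderiv_axioms[unfolded eul_def]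
 show "eul (l0 \<odot> 1) = 0" "eul (l2 i \<odot> 1) = 2 \<odot> l2 i \<odot> 1" "eul (mL i j \<odot> 1) = mL i j \<odot> 1"
  unfolding eul_def l0_def l2_def mL_def vfield_linr by (simp_all add: Lin_lamT scal_two l0_def l2_def)
 have "eul (Lin l gen) = Lin l (comb 1 gen (- th0) (%j. th2 j - 2 \<odot> \<eta> j))" for l
  unfolding eul_def vfield_Lin[OF E] vfield_gen ..
 from this[of \<kappa>] this[of "\<tau> i"] this[of "M i j"]
 show "eul th0 = 0" "eul (th2 i) = 2 \<odot> th2 i - 2 \<odot> \<eta> i" "eul (mT i j) = mT i j"
  by (simp_all add: scal_two th0_def[symmetric] th2_def[symmetric] mT_def[symmetric])
 have b: "bil (\<beta> j) lamr (comb 1 W y z) = bil (\<beta> j) lamr W" for W y z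
  by (simp add: bil_def)
 have s: "(SU b. Lin (%a. \<beta> j a b) lamT * W b) = bil (\<beta> j) lamr W" for W
 proof -
  have "(SU b. Lin (%a. \<beta> j a b) lamT * W b) = (SU b a. (cst (\<beta> j a b) * lamr a) \<odot> W b)"
   by (simp add: Lin_def sum_distrib_right scal_mult_left scal_simps(7))
  also have "\<dots> = bil (\<beta> j) lamr W"
   by (subst sum.swap) (simp add: bil_def Lin_def scal_sum scal_simps(7) mult.commute)
  finally show ?thesis .
 qed
 have "eul (bil (\<beta> j) lamr lamT) = 2 \<odot> bil (\<beta> j) lamr lamT"
  unfolding eul_def vfield_bil[OF E] by (simp add: vfield_lamT b \<beta>_swap scal_two s[unfolded \<beta>_swap])
 thus "eul (bLL j \<odot> 1) = 2 \<odot> bLL j \<odot> 1" by (simp only: bil_lamT bLL_def)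
 have "eul (bil (\<beta> j) lamr gen) = 2 \<odot> bil (\<beta> j) lamr gen"
  unfolding eul_def vfield_bil[OF E] by (simp add: vfield_gen b \<beta>_swap scal_two s[unfolded \<beta>_swap])
 thus "eul (bLT j) = 2 \<odot> bLT j" by (simp only: bLT_def)
qed

lemma eul_eta [simp]: "eul (\<eta> j) = 0"
proof -
 have "eul (\<eta> j) = 2 \<odot> th2 j - 2 \<odot> \<eta> j + ui \<odot> (2 \<odot> bLT j - 2 \<odot> l2 j \<odot> th0)"
  by (subst \<eta>_def) (simp add: eul.add eul.diff eul_simps eul.scal[of "l2 j"] scal_mult_left)
 also have "\<dots> = 0" unfolding \<eta>_def by (simp add: scal_simps mult_ac)
 finally show ?thesis .
qed

lemma eul_I: "x : I ==> eul x : I"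
proof (erule sderiv_I[OF eul.sderiv_axioms, rotated], rule sderiv_rel[OF eul.sderiv_axioms eul_const])
 fix i
 have "eul ((l0 * l2 i - bLL i) \<odot> 1) = 2 \<odot> (l0 * l2 i - bLL i) \<odot> 1"
  unfolding scalar_diff scalar_mult eul.diff eul.mult eul_simps by (simp add: scal_mult_left scal_simps mult_ac)
 thus "eul ((l0 * l2 i - bLL i) \<odot> 1) : I" by (simp only:) (intro I_scal I_Ir rel1)
 have "eul ((SU j. mL i j * l2 j) \<odot> 1) = 3 \<odot> (SU j. mL i j * l2 j) \<odot> 1"
 proof -
  have "mL i j \<odot> l2 j \<odot> 1 + (2 * mL i j) \<odot> l2 j \<odot> 1 = 3 \<odot> mL i j \<odot> l2 j \<odot> (1 :: ('d, 's) tfield)" for j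
   by (rule ext_eqI) simp
  thus ?thesis unfolding sum_scal scalar_mult eul.sum eul.mult eul_simps scal_sum
   by (simp add: scal_mult_left scal_mult_right scal_simps(7) mult_ac)
 qed
 thus "eul ((SU j. mL i j * l2 j) \<odot> 1) : I" by (simp only:) (intro I_scal I_Ir rel2)
qed

lemma K_eta_I: "K (\<eta> j) : I"
proof -
 have "ui * (bLL j - l0 * l2 j) = - ui * (l0 * l2 j - bLL j)" by (simp add: algebra_simps)
 thus ?thesis unfolding K_eta by (simp only:) (intro I_Ir Ir_mult rel1)
qed

lemma K_comb: "K (comb c W y z a) = comb c (%a. K (W a)) (K y) (%j. K (z j)) a"
 by (simp add: comb_def K.add K.sum K_scal)

lemma K_scalar [simp]: "K (c \<odot> 1) = 0" by (simp add: K_scal)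

text \<open>\<open>eul\<close> treats \<lambda> and \<theta> alike, except for the term that gives
  \<eta> weight 0. On a generator the commutator with K is therefore a combination of the K (\<eta>
  j), which lie in I.\<close>

lemma K_eul: "K (eul x) - eul (K x) : I"
proof (induction x rule: ext_induct)
 case (scalar c)
 have "K (eul (c \<odot> 1)) = 0"
  unfolding eul_def vfield_scalar by (simp add: K.sum K_scal K_comb K.minus) (simp add: comb_def)
 thus ?case by simp
next
 case (gen b x)
 have e: "eul (gen b) = comb 1 gen (- th0) (%j. th2 j - 2 \<odot> \<eta> j) b" by (simp add: eul_def vfield_gen)
 have p: "parity (eul (gen b)) = - eul (gen b)" 
  unfolding e parity_comb comb_uminus[symmetric] by (simp add: scal_simps(5))
 have eV: "eul (V b) = comb 1 lamT (- (l0 \<odot> 1)) (%j. l2 j \<odot> 1) b"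
 proof -
  have "eul (V b) = eul (lamT b) + cst (Q $ b) \<odot> eul (ur \<odot> 1)"
   unfolding V_def scal_simps(2) eul.add scal_simps(7)[symmetric] eul_const ..
  moreover have "eul (lamT b) = comb 1 lamT (- (l0 \<odot> 1)) (%j. l2 j \<odot> 1) b" unfolding eul_def vfield_lamT ..
  ultimately show ?thesis by simp
 qed
 have "K (eul (gen b)) - eul (K (gen b)) = (SU j. cst (t j b) \<odot> (- 2 \<odot> K (\<eta> j)))"
  unfolding K_gen eV e K_comb
  by (simp add: comb_def K_gen V_def K.minus K.diff K_scal scal_simps sum.distrib sum_subtractf algebra_simps sum_negf)
 hence g: "K (eul (gen b)) - eul (K (gen b)) : I" by (simp only:) (intro I_sum I_scal K_eta_I)
 have "K (eul (gen b * x)) - eul (K (gen b * x)) = (K (eul (gen b)) - eul (K (gen b))) * x - gen b * (K (eul x) - eul (K x))"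
  by (simp add: eul.mult K.mult K.add eul.diff eul.add eul.minus p algebra_simps)
 thus ?case by (simp only:) (intro I_diff I_right I_left g gen)
next
 case (add x y)
 have "K (eul (x + y)) - eul (K (x + y)) = (K (eul x) - eul (K x)) + (K (eul y) - eul (K y))"
  by (simp add: eul.add K.add)
 thus ?case using add I_add by metis
qed

text \<open>The Cartan formula modulo the relations. The anticommutator of two odd derivations is an
  even derivation, so it is enough to compare both sides on coordinates.\<close>

lemma K_ctr: "K (ctr x) + ctr (K x) - l0 \<odot> eul x : I"
proof (induction x rule: ext_induct)
 case (scalar c)
 have X: "K (comb l0 gen (- (l0 \<odot> th0)) (%j. 2 \<odot> bLT j - l0 \<odot> th2 j) a) - l0 \<odot> comb 1 lamT (- (l0 \<odot> 1)) (%j. l2 j \<odot> 1) a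
  = (SU j. cst (t j a) \<odot> (- 2 \<odot> (l0 * l2 j - bLL j) \<odot> 1))" for a
 proof -
  have 1: "K (comb l0 gen (- (l0 \<odot> th0)) (%j. 2 \<odot> bLT j - l0 \<odot> th2 j) a) = 
   l0 \<odot> V a - (cst (Q $ a) * l0) \<odot> (l0 + ur) \<odot> 1 + (SU j. cst (t j a) \<odot> (2 \<odot> bLL j \<odot> 1 - l0 \<odot> l2 j \<odot> 1))"
   unfolding K_comb by (simp add: comb_def K_gen K.minus K.diff K_scal scal_simps(5,7) mult.assoc)
  have 2: "l0 \<odot> comb 1 lamT (- (l0 \<odot> 1)) (%j. l2 j \<odot> 1) a = l0 \<odot> lamT a - (cst (Q $ a) * l0) \<odot> l0 \<odot> 1 + (SU j. cst (t j a) \<odot> (l0 * l2 j) \<odot> 1)"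
   by (simp add: comb_def scal_simps scal_sum mult_ac)
  have 3: "cst (t j a) \<odot> (2 \<odot> bLL j \<odot> 1 - l0 \<odot> l2 j \<odot> 1) - cst (t j a) \<odot> (l0 * l2 j) \<odot> 1 = cst (t j a) \<odot> (- 2 \<odot> (l0 * l2 j - bLL j) \<odot> (1 :: ('d, 's) tfield))" for j
   by (rule ext_eqI) (simp add: algebra_simps)
  show ?thesis unfolding 1 2 3[symmetric] sum_subtractf
   by (simp add: V_def scal_simps algebra_simps)
 qed
 have "K (ctr (c \<odot> 1)) + ctr (K (c \<odot> 1)) - l0 \<odot> eul (c \<odot> 1) = (SU a. ldp a c \<odot>
  (K (comb l0 gen (- (l0 \<odot> th0)) (%j. 2 \<odot> bLT j - l0 \<odot> th2 j) a) - l0 \<odot> comb 1 lamT (- (l0 \<odot> 1)) (%j. l2 j \<odot> 1) a))"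
  unfolding K_scalar ctr.zero unfolding ctr_def eul_def vfield_scalar
  by (simp add: K.sum K_scal K_comb scal_sum sum_subtractf scal_simps(3) scal_left_commute[of l0])
 thus ?case unfolding X by (simp only:) (intro I_sum I_scal I_Ir rel1)
next
 case (gen b x)
 have c: "ctr (gen b) = comb 0 gen 0 (%j. - ((2 * ui) \<odot> (th0 * bLT j))) b" by (simp add: ctr_def vfield_gen)
 have p: "parity (ctr (gen b)) = ctr (gen b)" 
  unfolding c parity_comb by (simp add: comb_def scal_simps(5))
 have e: "eul (gen b) = comb 1 gen (- th0) (%j. th2 j - 2 \<odot> \<eta> j) b" by (simp add: eul_def vfield_gen)
 have cV: "ctr (V b) = comb l0 gen (- (l0 \<odot> th0)) (%j. 2 \<odot> bLT j - l0 \<odot> th2 j) b"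
 proof -
  have "ctr (V b) = ctr (lamT b) + cst (Q $ b) \<odot> ctr (ur \<odot> 1)"
   unfolding V_def scal_simps(2) ctr.add scal_simps(7)[symmetric] ctr_const ..
  moreover have "ctr (lamT b) = comb l0 gen (- (l0 \<odot> th0)) (%j. 2 \<odot> bLT j - l0 \<odot> th2 j) b" unfolding ctr_def vfield_lamT ..
  ultimately show ?thesis by simp
 qed
 \<comment> \<open>This identity dictates the \<theta> component of \<open>ctr\<close> along t j:
   its image under K turns the term with \<eta> j into a multiple of a relation.\<close>
 have 3: "- (2 * ui) \<odot> ((l0 + ur) \<odot> bLT j - bLL j \<odot> th0) + (2 \<odot> bLT j - l0 \<odot> th2 j) - l0 \<odot> (th2 j - 2 \<odot> \<eta> j)
  = - (2 * ui) \<odot> (l0 * l2 j - bLL j) \<odot> th0" for j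
  unfolding \<eta>_def by (rule ext_eqI) (simp add: algebra_simps)
 have "K (th0 * bLT j) = (l0 + ur) \<odot> bLT j - bLL j \<odot> th0" for j
  by (simp add: K.mult scal_mult_left scal_mult_right scal_simps(5))
 hence 4: "K (ctr (gen b)) = (SU j. cst (t j b) \<odot> (- (2 * ui) \<odot> ((l0 + ur) \<odot> bLT j - bLL j \<odot> th0)))"
  unfolding c K_comb by (simp add: comb_def K.minus K_scal scal_simps(6))
 have "K (ctr (gen b)) + ctr (K (gen b)) - l0 \<odot> eul (gen b) = (SU j. cst (t j b) \<odot> (- (2 * ui) \<odot> (l0 * l2 j - bLL j) \<odot> th0))"
  unfolding K_gen cV 4 e 3[symmetric]
  by (simp only: scal_simps(1,3) sum.distrib sum_subtractf) (simp add: comb_def scal_simps scal_sum sum_subtractf algebra_simps sum.distrib)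
 hence g: "K (ctr (gen b)) + ctr (K (gen b)) - l0 \<odot> eul (gen b) : I" by (simp only:) (intro I_sum I_scal I_Ir rel1)
 have V: "parity (V b) = V b" "V b * ctr x = ctr x * V b" by (simp_all add: V_def scal_mult_left scal_mult_right)
 have "K (ctr (gen b * x)) + ctr (K (gen b * x)) - l0 \<odot> eul (gen b * x)
  = (K (ctr (gen b)) + ctr (K (gen b)) - l0 \<odot> eul (gen b)) * x + gen b * (K (ctr x) + ctr (K x) - l0 \<odot> eul x)"
  by (simp add: eul.mult K.mult K.add K.diff ctr.mult ctr.diff ctr.add ctr.minus K.minus p V K_gen scal_simps(1) scal_mult_left scal_mult_right algebra_simps)
 thus ?case by (simp only:) (intro I_add I_right I_left g gen)
next
 case (add x y)
 have "K (ctr (x + y)) + ctr (K (x + y)) - l0 \<odot> eul (x + y) = (K (ctr x) + ctr (K x) - l0 \<odot> eul x) + (K (ctr y) + ctr (K y) - l0 \<odot> eul y)"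
  by (simp add: eul.add K.add ctr.add scal_simps(1))
 thus ?case using add I_add by metis
qed

end

subsection \<open>Homogeneous polynomials\<close>

definition homog :: "('e => int) => int => ('e \<Rightarrow>\<^sub>0 'a::zero) => bool" where
 "homog deg q p \<longleftrightarrow> (\<forall>e\<in>keys p. deg e = q)"

lemma homog_add: "homog deg q p ==> homog deg q p' ==> homog deg q (p + p')"
 by (auto simp: homog_def dest!: subsetD[OF keys_add])
lemma homog_sum: "(!!i. i : A ==> homog deg q (f i)) ==> homog deg q (sum f A)"
 by (induction A rule: infinite_finite_induct) (simp_all add: homog_add, simp_all add: homog_def)
lemma homog_mult:
 "(!!e e'. deg (e + e') = deg e + deg e') ==> homog deg q p ==> homog deg q' p' ==> homog deg (q + q') (p * p')"
 unfolding homog_def using keys_mult by fastforce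
lemma homog_single: "deg e = q ==> homog deg q (single e f)" by (simp add: homog_def)
lemma homog_cst: "deg 0 = 0 ==> homog deg 0 (cst c)" by (simp add: homog_def cst_def)

lemma pproj_homog:
 assumes "homog deg q p" "!!e e'. deg (e + e') = deg e + deg e'"
 shows "pproj {e. deg e : B} (p * c) = p * pproj {e. q + deg e : B} c"
proof -
 have "pproj {e. deg e : B} (\<Sum>k\<in>keys p. single k (lookup p k) * c)
  = (\<Sum>k\<in>keys p. single k (lookup p k) * pproj {e. q + deg e : B} c)"
  unfolding pproj_sum by (intro sum.cong refl pproj_single_mult) (use assms in \<open>auto simp: homog_def\<close>)
 thus ?thesis by (simp add: sum_distrib_right[symmetric] pm_expand[symmetric])
qed

context adapted
begin

lemma homog_linr:
 fixes deg :: "(nat^'s) \<times> int => int"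
 assumes "!!a. deg (axis a 1, 0) = q" "deg 0 = 0" "!!e e'. deg (e + e') = deg e + deg e'"
 shows "homog deg q (linr l :: ('d, 's) tpol)"
proof -
 have "homog deg (0 + q) (cst (l a) * lamr a :: ('d, 's) tpol)" for a
  unfolding lamr_def by (rule homog_mult[OF assms(3) homog_cst[of deg, OF assms(2)] homog_single[of deg, OF assms(1)]])
 thus ?thesis unfolding linr_def by (intro homog_sum) simp
qed

lemma homog_bilr:
 fixes deg :: "(nat^'s) \<times> int => int"
 assumes "!!a. deg (axis a 1, 0) = q" "deg 0 = 0" "!!e e'. deg (e + e') = deg e + deg e'"
 shows "homog deg (q + q) (bilr l :: ('d, 's) tpol)"
 unfolding bilr_def lamr_def
 by (intro homog_sum homog_mult[OF assms(3)] homog_linr assms homog_single[of deg, OF assms(1)])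

lemma Ir_pproj:
 fixes deg :: "(nat^'s) \<times> int => int"
 assumes "c : Ir" "!!a. deg (axis a 1, 0) = q" "deg 0 = 0" "!!e e'. deg (e + e') = deg e + deg e'"
 shows "pproj {e. deg e : B} c : Ir"
proof -
 obtain g where g: "c = (SU \<mu>. rel \<mu> * g \<mu>)" using assms(1) unfolding Ir_def by auto
 have "pproj {e. deg e : B} c = (SU \<mu>. pproj {e. (q + q) + deg e : B} (g \<mu>) * rel \<mu>)"
  unfolding g pproj_sum rel_def
  by (intro sum.cong refl) (subst pproj_homog[OF homog_bilr[OF assms(2-4)] assms(4)], simp add: mult.commute)
 also have "\<dots> : Ir" by (intro Ir_sum Ir_mult Ir_rel)
 finally show ?thesis .
qed

text \<open>The relations do not involve \<open>u\<close>, so one can compare the coefficients of the highest power of \<open>u\<close>.\<close>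

lemma l0_u_regular:
 assumes "(l0 + ur) * c : Ir" shows "c : Ir"
proof -
 let ?p = "%k. pproj {e. snd e : {k}} :: ('d, 's) tpol => _"
 have deg: "!!a. snd (axis a (1::nat) :: nat^'s, 0::int) = 0" "snd (0 :: (nat^'s) \<times> int) = 0"
  "!!e e' :: (nat^'s) \<times> int. snd (e + e') = snd e + snd e'" by simp_all
 have l0: "?p k (l0 * c) = l0 * ?p k c" for k
  unfolding l0_def by (subst pproj_homog[OF homog_linr[of snd, OF deg] deg(3)]) simp
 have u: "?p k (ur * c) = ur * ?p (k - 1) c" for k
 proof -
  have "1 + snd e : {k} \<longleftrightarrow> snd e : {k - 1}" for e :: "(nat^'s) \<times> int" by auto
  thus ?thesis unfolding ur_def by (subst pproj_homog[OF homog_single[of snd _ 1] deg(3)]) simp_all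
 qed
 define m where "m = (if keys c = {} then 0 else Max (snd ` keys c))"
 have m: "snd e \<le> m" if "e : keys c" for e using that by (auto simp: m_def)
 \<comment> \<open>Descending induction on the power of u, started one above the highest power,
   where the component is 0.\<close>
 have step: "?p (m + 1 - int j) c : Ir" for j
 proof (induction j)
  case 0
  have "lookup c e = 0" if "snd e = m + 1" for e using m[of e] that by (force simp: in_keys_iff)
  hence "?p (m + 1) c = 0" by (intro poly_mapping_eqI) (simp add: lookup_pproj)
  thus ?case by simp
 next
  case (Suc j)
  have "?p (m + 1 - int j) ((l0 + ur) * c) : Ir" by (rule Ir_pproj[OF assms deg])
  hence "l0 * ?p (m + 1 - int j) c + ur * ?p (m + 1 - int j - 1) c : Ir"
   by (simp only: distrib_right pproj_add l0 u)
  from Ir_add[OF this Ir_uminus[OF Ir_mult[OF Suc, of l0]]]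
  have "ur * ?p (m + 1 - int j - 1) c : Ir" by simp
  from Ir_mult[OF this, of ui] show ?case by (simp add: algebra_simps)
 qed
 have "c = (\<Sum>k\<in>snd ` keys c. ?p k c)"
 proof (rule poly_mapping_eqI)
  fix e
  have "(\<Sum>k\<in>snd ` keys c. lookup (?p k c) e) = (\<Sum>k\<in>snd ` keys c. if k = snd e then lookup c e else 0)"
   by (rule sum.cong) (auto simp: lookup_pproj)
  also have "\<dots> = lookup c e" by (auto simp: in_keys_iff image_iff)
  finally show "lookup c e = lookup (\<Sum>k\<in>snd ` keys c. ?p k c) e" by (simp add: lookup_sum)
 qed
 also have "\<dots> : Ir"
 proof (rule Ir_sum)
  fix k assume "k : snd ` keys c"
  hence "k \<le> m" using m by auto
  hence "k = m + 1 - int (nat (m + 1 - k))" by simp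
  thus "?p k c : Ir" using step by metis
 qed
 finally show ?thesis .
qed

lemma l0_u_regular_I: "(l0 + ur) \<odot> x : I ==> x : I"
 unfolding I_def using l0_u_regular by simp

lemma I_gproj: assumes "x : I" shows "gproj tdeg A x : I"
proof -
 have "pproj {e. tdeg e : {j. (int (card J), j) : A}} (coef x J) : Ir" for J
  using assms by (intro Ir_pproj[where q = 1]) (auto simp: I_def tdeg_lam[simplified] tdeg_add)
 thus ?thesis unfolding I_def by simp
qed

text \<open>K lowers the exterior degree by one and raises the polynomial degree by one, whence the
  shifted set of bidegrees.\<close>

lemma K_gproj: "K (gproj tdeg A x) = gproj tdeg {(i, j). (i + 1, j - 1) : A} (K x)"
proof (rule ext_eqI)
 fix J :: "'s set"
 let ?B = "{j. (int (card J), j) : {(i, j). (i + 1, j - 1) : A}}"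
 have V: "homog tdeg 1 (lamr a + cst (Q $ a) * ur :: ('d, 's) tpol)" for a
  unfolding lamr_def cst_def ur_def mult_single
  by (intro homog_add homog_single) (use tdeg_lam in \<open>auto simp: tdeg_def\<close>)
 have sg: "pproj S (ssign {a} J * c) = ssign {a} J * pproj S c" for S a and c :: "('d, 's) tpol"
  by (cases "even (card (inversions {a} J))") (simp_all add: ssign_def, metis add.inverse_unique add.right_inverse pproj_add pproj_zero)
 have coefK: "coef (K x) J = (SU a. (lamr a + cst (Q $ a) * ur) * coef (odd_deriv a x) J)" for x
  by (simp add: K_def vfield_def V_def coef_sum scal_mult_left)
 have "pproj {e. tdeg e : ?B} ((lamr a + cst (Q $ a) * ur) * coef (odd_deriv a x) J)
   = (lamr a + cst (Q $ a) * ur) * coef (odd_deriv a (gproj tdeg A x)) J" for a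
  by (subst pproj_homog[OF V tdeg_add]) (auto simp: coef_odd_deriv sg add.commute[of 1])
 thus "coef (K (gproj tdeg A x)) J = coef (gproj tdeg {(i, j). (i + 1, j - 1) : A} (K x)) J"
  unfolding coefK coef_gproj by (simp add: coefK pproj_sum)
qed

subsection \<open>The Koszul complex\<close>

text \<open>Generated by the classes of weight 0 other than th0. In \<open>B1\<close> the generator
  l0 is left out, because it is homologous to - u; \<open>B1\<close> will be the image of
  \<open>\<Phi>0\<close>.\<close>

inductive_set B0 :: "('d, 's) tfield set" where
 fn: "single (0, k) f \<odot> 1 : B0"
| eta: "x : B0 ==> \<eta> j * x : B0"
| l0: "x : B0 ==> l0 \<odot> x : B0"
| add: "x : B0 ==> y : B0 ==> x + y : B0"

inductive_set B1 :: "('d, 's) tfield set" where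
 fn: "single (0, k) f \<odot> 1 : B1"
| eta: "x : B1 ==> \<eta> j * x : B1"
| add: "x : B1 ==> y : B1 ==> x + y : B1"

lemma eul_fn: "eul (single (0, k) f \<odot> 1) = 0" by (simp add: eul_def vfield_scalar)

lemma B0_eul: "x : B0 ==> eul x = 0"
proof (induction rule: B0.induct)
 case (l0 x)
 have "eul (l0 \<odot> x) = eul (l0 \<odot> 1) * x + l0 \<odot> eul x" by (rule eul.scal)
 thus ?case using l0 by (simp add: eul_simps)
qed (simp_all add: eul_fn eul.mult eul.add)

lemma K_eta_mult: "K x : I ==> K (\<eta> j * x) : I"
 unfolding K.mult twist_simps parity_eta using I_add[OF I_right[OF K_eta_I, of j x] I_left[of "K x" "- \<eta> j"]] by blast

lemma B0_K: "x : B0 ==> K x : I"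
proof (induction rule: B0.induct)
 case (fn k f) show ?case by simp
next
 case (eta x j) show ?case by (rule K_eta_mult[OF eta(2)])
next
 case (l0 x) show ?case unfolding K_scal by (rule I_scal[OF l0(2)])
next
 case (add x y) show ?case unfolding K.add by (rule I_add[OF add(3,4)])
qed

lemma fn_closed:
 "x : B0 ==> single (0, k) f \<odot> x : B0" "x : B1 ==> single (0, k) f \<odot> x : B1"
proof -
 show "single (0, k) f \<odot> x : B0" if "x : B0" using that
 proof induction
  case (fn k' f')
  show ?case using B0.fn[of "k + k'" "f * f'"] by (simp add: scal_simps(7) mult_single)
 next
  case (eta x j)
  show ?case using B0.eta[OF eta(2), of j] by (simp add: scal_mult_right)
 next
  case (l0 x)
  show ?case using B0.l0[OF l0(2)] by (subst scal_left_commute)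
 next
  case (add x y)
  show ?case using B0.add[OF add(3,4)] by (simp add: scal_simps(1))
 qed
 show "single (0, k) f \<odot> x : B1" if "x : B1" using that
 proof induction
  case (fn k' f')
  show ?case using B1.fn[of "k + k'" "f * f'"] by (simp add: scal_simps(7) mult_single)
 next
  case (eta x j)
  show ?case using B1.eta[OF eta(2), of j] by (simp add: scal_mult_right)
 next
  case (add x y)
  show ?case using B1.add[OF add(3,4)] by (simp add: scal_simps(1))
 qed
qed

lemma cst_as_fn: "cst c = single ((0 :: nat^'s), (0::int)) (cfun c)" by (simp add: cst_def zero_prod_def)

lemma B0_zero: "0 : B0" using B0.fn[of 0 0] by simp
lemma B0_cst: "x : B0 ==> cst c \<odot> x : B0" unfolding cst_as_fn by (rule fn_closed)

section \<open>Decomposition by weight modulo the relations\<close>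

definition W :: "nat => ('d, 's) tfield set" where "W w = {y. eul y - of_nat w \<odot> y : I}"

lemma W_mult: assumes "x : W v" "y : W w" shows "x * y : W (v + w)"
proof -
 have "eul (x * y) - of_nat (v + w) \<odot> (x * y) = (eul x - of_nat v \<odot> x) * y + x * (eul y - of_nat w \<odot> y)"
  by (simp add: eul.mult scal_simps(2) scal_mult_left scal_mult_right algebra_simps)
 moreover have "\<dots> : I" using assms unfolding W_def by (intro I_add[OF I_right I_left]) simp_all
 ultimately show ?thesis unfolding W_def by (simp only: mem_Collect_eq)
qed

lemma W_add: "x : W w ==> y : W w ==> x + y : W w"
proof -
 assume a: "x : W w" "y : W w"
 have "eul (x + y) - of_nat w \<odot> (x + y) = (eul x - of_nat w \<odot> x) + (eul y - of_nat w \<odot> y)"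
  by (simp add: eul.add scal_simps(1) algebra_simps)
 thus ?thesis using a unfolding W_def by (auto intro!: I_add)
qed

lemma W_zero [simp]: "0 : W w" by (simp add: W_def)

lemma W_cst: "x : W w ==> cst c \<odot> x : W w"
 using I_scal[of "eul x - of_nat w \<odot> x" "cst c"] by (simp add: W_def eul_const scal_simps(3) scal_left_commute[of "cst c"])

lemma W_u: "x : W w ==> ui \<odot> x : W w"
 using I_scal[of "eul x - of_nat w \<odot> x" ui] by (simp add: W_def scal_simps(3) scal_left_commute[of ui])

lemma B0_W: "x : B0 ==> x : W 0" by (simp add: W_def B0_eul)

lemma W_elements: "th0 : W 0" "\<eta> j : W 0" "bLT j : W 2" "l2 j \<odot> 1 : W 2" "l0 \<odot> 1 : W 0"
 by (simp_all add: W_def eul_simps)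

text \<open>The middle component of the coordinate: what is left after subtracting the parts along Q
  and along the t j. It is the part of weight 1.\<close>

definition "lam1 a = (lamr a - cst (Q $ a) * l0 - (SU j. cst (t j a) * l2 j)) \<odot> (1 :: ('d, 's) tfield)"
definition "th1 a = (gen a - cst (Q $ a) \<odot> th0 - (SU j. cst (t j a) \<odot> th2 j) :: ('d, 's) tfield)"

lemma lam1_W: "lam1 a : W 1"
proof -
 have e: "lam1 a = lamT a - cst (Q $ a) \<odot> (l0 \<odot> 1) - (SU j. cst (t j a) \<odot> (l2 j \<odot> 1))"
  by (simp add: lam1_def scal_simps sum_scal)
 have "eul (lamT a) = comb 1 lamT (- (l0 \<odot> 1)) (%j. l2 j \<odot> 1) a" by (simp only: eul_def vfield_lamT)
 hence "eul (lam1 a) = lam1 a" unfolding e eul.diff eul.sum eul_const eul_simps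
  by (simp add: comb_def scal_two scal_simps(1,3,5) sum.distrib sum_subtractf algebra_simps)
 thus ?thesis by (simp add: W_def)
qed

lemma th1_W: "th1 a : W 1"
proof -
 have "eul (gen a) = comb 1 gen (- th0) (%j. th2 j - 2 \<odot> \<eta> j) a" by (simp only: eul_def vfield_gen)
 hence "eul (th1 a) = th1 a" unfolding th1_def eul.diff eul.sum eul_const eul_simps
  by (simp add: comb_def scal_two scal_simps(1,3,5) sum.distrib sum_subtractf algebra_simps)
 thus ?thesis by (simp add: W_def)
qed

inductive_set Pos :: "('d, 's) tfield set" where
 pos: "w \<ge> 1 ==> y : W w ==> y : Pos"
| add: "x : Pos ==> y : Pos ==> x + y : Pos"

lemma Pos_zero: "0 : Pos" by (rule Pos.pos[of 1]) auto

lemma Pos_mult: assumes "z : Pos" "y : W w" shows "y * z : Pos"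
 using assms(1)
proof induction
 case (pos v x)
 thus ?case using W_mult[OF assms(2) pos(2)] by (intro Pos.pos[of "w + v"]) auto
qed (simp add: distrib_left Pos.add)

lemma Pos_rep: "y : Pos ==> \<exists>n g. (\<forall>w. g w : W w) \<and> y = (\<Sum>w\<in>{1..n}. g w)"
proof (induction rule: Pos.induct)
 case (pos w y)
 have "y = (\<Sum>v\<in>{1..w}. if v = w then y else 0)" using pos by simp
 moreover have "(if v = w then y else 0) : W v" for v using pos by auto
 ultimately show ?case by (intro exI[of _ w] exI[of _ "%v. if v = w then y else 0"]) auto
next
 case (add x y)
 then obtain n g n' g' where g: "\<forall>w. g w : W w" "x = (\<Sum>w\<in>{1..n}. g w)" and g': "\<forall>w. g' w : W w" "y = (\<Sum>w\<in>{1..n'}. g' w)"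
  by blast
 let ?m = "max n n'"
 have "(\<Sum>w\<in>{1..k}. h w) = (\<Sum>w\<in>{1..?m}. if w \<le> k then h w else 0)" if "k \<le> ?m" for k and h :: "nat => ('d, 's) tfield"
  using that by (intro sum.mono_neutral_cong_left) auto
 from this[of n g] this[of n' g']
 have "x + y = (\<Sum>w\<in>{1..?m}. (if w \<le> n then g w else 0) + (if w \<le> n' then g' w else 0))"
  unfolding g(2) g'(2) sum.distrib by simp
 moreover have "(if w \<le> n then g w else 0) + (if w \<le> n' then g' w else 0) : W w" for w
  using g g' by (intro W_add) auto
 ultimately show ?case by (intro exI[of _ ?m] exI conjI) auto
qed

definition "dec x \<longleftrightarrow> (\<exists>a\<in>B0. \<exists>b\<in>B0. \<exists>z\<in>Pos. x - (a + th0 * b + z) : I)"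

lemma decI: "a : B0 ==> b : B0 ==> z : Pos ==> x - (a + th0 * b + z) : I ==> dec x"
 unfolding dec_def by blast

lemma dec_add: assumes "dec x" "dec y" shows "dec (x + y)"
proof -
 obtain a b z where 1: "a : B0" "b : B0" "z : Pos" "x - (a + th0 * b + z) : I" using assms(1) unfolding dec_def by blast
 obtain a' b' z' where 2: "a' : B0" "b' : B0" "z' : Pos" "y - (a' + th0 * b' + z') : I" using assms(2) unfolding dec_def by blast
 have "(x + y) - ((a + a') + th0 * (b + b') + (z + z')) = (x - (a + th0 * b + z)) + (y - (a' + th0 * b' + z'))"
  by (simp add: algebra_simps)
 hence "(x + y) - ((a + a') + th0 * (b + b') + (z + z')) : I" using I_add[OF 1(4) 2(4)] by (simp only:)
 thus ?thesis by (rule decI[OF B0.add[OF 1(1) 2(1)] B0.add[OF 1(2) 2(2)] Pos.add[OF 1(3) 2(3)]])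
qed

lemma dec_zero: "dec 0" by (rule decI[OF B0_zero B0_zero Pos_zero]) simp

lemma dec_sum: "(!!i. i : A ==> dec (f i)) ==> dec (sum f A)"
 by (induction A rule: infinite_finite_induct) (auto intro: dec_add dec_zero)

lemma th0_square: "th0 * th0 = 0"
 by (rule eq_neg_self) (use odd_commute[of th0 th0] in simp)

lemma dec_mult_pos: assumes "dec x" "y : W w" "w \<ge> 1" shows "dec (y * x)"
proof -
 obtain a b z where 1: "a : B0" "b : B0" "z : Pos" "x - (a + th0 * b + z) : I" using assms(1) unfolding dec_def by blast
 have "y * x - (0 + th0 * 0 + y * (a + th0 * b + z)) = y * (x - (a + th0 * b + z))" by (simp add: algebra_simps)
 moreover have "y * (a + th0 * b + z) : Pos"
 proof -
  have "y * a : Pos" "y * (th0 * b) : Pos"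
   using W_mult[OF assms(2) B0_W[OF 1(1)]] W_mult[OF assms(2) W_mult[OF W_elements(1) B0_W[OF 1(2)]]] assms(3)
   by (auto intro: Pos.pos)
  thus ?thesis unfolding distrib_left by (intro Pos.add Pos_mult[OF 1(3) assms(2)])
 qed
 ultimately show ?thesis using 1 by (intro decI[of 0 0]) (auto intro: B0_zero I_left)
qed

text \<open>The flag p records the sign that y picks up when it is moved past th0.\<close>

lemma dec_mult_null:
 assumes "dec x" "y : W 0" "!!a. a : B0 ==> y * a : B0" "parity y = (if p then - y else y)"
 shows "dec (y * x)"
proof -
 obtain a b z where 1: "a : B0" "b : B0" "z : Pos" "x - (a + th0 * b + z) : I" using assms(1) unfolding dec_def by blast
 have c: "y * th0 = (if p then -1 else 1) * (th0 * y)" using assms(4) odd_commute[of y th0] even_commute[of y th0] by (cases p) auto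
 have s: "(if p then -1 else 1) * b' : B0" if "b' : B0" for b'
  using that B0_cst[of b' "-1"] by (auto simp: cst_minus scal_simps(6))
 have "y * x - (y * a + th0 * ((if p then -1 else 1) * (y * b)) + y * z) = y * (x - (a + th0 * b + z))"
  using c by (cases p) (simp_all add: right_diff_distrib distrib_left mult.assoc[symmetric])
 thus ?thesis using 1 assms(3) s by (intro decI[of "y * a" "(if p then -1 else 1) * (y * b)" "y * z"]) (auto intro: I_left Pos_mult[OF _ assms(2)])
qed

lemma dec_th0: assumes "dec x" shows "dec (th0 * x)"
proof -
 obtain a b z where 1: "a : B0" "b : B0" "z : Pos" "x - (a + th0 * b + z) : I" using assms(1) unfolding dec_def by blast
 have "th0 * x - (0 + th0 * a + th0 * z) = th0 * (x - (a + th0 * b + z))"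
  using th0_square by (simp add: right_diff_distrib distrib_left mult.assoc[symmetric])
 thus ?thesis using 1 by (intro decI[of 0 a "th0 * z"]) (auto intro: B0_zero I_left Pos_mult[OF _ W_elements(1)])
qed

lemma dec_scal_fn: assumes "dec x" shows "dec (cst c \<odot> x)"
proof -
 have "dec ((cst c \<odot> 1) * x)"
 proof (rule dec_mult_null[OF assms, of _ False])
  show "cst c \<odot> 1 : W 0" unfolding cst_as_fn by (intro B0_W B0.fn)
 qed (auto simp: scal_mult_left B0_cst)
 thus ?thesis by (simp add: scal_mult_left)
qed

text \<open>Each coordinate splits into its parts along Q, the middle summand and the t j, and the
  last two parts of \<lambda> have positive weight. For \<theta> the last part is rewritten by
  \<eta>, whose contribution stays in \<open>B0\<close> while the corrections have weight 2.\<close>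

lemma decompose: "dec x"
proof (induction x rule: tfield_induct)
 case (fn k f)
 show ?case by (rule decI[OF B0.fn[of k f] B0_zero Pos_zero]) simp
next
 case (lam a x)
 have e: "lamr a \<odot> x = cst (Q $ a) \<odot> ((l0 \<odot> 1) * x) + lam1 a * x + (SU j. cst (t j a) \<odot> ((l2 j \<odot> 1) * x))"
  by (simp add: lam1_def scal_mult_left scal_simps sum_scal left_diff_distrib sum_distrib_right)
 show ?case unfolding e
  by (intro dec_add dec_sum dec_scal_fn dec_mult_pos[OF lam lam1_W] dec_mult_pos[OF lam W_elements(4)] dec_mult_null[OF lam W_elements(5), of False])
   (simp_all add: scal_mult_left B0.l0)
next
 case (theta a x)
 have th2: "th2 j = \<eta> j - ui \<odot> bLT j + ui \<odot> ((l2 j \<odot> 1) * th0)" for j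
  by (simp add: \<eta>_def scal_simps scal_mult_left)
 have e: "gen a * x = cst (Q $ a) \<odot> (th0 * x) + th1 a * x + (SU j. cst (t j a) \<odot> (\<eta> j * x + cst (-1) \<odot> ((ui \<odot> bLT j) * x) + (ui \<odot> ((l2 j \<odot> 1) * th0)) * x))"
 proof -
  have "\<eta> j * x + cst (-1) \<odot> ((ui \<odot> bLT j) * x) + (ui \<odot> ((l2 j \<odot> 1) * th0)) * x = th2 j * x" for j
   by (subst th2) (simp add: cst_minus scal_simps(6) algebra_simps)
  thus ?thesis by (simp add: th1_def scal_mult_left algebra_simps sum_distrib_right)
 qed
 have w: "ui \<odot> ((l2 j \<odot> 1) * th0) : W 2" for j using W_mult[OF W_elements(4) W_elements(1)] by (intro W_u) simp
 show ?case unfolding e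
  by (intro dec_add dec_sum dec_scal_fn dec_th0[OF theta] dec_mult_pos[OF theta th1_W] dec_mult_pos[OF theta w]
    dec_mult_pos[OF theta W_u[OF W_elements(3)]] dec_mult_null[OF theta W_elements(2), where p = True] B0.eta) simp_all
qed (rule dec_add)

text \<open>Let z = eul x. By the Cartan formula \<open>ctr x\<close> bounds l0 z, and th0 z bounds
  (l0 + u) z; the difference bounds u z, and u is invertible.\<close>

lemma eul_exact: assumes "K x : I" shows "\<exists>y. eul x - K y : I"
proof
 let ?z = "eul x"
 have 1: "K ?z : I" using I_add[OF K_eul[of x] eul_I[OF assms]] by simp
 have k: "K (th0 * ?z) = (l0 + ur) \<odot> ?z - th0 * K ?z" by (simp add: K.mult scal_mult_left)
 have "?z - K (ui \<odot> (th0 * ?z - ctr x)) = ui \<odot> (th0 * K ?z + ((K (ctr x) + ctr (K x) - l0 \<odot> ?z) - ctr (K x)))"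
  unfolding K_scal K.diff k by (simp add: scal_simps algebra_simps)
 also have "\<dots> : I" by (intro I_scal I_add I_diff I_left 1 K_ctr ctr_I assms)
 finally show "?z - K (ui \<odot> (th0 * ?z - ctr x)) : I" .
qed

text \<open>Removal of the top weight n: up to a boundary x equals x - eul x / n, where b is
  unchanged, weight w is multiplied by 1 - w / n, and weight n disappears.\<close>

lemma pos_exact:
 assumes "\<forall>w. g w : W w" "eul b : I" "x - (b + (\<Sum>w\<in>{1..n}. g w)) : I" "K x : I"
 shows "\<exists>y. x - b - K y : I"
 using assms
proof (induction n arbitrary: x g)
 case 0
 thus ?case by (intro exI[of _ 0]) simp
next
 case (Suc n)
 let ?c = "%w::nat. cst (1 - of_nat w / of_nat (Suc n)) :: ('d, 's) tpol"
 let ?i = "cst (1 / of_nat (Suc n)) :: ('d, 's) tpol"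
 define x' where "x' = x - ?i \<odot> eul x"
 have ci: "?i * of_nat w = 1 - ?c w" for w
  by (simp add: cst_diff cst_of_nat[symmetric] cst_mult[symmetric] del: of_nat_Suc)
 have cn: "?c (Suc n) = 0" by (simp del: of_nat_Suc)
 have "eul (x - (b + (\<Sum>w\<in>{1..Suc n}. g w))) : I" by (rule eul_I[OF Suc(4)])
 hence "eul x - (eul b + (\<Sum>w\<in>{1..Suc n}. eul (g w))) : I" by (simp only: eul.diff eul.add eul.sum)
 from I_add[OF this I_add[OF Suc(3) I_sum[of "{1..Suc n}" "%w. eul (g w) - of_nat w \<odot> g w"]]]
 have "eul x - (\<Sum>w\<in>{1..Suc n}. of_nat w \<odot> g w) : I" using Suc(2)
  by (simp add: W_def sum_subtractf algebra_simps del: sum.cl_ivl_Suc)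
 from I_diff[OF Suc(4) I_scal[OF this, of ?i]]
 have "x' - (b + (\<Sum>w\<in>{1..Suc n}. g w - (?i * of_nat w) \<odot> g w)) : I"
  by (simp add: x'_def scal_simps(3,7) scal_sum sum_subtractf algebra_simps del: sum.cl_ivl_Suc)
 also have "(\<Sum>w\<in>{1..Suc n}. g w - (?i * of_nat w) \<odot> g w) = (\<Sum>w\<in>{1..Suc n}. ?c w \<odot> g w)"
  unfolding ci by (simp add: scal_simps(4) del: sum.cl_ivl_Suc)
 also have "\<dots> = (\<Sum>w\<in>{1..n}. ?c w \<odot> g w)" by (simp add: cn del: of_nat_Suc)
 finally have 1: "x' - (b + (\<Sum>w\<in>{1..n}. ?c w \<odot> g w)) : I" .
 have 2: "K x' : I"
  using I_add[OF K_eul[of x] eul_I[OF Suc(5)]] Suc(5) unfolding x'_def K.diff K_scal by (intro I_diff I_scal) auto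
 have "\<forall>w. ?c w \<odot> g w : W w" using Suc(2) W_cst by blast
 from Suc(1)[OF this Suc(3) 1 2] obtain y where y: "x' - b - K y : I" by blast
 obtain y' where y': "eul x - K y' : I" using eul_exact[OF Suc(5)] by blast
 have "x - b - K (y + ?i \<odot> y') = (x' - b - K y) + ?i \<odot> (eul x - K y')"
  by (simp add: x'_def K.add K_scal scal_simps(3))
 thus ?case using I_add[OF y I_scal[OF y', of ?i]] by metis
qed

text \<open>Since K th0 = l0 + u, a factor l0 can be traded for - u up to a boundary.\<close>

lemma B0_reduce: "x : B0 ==> \<exists>b\<in>B1. \<exists>y. x - b - K y : I"
proof (induction rule: B0.induct)
 case (fn k f)
 show ?case by (rule bexI[OF exI[of _ 0] B1.fn[of k f]]) simp
next
 case (eta x j)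
 then obtain b y where b: "b : B1" "x - b - K y : I" by blast
 have "\<eta> j * x - \<eta> j * b - K (- (\<eta> j * y)) = \<eta> j * (x - b - K y) + K (\<eta> j) * y"
  by (simp add: K.minus K.mult algebra_simps)
 thus ?case using I_add[OF I_left[OF b(2), of "\<eta> j"] I_right[OF K_eta_I, of j y]] B1.eta[OF b(1)] by metis
next
 case (l0 x)
 then obtain b y where b: "b : B1" "x - b - K y : I" by blast
 have "l0 \<odot> x - (- (ur \<odot> b)) - K (th0 * x - ur \<odot> y) = ur \<odot> (b + K y - x) + th0 * K x"
  by (simp add: K.diff K_scal K.mult scal_mult_left scal_simps algebra_simps)
 moreover have "b + K y - x : I" using I_uminus[OF b(2)] by (simp add: algebra_simps)
 moreover have "- (ur \<odot> b) : B1"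
  using fn_closed(2)[OF b(1), of 1 "- 1"] by (simp add: ur_def single_uminus scal_simps(6))
 ultimately show ?case using I_add[OF I_scal I_left[OF B0_K[OF l0(1)]]] by metis
next
 case (add x x')
 then obtain b y b' y' where b: "b : B1" "x - b - K y : I" "b' : B1" "x' - b' - K y' : I" by blast
 have "(x + x') - (b + b') - K (y + y') = (x - b - K y) + (x' - b' - K y')" by (simp add: K.add)
 thus ?case using I_add[OF b(2,4)] B1.add[OF b(1,3)] by metis
qed

text \<open>Positive weights are exact. In weight 0, applying K to a + th0 b shows that (l0 + u) b
  lies in I, hence so does b, and \<open>B0_reduce\<close> moves a into \<open>B1\<close>.\<close>

theorem koszul: assumes "K x : I" shows "\<exists>b\<in>B1. \<exists>y. x - b - K y : I"
proof -
 obtain a b z where 1: "a : B0" "b : B0" "z : Pos" "x - (a + th0 * b + z) : I" using decompose[of x] unfolding dec_def by blast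
 obtain n g where g: "\<forall>w. g w : W w" "z = (\<Sum>w\<in>{1..n}. g w)" using Pos_rep[OF 1(3)] by blast
 have "eul (a + th0 * b) : I" using 1 by (simp add: eul.add eul.mult eul_simps B0_eul)
 from pos_exact[OF g(1) this 1(4)[unfolded g(2)] assms] obtain y where y: "x - (a + th0 * b) - K y : I" by blast
 have KK: "K (K y) = 0"
 proof -
  have "K (K y) + K (K y) = 0" 
  proof (induction y rule: ext_induct)
   case (gen c x)
   have V: "parity (V c) = V c" "K (V c) = 0" by (simp_all add: V_def)
   have "K (K (gen c * x)) + K (K (gen c * x)) = gen c * (K (K x) + K (K x))"
    by (simp add: K.mult K.diff K_gen V algebra_simps)
   thus ?case using gen by simp
  qed (simp_all add: K.add algebra_simps)
  thus ?thesis by (intro eq_neg_self) (simp add: eq_neg_iff_add_eq_0)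
 qed
 have "K (x - (a + th0 * b) - K y) : I" by (rule K_I[OF y])
 hence "K x - (K a + ((l0 + ur) \<odot> b - th0 * K b)) : I"
  by (simp add: K.diff K.add K.mult KK scal_mult_left)
 from I_diff[OF I_diff[OF assms this] I_diff[OF B0_K[OF 1(1)] I_left[OF B0_K[OF 1(2)], of th0]]]
 have "(l0 + ur) \<odot> b : I" by (simp add: algebra_simps)
 hence b: "b : I" by (rule l0_u_regular_I)
 obtain c y' where c: "c : B1" "a - c - K y' : I" using B0_reduce[OF 1(1)] by blast
 have "x - c - K (y + y') = (x - (a + th0 * b) - K y) + (a - c - K y') + th0 * b" by (simp add: K.add algebra_simps)
 thus ?thesis using I_add[OF I_add[OF y c(2)] I_left[OF b, of th0]] c(1) by metis
qed

end

subsection \<open>Directional derivatives\<close>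

definition pdir :: "complex^'d::finite => ('d, 's::finite) tfield => ('d, 's) tfield" where
 "pdir v x = (SU \<mu>. cst (v $ \<mu>) \<odot> partial (axis \<mu> 1) x)"

lemma sderiv_pdir: "sderiv False (pdir v)"
 unfolding pdir_def by (intro sderiv_sum sderiv_scal sderiv_coefwise derivation_dpol)

interpretation pdir: sderiv False "pdir v" by (rule sderiv_pdir)

lemma partial_cst_scal: "partial v (cst c \<odot> x) = cst c \<odot> partial v x"
 by (simp add: coefwise_scal[OF derivation_dpol])

lemma partial_sum: "partial v (sum f A) = (\<Sum>i\<in>A. partial v (f i))"
 by (rule sderiv.sum[OF sderiv_coefwise[OF derivation_dpol]])

lemma pdir_commute:
 fixes x :: "('d::finite, 's::finite) tfield"
 shows "pdir v (pdir w x) = pdir w (pdir v x)"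
proof -
 have *: "pdir v (pdir w x) = (SU \<mu> \<nu>. (cst (v $ \<mu>) * cst (w $ \<nu>)) \<odot> partial (axis \<mu> 1) (partial (axis \<nu> 1) x))" for v w
  by (simp add: pdir_def partial_sum partial_cst_scal scal_sum scal_simps(7))
 show ?thesis unfolding *
  by (rule trans[OF sum.swap]) (intro sum.cong refl, subst partial_commute, simp add: mult.commute)
qed

definition flat :: "('d::finite, 's::finite) tfield => bool" where "flat x \<longleftrightarrow> (\<forall>v. partial v x = 0)"

lemma flat_pdir: "flat x ==> pdir v x = 0" by (simp add: flat_def pdir_def)

lemma flat_add: "flat x ==> flat y ==> flat (x + y)" by (simp add: flat_def partial_add)
lemma flat_zero: "flat 0" by (simp add: flat_def, rule allI, rule ext_eqI) (simp add: derivation_zero[OF derivation_dpol])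
lemma flat_sum: "(!!i. i : A ==> flat (f i)) ==> flat (sum f A)"
 by (induction A rule: infinite_finite_induct) (auto intro: flat_add flat_zero)
lemma flat_mult: "flat x ==> flat y ==> flat (x * y)" by (simp add: flat_def partial_mult)
lemma flat_scal: "(!!v. dpol v c = 0) ==> flat x ==> flat (c \<odot> x)"
 by (simp add: flat_def coefwise_scal[OF derivation_dpol])
lemma flat_uminus: "flat x ==> flat (- x)"
 using flat_scal[of "-1" x] by (simp add: derivation_minus[OF derivation_dpol] derivation_one[OF derivation_dpol] scal_simps(6))
lemma flat_diff: "flat x ==> flat y ==> flat (x - y)" using flat_add[OF _ flat_uminus, of x y] by simp
lemma flat_gen: "flat (gen a)" by (simp add: flat_def coefwise_emono[OF derivation_dpol])
lemma flat_one: "flat 1"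
 unfolding flat_def emono_empty[symmetric] by (simp add: coefwise_emono[OF derivation_dpol] del: emono_empty)

lemma dpol_linr [simp]: "dpol v (linr l) = 0"
 by (simp add: linr_def derivation_sum[OF derivation_dpol] dpol_mult)

lemma flat_Lin: "(!!a. flat (X a)) ==> flat (Lin l X)"
 unfolding Lin_def by (intro flat_sum flat_scal) simp_all
lemma flat_bil: "(!!a. flat (X a)) ==> flat (bil l lamr X)"
 unfolding bil_def by (intro flat_sum flat_scal flat_Lin) simp_all

lemma odd_deriv_partial:
 fixes x :: "('o::finite, 'e::comm_monoid_add \<Rightarrow>\<^sub>0 'x::euclidean_space sfun) ext"
 shows "odd_deriv a (partial v x) = partial v (odd_deriv a x)"
proof (rule ext_eqI)
 fix J
 have "dpol v (ssign {a} J * c) = ssign {a} J * dpol v c" for c :: "'e \<Rightarrow>\<^sub>0 'x sfun"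
  by (cases "even (card (inversions {a} J))") (simp_all add: ssign_def derivation_minus[OF derivation_dpol])
 thus "coef (odd_deriv a (partial v x)) J = coef (partial v (odd_deriv a x)) J"
  by (simp add: coef_odd_deriv derivation_zero[OF derivation_dpol])
qed

lemma odd_deriv_sum: "odd_deriv a (sum f A) = (\<Sum>i\<in>A. odd_deriv a (f i))"
 by (rule sderiv.sum[OF sderiv_odd_deriv])

lemma odd_deriv_pdir: "odd_deriv a (pdir v x) = pdir v (odd_deriv a x)"
 by (simp add: pdir_def odd_deriv_sum odd_deriv_partial)

lemma graded_pdir: "x : graded tdeg A ==> pdir v x : graded tdeg A"
 unfolding pdir_def
 by (intro graded_sum graded_scal[where k = 0 and A = A] graded_partial) (auto simp: tdeg_add cst_def split: if_splits)

definition susy_dif :: "('s::finite => 's => complex^'d::finite) => complex^'s => ('d, 's) tfield => ('d, 's) tfield" where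
 "susy_dif \<Gamma> Q x =
  (SU a. lamr a \<odot> (odd_deriv a x - cst (1/2) \<odot> (SU b \<mu>. cst (\<Gamma> a b $ \<mu>) \<odot> (gen b * partial (axis \<mu> 1) x)))) +
  (SU a. (cst (Q $ a) * ur) \<odot> (odd_deriv a x + cst (1/2) \<odot> (SU b \<mu>. cst (\<Gamma> a b $ \<mu>) \<odot> (gen b * partial (axis \<mu> 1) x))))"

context adapted
begin

definition "om_L i = cst (-1/2) \<odot> ((l0 - ur) \<odot> th2 i + l2 i \<odot> th0 - 2 \<odot> bLT i)"
definition "om_R i = cst (-1/2) \<odot> (SU j. mL i j \<odot> th2 j + l2 j \<odot> mT i j)"
definition "H_L i = cst (-1/2) \<odot> (th0 * th2 i)"
text \<open>A primitive of \<open>om_R\<close> under K, modulo I. The factor 2/3 comes from the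
  cubic identity: the sum of the mL * bLT is -1/2 times that of the bLL * mT, so K of the last term
  produces 2/3 * (-1/2 - 1) = -1 times the latter.\<close>

definition "H_R i = cst (-1/2) \<odot> (SU j. mT i j * th2 j)
 - ui \<odot> (SU j. l2 j \<odot> (th0 * mT i j) + cst (2/3) \<odot> (mT i j * bLT j))"

definition "evec = case_sum \<zeta> \<xi>"
definition "om = case_sum om_L om_R"
definition "H = case_sum H_L H_R"

abbreviation "D \<equiv> susy_dif \<Gamma> Q"

section \<open>The differential in adapted coordinates\<close>

lemma partial_complete: "partial (axis \<mu> 1) x = (SU i. cst (\<phi> i \<mu>) \<odot> pdir (\<zeta> i) x + cst (\<psi> i \<mu>) \<odot> pdir (\<xi> i) x)"
proof -
 have "(SU i. cst (\<phi> i \<mu>) \<odot> pdir (\<zeta> i) x + cst (\<psi> i \<mu>) \<odot> pdir (\<xi> i) x)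
  = (SU i \<nu>. cst (\<zeta> i $ \<nu> * \<phi> i \<mu> + \<xi> i $ \<nu> * \<psi> i \<mu>) \<odot> partial (axis \<nu> 1) x)"
  by (simp add: pdir_def scal_sum scal_simps(2,7) cst_add cst_mult sum.distrib mult.commute)
 also have "\<dots> = (SU \<nu>. cst (SU i. \<zeta> i $ \<nu> * \<phi> i \<mu> + \<xi> i $ \<nu> * \<psi> i \<mu>) \<odot> partial (axis \<nu> 1) x)"
  unfolding cst_sum sum_scal by (rule sum.swap)
 also have "\<dots> = (SU \<nu>. if \<nu> = \<mu> then partial (axis \<mu> 1) x else 0)"
  unfolding complete by (rule sum.cong) auto
 finally show ?thesis by simp
qed

lemma Lin_gen_add: "Lin (%b. f b + g b) X = Lin f X + Lin g X"
 by (simp add: Lin_def cst_add scal_simps(2) sum.distrib)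
lemma Lin_gen_diff: "Lin (%b. f b - g b) X = Lin f X - Lin g X"
 by (simp add: Lin_def cst_diff scal_simps(4) sum_subtractf)
lemma Lin_gen_scale: "Lin (%b. c * f b) X = cst c \<odot> Lin f X" "Lin (%b. f b * c) X = cst c \<odot> Lin f X"
 by (simp_all add: Lin_def cst_mult scal_sum scal_simps(7) mult.commute)
lemma Lin_gen_sum: "Lin (%b. \<Sum>j\<in>A. f j b) X = (\<Sum>j\<in>A. Lin (f j) X)"
 unfolding Lin_def cst_sum sum_scal by (rule sum.swap)

lemma bracket_sum:
 "(SU b \<mu>. cst (\<Gamma> a b $ \<mu>) \<odot> (gen b * partial (axis \<mu> 1) x))
 = (SU i. (cst (\<kappa> a) \<odot> th2 i + cst (\<tau> i a) \<odot> th0 - 2 \<odot> Lin (\<beta> i a) gen) * pdir (\<zeta> i) x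
   + (SU j. cst (M i j a) \<odot> th2 j + cst (\<tau> j a) \<odot> mT i j) * pdir (\<xi> i) x)"
proof -
 have "(SU b \<mu>. cst (\<Gamma> a b $ \<mu>) \<odot> (gen b * partial (axis \<mu> 1) x))
  = (SU b \<mu> i. cst (\<phi> i \<mu> * \<Gamma> a b $ \<mu>) \<odot> (gen b * pdir (\<zeta> i) x) + cst (\<psi> i \<mu> * \<Gamma> a b $ \<mu>) \<odot> (gen b * pdir (\<xi> i) x))"
  by (subst partial_complete) (simp add: sum_distrib_left distrib_left scal_sum scal_simps(1,7) scal_mult_right cst_mult mult.commute)
 also have "\<dots> = (SU b i. cst (SU \<mu>. \<phi> i \<mu> * \<Gamma> a b $ \<mu>) \<odot> (gen b * pdir (\<zeta> i) x) + cst (SU \<mu>. \<psi> i \<mu> * \<Gamma> a b $ \<mu>) \<odot> (gen b * pdir (\<xi> i) x))"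
  by (rule sum.cong[OF refl], subst sum.swap) (simp add: cst_sum sum_scal sum.distrib)
 also have "\<dots> = (SU i. Lin (%b. SU \<mu>. \<phi> i \<mu> * \<Gamma> a b $ \<mu>) gen * pdir (\<zeta> i) x + Lin (%b. SU \<mu>. \<psi> i \<mu> * \<Gamma> a b $ \<mu>) gen * pdir (\<xi> i) x)"
  by (subst sum.swap) (simp add: Lin_def sum_distrib_right scal_mult_left sum.distrib)
 finally show ?thesis unfolding \<phi>_bracket \<psi>_bracket
  by (simp add: Lin_gen_add Lin_gen_diff Lin_gen_scale Lin_gen_sum th0_def th2_def mT_def cst_numeral)
qed

lemma sum_Inl_Inr: "(SU k. f k) = (SU i. f (Inl i)) + (SU i. f (Inr i))"
 for f :: "'n + 'n => 'b::comm_monoid_add"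
 unfolding UNIV_Plus_UNIV[symmetric] by (subst sum.Plus) simp_all

text \<open>The fields R and L carry the bracket with opposite signs, so the derivatives on space
  are contracted with \<lambda> - u Q, whereas the derivatives in \<theta> are contracted with
  \<lambda> + u Q.\<close>

lemma D_eq: "D x = K x + (SU k. om k * pdir (evec k) x)"
proof -
 define C :: "'s => ('d, 's) tpol" where "C a = cst (-1/2) * (lamr a - cst (Q $ a) * ur)" for a
 let ?B = "%a. SU b \<mu>. cst (\<Gamma> a b $ \<mu>) \<odot> (gen b * partial (axis \<mu> 1) x)"
 have h: "cst (-1/2) = - (cst (1/2) :: ('d, 's) tpol)" unfolding cst_minus[symmetric] by simp
 have c: "(SU a. C a * cst (l a)) = cst (-1/2) * (linr l - cst (SU a. l a * Q $ a) * ur)" for l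
  by (simp add: C_def linr_def cst_sum cst_mult sum_distrib_left sum_distrib_right sum_subtractf right_diff_distrib left_diff_distrib mult_ac)
 have bl: "(SU a. C a \<odot> Lin (\<beta> i a) gen) = cst (-1/2) \<odot> bLT i" for i
 proof -
  have "(SU a. cst (Q $ a) \<odot> Lin (\<beta> i a) gen) = Lin (%b. SU a. Q $ a * \<beta> i a b) gen"
   by (simp add: Lin_gen_sum Lin_gen_scale)
  also have "(%b. SU a. Q $ a * \<beta> i a b) = (%b. 0)" using \<beta>Q[of i] \<beta>_sym[of i] by (simp add: mult.commute)
  finally have z: "(SU a. cst (Q $ a) \<odot> Lin (\<beta> i a) gen) = 0" by (simp add: Lin_def)
  have "(SU a. C a \<odot> Lin (\<beta> i a) gen) = cst (-1/2) \<odot> (SU a. lamr a \<odot> Lin (\<beta> i a) gen) - (cst (-1/2) * ur) \<odot> (SU a. cst (Q $ a) \<odot> Lin (\<beta> i a) gen)"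
   by (simp add: C_def scal_sum scal_simps(4,7) right_diff_distrib sum_subtractf mult_ac)
  thus ?thesis unfolding z by (simp add: bLT_def bil_def)
 qed
 have "D x = (SU a. V a * odd_deriv a x) + (SU a. C a \<odot> ?B a)"
 proof -
  have "lamr a \<odot> (y - cst (1/2) \<odot> z) + (cst (Q $ a) * ur) \<odot> (y + cst (1/2) \<odot> z) = V a * y + C a \<odot> z" for a y z
   unfolding C_def h by (rule ext_eqI) (simp add: V_def scal_mult_left algebra_simps)
  thus ?thesis unfolding susy_dif_def sum.distrib[symmetric] by (simp only:)
 qed
 also have "(SU a. C a \<odot> ?B a) = (SU i.
   ((SU a. C a * cst (\<kappa> a)) \<odot> th2 i + (SU a. C a * cst (\<tau> i a)) \<odot> th0 - 2 \<odot> (SU a. C a \<odot> Lin (\<beta> i a) gen)) * pdir (\<zeta> i) x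
   + (SU j. (SU a. C a * cst (M i j a)) \<odot> th2 j + (SU a. C a * cst (\<tau> j a)) \<odot> mT i j) * pdir (\<xi> i) x)"
 proof -
  have 1: "(SU a. C a \<odot> ((cst (\<kappa> a) \<odot> th2 i + cst (\<tau> i a) \<odot> th0 - 2 \<odot> Lin (\<beta> i a) gen) * y)) =
   ((SU a. C a * cst (\<kappa> a)) \<odot> th2 i + (SU a. C a * cst (\<tau> i a)) \<odot> th0 - 2 \<odot> (SU a. C a \<odot> Lin (\<beta> i a) gen)) * y" for i y
   by (simp add: sum_scal scal_sum sum_distrib_right scal_mult_left distrib_right left_diff_distrib scal_simps(1,3,7) sum.distrib sum_subtractf mult.commute)
  have 2: "(SU a. C a \<odot> ((SU j. cst (M i j a) \<odot> th2 j + cst (\<tau> j a) \<odot> mT i j) * y)) =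
   (SU j. (SU a. C a * cst (M i j a)) \<odot> th2 j + (SU a. C a * cst (\<tau> j a)) \<odot> mT i j) * y" for i y
   unfolding sum_distrib_right scal_sum by (subst sum.swap) (simp add: sum_scal sum_distrib_right scal_mult_left distrib_right scal_simps(1,7) sum.distrib)
  have 0: "(SU a. C a \<odot> (P a * y + R a * w)) = (SU a. C a \<odot> (P a * y)) + (SU a. C a \<odot> (R a * w))" for P R y w
   by (simp add: scal_simps(1) sum.distrib)
  show ?thesis unfolding bracket_sum scal_sum by (subst sum.swap) (simp only: 0 1[unfolded scal_sum] 2[unfolded scal_sum])
 qed
 also have "\<dots> = (SU k. om k * pdir (evec k) x)"
  unfolding sum_Inl_Inr c bl \<kappa>Q \<tau>Q MQ
  by (simp add: om_def evec_def om_L_def om_R_def l0_def[symmetric] l2_def[symmetric] mL_def[symmetric] sum.distrib scal_sum scal_simps(1,3,7) mult.commute)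
 finally show ?thesis by (simp add: K_def vfield_def)
qed

lemma cst_half: "cst (1/2) * 2 = (1 :: ('d, 's) tpol)" "cst (-1/2) * 2 = (-1 :: ('d, 's) tpol)"
 using cst_mult[of "1/2" 2] cst_mult[of "-1/2" 2] by (simp_all add: cst_numeral cst_minus)

lemma K_H_L: "K (H_L i) = om_L i - ur \<odot> \<eta> i"
proof -
 have "K (H_L i) = cst (-1/2) \<odot> ((l0 + ur) \<odot> th2 i - l2 i \<odot> th0)"
  by (simp add: H_L_def K_scal K.mult scal_mult_left scal_mult_right scal_simps(5))
 also have "\<dots> = om_L i - ur \<odot> \<eta> i"
 proof -
  have u: "ur = - (cst (-1/2) * 2 * ur :: ('d, 's) tpol)" unfolding cst_half by simp
  have e: "ur \<odot> \<eta> i = ur \<odot> th2 i + bLT i - l2 i \<odot> th0" by (simp add: \<eta>_def scal_simps)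
  have "cst (-1/2) \<odot> ((l0 + ur) \<odot> th2 i - l2 i \<odot> th0) - om_L i = (cst (-1/2) * 2) \<odot> (ur \<odot> th2 i + bLT i - l2 i \<odot> th0)"
   unfolding om_L_def by (rule ext_eqI) (simp add: algebra_simps)
  thus ?thesis unfolding e cst_half by (simp add: scal_simps algebra_simps)
 qed
 finally show ?thesis .
qed

lemma K_H_R: "K (H_R i) - om_R i : I"
proof -
 have c: "(SU j. mL i j \<odot> bLT j) = cst (-1/2) \<odot> (SU j. bLL j \<odot> mT i j)"
 proof -
  have "2 \<odot> (SU j. mL i j \<odot> bLT j) = - (SU j. bLL j \<odot> mT i j)"
   using cyclic_fields[of i] by (simp add: sum.distrib scal_sum eq_neg_iff_add_eq_0)
  hence "(cst (-1/2) * 2) \<odot> (SU j. mL i j \<odot> bLT j) = - (cst (-1/2) \<odot> (SU j. bLL j \<odot> mT i j))"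
   by (simp only: scal_simps(7)[symmetric] scal_simps(5))
  thus ?thesis unfolding cst_half by (simp add: scal_simps(6))
 qed
 have e: "K (H_R i) = cst (-1/2) \<odot> (SU j. mL i j \<odot> th2 j - l2 j \<odot> mT i j)
  - ui \<odot> ((SU j. l2 j \<odot> ((l0 + ur) \<odot> mT i j - mL i j \<odot> th0)) + cst (2/3) \<odot> ((SU j. mL i j \<odot> bLT j) - (SU j. bLL j \<odot> mT i j)))"
  by (simp add: H_R_def K.diff K.sum K.add K_scal K.mult scal_mult_left scal_mult_right scal_simps(5) scal_sum scal_simps(3) sum.distrib sum_subtractf)
 have "cst (2/3) \<odot> ((SU j. mL i j \<odot> bLT j) - (SU j. bLL j \<odot> mT i j)) = - (SU j. bLL j \<odot> mT i j)"
 proof -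
  have "cst (2/3) * (cst (-1/2) - 1) = (cst (2/3 * (-1/2 - 1)) :: ('d, 's) tpol)" unfolding cst_mult cst_diff by simp
  also have "\<dots> = -1" by (simp add: cst_minus)
  finally have n: "cst (2/3) * (cst (-1/2) - 1) = (-1 :: ('d, 's) tpol)" .
  have "cst (2/3) \<odot> ((SU j. mL i j \<odot> bLT j) - (SU j. bLL j \<odot> mT i j)) = (cst (2/3) * (cst (-1/2) - 1)) \<odot> (SU j. bLL j \<odot> mT i j)"
   unfolding c by (simp only: scal_simps(7)[symmetric]) (simp add: scal_simps(3,4))
  thus ?thesis unfolding n by (simp add: scal_simps(6))
 qed
 note e = e[unfolded this]
 have "K (H_R i) - om_R i = (SU j. cst (-1/2) \<odot> (mL i j \<odot> th2 j - l2 j \<odot> mT i j) - ui \<odot> (l2 j \<odot> ((l0 + ur) \<odot> mT i j - mL i j \<odot> th0) - bLL j \<odot> mT i j)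
   - cst (-1/2) \<odot> (mL i j \<odot> th2 j + l2 j \<odot> mT i j))"
  unfolding e om_R_def by (simp add: scal_sum scal_simps(1,3,5) sum.distrib sum_subtractf algebra_simps)
 also have "\<dots> = (SU j. - ui \<odot> (l0 * l2 j - bLL j) \<odot> mT i j + ui \<odot> (mL i j * l2 j) \<odot> th0)"
 proof (rule sum.cong[OF refl])
  fix j
  have 1: "cst (-1/2) \<odot> (mL i j \<odot> th2 j - l2 j \<odot> mT i j) - cst (-1/2) \<odot> (mL i j \<odot> th2 j + l2 j \<odot> mT i j) = - ((cst (-1/2) * 2) \<odot> (l2 j \<odot> mT i j))"
   by (rule ext_eqI) (simp add: algebra_simps)
  have 2: "ui \<odot> (l2 j \<odot> ((l0 + ur) \<odot> mT i j - mL i j \<odot> th0) - bLL j \<odot> mT i j) = ui \<odot> (l0 * l2 j - bLL j) \<odot> mT i j + l2 j \<odot> mT i j - ui \<odot> (mL i j * l2 j) \<odot> th0"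
   by (rule ext_eqI) (simp add: algebra_simps)
  show "cst (-1/2) \<odot> (mL i j \<odot> th2 j - l2 j \<odot> mT i j) - ui \<odot> (l2 j \<odot> ((l0 + ur) \<odot> mT i j - mL i j \<odot> th0) - bLL j \<odot> mT i j)
   - cst (-1/2) \<odot> (mL i j \<odot> th2 j + l2 j \<odot> mT i j) = - ui \<odot> (l0 * l2 j - bLL j) \<odot> mT i j + ui \<odot> (mL i j * l2 j) \<odot> th0"
   using 1 unfolding 2 cst_half by (simp add: scal_simps(6) algebra_simps)
 qed
 also have "\<dots> = (SU j. - ui \<odot> (l0 * l2 j - bLL j) \<odot> mT i j) + ui \<odot> (SU j. mL i j * l2 j) \<odot> th0"
  by (simp add: sum.distrib scal_sum sum_scal)
 also have "\<dots> : I" by (intro I_add I_sum I_scal I_Ir rel1 rel2)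
 finally show ?thesis .
qed

text \<open>What is left of the coefficients \<open>om\<close> up to K-exact terms: u \<eta> along L
  and nothing along the complement. This makes \<open>D'\<close> u times the Dolbeault operator on
  the classes \<eta>.\<close>

definition "et = case_sum (%i. ur \<odot> \<eta> i) (%_. 0)"

lemma K_H: "K (H k) - (om k - et k) : I"
 using K_H_R by (cases k) (simp_all add: H_def om_def et_def K_H_L)

lemma parity_scal_uminus: "parity (c \<odot> x) = c \<odot> parity x" by simp

lemma parity_H [simp]: "parity (H k) = H k"
 by (cases k) (simp_all add: H_def H_L_def H_R_def parity_sum)

lemma parity_om [simp]: "parity (om k) = - om k"
proof (cases k)
 case (Inl i)
 have "parity (om_L i) = - om_L i" unfolding om_L_def by (rule ext_eqI) (simp add: scal_simps(5), simp add: algebra_simps)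
 thus ?thesis using Inl by (simp add: om_def)
next
 case (Inr i)
 have "parity (om_R i) = - om_R i" 
 proof -
  have "parity (mL i j \<odot> th2 j + l2 j \<odot> mT i j) = - (mL i j \<odot> th2 j + l2 j \<odot> mT i j)" for j by (simp add: scal_simps(5))
  thus ?thesis unfolding om_R_def parity_scal_uminus parity_sum by (simp only: sum_negf scal_simps(5))
 qed
 thus ?thesis using Inr by (simp add: om_def)
qed

lemma flats: "flat th0" "flat (th2 j)" "flat (mT i j)" "flat (bLT j)" "flat (\<eta> j)" "flat (H k)" "flat (om k)" "flat (V a)"
proof -
 show 1: "flat th0" "flat (th2 j)" "flat (mT i j)" "flat (bLT j)" for i j
  unfolding th0_def th2_def mT_def bLT_def by (intro flat_Lin flat_bil flat_gen)+
 have l: "dpol v l0 = 0" "dpol v (l2 j) = 0" "dpol v (mL i j) = 0" for v i j by (simp_all add: l0_def l2_def mL_def)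
 have "dpol v (2 :: ('d, 's) tpol) = 0" for v :: "real^'d"
  unfolding cst_numeral[symmetric] by (rule dpol_cst)
 moreover have "dpol v (l0 - ur) = 0" for v
  using l(1)[of v] by (simp add: diff_conv_add_uminus dpol_add derivation_minus[OF derivation_dpol] del: add_uminus_conv_diff)
 ultimately have d: "dpol v (l0 - ur) = 0" "dpol v (2 :: ('d, 's) tpol) = 0" for v by simp_all
 show "flat (\<eta> j)" unfolding \<eta>_def by (intro flat_add flat_diff flat_scal 1 l dpol_vars)
 have "flat (H_L i)" "flat (H_R i)" for i unfolding H_L_def H_R_def
  by (intro flat_diff flat_sum flat_add flat_mult flat_scal 1 l dpol_vars dpol_cst)+
 thus "flat (H k)" by (cases k) (simp_all add: H_def)
 have "flat (om_L i)" "flat (om_R i)" for i unfolding om_L_def om_R_def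
  by (intro flat_diff flat_sum flat_add flat_mult flat_scal 1 l d dpol_vars dpol_cst)+
 thus "flat (om k)" by (cases k) (simp_all add: om_def)
 show "flat (V a)" unfolding V_def by (intro flat_scal flat_one) (simp add: dpol_add dpol_mult)
qed

lemma pdir_flat_mult: "flat y ==> pdir v (y * x) = y * pdir v x"
 by (simp add: pdir.mult flat_pdir)

lemma pdir_K: "pdir v (K x) = K (pdir v x)"
 by (simp add: K_def vfield_def pdir.sum pdir_flat_mult flats odd_deriv_pdir)

section \<open>The nilpotent operator and its commutator with the differential\<close>

definition "N x = (SU k. H k * pdir (evec k) x)"
definition "C x = (SU k. K (H k) * pdir (evec k) x)"
definition "D' x = K x + (SU k. et k * pdir (evec k) x)"

sublocale N: sderiv False N
proof -
 have "sderiv False (%x. H k * pdir (evec k) x)" for k using sderiv_left_mult[OF sderiv_pdir, of "H k" False] by simp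
 thus "sderiv False N" unfolding N_def by (intro sderiv_sum)
qed

lemma flat_KH: "flat (K (H k))"
proof -
 have "partial v (K x) = K (partial v x)" for v x
  unfolding K_def vfield_def using flats(8)
  by (simp add: partial_sum partial_mult odd_deriv_partial flat_def)
 thus ?thesis using flats(6) K.zero by (simp add: flat_def)
qed

text \<open>The derivative terms of D commute with N, since the H k are even with constant
  coefficients and directional derivatives commute; only the Koszul part contributes, through K (H
  k).\<close>

lemma D_N: "D (N x) = N (D x) + C x"
proof -
 have 1: "K (N x) = N (K x) + C x"
  by (simp add: N_def C_def K.sum K.mult pdir_K sum.distrib add.commute)
 have "om j * pdir (evec j) (H k * pdir (evec k) x) = H k * pdir (evec k) (om j * pdir (evec j) x)" for j k
  using even_commute[of "H k" "om j"] by (simp add: pdir_flat_mult flats pdir_commute[of "evec j"] mult.assoc[symmetric])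
 hence 2: "(SU j. om j * pdir (evec j) (N x)) = N (SU j. om j * pdir (evec j) x)"
  by (simp add: N_def pdir.sum sum_distrib_left) (rule sum.swap)
 show ?thesis unfolding D_eq N.add 1 2 by (simp add: add_ac)
qed

text \<open>The commutator of D and N commutes with N again, so conjugating D by the exponential
  produces the linear correction C and no higher ones.\<close>

lemma C_N: "C (N x) = N (C x)"
proof -
 have "K (H j) * pdir (evec j) (H k * pdir (evec k) x) = H k * pdir (evec k) (K (H j) * pdir (evec j) x)" for j k
  using even_commute[of "H k" "K (H j)"] by (simp add: pdir_flat_mult flats flat_KH pdir_commute[of "evec j"] mult.assoc[symmetric])
 thus ?thesis by (simp add: C_def N_def pdir.sum sum_distrib_left) (rule sum.swap)
qed

lemma D_C: "(D x - C x) - D' x : I"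
proof -
 have "(D x - C x) - D' x = (SU k. - (K (H k) - (om k - et k)) * pdir (evec k) x)"
  by (simp add: D_eq C_def D'_def sum_subtractf left_diff_distrib sum.distrib algebra_simps)
 also have "\<dots> : I" by (intro I_sum I_right I_uminus K_H)
 finally show ?thesis .
qed

lemma flat_rel: "flat (rel \<mu> \<odot> 1)"
 unfolding rel_def bilr_def by (intro flat_scal flat_one) (simp add: derivation_sum[OF derivation_dpol] dpol_mult)

lemma pdir_I: "x : I ==> pdir v x : I"
 by (rule sderiv_I[OF sderiv_pdir]) (simp_all add: flat_pdir flat_rel)

lemma N_I: "x : I ==> N x : I"
 unfolding N_def by (intro I_sum I_left pdir_I)

lemma D_I: "x : I ==> D x : I"
 unfolding D_eq by (intro I_add I_sum I_left pdir_I K_I)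

lemma cst_scal_D: "D (cst c \<odot> x) = cst c \<odot> D x"
proof -
 have "pdir v (cst c \<odot> x) = cst c \<odot> pdir v x" for v
  by (simp add: pdir_def partial_cst_scal scal_sum scal_left_commute[of "cst c"])
 thus ?thesis by (simp add: D_eq K_scal scal_mult_right scal_sum scal_simps(1))
qed

text \<open>Divided powers of the nilpotent derivation \<open>- N\<close>, whose exponential intertwines \<open>D'\<close> and \<open>D\<close>.\<close>

primrec Np :: "nat => ('d, 's) tfield => ('d, 's) tfield" where
 "Np 0 x = x"
| "Np (Suc k) x = cst (-1 / of_nat (Suc k)) \<odot> N (Np k x)"

lemma Np_add: "Np k (x + y) = Np k x + Np k y"
 by (induction k) (simp_all add: N.add scal_simps(1))
lemma Np_diff: "Np k (x - y) = Np k x - Np k y"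
 by (induction k) (simp_all add: N.diff scal_simps(3))
lemma Np_I: "x : I ==> Np k x : I"
 by (induction k) (simp_all add: N_I I_scal)

lemma Np_Suc: "of_nat (Suc k) \<odot> Np (Suc k) x = - N (Np k x)"
proof -
 have "of_nat (Suc k) * cst (-1 / of_nat (Suc k)) = (cst (-1) :: ('d, 's) tpol)"
  unfolding cst_of_nat[symmetric] cst_mult[symmetric] by (simp del: of_nat_Suc)
 hence "of_nat (Suc k) \<odot> Np (Suc k) x = cst (-1) \<odot> N (Np k x)" by (simp only: Np.simps scal_simps(7))
 thus ?thesis by (simp add: scal_simps(6) cst_minus del: of_nat_Suc Np.simps)
qed

text \<open>The Leibniz rule for divided powers. After multiplication by k + 1 the induction step is
  the splitting k + 1 = i + (k + 1 - i) of the coefficient.\<close>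

lemma Np_mult: "Np k (x * y) = (\<Sum>i\<le>k. Np i x * Np (k - i) y)"
proof (induction k)
 case (Suc k)
 have "- N (Np k (x * y)) = (\<Sum>i\<le>k. - N (Np i x) * Np (k - i) y + Np i x * (- N (Np (k - i) y)))"
  unfolding Suc N.sum by (simp add: N.mult sum_negf[symmetric])
 also have "\<dots> = (\<Sum>i\<le>k. of_nat (Suc i) \<odot> (Np (Suc i) x * Np (k - i) y)) + (\<Sum>i\<le>k. of_nat (Suc (k - i)) \<odot> (Np i x * Np (Suc (k - i)) y))"
  by (simp only: Np_Suc[symmetric] scal_mult_left scal_mult_right sum.distrib)
 also have "(\<Sum>i\<le>k. of_nat (Suc i) \<odot> (Np (Suc i) x * Np (k - i) y)) = (\<Sum>i\<le>Suc k. of_nat i \<odot> (Np i x * Np (Suc k - i) y))"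
  by (subst sum.atMost_Suc_shift) (simp del: Np.simps of_nat_Suc)
 also have "(\<Sum>i\<le>k. of_nat (Suc (k - i)) \<odot> (Np i x * Np (Suc (k - i)) y)) = (\<Sum>i\<le>Suc k. of_nat (Suc k - i) \<odot> (Np i x * Np (Suc k - i) y))"
 proof -
  have "(\<Sum>i\<le>k. of_nat (Suc (k - i)) \<odot> (Np i x * Np (Suc (k - i)) y)) = (\<Sum>i\<le>k. of_nat (Suc k - i) \<odot> (Np i x * Np (Suc k - i) y))"
   by (intro sum.cong refl) (simp only: Suc_diff_le atMost_iff)
  thus ?thesis unfolding sum.atMost_Suc by (simp del: Np.simps of_nat_Suc)
 qed
 also have "(\<Sum>i\<le>Suc k. of_nat i \<odot> (Np i x * Np (Suc k - i) y)) + (\<Sum>i\<le>Suc k. of_nat (Suc k - i) \<odot> (Np i x * Np (Suc k - i) y))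
  = (\<Sum>i\<le>Suc k. of_nat (Suc k) \<odot> (Np i x * Np (Suc k - i) y))"
  unfolding sum.distrib[symmetric] scal_simps(2)[symmetric] of_nat_add[symmetric] by (intro sum.cong refl) simp
 finally have "of_nat (Suc k) \<odot> Np (Suc k) (x * y) = of_nat (Suc k) \<odot> (\<Sum>i\<le>Suc k. Np i x * Np (Suc k - i) y)"
  unfolding Np_Suc scal_sum .
 hence "cst (1 / of_nat (Suc k)) \<odot> of_nat (Suc k) \<odot> Np (Suc k) (x * y) = cst (1 / of_nat (Suc k)) \<odot> of_nat (Suc k) \<odot> (\<Sum>i\<le>Suc k. Np i x * Np (Suc k - i) y)"
  by (simp only:)
 moreover have "cst (1 / of_nat (Suc k)) * of_nat (Suc k) = (1 :: ('d, 's) tpol)"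
  unfolding cst_of_nat[symmetric] cst_mult[symmetric] by (simp del: of_nat_Suc)
 ultimately show ?case by (simp only: scal_simps(7) scal_trivial)
qed simp

lemma C_Np: "C (Np k x) = Np k (C x)"
proof (induction k)
 case (Suc k)
 have "C (cst c \<odot> y) = cst c \<odot> C y" for c y
  unfolding C_def by (simp add: pdir_def partial_cst_scal scal_sum scal_mult_right sum_distrib_left scal_left_commute[of "cst c"])
 thus ?case using Suc by (simp add: C_N)
qed simp

lemma D_Np: "D (Np k x) = Np k (D x) - (if k = 0 then 0 else Np (k - 1) (C x))"
proof (induction k)
 case (Suc k)
 have N: "N (if k = 0 then 0 else Np (k - 1) (C x)) = - (of_nat k \<odot> Np k (C x))"
 proof (cases k)
  case (Suc l)
  thus ?thesis using Np_Suc[of l "C x"] by (simp del: Np.simps of_nat_Suc)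
 qed simp
 have "D (Np (Suc k) x) = cst (-1 / of_nat (Suc k)) \<odot> (N (Np k (D x)) + (of_nat k \<odot> Np k (C x)) + Np k (C x))"
  by (simp add: cst_scal_D D_N Suc N.diff N C_Np del: of_nat_Suc)
 also have "\<dots> = Np (Suc k) (D x) + (cst (-1 / of_nat (Suc k)) * of_nat (Suc k)) \<odot> Np k (C x)"
  by (simp add: scal_simps(1,2,7) algebra_simps)
 also have "cst (-1 / of_nat (Suc k)) * of_nat (Suc k) = (-1 :: ('d, 's) tpol)"
  unfolding cst_of_nat[symmetric] cst_mult[symmetric] by (simp add: cst_minus del: of_nat_Suc)
 finally show ?case by (simp add: scal_simps(6))
qed simp

section \<open>Bidegrees of the basic elements\<close>

lemma keys_linr: "e : keys (linr l :: ('d, 's) tpol) ==> tdeg e = 1"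
 using homog_linr[of tdeg 1 l] by (simp add: homog_def tdeg_lam[simplified] tdeg_add)

lemma graded_gen: "gen a : graded tdeg {(1, 0)}" by (rule graded_emono) simp_all

lemma graded_cst: "x : graded tdeg A ==> cst c \<odot> x : graded tdeg A"
 by (rule graded_scal[where k = 0]) (auto simp: tdeg_add cst_def split: if_splits)

lemma graded_linr: "(x :: ('d, 's) tfield) : graded tdeg {(i, j)} ==> linr l \<odot> x : graded tdeg {(i, j + 1)}"
 by (rule graded_scal[where k = 1, OF _ keys_linr tdeg_add]) auto

lemma graded_lamr: "x : graded tdeg {(i, j)} ==> lamr a \<odot> x : graded tdeg {(i, j + 1)}"
 by (rule graded_scal[where k = 1]) (auto simp: tdeg_add lamr_def tdeg_lam[simplified] split: if_splits)

lemma tdeg_u: "tdeg (0, k) = k" by (simp add: tdeg_def)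

lemma graded_u:
 assumes "x : graded tdeg {(i, j)}"
 shows "ur \<odot> x : graded tdeg {(i, j + 1)}" "ui \<odot> x : graded tdeg {(i, j - 1)}"
proof -
 show "ur \<odot> x : graded tdeg {(i, j + 1)}"
  by (rule graded_scal[where k = 1, OF assms _ tdeg_add]) (auto simp: ur_def tdeg_u)
 show "ui \<odot> x : graded tdeg {(i, j - 1)}"
  by (rule graded_scal[where k = "-1", OF assms _ tdeg_add]) (auto simp: ui_def tdeg_u)
qed

lemma graded_prod: "x : graded tdeg {(i, j)} ==> y : graded tdeg {(i', j')} ==> x * y : graded tdeg {(i + i', j + j')}"
 by (rule graded_mult) (auto simp: tdeg_add)

lemma graded_Lin: "(!!a. X a : graded tdeg A) ==> Lin l X : graded tdeg A"
 unfolding Lin_def by (intro graded_sum graded_cst)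

lemma graded_basic: "th0 : graded tdeg {(1, 0)}" "th2 j : graded tdeg {(1, 0)}" "mT i j : graded tdeg {(1, 0)}" "bLT j : graded tdeg {(1, 1)}"
 "\<eta> j : graded tdeg {(1, 0)}"
proof -
 show 1: "th0 : graded tdeg {(1, 0)}" "th2 j : graded tdeg {(1, 0)}" "mT i j : graded tdeg {(1, 0)}" for i j
  unfolding th0_def th2_def mT_def by (intro graded_Lin graded_gen)+
 show 2: "bLT j : graded tdeg {(1, 1)}"
  unfolding bLT_def bil_def using graded_lamr[OF graded_Lin[OF graded_gen]] by (intro graded_sum) simp
 have "l2 j \<odot> th0 : graded tdeg {(1, 1)}" unfolding l2_def using graded_linr[OF 1(1)] by simp
 from graded_u(2)[OF graded_diff[OF 2 this]] 1(2)
 show "\<eta> j : graded tdeg {(1, 0)}" unfolding \<eta>_def by (intro graded_add) simp_all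
qed

lemma graded_H: "H k : graded tdeg {(2, 0)}"
proof -
 note 1 = graded_basic
 have "H_L i : graded tdeg {(2, 0)}" for i unfolding H_L_def using graded_prod[OF 1(1,2)] by (intro graded_cst) simp
 moreover have "H_R i : graded tdeg {(2, 0)}" for i
 proof -
  have a: "mT i j * th2 j : graded tdeg {(2, 0)}" for j using graded_prod[OF 1(3,2)] by simp
  have b: "l2 j \<odot> (th0 * mT i j) : graded tdeg {(2, 1)}" for j unfolding l2_def using graded_linr[OF graded_prod[OF 1(1,3)]] by simp
  have c: "mT i j * bLT j : graded tdeg {(2, 1)}" for j using graded_prod[OF 1(3,4)] by simp
  have "(SU j. l2 j \<odot> (th0 * mT i j) + cst (2/3) \<odot> (mT i j * bLT j)) : graded tdeg {(2, 1)}"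
   by (intro graded_sum graded_add graded_cst b c)
  from graded_u(2)[OF this] show ?thesis unfolding H_R_def by (intro graded_diff graded_cst graded_sum a) simp
 qed
 ultimately show ?thesis by (cases k) (simp_all add: H_def)
qed

lemma graded_om: "om k : graded tdeg {(1, 1)}"
proof -
 note 1 = graded_basic
 have "om_L i : graded tdeg {(1, 1)}" for i unfolding om_L_def scal_simps(4) l0_def l2_def scal_two
  using graded_linr[OF 1(1)] graded_linr[OF 1(2)] graded_u(1)[OF 1(2)]
  by (intro graded_cst graded_add graded_diff 1) simp_all
 moreover have "om_R i : graded tdeg {(1, 1)}" for i unfolding om_R_def mL_def l2_def
  using graded_linr[OF 1(2)] graded_linr[OF 1(3)] by (intro graded_cst graded_sum graded_add) simp_all
 ultimately show ?thesis by (cases k) (simp_all add: om_def)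
qed

lemma graded_N:
 assumes "x : graded tdeg A" "!!i j. (i, j) : A ==> (i + 2, j) : B" shows "N x : graded tdeg B"
 unfolding N_def
proof (intro graded_sum)
 fix k
 show "H k * pdir (evec k) x : graded tdeg B"
  by (rule graded_mult[OF graded_H graded_pdir[OF assms(1)] tdeg_add]) (use assms(2) in \<open>force simp: add.commute\<close>)
qed

text \<open>N raises the exterior degree by 2, and this degree cannot exceed CARD('s).\<close>

lemma Np_top: assumes "CARD('s) \<le> k" shows "Np k (x :: ('d, 's) tfield) = 0"
proof -
 have "Np k x : graded tdeg {(i, j). 2 * int k \<le> i}"
 proof (induction k)
  case 0 show ?case by (auto simp: graded_def)
 next
  case (Suc k)
  show ?case unfolding Np.simps by (intro graded_cst graded_N[OF Suc]) auto
 qed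
 hence "Np k x : graded tdeg {}"
 proof -
  assume a: "Np k x : graded tdeg {(i, j). 2 * int k \<le> i}"
  have "\<not> 2 * int k \<le> int (card (J :: 's set))" for J
  proof -
   have "card J \<le> CARD('s)" by (rule card_mono) auto
   moreover have "CARD('s) > 0" by simp
   ultimately show ?thesis using assms by linarith
  qed
  thus ?thesis using a by (auto simp: graded_def)
 qed
 thus ?thesis using gproj_id[of "Np k x" tdeg "{}"] gproj_disjoint[of "Np k x" tdeg "{}" "{}"] by simp
qed

definition "E x = (\<Sum>k<CARD('s). Np k (x :: ('d, 's) tfield))"

lemma E_eq: "CARD('s) \<le> n ==> E x = (\<Sum>k<n. Np k x)"
 unfolding E_def by (rule sum.mono_neutral_left) (auto simp: Np_top)

lemma E_add: "E (x + y) = E x + E y" by (simp add: E_def Np_add sum.distrib)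
lemma E_diff: "E (x - y) = E x - E y" by (simp add: E_def Np_diff sum_subtractf)
lemma E_I: "x : I ==> E x : I" unfolding E_def by (intro I_sum Np_I)

lemma E_mult: "E (x * y) = E x * E y"
proof -
 let ?n = "CARD('s)"
 have "E (x * y) = (\<Sum>k<2 * ?n. \<Sum>i\<le>k. Np i x * Np (k - i) y)"
  by (subst E_eq[of "2 * ?n"]) (simp_all add: Np_mult)
 also have "\<dots> = (\<Sum>(i, j)\<in>{(i, j). i + j < 2 * ?n}. Np i x * Np j y)"
  by (rule sum.triangle_reindex[symmetric])
 \<comment> \<open>The square lies in the triangle of twice its size, and outside the square one of
   the two factors vanishes by \<open>Np_top\<close>.\<close>
 also have "\<dots> = (\<Sum>(i, j)\<in>{..<?n} \<times> {..<?n}. Np i x * Np j y)"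
 proof (rule sum.mono_neutral_right)
  have "{(i, j). i + j < 2 * ?n} \<subseteq> {..<2 * ?n} \<times> {..<2 * ?n}" by auto
  thus "finite {(i, j). i + j < 2 * ?n}" by (rule finite_subset) simp
  show "\<forall>p\<in>{(i, j). i + j < 2 * ?n} - {..<?n} \<times> {..<?n}. (case p of (i, j) => Np i x * Np j y) = 0"
  proof
   fix p assume "p : {(i, j). i + j < 2 * ?n} - {..<?n} \<times> {..<?n}"
   then obtain i j where "p = (i, j)" "?n \<le> i \<or> ?n \<le> j" by (cases p) (auto simp: not_less)
   thus "(case p of (i, j) => Np i x * Np j y) = 0" using Np_top[of i x] Np_top[of j y] by auto
  qed
 qed auto
 also have "\<dots> = E x * E y" by (simp add: E_def sum_product sum.cartesian_product)
 finally show ?thesis .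
qed

lemma D_E: "D (E x) - E (D' x) : I"
proof -
 let ?n = "CARD('s)"
 have Dsum: "D (sum f A) = (\<Sum>i\<in>A. D (f i))" for f :: "nat => _" and A
  by (simp add: D_eq K.sum pdir.sum sum_distrib_left sum.distrib) (rule sum.swap)
 \<comment> \<open>One more divided power, which is 0, is added so that the shifted sum of the
   \<open>Np (k - 1) (C x)\<close> is all of \<open>E (C x)\<close>.\<close>
 have "E x = (\<Sum>k<Suc ?n. Np k x)" by (rule E_eq) simp
 hence "D (E x) = (\<Sum>k<Suc ?n. Np k (D x) - (if k = 0 then 0 else Np (k - 1) (C x)))"
  by (simp only: Dsum D_Np)
 also have "\<dots> = (\<Sum>k<Suc ?n. Np k (D x)) - (\<Sum>k<Suc ?n. if k = 0 then 0 else Np (k - 1) (C x))"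
  by (rule sum_subtractf)
 also have "(\<Sum>k<Suc ?n. if k = 0 then 0 else Np (k - 1) (C x)) = E (C x)"
  by (subst sum.lessThan_Suc_shift) (simp add: E_def)
 also have "(\<Sum>k<Suc ?n. Np k (D x)) = E (D x)" by (rule E_eq[symmetric]) simp
 finally have "D (E x) - E (D' x) = E ((D x - C x) - D' x)" by (simp add: E_diff)
 thus ?thesis using E_I[OF D_C] by simp
qed

end

subsection \<open>The Dolbeault complex\<close>

definition pull :: "('x::euclidean_space => 'y::euclidean_space) => 'y sfun => 'x sfun" where
 "pull Z f = Sfun (fun_of f \<circ> Z)"

lemma fun_of_pull: "linear Z ==> fun_of (pull Z f) = fun_of f \<circ> Z"
 unfolding pull_def by (intro Sfun_inverse) (simp add: smooth_compose_linear)

lemma fun_of_eqI: "(!!x. fun_of f x = fun_of g x) ==> f = g"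
 by (simp add: fun_of_inject[symmetric] fun_eq_iff)

lemma pull_simps:
 assumes "linear Z"
 shows "pull Z 1 = 1" "pull Z (f + g) = pull Z f + pull Z g" "pull Z (f * g) = pull Z f * pull Z g"
  "pull Z (cfun c) = cfun c" "pds v (pull Z f) = pull Z (pds (Z v) f)"
 by (rule fun_of_eqI; simp add: fun_of_pull[OF assms] one_sfun.rep_eq plus_sfun.rep_eq times_sfun.rep_eq
   pds.rep_eq pd_compose_linear[OF assms])+

lemma pull_pull: "linear Z ==> linear W ==> (!!x. Z (W x) = x) ==> pull W (pull Z f) = f"
 by (rule fun_of_eqI) (simp add: fun_of_pull)

lemma pds_sum: "pds (\<Sum>i\<in>A. v i) f = (\<Sum>i\<in>A. pds (v i) f)"
proof (induction A rule: infinite_finite_induct)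
 have "pds 0 f = 0" using pds_plus[of 0 0 f] by simp
 thus "pds (\<Sum>i\<in>{}. v i) f = (\<Sum>i\<in>{}. pds (v i) f)" by simp
 thus "!!A. infinite A ==> pds (\<Sum>i\<in>A. v i) f = (\<Sum>i\<in>A. pds (v i) f)" by simp
qed (simp add: pds_plus)

lemma pds_expand: "pds v f = (SU \<mu>. cfun (of_real (v $ \<mu>)) * pds (axis \<mu> 1) f)" for v :: "real^'d::finite"
proof -
 have "pds v f = pds (SU \<mu>. v $ \<mu> *\<^sub>R axis \<mu> 1) f" by (simp only: basis_expansion scalar_mult_eq_scaleR[symmetric])
 thus ?thesis unfolding pds_sum pds_scale .
qed

definition szb :: "'n::finite => (complex^'n) sfun => (complex^'n) sfun" where
 "szb i f = cfun (1/2) * (pds (axis i 1) f + cfun \<i> * pds (axis i \<i>) f)"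

definition sz :: "'n::finite => (complex^'n) sfun => (complex^'n) sfun" where
 "sz i f = cfun (1/2) * (pds (axis i 1) f - cfun \<i> * pds (axis i \<i>) f)"

lemma fun_of_szb: "fun_of (szb i f) = d_zbar i (fun_of f)" "fun_of (sz i f) = d_z i (fun_of f)"
 by (rule ext; simp add: szb_def sz_def d_zbar_def d_z_def times_sfun.rep_eq plus_sfun.rep_eq minus_sfun.rep_eq pds.rep_eq)+

lemma vec_zbar_derivative:
 fixes Z :: "real^'d::finite => complex^'n::finite"
 assumes "linear Z" "bij Z"
 shows "(SU \<mu>. cfun (vec_zbar Z i $ \<mu>) * pds (axis \<mu> 1) (pull Z f)) = pull Z (szb i f)"
  "(SU \<mu>. cfun (vec_z Z i $ \<mu>) * pds (axis \<mu> 1) (pull Z f)) = pull Z (sz i f)"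
proof -
 have Z: "Z (inv_into UNIV Z z) = z" for z using assms(2) by (simp add: bij_is_surj surj_f_inv_f)
 let ?A = "inv_into UNIV Z (axis i 1)" and ?B = "inv_into UNIV Z (axis i \<i>)"
 have c: "cfun ((x + \<i> * y) / 2) = cfun (1/2) * (cfun x + cfun \<i> * cfun y)"
  "cfun ((x - \<i> * y) / 2) = cfun (1/2) * (cfun x - cfun \<i> * cfun y)" for x y
  unfolding cfun_mult[symmetric] cfun_add[symmetric] cfun_diff[symmetric] by simp_all
 have "(SU \<mu>. cfun (vec_zbar Z i $ \<mu>) * pds (axis \<mu> 1) (pull Z f)) =
  cfun (1/2) * (pds ?A (pull Z f) + cfun \<i> * pds ?B (pull Z f))"
  unfolding pds_expand[of ?A] pds_expand[of ?B]
  by (simp add: vec_zbar_def c sum_distrib_left distrib_left distrib_right sum.distrib mult.assoc)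
 thus "(SU \<mu>. cfun (vec_zbar Z i $ \<mu>) * pds (axis \<mu> 1) (pull Z f)) = pull Z (szb i f)"
  by (simp add: pull_simps[OF assms(1)] Z szb_def)
 have "(SU \<mu>. cfun (vec_z Z i $ \<mu>) * pds (axis \<mu> 1) (pull Z f)) =
  cfun (1/2) * (pds ?A (pull Z f) - cfun \<i> * pds ?B (pull Z f))"
  unfolding pds_expand[of ?A] pds_expand[of ?B]
  by (simp add: vec_z_def c sum_distrib_left distrib_left distrib_right sum_subtractf mult.assoc right_diff_distrib left_diff_distrib)
 moreover have "pull Z (f - g) = pull Z f - pull Z g" for f g
  by (rule fun_of_eqI) (simp add: fun_of_pull[OF assms(1)] minus_sfun.rep_eq)
 ultimately show "(SU \<mu>. cfun (vec_z Z i $ \<mu>) * pds (axis \<mu> 1) (pull Z f)) = pull Z (sz i f)"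
  by (simp add: pull_simps[OF assms(1)] Z sz_def)
qed

definition pzb :: "'n::finite => 'n dpoly => 'n dpoly" where
 "pzb i c = cst (1/2) * (dpol (axis i 1) c + cst \<i> * dpol (axis i \<i>) c)"

definition dzb :: "'n::finite => 'n dfield => 'n dfield" where
 "dzb i = coefwise (pzb i)"

definition ud :: "'n::finite dpoly" where "ud = single 1 1"

definition dbar :: "'n::finite dfield => 'n dfield" where
 "dbar x = (SU i. ud \<odot> (gen i * dzb i x))"

lemma pzb_add: "pzb i (c + d) = pzb i c + pzb i d"
 by (simp add: pzb_def dpol_add algebra_simps)

lemma pzb_single: "pzb i (single k f) = single k (szb i f)"
 by (simp add: pzb_def szb_def cst_def mult_single single_add[symmetric])

lemma derivation_pzb: "derivation (pzb i)"
 by (simp add: derivation_def pzb_def dpol_add dpol_mult algebra_simps)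

lemma sderiv_dzb: "sderiv False (dzb i)"
 unfolding dzb_def by (rule sderiv_coefwise[OF derivation_pzb])

lemma pdir_scal_flat: "flat x ==> pdir v (c \<odot> x) = (SU \<mu>. cst (v $ \<mu>) * dpol (axis \<mu> 1) c) \<odot> x"
 by (simp add: pdir_def coefwise_scal[OF derivation_dpol] flat_def sum_scal scal_simps(7))

lemma graded_epow:
 fixes y :: "'n::finite => ('o::finite, 'e::comm_monoid_add \<Rightarrow>\<^sub>0 'x::euclidean_space sfun) ext"
 assumes "!!i. y i : graded deg {(1, 0)}" "deg 0 = 0" "!!e e'. deg (e + e') = deg e + deg e'"
 shows "epow y J : graded deg {(int (card J), 0)}"
proof -
 have "prod_list (map y xs) : graded deg {(int (length xs), 0)}" for xs
 proof (induction xs)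
  case Nil
  show ?case using graded_emono[of deg "{}" "{(0, 0)}"] assms(2) by simp
 next
  case (Cons i xs)
  show ?case by simp (rule graded_mult[OF assms(1) Cons assms(3)], auto)
 qed
 from this[of "map (inv_into UNIV position) (sorted_list_of_set (position ` J))"]
 show ?thesis unfolding epow_def by (simp add: o_def card_image inj_on_def position_inj)
qed

lemma graded_ext_hom:
 fixes y :: "'n::finite => ('o::finite, 'e::comm_monoid_add \<Rightarrow>\<^sub>0 'x::euclidean_space sfun) ext" and h g w
 assumes y: "!!i. y i : graded deg {(1, 0)}" "deg 0 = 0" "!!e e'. deg (e + e') = deg e + deg e'"
  and h: "!!k. deg (h k) = deg' k" and x: "x : graded deg' A"
 shows "ext_hom (pol_hom h w g) y x : graded deg A"
 unfolding ext_hom_def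
proof (intro graded_sum)
 fix J
 have "single (h e) (w e * g (lookup (coef x J) e)) \<odot> epow y J : graded deg A" if e: "e : keys (coef x J)" for e
 proof (rule graded_scal[OF graded_epow[OF y]])
  show "(i, deg' e + j) : A" if "(i, j) : {(int (card J), 0)}" for i j
   using x e that by (auto simp: graded_def)
 qed (auto simp: y h split: if_splits)
 thus "pol_hom h w g (coef x J) \<odot> epow y J : graded deg A"
  unfolding pol_hom_def sum_scal by (intro graded_sum)
qed

text \<open>The vectors \<open>vec_zbar\<close> and \<open>vec_z\<close> play the roles of \<zeta>
  and \<xi>; their dual forms \<phi> and \<psi> are then the conjugates of the coordinates and the
  coordinates themselves.\<close>

locale holo = adapted \<Gamma> Q "vec_zbar Z" "vec_z Z" "%i \<mu>. cnj (Z (axis \<mu> 1) $ i)" "%i \<mu>. Z (axis \<mu> 1) $ i" \<kappa> \<tau> t \<beta> M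
 for \<Gamma> :: "'s::finite => 's => complex^'d::finite" and Q and Z :: "real^'d => complex^'n::finite"
  and \<kappa> and \<tau> :: "'n => 's => complex" and t \<beta> M +
 assumes linZ: "linear Z" and bijZ: "bij Z"
begin

section \<open>The comparison map and its one-sided inverse\<close>

definition "Zi = inv_into UNIV Z"

lemma Z_Zi [simp]: "Z (Zi z) = z" using bijZ by (simp add: Zi_def bij_is_surj surj_f_inv_f)
lemma Zi_Z [simp]: "Zi (Z x) = x" using bijZ by (simp add: Zi_def bij_is_inj)
lemma linZi: "linear Zi"
proof (rule linearI)
 show "Zi (x + y) = Zi x + Zi y" for x y
  using Zi_Z[of "Zi x + Zi y"] by (simp only: linear_add[OF linZ] Z_Zi)
 show "Zi (c *\<^sub>R x) = c *\<^sub>R Zi x" for c x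
  using Zi_Z[of "c *\<^sub>R Zi x"] by (simp only: linear_cmul[OF linZ] Z_Zi)
qed

definition jD :: "'n dpoly => ('d, 's) tpol" where "jD = pol_hom (%k. (0, k)) (%_. 1) (pull Z)"

text \<open>Restriction to \<lambda> = - u Q, where the Koszul coefficients \<lambda> + u Q vanish:
  a monomial in \<lambda> and u becomes its value at - Q times a power of u given by its total
  degree.\<close>

definition jR :: "('d, 's) tpol => 'n dpoly" where
 "jR = pol_hom tdeg (%e. cfun (\<Prod>a\<in>UNIV. (- Q $ a) ^ (fst e $ a))) (pull Zi)"

sublocale jD: pol_hom_data "%k. (0 :: nat^'s, k :: int)" "%_. 1 :: (real^'d) sfun" "pull Z"
 by unfold_locales (simp_all add: zero_prod_def pull_simps[OF linZ])

sublocale jR: pol_hom_data "tdeg :: (nat^'s) \<times> int => int" "%e. cfun (\<Prod>a\<in>UNIV. (- Q $ a) ^ (fst e $ a)) :: (complex^'n) sfun" "pull Zi"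
 by unfold_locales (simp_all add: tdeg_add pull_simps[OF linZi] cfun_mult[symmetric] power_add prod.distrib)

lemmas jD_simps = jD.hom_add[folded jD_def] jD.hom_mult[folded jD_def] jD.hom_one[folded jD_def] jD.hom_single[folded jD_def, unfolded mult_1]
lemmas jR_simps = jR.hom_add[folded jR_def] jR.hom_mult[folded jR_def] jR.hom_one[folded jR_def] jR.hom_single[folded jR_def]

text \<open>Restriction of \<theta> to the span of the t i: the coordinates on the line of Q and on
  the middle summand are put to 0.\<close>

definition "rho a = (SU i. cst (t i a) \<odot> (gen i :: 'n dfield))"

lemma rho_odd: "parity (rho a) = - rho a" by (simp add: rho_def parity_sum scal_simps(5) sum_negf)

lemma odd_anti:
 assumes "!!a. parity (y a) = - y a" shows "y a * y b = - (y b * y a)"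
 using odd_commute[of "y a" "y b"] assms by simp

sublocale \<Phi>0: ext_hom_data jD \<eta>
 by unfold_locales (simp_all add: jD_simps, rule odd_anti, simp, rule eq_neg_self, rule odd_anti, simp)

sublocale r: ext_hom_data jR rho
 by unfold_locales (simp_all add: jR_simps, rule odd_anti[OF rho_odd], rule eq_neg_self, rule odd_anti[OF rho_odd])

definition "\<Phi>0 = ext_hom jD \<eta>"
definition "r = ext_hom jR rho"
definition "\<Phi> x = E (\<Phi>0 x)"

lemmas \<Phi>0_simps = \<Phi>0.ext_hom_add[folded \<Phi>0_def] \<Phi>0.ext_hom_mult[folded \<Phi>0_def] \<Phi>0.ext_hom_one[folded \<Phi>0_def]
 \<Phi>0.ext_hom_scal[folded \<Phi>0_def] \<Phi>0.ext_hom_gen[folded \<Phi>0_def] \<Phi>0.ext_hom_sum[folded \<Phi>0_def]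
lemmas r_simps = r.ext_hom_add[folded r_def] r.ext_hom_mult[folded r_def] r.ext_hom_one[folded r_def]
 r.ext_hom_scal[folded r_def] r.ext_hom_gen[folded r_def] r.ext_hom_sum[folded r_def]

lemma additive_diff: "(!!x y. f (x + y) = f x + f y) ==> f (x - y) = f x - f y" for f :: "'x::ab_group_add => 'y::ab_group_add"
 by (metis add_diff_cancel_right' diff_add_cancel)

lemmas r_diff = additive_diff[of r, OF r_simps(1)] and \<Phi>0_diff = additive_diff[of \<Phi>0, OF \<Phi>0_simps(1)]
 and jR_diff = additive_diff[of jR, OF jR_simps(1)]

lemma jD_ud: "jD ud = ur"
 by (simp add: ud_def ur_def jD_simps pull_simps[OF linZ])

lemma jR_vars: "jR (cst c) = cst c" "jR ur = ud" "jR (lamr a) = cst (- Q $ a) * ud"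
proof -
 show "jR (cst c) = cst c" by (simp add: cst_def jR_simps pull_simps[OF linZi])
 show "jR ur = ud" by (simp add: ur_def ud_def jR_simps tdeg_u pull_simps[OF linZi])
 have "(\<Prod>b\<in>UNIV. (- Q $ b) ^ (axis a 1 $ b)) = (\<Prod>b\<in>UNIV. if b = a then - Q $ a else 1)"
  by (rule prod.cong) (auto simp: axis_def)
 thus "jR (lamr a) = cst (- Q $ a) * ud"
  by (simp add: lamr_def ud_def cst_def mult_single jR_simps tdeg_lam[simplified] pull_simps[OF linZi])
qed

lemma jR_sum: "jR (sum f A) = (\<Sum>i\<in>A. jR (f i))"
proof (induction A rule: infinite_finite_induct)
 have "jR 0 = 0" using jR_simps(1)[of 0 0] by simp
 thus "jR (sum f {}) = (\<Sum>i\<in>{}. jR (f i))" by simp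
 thus "!!A. infinite A ==> jR (sum f A) = (\<Sum>i\<in>A. jR (f i))" by simp
qed (simp add: jR_simps)

lemma jR_linr: "jR (linr l) = cst (- (SU a. l a * Q $ a)) * ud"
 by (simp add: linr_def jR_sum jR_simps jR_vars cst_minus cst_sum cst_mult sum_negf sum_distrib_right mult.assoc)

lemma jR_forms: "jR l0 = - ud" "jR (l2 j) = 0" "jR (mL i j) = 0" "jR (bLL j) = 0"
 by (simp_all add: l0_def l2_def mL_def bLL_def bilr_def jR_linr jR_sum jR_simps \<kappa>Q \<tau>Q MQ \<beta>Q cst_minus)

lemma jR_rel: "jR (rel \<mu>) = 0"
 by (subst rel_complete) (simp add: jR_sum jR_simps jR_diff jR_forms)

lemma r_scalar: "r (c \<odot> 1) = jR c \<odot> 1" by (simp add: r_simps)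

lemma r_I: "x : I ==> r x = 0"
 unfolding I_expand by (auto simp: r_simps jR_rel)

lemma r_Lin: "r (Lin l gen) = (SU i. cst (SU a. l a * t i a) \<odot> gen i)"
proof -
 have "r (Lin l gen) = (SU a i. cst (l a * t i a) \<odot> gen i)"
  by (simp add: Lin_def r_simps jR_vars rho_def scal_sum scal_simps(7) cst_mult)
 thus ?thesis by (subst (asm) sum.swap) (simp add: cst_sum sum_scal)
qed

lemma r_basic [simp]: "r th0 = 0" "r (th2 j) = gen j" "r (mT i j) = 0" "r (bLT j) = 0"
proof -
 show "r th0 = 0" "r (mT i j) = 0" unfolding th0_def mT_def r_Lin by (simp_all add: \<kappa>t Mt)
 have "(SU i. cst (if j = i then 1 else 0) \<odot> gen i) = (SU i. if i = j then gen j else (0 :: 'n dfield))"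
  by (rule sum.cong) auto
 thus "r (th2 j) = gen j" unfolding th2_def r_Lin \<tau>t by simp
 show "r (bLT j) = 0" unfolding bLT_def bil_def by (simp add: r_simps r_Lin \<beta>t)
qed

lemma r_eta [simp]: "r (\<eta> j) = gen j" by (simp add: \<eta>_def r_simps r_diff jR_forms)

lemma r_\<Phi>0: "r (\<Phi>0 x) = x"
proof (induction x rule: ext_induct)
 case (scalar c)
 have "jR (jD c) = c"
  by (induction c rule: pm_induct) (simp_all add: jD_simps jR_simps tdeg_u pull_pull[OF linZ linZi])
 thus ?case by (simp add: \<Phi>0_simps r_simps)
qed (simp_all add: \<Phi>0_simps r_simps)

lemma r_V: "r (V a) = 0"
 by (simp add: V_def r_scalar jR_simps jR_vars cst_minus)

lemma r_K: "r (K x) = 0"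
 by (simp add: K_def vfield_def r_simps r_V)

lemma r_H: "r (H k) = 0"
 by (cases k) (simp_all add: H_def H_L_def H_R_def r_simps r_diff jR_forms)

text \<open>At \<lambda> = - u Q the coefficient l0 - u of th2 becomes - 2 u, which the factor - 1/2
  turns into u.\<close>

lemma r_om_Inl: "r (om (Inl i)) = ud \<odot> gen i"
proof -
 have "r (om (Inl i)) = (cst (-1/2) * (- ud - ud)) \<odot> gen i"
  by (simp add: om_def om_L_def r_simps r_diff jR_forms jR_vars jR_diff scal_simps(7))
 also have "cst (-1/2) * (- ud - ud) = (- (cst (-1/2) + cst (-1/2))) * (ud :: 'n dpoly)" by (simp add: algebra_simps)
 also have "\<dots> = ud" unfolding cst_add[symmetric] by (simp add: cst_minus)
 finally show ?thesis .
qed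

lemma r_om_Inr: "r (om (Inr i)) = 0"
 by (simp add: om_def om_R_def r_simps jR_forms)

lemma jR_pdir: "jR (SU \<mu>. cst (vec_zbar Z i $ \<mu>) * dpol (axis \<mu> 1) c) = pzb i (jR c)"
proof (induction c rule: pm_induct)
 case (single e f)
 have f: "pull Z (pull Zi f) = f" by (rule pull_pull[OF linZi linZ]) simp
 have "(SU \<mu>. cfun (vec_zbar Z i $ \<mu>) * pds (axis \<mu> 1) f) = pull Z (szb i (pull Zi f))"
  using vec_zbar_derivative(1)[OF linZ bijZ, of i "pull Zi f"] unfolding f .
 hence s: "pull Zi (SU \<mu>. cfun (vec_zbar Z i $ \<mu>) * pds (axis \<mu> 1) f) = szb i (pull Zi f)"
  using pull_pull[OF linZ linZi] by simp
 have "(SU \<mu>. cst (vec_zbar Z i $ \<mu>) * dpol (axis \<mu> 1) (single e f)) = single e (SU \<mu>. cfun (vec_zbar Z i $ \<mu>) * pds (axis \<mu> 1) f)"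
  by (simp add: cst_def mult_single) (rule poly_mapping_eqI, simp add: lookup_sum lookup_single when_def)
 moreover have "szb i (cfun a * g) = cfun a * szb i g" for a g
  by (simp add: szb_def pds_mult algebra_simps)
 ultimately show ?case by (simp add: jR_simps s pzb_single)
qed (simp add: dpol_add distrib_left sum.distrib jR_simps pzb_add)

lemma r_pdir: "r (pdir (vec_zbar Z i) x) = dzb i (r x)"
proof -
 interpret d: sderiv False "dzb i" by (rule sderiv_dzb)
 have z: "r (pdir (vec_zbar Z i) (gen a)) = 0" "dzb i (rho a) = 0" for a
 proof -
  have "dzb i (cst c \<odot> gen j) = 0" for c j
   by (simp add: dzb_def coefwise_scal[OF derivation_pzb] coefwise_emono[OF derivation_pzb] pzb_def)
  thus "dzb i (rho a) = 0" by (simp add: rho_def d.sum)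
  have "r 0 = 0" using r_simps(1)[of 0 0] by simp
  thus "r (pdir (vec_zbar Z i) (gen a)) = 0" by (simp add: flat_pdir flat_gen)
 qed
 show ?thesis
 proof (induction x rule: ext_induct)
  case (scalar c)
  have "dzb i (c \<odot> 1) = pzb i c \<odot> 1" for c
   unfolding dzb_def by (rule coefwise_scal_one) (rule derivation_zero[OF derivation_pzb])
  thus ?case by (simp add: pdir_scal_flat flat_one r_simps jR_pdir)
 qed (simp_all add: pdir.mult pdir.add d.mult d.add r_simps z)
qed

text \<open>r kills K and the coefficients along \<open>vec_z\<close>, and what is left is the
  Dolbeault operator. The equation holds exactly, because r also kills I.\<close>

lemma r_D: "r (D x) = dbar (r x)"
 by (simp add: D_eq r_simps r_K sum_Inl_Inr r_om_Inl r_om_Inr evec_def r_pdir dbar_def scal_mult_left)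

lemma r_N: "r (N x) = 0" by (simp add: N_def r_simps r_H)

lemma r_E: "r (E x) = r x"
proof -
 have "r (Np k x) = (if k = 0 then r x else 0)" for k
  by (cases k) (simp_all add: r_simps r_N)
 thus ?thesis by (simp add: E_def r_simps sum.delta)
qed

text \<open>r kills every H k and therefore N, so it does not see the exponential.\<close>

lemma r_\<Phi>: "r (\<Phi> x) = x" by (simp add: \<Phi>_def r_E r_\<Phi>0)

section \<open>Compatibility with the differentials\<close>

lemma \<Phi>0_B1: "\<Phi>0 x : B1"
proof (induction x rule: ext_induct)
 case (scalar c)
 show ?case
 proof (induction c rule: pm_induct)
  case (single k f)
  show ?case by (simp add: \<Phi>0_simps jD_simps B1.fn)
 qed (simp add: \<Phi>0_simps jD_simps scal_simps(2) B1.add)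
qed (simp_all add: \<Phi>0_simps B1.intros)

lemma B1_\<Phi>0: "b : B1 ==> \<exists>x. b = \<Phi>0 x"
proof (induction rule: B1.induct)
 case (fn k f)
 have "single (0, k) f \<odot> 1 = \<Phi>0 (single k (pull Zi f) \<odot> 1)"
  by (simp add: \<Phi>0_simps jD_simps pull_pull[OF linZi linZ])
 thus ?case ..
next
 case (eta x j)
 thus ?case by (metis \<Phi>0_simps(2,5))
next
 case (add x y)
 thus ?case by (metis \<Phi>0_simps(1))
qed

lemma B1_B0: "x : B1 ==> x : B0" by (induction rule: B1.induct) (auto intro: B0.intros)

lemma K_\<Phi>0: "K (\<Phi>0 x) : I" by (rule B0_K[OF B1_B0[OF \<Phi>0_B1]])

lemma jD_pdir:
 "(SU \<mu>. cst (vec_zbar Z i $ \<mu>) * dpol (axis \<mu> 1) (jD c)) = jD (pzb i c)"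
proof (induction c rule: pm_induct)
 case (single k f)
 have "(SU \<mu>. cst (vec_zbar Z i $ \<mu>) * dpol (axis \<mu> 1) (single (0, k) (pull Z f))) = (single (0, k) (SU \<mu>. cfun (vec_zbar Z i $ \<mu>) * pds (axis \<mu> 1) (pull Z f)) :: ('d, 's) tpol)"
  by (simp add: cst_def mult_single) (rule poly_mapping_eqI, simp add: lookup_sum lookup_single when_def)
 thus ?case by (simp add: jD_simps pzb_single vec_zbar_derivative(1)[OF linZ bijZ])
qed (simp add: jD_simps dpol_add distrib_left sum.distrib pzb_add)

lemma pdir_\<Phi>0: "pdir (vec_zbar Z i) (\<Phi>0 x) = \<Phi>0 (dzb i x)"
proof -
 interpret d: sderiv False "dzb i" by (rule sderiv_dzb)
 have z: "dzb i (gen a) = 0" for a by (simp add: dzb_def coefwise_emono[OF derivation_pzb])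
 show ?thesis
 proof (induction x rule: ext_induct)
  case (scalar c)
  have "dzb i (c \<odot> 1) = pzb i c \<odot> 1" for c
   unfolding dzb_def by (rule coefwise_scal_one) (rule derivation_zero[OF derivation_pzb])
  thus ?case by (simp add: pdir_scal_flat flat_one \<Phi>0_simps jD_pdir)
 qed (simp_all add: pdir.mult pdir.add d.mult d.add \<Phi>0_simps z flat_pdir flats)
qed

text \<open>On the image of \<open>\<Phi>0\<close> the operator \<open>D'\<close> differs from u
  times the Dolbeault operator only by K, which maps this image into I.\<close>

lemma D'_\<Phi>0: "D' (\<Phi>0 x) - \<Phi>0 (dbar x) : I"
proof -
 have "D' (\<Phi>0 x) - \<Phi>0 (dbar x) = K (\<Phi>0 x)"
  by (simp add: D'_def sum_Inl_Inr et_def evec_def pdir_\<Phi>0 dbar_def \<Phi>0_simps jD_ud scal_mult_left)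
 thus ?thesis using K_\<Phi>0 by simp
qed

lemma \<Phi>_simps: "\<Phi> (x + y) = \<Phi> x + \<Phi> y" "\<Phi> (x * y) = \<Phi> x * \<Phi> y" "\<Phi> (x - y) = \<Phi> x - \<Phi> y"
 by (simp_all add: \<Phi>_def \<Phi>0_simps \<Phi>0_diff E_add E_mult E_diff)

lemma D_\<Phi>: "D (\<Phi> x) - \<Phi> (dbar x) : I"
proof -
 have "D (\<Phi> x) - \<Phi> (dbar x) = (D (E (\<Phi>0 x)) - E (D' (\<Phi>0 x))) + E (D' (\<Phi>0 x) - \<Phi>0 (dbar x))"
  by (simp add: \<Phi>_def E_diff)
 thus ?thesis using I_add[OF D_E E_I[OF D'_\<Phi>0]] by simp
qed

lemma K_K: "K (K x) = 0"
proof (rule eq_neg_self)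
 have "K (K x) + K (K x) = 0" 
 proof (induction x rule: ext_induct)
  case (gen c x)
  have V: "parity (V c) = V c" "K (V c) = 0" by (simp_all add: V_def)
  have "K (K (gen c * x)) + K (K (gen c * x)) = gen c * (K (K x) + K (K x))"
   by (simp add: K.mult K.diff K_gen V algebra_simps)
  thus ?case using gen by simp
 qed (simp_all add: K.add algebra_simps)
 thus "K (K x) = - K (K x)" by (simp only: eq_neg_iff_add_eq_0)
qed

lemma K_om: "K (om k) : I"
proof -
 have "K (et k) : I" by (cases k) (simp_all add: et_def K_scal I_scal K_eta_I)
 from I_diff[OF this K_I[OF K_H[of k]]] show ?thesis by (simp add: K.diff K_K)
qed

text \<open>The second order terms cancel since the \<open>om\<close> anticommute and the
  derivatives commute; the first order coefficients K (om k) lie in I, as om k is homologous to et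
  k, which vanishes or is a multiple of the cycle \<eta>.\<close>

lemma D_D: "D (D x) : I"
proof -
 let ?S = "SU j k. om j * om k * pdir (evec j) (pdir (evec k) x)"
 have "?S = (SU k j. om j * om k * pdir (evec j) (pdir (evec k) x))" by (rule sum.swap)
 also have "\<dots> = - ?S"
  unfolding sum_negf[symmetric]
 proof (intro sum.cong refl)
  fix j k
  have "om j * om k = - (om k * om j)" using odd_commute[of "om j" "om k"] by simp
  thus "om j * om k * pdir (evec j) (pdir (evec k) x) = - (om k * om j * pdir (evec k) (pdir (evec j) x))"
   by (simp add: pdir_commute[of "evec j"])
 qed
 finally have S: "?S = 0" by (rule eq_neg_self)
 have "D (D x) = (SU k. K (om k) * pdir (evec k) x) + ?S"
  unfolding D_eq K.add K.sum pdir.add pdir.sum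
  by (simp add: K_K K.mult pdir_K pdir_flat_mult flats sum.distrib sum_subtractf sum_distrib_left distrib_left sum_negf mult.assoc)
 thus ?thesis unfolding S by (simp only: add_0_right) (intro I_sum I_right K_om)
qed

end

context holo
begin

subsection \<open>Comparison of filtered complexes\<close>

lemma graded_\<Phi>0: "x : graded id A ==> \<Phi>0 x : graded tdeg A"
 unfolding \<Phi>0_def jD_def by (rule graded_ext_hom) (auto simp: graded_basic tdeg_add tdeg_u)

lemma graded_r: "x : graded tdeg A ==> r x : graded id A"
proof -
 have "cst c \<odot> gen i : graded id {(1, 0)}" for c and i :: 'n
  by (rule graded_scal[where A = "{(1, 0)}" and k = 0, OF graded_emono]) (auto simp: cst_def split: if_splits)
 hence "rho a : graded id {(1, 0)}" for a unfolding rho_def by (intro graded_sum)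
 thus "x : graded tdeg A ==> r x : graded id A"
  unfolding r_def jR_def by (intro graded_ext_hom) auto
qed

lemma graded_Np:
 assumes "x : graded tdeg A" shows "Np k x : graded tdeg {(i + 2 * int k, j) |i j. (i, j) : A}"
proof (induction k)
 case 0
 thus ?case using assms by simp
next
 case (Suc k)
 show ?case unfolding Np.simps by (intro graded_cst graded_N[OF Suc]) force
qed

lemma graded_E_diff:
 assumes "x : graded tdeg A" "!!i j l. (i, j) : A ==> l \<ge> 1 ==> (i + 2 * int l, j) : B"
 shows "E x - x : graded tdeg B"
proof -
 obtain n where n: "CARD('s) = Suc n" using gr0_implies_Suc[of "CARD('s)"] by auto
 have "E x - x = (\<Sum>k<n. Np (Suc k) x)" unfolding E_def n by (subst sum.lessThan_Suc_shift) simp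
 also have "\<dots> : graded tdeg B"
  using assms(2)[of _ _ "Suc _"] by (intro graded_sum graded_mono[OF graded_Np[OF assms(1)]]) force
 finally show ?thesis .
qed

lemma graded_E:
 assumes "x : graded tdeg A" "!!i j l. (i, j) : A ==> (i + 2 * int l, j) : B"
 shows "E x : graded tdeg B"
proof -
 have "E x - x : graded tdeg B" by (rule graded_E_diff[OF assms(1)]) (rule assms(2))
 moreover have "x : graded tdeg B" by (rule graded_mono[OF assms(1)]) (use assms(2)[of _ _ 0] in auto)
 ultimately have "(E x - x) + x : graded tdeg B" by (rule graded_add)
 thus ?thesis by simp
qed

lemma graded_\<Phi>:
 assumes "x : graded id A" "!!i j l. (i, j) : A ==> (i + 2 * int l, j) : A" shows "\<Phi> x : graded tdeg A"
 unfolding \<Phi>_def by (rule graded_E[OF graded_\<Phi>0[OF assms(1)] assms(2)])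

lemma graded_omd:
 assumes "x : graded tdeg A" "!!i j. (i, j) : A ==> (i + 1, j + 1) : B"
 shows "(SU k. om k * pdir (evec k) x) : graded tdeg B"
proof (intro graded_sum)
 fix k
 show "om k * pdir (evec k) x : graded tdeg B"
  by (rule graded_mult[OF graded_om graded_pdir[OF assms(1)] tdeg_add]) (use assms(2) in \<open>force simp: add.commute\<close>)
qed

lemma graded_dbar:
 assumes "(x :: 'n dfield) : graded id A" "!!i j. (i, j) : A ==> (i + 1, j + 1) : B"
 shows "dbar x : graded id B"
 unfolding dbar_def
proof (intro graded_sum)
 fix i :: 'n
 have k: "keys (cst c * p) \<subseteq> keys p" for c and p :: "'n dpoly"
  using keys_mult[of "cst c" p] by (auto simp: cst_def split: if_splits)
 have "keys (pzb i c) \<subseteq> keys c" for c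
  using k[of "1/2" "dpol (axis i 1) c + cst \<i> * dpol (axis i \<i>) c"] k[of \<i> "dpol (axis i \<i>) c"]
   keys_dpol[of "axis i 1" c] keys_dpol[of "axis i \<i>" c] keys_add[of "dpol (axis i 1) c" "cst \<i> * dpol (axis i \<i>) c"]
  unfolding pzb_def by blast
 hence 1: "dzb i x : graded id A" unfolding dzb_def by (rule graded_coefwise[OF _ assms(1)])
 have "gen i * dzb i x : graded id {(i + 1, j) |i j. (i, j) : A}"
  by (rule graded_mult[OF graded_emono[where A = "{(1, 0)}"] 1]) (auto simp: add.commute)
 thus "ud \<odot> (gen i * dzb i x) : graded id B"
  by (rule graded_scal[where k = 1]) (auto simp: ud_def add.commute assms(2) split: if_splits)
qed

text \<open>Weight at least k and polynomial degree at most m. As the exterior degree is at most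
  CARD('s), no such bidegree occurs once k exceeds m + CARD('s); this ends the descent.\<close>

definition "Fge k m = {(i, j :: int). i + j \<ge> k \<and> j \<le> (m :: int)}"
definition "Feq k m = {(i, j :: int). i + j = k \<and> j \<le> (m :: int)}"

text \<open>K preserves the weight, whereas the derivative terms and the corrections of the
  exponential raise it by at least 2. Hence the part of lowest weight of a cocycle is a K-cycle
  modulo I, and \<open>koszul\<close> applies to it.\<close>

lemma filtered_step:
 assumes x: "x : graded tdeg (Fge k m)" and z: "z : graded tdeg {(i, j). i + j \<ge> k + 1}" and D: "D x - z : I"
 shows "\<exists>y\<in>graded tdeg (Feq k (m - 1)). \<exists>x'\<in>graded tdeg (Fge (k + 1) m).
  x - \<Phi> (r (gproj tdeg (Feq k m) x)) - D y - x' : I"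
proof -
 let ?p = "gproj tdeg (Feq k m)"
 let ?om = "%x. SU l. om l * pdir (evec l) x"
 let ?B = "{(i, j). (i + 1, j - 1) : Feq k m}"
 have disj: "?B \<inter> {(i, j). i + j \<ge> k + 1} = {}" by (auto simp: Feq_def)
 have om: "?om x : graded tdeg {(i, j). i + j \<ge> k + 1}"
  by (rule graded_omd[OF x]) (auto simp: Fge_def)
 have "K (?p x) = gproj tdeg ?B (D x - z) + gproj tdeg ?B (z - ?om x)"
  unfolding K_gproj gproj_add[symmetric] by (simp add: D_eq)
 also have "gproj tdeg ?B (z - ?om x) = 0"
  by (rule gproj_disjoint[OF graded_diff[OF z om] disj])
 finally have "K (?p x) : I" using I_gproj[OF D, of ?B] by simp
 from koszul[OF this] obtain b y0 where b: "b : B1" "?p x - b - K y0 : I" by blast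
 obtain d where d: "b = \<Phi>0 d" using B1_\<Phi>0[OF b(1)] by blast
 \<comment> \<open>As r kills I and boundaries of K, it identifies the representative that
   \<open>koszul\<close> only asserts to exist.\<close>
 have "r (?p x - b - K y0) = 0" by (rule r_I[OF b(2)])
 hence d': "d = r (?p x)" by (simp add: r_diff d r_\<Phi>0 r_K)
 have g: "?p x : graded tdeg (Feq k m)" by (rule gproj_graded)
 hence gd: "d : graded id (Feq k m)" unfolding d' by (rule graded_r)
 \<comment> \<open>Only the part of y0 that K sends into the lowest weight part is kept. K raises
   the polynomial degree by one, whence m - 1; then also the derivative terms of D y have polynomial
   degree at most m.\<close>
 define y where "y = gproj tdeg (Feq k (m - 1)) y0"
 have y: "y : graded tdeg (Feq k (m - 1))" unfolding y_def by (rule gproj_graded)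
 have "{(i, j). (i + 1, j - 1) : Feq k (m - 1)} = Feq k m" by (auto simp: Feq_def)
 hence "K y = ?p (K y0)" unfolding y_def K_gproj by simp
 hence "?p x - \<Phi>0 d - K y = ?p (?p x - b - K y0)"
  using gproj_id[OF g] gproj_id[OF graded_\<Phi>0[OF gd]] by (simp add: gproj_diff d)
 hence 1: "?p x - \<Phi>0 d - K y : I" using I_gproj[OF b(2)] by simp
 define x' where "x' = (x - ?p x) - (\<Phi> d - \<Phi>0 d) - ?om y"
 have "x - ?p x : graded tdeg (Fge (k + 1) m)"
  by (rule graded_mono[OF gproj_compl[OF x]]) (auto simp: Fge_def Feq_def)
 moreover have "\<Phi> d - \<Phi>0 d : graded tdeg (Fge (k + 1) m)"
  unfolding \<Phi>_def by (rule graded_E_diff[OF graded_\<Phi>0[OF gd]]) (auto simp: Fge_def Feq_def)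
 moreover have "?om y : graded tdeg (Fge (k + 1) m)"
  by (rule graded_omd[OF y]) (auto simp: Fge_def Feq_def)
 ultimately have x': "x' : graded tdeg (Fge (k + 1) m)"
  unfolding x'_def using graded_diff[OF graded_diff] by blast
 have "x - \<Phi> d - D y - x' = ?p x - \<Phi>0 d - K y" by (simp add: x'_def D_eq algebra_simps)
 thus ?thesis using 1 y x' unfolding d' by metis
qed

lemma D_diff: "D (x - y) = D x - D y" and D_add: "D (x + y) = D x + D y"
 by (simp_all add: D_eq K.diff K.add pdir.diff pdir.add distrib_left right_diff_distrib sum.distrib sum_subtractf)

text \<open>Each step removes the lowest weight without raising the bound m, and n counts the
  weights that remain. For n = 0 no bidegree is left and x is 0.\<close>

lemma exact_bounded:
 assumes "x : graded tdeg (Fge k m)" "D x : I" "int n = max 0 (m + int CARD('s) + 1 - k)"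
 shows "\<exists>y. x - \<Phi> (r x) - D y : I"
 using assms
proof (induction n arbitrary: x k)
 case 0
 have "card (J :: 's set) \<le> CARD('s)" for J by (rule card_mono) auto
 hence "(int (card (J :: 's set)), j) \<notin> Fge k m" for J j
  using 0(3) by (auto simp: Fge_def) (smt (verit) of_nat_mono)
 hence "x : graded tdeg {}" using 0(1) by (auto simp: graded_def)
 hence "x = 0" using gproj_id[of x tdeg "{}"] gproj_disjoint[of x tdeg "{}" "{}"] by simp
 moreover have "r 0 = 0" "\<Phi> 0 = 0" "D 0 = 0" using r_simps(1)[of 0 0] \<Phi>_simps(1)[of 0 0] D_add[of 0 0] by simp_all
 ultimately show ?case by (intro exI[of _ 0]) simp
next
 case (Suc n)
 let ?p = "gproj tdeg (Feq k m)"
 obtain y x' where y: "x' : graded tdeg (Fge (k + 1) m)" "x - \<Phi> (r (?p x)) - D y - x' : I"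
  using filtered_step[OF Suc(2), of 0] Suc(3) by auto
 \<comment> \<open>The step compared x with the image of r of its lowest part; the rest of r x is
   subtracted here, so that the remainder refers to the full r x.\<close>
 define x'' where "x'' = x' - \<Phi> (r (x - ?p x))"
 have "x - ?p x : graded tdeg (Fge (k + 1) m)"
  by (rule graded_mono[OF gproj_compl[OF Suc(2)]]) (auto simp: Fge_def Feq_def)
 hence x'': "x'' : graded tdeg (Fge (k + 1) m)" unfolding x''_def
  by (intro graded_diff[OF y(1)] graded_\<Phi>[OF graded_r]) (auto simp: Fge_def)
 have e: "x - \<Phi> (r x) - D y - x'' : I" using y(2) by (simp add: x''_def r_diff \<Phi>_simps algebra_simps)
 have rDx: "dbar (r x) = 0" using r_I[OF Suc(3)] by (simp add: r_D)
 have D\<Phi>: "D (\<Phi> (r x)) : I" 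
  using D_\<Phi>[of "r x"] \<Phi>_simps(1)[of 0 0] by (simp add: rDx)
 have "D x'' = D x - D (\<Phi> (r x)) - D (D y) - D (x - \<Phi> (r x) - D y - x'')" by (simp add: D_diff)
 hence "D x'' : I" using Suc(3) D\<Phi> D_D D_I[OF e] by (simp only:) (intro I_diff)
 moreover have "int n = max 0 (m + int CARD('s) + 1 - (k + 1))" using Suc(4) by linarith
 ultimately obtain y' where y': "x'' - \<Phi> (r x'') - D y' : I" using Suc(1)[OF x''] by blast
 \<comment> \<open>The induction leaves \<Phi> (r x''), which is not 0; but it is minus \<Phi> of a
   Dolbeault boundary and is absorbed by adding - \<Phi> (r y) to the primitive.\<close>
 have "r x'' = - dbar (r y)"
  using r_I[OF e] by (simp add: r_diff r_\<Phi> r_D eq_neg_iff_add_eq_0 add.commute)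
 moreover have "\<Phi> (- z) = - \<Phi> z" for z using \<Phi>_simps(3)[of 0 z] \<Phi>_simps(1)[of 0 0] by simp
 ultimately have 2: "\<Phi> (r x'') = - \<Phi> (dbar (r y))" by simp
 have "x - \<Phi> (r x) - D (y + y' - \<Phi> (r y)) = (x - \<Phi> (r x) - D y - x'') + (x'' - \<Phi> (r x'') - D y') + (D (\<Phi> (r y)) - \<Phi> (dbar (r y)))"
  by (simp add: 2 D_add D_diff)
 thus ?case using I_add[OF I_add[OF e y'] D_\<Phi>] by metis
qed

lemma graded_bounds: "\<exists>k m. x : graded tdeg (Fge k m)"
proof -
 define S where "S = (\<Union>J\<in>UNIV. tdeg ` keys (coef x J))"
 have fin: "finite S" by (simp add: S_def)
 have "x : graded tdeg (Fge (Min (insert 0 S)) (Max (insert 0 S)))"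
  unfolding graded_def mem_Collect_eq
 proof (intro allI ballI)
  fix J e assume "e : keys (coef x J)"
  hence "tdeg e : S" by (auto simp: S_def)
  hence "Min (insert 0 S) \<le> tdeg e" "tdeg e \<le> Max (insert 0 S)" using fin by auto
  thus "(int (card J), tdeg e) : Fge (Min (insert 0 S)) (Max (insert 0 S))" by (simp add: Fge_def)
 qed
 thus ?thesis by blast
qed

theorem exact_total: assumes "D x : I" shows "\<exists>y. x - \<Phi> (r x) - D y : I"
proof -
 obtain k m where "x : graded tdeg (Fge k m)" using graded_bounds by blast
 from exact_bounded[OF this assms, of "nat (m + int CARD('s) + 1 - k)"] show ?thesis by simp
qed

text \<open>On the associated graded complex a single step is enough, its remainder being of weight
  at least k + 1.\<close>

theorem exact_graded:
 assumes x: "x : graded tdeg {(i, j). i + j \<ge> k}" and z: "z : graded tdeg {(i, j). i + j \<ge> k + 1}" and D: "D x - z : I"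
 shows "\<exists>d\<in>graded id {(i, j). i + j \<ge> k}. \<exists>y\<in>graded tdeg {(i, j). i + j \<ge> k}. \<exists>x'\<in>graded tdeg {(i, j). i + j \<ge> k + 1}.
  x - \<Phi> d - D y - x' : I"
proof -
 obtain k' m where "x : graded tdeg (Fge k' m)" using graded_bounds by blast
 hence "x : graded tdeg (Fge k m)" using x by (fastforce simp: graded_def Fge_def)
 from filtered_step[OF this z D] obtain y x' where
  y: "y : graded tdeg (Feq k (m - 1))" "x' : graded tdeg (Fge (k + 1) m)" "x - \<Phi> (r (gproj tdeg (Feq k m) x)) - D y - x' : I"
  by blast
 have "r (gproj tdeg (Feq k m) x) : graded id (Feq k m)" by (intro graded_r gproj_graded)
 hence "r (gproj tdeg (Feq k m) x) : graded id {(i, j). i + j \<ge> k}" by (rule graded_mono) (auto simp: Feq_def)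
 moreover have "y : graded tdeg {(i, j). i + j \<ge> k}" by (rule graded_mono[OF y(1)]) (auto simp: Feq_def)
 moreover have "x' : graded tdeg {(i, j). i + j \<ge> k + 1}" by (rule graded_mono[OF y(2)]) (auto simp: Fge_def)
 ultimately show ?thesis using y(3) by blast
qed

text \<open>The exponential changes a pulled back function only in positive exterior degree. In
  \<open>diff_op_\<Phi>\<close> each commutator with a function thereby gains a nilpotent
  factor.\<close>

lemma \<Phi>_function:
 "single 0 (pull Z f) \<odot> 1 - \<Phi> (single 0 f \<odot> 1) : graded tdeg {(i, j). i \<ge> 1}"
proof -
 have "single 0 f \<odot> 1 : graded id {(0, 0)}"
  unfolding graded_def by (auto split: if_splits)
 from graded_E_diff[OF graded_\<Phi>0[OF this], of "{(i, j). i \<ge> 1}"]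
 have "\<Phi> (single 0 f \<odot> 1) - single 0 (pull Z f) \<odot> 1 : graded tdeg {(i, j). i \<ge> 1}"
  by (simp add: \<Phi>_def \<Phi>0_simps jD_simps zero_prod_def)
 from graded_uminus[OF this] show ?thesis by simp
qed

lemma E_scalar: "flat (c \<odot> 1) ==> E (c \<odot> 1) = c \<odot> 1"
proof -
 assume "flat (c \<odot> 1)"
 hence "N (c \<odot> 1) = 0" by (simp add: N_def flat_pdir)
 hence "Np (Suc k) (c \<odot> 1) = 0" for k by (induction k) simp_all
 hence "Np k (c \<odot> 1) = (if k = 0 then c \<odot> 1 else 0)" for k by (cases k) (simp_all del: Np.simps(2))
 thus ?thesis by (simp add: E_def sum.delta)
qed

lemma \<Phi>_constant: "\<Phi> (cst c \<odot> 1) = cst c \<odot> 1" and \<Phi>_ud: "\<Phi> (ud \<odot> 1) = ur \<odot> 1" and \<Phi>_one: "\<Phi> 1 = 1"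
proof -
 have "jD (cst c) = cst c" for c by (simp add: cst_def jD_simps pull_simps[OF linZ] zero_prod_def)
 thus c: "\<Phi> (cst c \<odot> 1) = cst c \<odot> 1" for c
  by (simp add: \<Phi>_def \<Phi>0_simps) (intro E_scalar flat_scal flat_one, simp)
 show "\<Phi> (ud \<odot> 1) = ur \<odot> 1"
  by (simp add: \<Phi>_def \<Phi>0_simps jD_ud) (intro E_scalar flat_scal flat_one, simp)
 show "\<Phi> 1 = 1" using c[of 1] by simp
qed

end

subsection \<open>Equivariance\<close>

definition coordf :: "'d::finite => (real^'d) sfun" where "coordf \<nu> = Sfun (%x. of_real (x $ \<nu>))"

lemma fun_of_coordf: "fun_of (coordf \<nu>) = (%x. of_real (x $ \<nu>))"
 unfolding coordf_def
 by (rule Sfun_inverse) (simp, rule smooth_bounded_linear, intro bounded_linear_compose[OF bounded_linear_of_real] bounded_linear_vec_nth)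

lemma pds_coordf: "pds v (coordf \<nu>) = cfun (of_real (v $ \<nu>))"
 by (rule fun_of_eqI) (simp add: pds.rep_eq fun_of_coordf pd_bounded_linear[OF bounded_linear_compose[OF bounded_linear_of_real bounded_linear_vec_nth]])

definition udeg :: "('d::finite, 's::finite) tpol => ('d, 's) tpol" where
 "udeg = Poly_Mapping.mapp (%e v. of_int (snd e) * v)"

lemma lookup_udeg: "lookup (udeg c) e = of_int (snd e) * lookup c e"
 by (simp add: udeg_def lookup_mapp when_def in_keys_iff)

lemma udeg_single: "udeg (single e f) = single e (of_int (snd e) * f)"
 by (rule poly_mapping_eqI) (simp add: lookup_udeg lookup_single when_def)

lemma derivation_udeg: "derivation (udeg :: ('d::finite, 's::finite) tpol => _)"
proof -
 have add: "udeg (c + d) = udeg c + udeg d" for c d :: "('d, 's) tpol"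
  by (rule poly_mapping_eqI) (simp add: lookup_udeg lookup_add algebra_simps)
 have "udeg (c * d) = udeg c * d + c * udeg d" for c d :: "('d, 's) tpol"
 proof (induction c rule: pm_induct)
  case (single k f)
  show ?case
   by (induction d rule: pm_induct) (simp_all add: mult_single udeg_single single_add[symmetric] add algebra_simps)
 qed (simp add: add algebra_simps)
 thus ?thesis using add by (simp add: derivation_def)
qed

definition actr :: "complex^'d^'d => complex^'s^'s => complex => ('d::finite, 's::finite) tpol => ('d, 's) tpol" where
 "actr X \<rho> w c = - (SU \<mu> \<nu>. cst (X $ \<mu> $ \<nu>) * (single 0 (coordf \<nu>) * dpol (axis \<mu> 1) c))
  - (SU a b. cst (\<rho> $ a $ b) * (lamr b * ldp a c)) + cst w * udeg c"

definition act :: "complex^'d^'d => complex^'s^'s => complex => ('d::finite, 's::finite) tfield => ('d, 's) tfield" where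
 "act X \<rho> w x = coefwise (actr X \<rho> w) x - (SU a b. cst (\<rho> $ a $ b) \<odot> (gen b * odd_deriv a x))"

lemma derivation_add: "derivation d ==> derivation d' ==> derivation (%c. d c + d' c)"
 by (simp add: derivation_def algebra_simps)
lemma derivation_uminus: "derivation d ==> derivation (%c. - d c)"
 by (simp add: derivation_def algebra_simps)
lemma derivation_mult: "derivation d ==> derivation (%c. p * d c)"
 by (simp add: derivation_def algebra_simps)
lemma derivation_sum_fun: "(!!i. i : A ==> derivation (f i)) ==> derivation (%c. \<Sum>i\<in>A. f i c)"
 by (induction A rule: infinite_finite_induct) (auto simp: derivation_def algebra_simps)

lemma derivation_actr: "derivation (actr X \<rho> w)"
proof -
 have "derivation (%c. - (SU \<mu> \<nu>. cst (X $ \<mu> $ \<nu>) * (single 0 (coordf \<nu>) * dpol (axis \<mu> 1) c))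
  + - (SU a b. cst (\<rho> $ a $ b) * (lamr b * ldp a c)) + cst w * udeg c)"
  by (intro derivation_add derivation_uminus derivation_sum_fun derivation_mult derivation_dpol derivation_ldp derivation_udeg)
 thus ?thesis unfolding actr_def by simp
qed

lemma sderiv_act: "sderiv False (act X \<rho> w)"
proof -
 have "sderiv False (%x. gen b * odd_deriv a x)" for a b
  using sderiv_left_mult[OF sderiv_odd_deriv, of "gen b" True] by simp
 hence "sderiv False (%x. coefwise (actr X \<rho> w) x + - (SU a b. cst (\<rho> $ a $ b) \<odot> (gen b * odd_deriv a x)))"
  by (intro sderiv_add sderiv_coefwise derivation_actr sderiv_uminus sderiv_sum sderiv_scal)
 thus ?thesis unfolding act_def by simp
qed

section \<open>The infinitesimal action on coordinates and derivatives\<close>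

context
 fixes X :: "complex^'d::finite^'d" and \<rho> :: "complex^'s::finite^'s" and w :: complex
begin

interpretation a: sderiv False "act X \<rho> w" by (rule sderiv_act)

lemma act_scalar: "act X \<rho> w (c \<odot> 1) = actr X \<rho> w c \<odot> 1"
 by (simp add: act_def coefwise_scal_one derivation_zero[OF derivation_actr])

lemma actr_flat: "(!!v. dpol v c = 0) ==> actr X \<rho> w c = - (SU a b. cst (\<rho> $ a $ b) * (lamr b * ldp a c)) + cst w * udeg c"
 by (simp add: actr_def)

lemma actr_cst: "actr X \<rho> w (cst c) = 0"
 by (simp add: actr_flat) (simp add: cst_def udeg_single)

lemma act_cst: "act X \<rho> w (cst c \<odot> x) = cst c \<odot> act X \<rho> w x"
 by (subst a.scal) (simp add: act_scalar actr_cst)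

lemma actr_linr: "actr X \<rho> w (linr l) = - linr (%b. SU a. l a * \<rho> $ a $ b)"
proof -
 have c: "udeg (cst z :: ('d, 's) tpol) = 0" for z by (simp add: cst_def udeg_single)
 have "udeg (lamr a :: ('d, 's) tpol) = 0" for a by (simp add: lamr_def udeg_single)
 moreover have "udeg (cst z * p) = cst z * udeg p" for z and p :: "('d, 's) tpol"
 proof -
  have "derivation (udeg :: ('d, 's) tpol => _)" by (rule derivation_udeg)
  thus ?thesis by (simp add: derivation_def c)
 qed
 ultimately have "udeg (linr l :: ('d, 's) tpol) = 0"
  by (simp add: linr_def derivation_sum[OF derivation_udeg])
 moreover have "ldp a (linr l) = (cst (l a) :: ('d, 's) tpol)" for a
 proof -
  have "ldp a (linr l) = (SU b. if b = a then cst (l a) else (0 :: ('d, 's) tpol))"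
   unfolding linr_def derivation_sum[OF derivation_ldp]
   by (rule sum.cong) (auto simp: ldp_mult ldp_lamr)
  thus ?thesis by simp
 qed
 ultimately have "actr X \<rho> w (linr l) = - (SU a b. cst (l a * \<rho> $ a $ b) * lamr b)"
  by (simp add: actr_flat cst_mult mult_ac)
 thus ?thesis by (subst (asm) sum.swap) (simp add: linr_def cst_sum sum_distrib_right)
qed

lemma act_gen: "act X \<rho> w (gen a) = - (SU b. cst (\<rho> $ a $ b) \<odot> gen b)"
proof -
 have "(SU c b. cst (\<rho> $ c $ b) \<odot> (gen b * odd_deriv c (gen a)))
  = (SU c. if c = a then SU b. cst (\<rho> $ a $ b) \<odot> gen b else (0 :: ('d, 's) tfield))"
  by (rule sum.cong) (auto simp: odd_deriv_gen)
 thus ?thesis by (simp add: act_def coefwise_emono[OF derivation_actr])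
qed

lemma act_Lin_gen: "act X \<rho> w (Lin l gen) = - Lin (%b. SU a. l a * \<rho> $ a $ b) gen"
proof -
 have "act X \<rho> w (Lin l gen) = - (SU a b. cst (l a * \<rho> $ a $ b) \<odot> gen b)"
  by (simp add: Lin_def a.sum act_cst act_gen scal_simps(5) scal_sum sum_negf scal_simps(7) cst_mult)
 thus ?thesis by (subst (asm) sum.swap) (simp add: Lin_def cst_sum sum_scal)
qed

lemma act_bil_gen: "act X \<rho> w (bil \<beta> lamr gen) = - bil (%a b. (SU c. \<rho> $ c $ a * \<beta> c b) + (SU c. \<beta> a c * \<rho> $ c $ b)) lamr gen"
proof -
 have l: "actr X \<rho> w (lamr a) = - (SU b. cst (\<rho> $ a $ b) * lamr b)" for a
 proof -
  have "lamr a = (linr (%b. if b = a then 1 else 0) :: ('d, 's) tpol)"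
  proof -
   have "linr (%b. if b = a then 1 else 0) = (SU b. if b = a then lamr a else (0 :: ('d, 's) tpol))"
    unfolding linr_def by (rule sum.cong) auto
   thus ?thesis by simp
  qed
  moreover have "(SU c. (if c = a then 1 else 0) * \<rho> $ c $ b) = \<rho> $ a $ b" for b
   by (simp add: if_distrib[of "%x. x * _"] cong: if_cong)
  ultimately show ?thesis using actr_linr[of "%b. if b = a then 1 else 0"] by (simp add: linr_def)
 qed
 have "act X \<rho> w (bil \<beta> lamr gen) = (SU a. actr X \<rho> w (lamr a) \<odot> Lin (\<beta> a) gen - lamr a \<odot> Lin (%b. SU c. \<beta> a c * \<rho> $ c $ b) gen)"
  unfolding bil_def a.sum by (rule sum.cong[OF refl], subst a.scal) (simp add: act_scalar scal_mult_left act_Lin_gen scal_simps(5))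
 also have "\<dots> = - ((SU a c. (cst (\<rho> $ a $ c) * lamr c) \<odot> Lin (\<beta> a) gen) + (SU a. lamr a \<odot> Lin (%b. SU c. \<beta> a c * \<rho> $ c $ b) gen))"
  by (simp add: l scal_simps(6) sum_scal sum_subtractf sum_negf)
 also have "(SU a c. (cst (\<rho> $ a $ c) * lamr c) \<odot> Lin (\<beta> a) (gen :: 's => ('d, 's) tfield)) = (SU c. lamr c \<odot> Lin (%b. SU a. \<rho> $ a $ c * \<beta> a b) gen)"
 proof -
  have "(SU a. (cst (\<rho> $ a $ c) * lamr c) \<odot> Lin (\<beta> a) gen) = lamr c \<odot> Lin (%b. SU a. \<rho> $ a $ c * \<beta> a b) (gen :: 's => ('d, 's) tfield)" for c
  proof -
   have "Lin (%b. SU a. \<rho> $ a $ c * \<beta> a b) gen = (SU a. cst (\<rho> $ a $ c) \<odot> Lin (\<beta> a) (gen :: 's => ('d, 's) tfield))"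
    unfolding Lin_def cst_sum sum_scal scal_sum by (subst sum.swap) (simp add: cst_mult scal_simps(7))
   thus ?thesis by (simp add: scal_sum scal_simps(7) mult.commute)
  qed
  note * = this
  show ?thesis by (subst sum.swap) (simp only: *)
 qed
 finally show ?thesis by (simp add: bil_def Lin_def cst_add scal_simps(1,2) sum.distrib)
qed

lemma act_u: "actr X \<rho> w ur = cst w * ur" "actr X \<rho> w ui = - (cst w * ui)"
 by (simp_all add: actr_flat) (simp_all add: ur_def ui_def udeg_single single_uminus)

text \<open>A rotation commutes with a translation up to rotating its direction. For functions this
  is a computation; it extends to products because \<lambda> and \<theta>, and their images under
  the action, have constant coefficients.\<close>

lemma act_pdir: "act X \<rho> w (pdir v x) - pdir v (act X \<rho> w x) = pdir (X *v v) x"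
proof (induction x rule: tfield_induct)
 case (fn k f)
 interpret p: sderiv False "pdir v" by (rule sderiv_pdir)
 let ?d = "%\<mu>. pds (axis \<mu> 1)"
 have s: "(\<Sum>\<mu>\<in>A. single e (h \<mu>)) = single e (sum h A)" for A e and h :: "'d => (real^'d) sfun"
  by (rule poly_mapping_eqI) (simp add: lookup_sum lookup_single when_def)
 have 1: "actr X \<rho> w (single (0, k) g) = single (0, k) (- (SU \<mu> \<nu>. cfun (X $ \<mu> $ \<nu>) * (coordf \<nu> * ?d \<mu> g)) + cfun w * (of_int k * g))" for g
  by (simp add: actr_def cst_def mult_single udeg_single s single_uminus[symmetric] single_add[symmetric])
 have 2: "pdir v (single (0, k) g \<odot> 1) = single (0, k) (SU \<mu>. cfun (v $ \<mu>) * ?d \<mu> g) \<odot> (1 :: ('d, 's) tfield)" for g v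
  unfolding pdir_def by (simp add: coefwise_scal_one derivation_zero[OF derivation_dpol] cst_def scal_simps(7) mult_single sum_scal[symmetric] s)
 have cd: "?d \<mu> (sum h A) = (\<Sum>i\<in>A. ?d \<mu> (h i))" for \<mu> and h :: "'d => (real^'d) sfun" and A
  by (induction A rule: infinite_finite_induct) (simp_all add: pds_add)
 have dm: "?d \<mu> (- g) = - ?d \<mu> g" for \<mu> g using pds_add[of "axis \<mu> 1" g "-g"] by (simp add: add_eq_0_iff)
 have di: "?d \<mu> (of_int k * g) = of_int k * ?d \<mu> g" for \<mu> and g :: "(real^'d) sfun"
 proof -
  have "cfun (of_int k) = (of_int k :: (real^'d) sfun)"
  proof -
   have "cfun (of_nat n) = (of_nat n :: (real^'d) sfun)" for n by (induction n) (simp_all add: cfun_add)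
   thus ?thesis by (cases k) (simp_all add: cfun_minus cfun_diff)
  qed
  moreover have "?d \<mu> (cfun (of_int k) * g) = cfun (of_int k) * ?d \<mu> g" by (simp add: pds_mult)
  ultimately show ?thesis by (simp only:)
 qed
 have xd: "?d \<kappa> (cfun c * (coordf \<nu> * ?d \<mu> f)) = cfun c * (coordf \<nu> * ?d \<mu> (?d \<kappa> f)) + (if \<nu> = \<kappa> then cfun c * ?d \<mu> f else 0)" for c \<nu> \<mu> \<kappa>
  unfolding pds_mult pds_coordf by (subst pds_commute) (simp add: axis_def algebra_simps)
 let ?S = "%h. SU \<mu> \<nu> \<kappa>. cfun (v $ \<kappa>) * (cfun (X $ \<mu> $ \<nu>) * h \<mu> \<nu> \<kappa>)"
 have A: "(SU \<mu> \<nu>. cfun (X $ \<mu> $ \<nu>) * (coordf \<nu> * ?d \<mu> (SU \<kappa>. cfun (v $ \<kappa>) * ?d \<kappa> f))) = ?S (%\<mu> \<nu> \<kappa>. coordf \<nu> * ?d \<mu> (?d \<kappa> f))"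
  by (simp add: cd pds_mult sum_distrib_left mult_ac)
 have B: "(SU \<kappa>. cfun (v $ \<kappa>) * ?d \<kappa> (SU \<mu> \<nu>. cfun (X $ \<mu> $ \<nu>) * (coordf \<nu> * ?d \<mu> f)))
  = ?S (%\<mu> \<nu> \<kappa>. coordf \<nu> * ?d \<mu> (?d \<kappa> f)) + (SU \<mu>. cfun ((X *v v) $ \<mu>) * ?d \<mu> f)"
 proof -
  have "(SU \<kappa>. cfun (v $ \<kappa>) * ?d \<kappa> (SU \<mu> \<nu>. cfun (X $ \<mu> $ \<nu>) * (coordf \<nu> * ?d \<mu> f)))
   = (SU \<kappa> \<mu> \<nu>. cfun (v $ \<kappa>) * (cfun (X $ \<mu> $ \<nu>) * (coordf \<nu> * ?d \<mu> (?d \<kappa> f)))) +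
    (SU \<kappa> \<mu> \<nu>. cfun (v $ \<kappa>) * (if \<nu> = \<kappa> then cfun (X $ \<mu> $ \<nu>) * ?d \<mu> f else 0))"
   by (simp only: cd xd sum_distrib_left distrib_left sum.distrib)
  also have "(SU \<kappa> \<mu> \<nu>. cfun (v $ \<kappa>) * (cfun (X $ \<mu> $ \<nu>) * (coordf \<nu> * ?d \<mu> (?d \<kappa> f)))) = ?S (%\<mu> \<nu> \<kappa>. coordf \<nu> * ?d \<mu> (?d \<kappa> f))"
   by (subst sum.swap, rule sum.cong[OF refl], subst sum.swap, rule refl)
  also have "(SU \<kappa> \<mu> \<nu>. cfun (v $ \<kappa>) * (if \<nu> = \<kappa> then cfun (X $ \<mu> $ \<nu>) * ?d \<mu> f else 0)) = (SU \<mu> \<kappa>. cfun (v $ \<kappa>) * (cfun (X $ \<mu> $ \<kappa>) * ?d \<mu> f))"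
   by (subst sum.swap) (simp add: sum_distrib_left[symmetric])
  also have "\<dots> = (SU \<mu>. cfun ((X *v v) $ \<mu>) * ?d \<mu> f)"
  proof -
   have "cfun (sum h A) = (\<Sum>i\<in>A. cfun (h i) :: (real^'d) sfun)" for h :: "'d => complex" and A
    by (induction A rule: infinite_finite_induct) (simp_all add: cfun_add)
   thus ?thesis by (simp add: matrix_vector_mult_def cfun_mult sum_distrib_right sum_distrib_left mult_ac)
  qed
  finally show ?thesis .
 qed
 have W: "(SU \<kappa>. cfun (v $ \<kappa>) * ?d \<kappa> (cfun w * (of_int k * f))) = cfun w * (of_int k * (SU \<kappa>. cfun (v $ \<kappa>) * ?d \<kappa> f))"
  unfolding pds_mult[of _ "cfun w"] di pds_cfun mult_zero_left add_0 sum_distrib_left by (simp only: mult_ac)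
 have "- (SU \<mu> \<nu>. cfun (X $ \<mu> $ \<nu>) * (coordf \<nu> * ?d \<mu> (SU \<kappa>. cfun (v $ \<kappa>) * ?d \<kappa> f))) + cfun w * (of_int k * (SU \<kappa>. cfun (v $ \<kappa>) * ?d \<kappa> f))
  - (SU \<kappa>. cfun (v $ \<kappa>) * ?d \<kappa> (- (SU \<mu> \<nu>. cfun (X $ \<mu> $ \<nu>) * (coordf \<nu> * ?d \<mu> f)) + cfun w * (of_int k * f)))
  = (SU \<mu>. cfun ((X *v v) $ \<mu>) * ?d \<mu> f)"
  unfolding A W[symmetric] pds_add dm distrib_left sum.distrib mult_minus_right sum_negf B by simp
 thus ?case unfolding act_scalar 1 2 scal_simps(4)[symmetric] single_diff[symmetric] by simp
next
 case (lam a x)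
 have f: "flat (lamr a \<odot> 1 :: ('d, 's) tfield)" by (intro flat_scal flat_one) simp
 have g: "flat (act X \<rho> w (lamr a \<odot> 1))"
 proof -
  have "lamr a = (linr (%b. if b = a then 1 else 0) :: ('d, 's) tpol)"
  proof -
   have "linr (%b. if b = a then 1 else 0) = (SU b. if b = a then lamr a else (0 :: ('d, 's) tpol))"
    unfolding linr_def by (rule sum.cong) auto
   thus ?thesis by simp
  qed
  thus ?thesis unfolding act_scalar by (simp only: actr_linr scal_simps(6)) (intro flat_uminus flat_scal flat_one dpol_linr)
 qed
 have "act X \<rho> w (pdir v ((lamr a \<odot> 1) * x)) - pdir v (act X \<rho> w ((lamr a \<odot> 1) * x)) = pdir (X *v v) ((lamr a \<odot> 1) * x)"
  using lam f g by (simp add: pdir.mult flat_pdir a.mult pdir.add right_diff_distrib[symmetric])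
 thus ?case by (simp only: scal_mult_left mult_1)
next
 case (theta a x)
 have g: "flat (act X \<rho> w (gen a))" unfolding act_gen by (intro flat_uminus flat_sum flat_scal flat_gen) simp
 have f: "flat (gen a :: ('d, 's) tfield)" by (rule flat_gen)
 show ?case using theta g f
  by (simp add: pdir.mult flat_pdir a.mult pdir.add right_diff_distrib[symmetric])
next
 case (add x y)
 thus ?case by (simp add: pdir.add a.add algebra_simps)
qed

end

section \<open>The action on the Dolbeault side\<close>

definition dactr :: "complex^'n^'n => complex^'n^'n => complex => 'n::finite dpoly => 'n dpoly" where
 "dactr a b w c = (\<Sum>k\<in>keys c. single k (
  - (SU i j. cfun (a $ i $ j) * (Sfun (%z. cnj (z $ j)) * szb i (lookup c k)))
  - (SU i j. cfun (b $ i $ j) * (Sfun (%z. z $ j) * sz i (lookup c k)))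
  - cfun (w * of_int k) * lookup c k))"

definition dact :: "complex^'n^'n => complex^'n^'n => complex => 'n::finite dfield => 'n dfield" where
 "dact a b w x = Ext (%J. dactr a b w (coef x J)
  - (SU i j. cst (a $ i $ j) * coef (gen j * odd_deriv i x) J)
  + cst (w * of_nat (card J)) * coef x J)"

definition dfun :: "complex^'n^'n => complex^'n^'n => complex => int => (complex^'n::finite) sfun => (complex^'n) sfun" where
 "dfun a b w k f = - (SU i j. cfun (a $ i $ j) * (Sfun (%z. cnj (z $ j)) * szb i f))
  - (SU i j. cfun (b $ i $ j) * (Sfun (%z. z $ j) * sz i f)) - cfun (w * of_int k) * f"

lemma szb_add: "szb i (f + g) = szb i f + szb i g" "sz i (f + g) = sz i f + sz i g"
 by (simp_all add: szb_def sz_def pds_add algebra_simps)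

lemma szb_zero: "szb i 0 = 0" "sz i 0 = 0"
 by (simp_all add: szb_def sz_def)

lemma dfun_add: "dfun a b w k (f + g) = dfun a b w k f + dfun a b w k g"
 by (simp add: dfun_def szb_add algebra_simps sum.distrib)

lemma dfun_zero: "dfun a b w k 0 = 0"
 by (simp add: dfun_def szb_zero)

lemma lookup_dactr: "lookup (dactr a b w c) k = dfun a b w k (lookup c k)"
proof -
 have "lookup (dactr a b w c) k = (\<Sum>l\<in>keys c. if l = k then dfun a b w k (lookup c k) else 0)"
  unfolding dactr_def dfun_def[symmetric] lookup_sum by (rule sum.cong) (auto simp: lookup_single)
 thus ?thesis by (simp add: in_keys_iff dfun_zero)
qed

lemma dactr_single: "dactr a b w (single k f) = single k (dfun a b w k f)"
 by (rule poly_mapping_eqI) (simp add: lookup_dactr lookup_single when_def dfun_zero)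

lemma dactr_add: "dactr a b w (c + d) = dactr a b w c + dactr a b w d"
 by (rule poly_mapping_eqI) (simp add: lookup_dactr lookup_add dfun_add)

lemma derivation_dactr: "derivation (dactr a b w :: 'n::finite dpoly => _)"
proof -
 have m: "dfun a b w (k + l) (f * g) = dfun a b w k f * g + f * dfun a b w l g" for k l and f g :: "(complex^'n) sfun"
 proof -
  have z: "szb i (f * g) = szb i f * g + f * szb i g" "sz i (f * g) = sz i f * g + f * sz i g" for i
   by (simp_all add: szb_def sz_def pds_mult algebra_simps)
  have w: "cfun (w * of_int (k + l)) = cfun (w * of_int k) + (cfun (w * of_int l) :: (complex^'n) sfun)"
   by (simp add: cfun_add[symmetric] algebra_simps)
  have s: "(SU i j. cfun (a $ i $ j) * (h j * (p i * g + f * q i)))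
    = (SU i j. cfun (a $ i $ j) * (h j * p i)) * g + f * (SU i j. cfun (a $ i $ j) * (h j * q i))"
   for a :: "complex^'n^'n" and h p q
   by (simp add: sum_distrib_left sum_distrib_right distrib_left sum.distrib mult_ac)
  show ?thesis unfolding dfun_def z w s by (simp add: algebra_simps)
 qed
 have "dactr a b w (c * d) = dactr a b w c * d + c * dactr a b w d" for c d :: "'n dpoly"
 proof (induction c rule: pm_induct)
  case (single k f)
  show ?case
   by (induction d rule: pm_induct) (simp_all add: mult_single dactr_single m single_add dactr_add algebra_simps)
 qed (simp add: dactr_add algebra_simps)
 thus ?thesis by (simp add: derivation_def dactr_add)
qed

lemma linear_coordinates:
 fixes Z :: "real^'d::finite => complex^'n::finite"
 assumes "linear Z"
 shows "(SU \<mu>. of_real (x $ \<mu>) * Z (axis \<mu> 1) $ i) = Z x $ i"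
proof -
 have "Z x = Z (SU \<mu>. x $ \<mu> *\<^sub>R axis \<mu> 1)" by (simp only: basis_expansion scalar_mult_eq_scaleR[symmetric])
 also have "\<dots> = (SU \<mu>. x $ \<mu> *\<^sub>R Z (axis \<mu> 1))" by (simp add: linear_sum[OF assms] linear_cmul[OF assms])
 finally have "Z x $ i = (SU \<mu>. (x $ \<mu> *\<^sub>R Z (axis \<mu> 1)) $ i)" by simp
 also have "\<dots> = (SU \<mu>. of_real (x $ \<mu>) * Z (axis \<mu> 1) $ i)"
  unfolding vector_scaleR_component by (simp only: scaleR_conv_of_real)
 finally show ?thesis ..
qed

lemma dual_bases:
 fixes Z :: "real^'d::finite => complex^'n::finite"
 assumes "linear Z" "bij Z"
 shows "(SU \<mu>. cnj (Z (axis \<mu> 1) $ i) * vec_zbar Z j $ \<mu>) = (if i = j then 1 else 0)"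
 "(SU \<mu>. cnj (Z (axis \<mu> 1) $ i) * vec_z Z j $ \<mu>) = 0"
 "(SU \<mu>. Z (axis \<mu> 1) $ i * vec_zbar Z j $ \<mu>) = 0"
 "(SU \<mu>. Z (axis \<mu> 1) $ i * vec_z Z j $ \<mu>) = (if i = j then 1 else 0)"
proof -
 note Zx = linear_coordinates[OF assms(1)]
 have Zc: "(SU \<mu>. of_real (x $ \<mu>) * cnj (Z (axis \<mu> 1) $ i)) = cnj (Z x $ i)" for x i
  using arg_cong[OF Zx[of x i], of cnj] by (simp add: cnj_sum)
 let ?A = "inv_into UNIV Z (axis j 1)" and ?B = "inv_into UNIV Z (axis j \<i>)"
 have ZZ: "Z (inv_into UNIV Z z) = z" for z using assms(2) by (simp add: bij_is_surj surj_f_inv_f)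
 have e: "(SU \<mu>. h \<mu> * vec_zbar Z j $ \<mu>) = ((SU \<mu>. of_real (?A $ \<mu>) * h \<mu>) + \<i> * (SU \<mu>. of_real (?B $ \<mu>) * h \<mu>)) / 2"
  "(SU \<mu>. h \<mu> * vec_z Z j $ \<mu>) = ((SU \<mu>. of_real (?A $ \<mu>) * h \<mu>) - \<i> * (SU \<mu>. of_real (?B $ \<mu>) * h \<mu>)) / 2" for h
 proof -
  have "(SU \<mu>. h \<mu> * vec_zbar Z j $ \<mu>) = (SU \<mu>. (of_real (?A $ \<mu>) * h \<mu> + \<i> * (of_real (?B $ \<mu>) * h \<mu>)) / 2)"
   "(SU \<mu>. h \<mu> * vec_z Z j $ \<mu>) = (SU \<mu>. (of_real (?A $ \<mu>) * h \<mu> - \<i> * (of_real (?B $ \<mu>) * h \<mu>)) / 2)"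
   by (auto intro!: sum.cong simp: vec_zbar_def vec_z_def algebra_simps add_divide_distrib diff_divide_distrib)
  thus "(SU \<mu>. h \<mu> * vec_zbar Z j $ \<mu>) = ((SU \<mu>. of_real (?A $ \<mu>) * h \<mu>) + \<i> * (SU \<mu>. of_real (?B $ \<mu>) * h \<mu>)) / 2"
   "(SU \<mu>. h \<mu> * vec_z Z j $ \<mu>) = ((SU \<mu>. of_real (?A $ \<mu>) * h \<mu>) - \<i> * (SU \<mu>. of_real (?B $ \<mu>) * h \<mu>)) / 2"
   by (simp_all only: sum_divide_distrib[symmetric] sum.distrib sum_subtractf sum_distrib_left[symmetric])
 qed
 show "(SU \<mu>. cnj (Z (axis \<mu> 1) $ i) * vec_zbar Z j $ \<mu>) = (if i = j then 1 else 0)"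
  "(SU \<mu>. cnj (Z (axis \<mu> 1) $ i) * vec_z Z j $ \<mu>) = 0"
  "(SU \<mu>. Z (axis \<mu> 1) $ i * vec_zbar Z j $ \<mu>) = 0"
  "(SU \<mu>. Z (axis \<mu> 1) $ i * vec_z Z j $ \<mu>) = (if i = j then 1 else 0)"
  unfolding e Zx Zc ZZ by (simp_all add: axis_def)
qed

context holo
begin

text \<open>
  The data of an element \<open>X\<close> of the stabilizer: its matrices \<open>A\<close> and \<open>B\<close> on the two summands of \<open>V\<close>,
  its matrix \<open>\<rho>\<close> on \<open>\<tt>\<^sub>1\<close>, and its weight \<open>w\<close> on the line of \<open>Q\<close>.
\<close>

context
 fixes X :: "complex^'d^'d" and \<rho> :: "complex^'s^'s" and A B :: "complex^'n^'n" and w :: complex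
 assumes X_zbar: "!!j. X *v vec_zbar Z j = (SU i. (A $ i $ j) *s vec_zbar Z i)"
  and X_z: "!!j. X *v vec_z Z j = (SU i. (B $ i $ j) *s vec_z Z i)"
  and X_\<Gamma>: "!!a b. X *v \<Gamma> a b = (SU c. \<rho> $ c $ a *s \<Gamma> c b) + (SU c. \<rho> $ c $ b *s \<Gamma> a c)"
  and \<kappa>\<rho>: "!!b. (SU a. \<kappa> a * \<rho> $ a $ b) = w * \<kappa> b"
  and \<tau>\<rho>: "!!i b. (SU a. \<tau> i a * \<rho> $ a $ b) = (SU j. A $ i $ j * \<tau> j b) - w * \<tau> i b"
  and \<rho>t: "!!k a. (SU b. \<rho> $ a $ b * t k b) = (SU l. A $ l $ k * t l a) - w * t k a"
begin

interpretation a: sderiv False "act X \<rho> (- w)" by (rule sderiv_act)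

lemma dual_X:
 "(SU \<mu>. cnj (Z (axis \<mu> 1) $ i) * (X *v v) $ \<mu>) = (SU j. A $ i $ j * (SU \<mu>. cnj (Z (axis \<mu> 1) $ j) * v $ \<mu>))"
 "(SU \<mu>. Z (axis \<mu> 1) $ i * (X *v v) $ \<mu>) = (SU j. B $ i $ j * (SU \<mu>. Z (axis \<mu> 1) $ j * v $ \<mu>))"
proof -
 let ?p = "%j. SU \<mu>. cnj (Z (axis \<mu> 1) $ j) * v $ \<mu>" and ?q = "%j. SU \<mu>. Z (axis \<mu> 1) $ j * v $ \<mu>"
 have v: "v = (SU j. ?p j *s vec_zbar Z j + ?q j *s vec_z Z j)"
 proof (rule vec_eq_iff[THEN iffD2], intro allI)
  fix \<nu>
  have "(SU j. ?p j *s vec_zbar Z j + ?q j *s vec_z Z j) $ \<nu>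
   = (SU j \<mu>. (vec_zbar Z j $ \<nu> * cnj (Z (axis \<mu> 1) $ j) + vec_z Z j $ \<nu> * Z (axis \<mu> 1) $ j) * v $ \<mu>)"
   by (simp add: sum_distrib_left sum_distrib_right distrib_right distrib_left sum.distrib mult.commute mult.left_commute mult.assoc)
  also have "\<dots> = (SU \<mu>. (SU j. vec_zbar Z j $ \<nu> * cnj (Z (axis \<mu> 1) $ j) + vec_z Z j $ \<nu> * Z (axis \<mu> 1) $ j) * v $ \<mu>)"
   unfolding sum_distrib_right by (rule sum.swap)
  also have "\<dots> = (SU \<mu>. if \<mu> = \<nu> then v $ \<nu> else 0)"
   unfolding complete by (rule sum.cong) auto
  finally show "v $ \<nu> = (SU j. ?p j *s vec_zbar Z j + ?q j *s vec_z Z j) $ \<nu>" by simp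
 qed
 have sv: "X *v (\<Sum>j\<in>S. f j) = (\<Sum>j\<in>S. X *v f j)" for f :: "'n => complex^'d" and S
  by (induction S rule: infinite_finite_induct) (simp_all add: matrix_vector_right_distrib)
 have Xv: "X *v v = (SU j i. (?p j * A $ i $ j) *s vec_zbar Z i + (?q j * B $ i $ j) *s vec_z Z i)"
  by (subst v) (simp add: sv matrix_vector_right_distrib vector_scalar_commute X_zbar X_z vec.scale_sum_right sum.distrib)
 have F: "(SU \<mu>. h \<mu> * (X *v v) $ \<mu>) = (SU j i. (?p j * A $ i $ j) * (SU \<mu>. h \<mu> * vec_zbar Z i $ \<mu>) + (?q j * B $ i $ j) * (SU \<mu>. h \<mu> * vec_z Z i $ \<mu>))" for h
 proof -
  have "(SU \<mu>. h \<mu> * (X *v v) $ \<mu>) = (SU \<mu> j i. (?p j * A $ i $ j) * (h \<mu> * vec_zbar Z i $ \<mu>) + (?q j * B $ i $ j) * (h \<mu> * vec_z Z i $ \<mu>))"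
   unfolding Xv by (simp add: sum_distrib_left distrib_left mult_ac)
  also have "\<dots> = (SU j i \<mu>. (?p j * A $ i $ j) * (h \<mu> * vec_zbar Z i $ \<mu>) + (?q j * B $ i $ j) * (h \<mu> * vec_z Z i $ \<mu>))"
   by (subst sum.swap) (intro sum.cong refl sum.swap)
  finally show ?thesis by (simp add: sum.distrib sum_distrib_left)
 qed
 have if1: "c * (if P then 1 else 0) = (if P then c else 0)" for c :: complex and P by simp
 show "(SU \<mu>. cnj (Z (axis \<mu> 1) $ i) * (X *v v) $ \<mu>) = (SU j. A $ i $ j * (SU \<mu>. cnj (Z (axis \<mu> 1) $ j) * v $ \<mu>))"
  unfolding F dual_bases[OF linZ bijZ] if1 by (simp add: mult.commute)
 show "(SU \<mu>. Z (axis \<mu> 1) $ i * (X *v v) $ \<mu>) = (SU j. B $ i $ j * (SU \<mu>. Z (axis \<mu> 1) $ j * v $ \<mu>))"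
  unfolding F dual_bases[OF linZ bijZ] if1 by (simp add: mult.commute)
qed

lemma sum_X_\<Gamma>: "(SU \<mu>. h \<mu> * (X *v \<Gamma> a b) $ \<mu>) = (SU c. \<rho> $ c $ a * (SU \<mu>. h \<mu> * \<Gamma> c b $ \<mu>)) + (SU c. \<rho> $ c $ b * (SU \<mu>. h \<mu> * \<Gamma> a c $ \<mu>))"
proof -
 have 1: "(SU \<mu> c. h \<mu> * (r c * g c \<mu>)) = (SU c. r c * (SU \<mu>. h \<mu> * g c \<mu>))" for r :: "'s => complex" and g
  by (subst sum.swap) (simp add: sum_distrib_left mult_ac)
 show ?thesis unfolding X_\<Gamma> by (simp add: distrib_left sum.distrib sum_distrib_left 1[unfolded sum_distrib_left])
qed

text \<open>Invariance of the bracket in the components \<phi>: the terms with \<kappa> and \<tau>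
  balance by their known transformation laws, and the remainder is the law for \<beta>.\<close>

lemma \<beta>\<rho>: "(SU c. \<rho> $ c $ a * \<beta> i c b) + (SU c. \<beta> i a c * \<rho> $ c $ b) = (SU j. A $ i $ j * \<beta> j a b)"
proof -
 have E: "(SU c. \<rho> $ c $ a * (\<kappa> c * \<tau> i b + \<tau> i c * \<kappa> b - 2 * \<beta> i c b)) + (SU c. \<rho> $ c $ b * (\<kappa> a * \<tau> i c + \<tau> i a * \<kappa> c - 2 * \<beta> i a c))
   = (SU j. A $ i $ j * (\<kappa> a * \<tau> j b + \<tau> j a * \<kappa> b - 2 * \<beta> j a b))"
  using dual_X(1)[of i "\<Gamma> a b"] unfolding sum_X_\<Gamma> \<phi>_bracket .
 have 1: "(SU c. \<rho> $ c $ a * (\<kappa> c * \<tau> i b + \<tau> i c * \<kappa> b - 2 * \<beta> i c b)) =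
  w * \<kappa> a * \<tau> i b + ((SU j. A $ i $ j * \<tau> j a) - w * \<tau> i a) * \<kappa> b - 2 * (SU c. \<rho> $ c $ a * \<beta> i c b)"
  unfolding \<kappa>\<rho>[symmetric] \<tau>\<rho>[symmetric] by (simp add: sum_distrib_left sum_distrib_right sum.distrib sum_subtractf algebra_simps)
 have 2: "(SU c. \<rho> $ c $ b * (\<kappa> a * \<tau> i c + \<tau> i a * \<kappa> c - 2 * \<beta> i a c)) =
  \<kappa> a * ((SU j. A $ i $ j * \<tau> j b) - w * \<tau> i b) + \<tau> i a * (w * \<kappa> b) - 2 * (SU c. \<beta> i a c * \<rho> $ c $ b)"
  unfolding \<kappa>\<rho>[symmetric] \<tau>\<rho>[symmetric] by (simp add: sum_distrib_left sum_distrib_right sum.distrib sum_subtractf algebra_simps)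
 have 3: "(SU j. A $ i $ j * (\<kappa> a * \<tau> j b + \<tau> j a * \<kappa> b - 2 * \<beta> j a b)) =
  \<kappa> a * (SU j. A $ i $ j * \<tau> j b) + (SU j. A $ i $ j * \<tau> j a) * \<kappa> b - 2 * (SU j. A $ i $ j * \<beta> j a b)"
  by (simp add: sum_distrib_left sum_distrib_right sum.distrib sum_subtractf algebra_simps)
 have "2 * ((SU c. \<rho> $ c $ a * \<beta> i c b) + (SU c. \<beta> i a c * \<rho> $ c $ b)) = 2 * (SU j. A $ i $ j * \<beta> j a b)"
  using E unfolding 1 2 3 by (simp add: algebra_simps)
 thus ?thesis by (simp only: mult_cancel_left) simp
qed

text \<open>M is recovered by inserting t k into the bracket, since \<tau> is dual to t and M
  vanishes on t. Its transformation law thus follows from those of the bracket and of t.\<close>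

lemma M_bracket: "M i k a = (SU b. (SU \<mu>. Z (axis \<mu> 1) $ i * \<Gamma> a b $ \<mu>) * t k b)"
proof -
 have "(SU b. (SU j. M i j a * \<tau> j b + \<tau> j a * M i j b) * t k b)
   = (SU b j. M i j a * (\<tau> j b * t k b) + \<tau> j a * (M i j b * t k b))"
  by (simp only: sum_distrib_right distrib_right mult.assoc)
 also have "\<dots> = (SU j b. M i j a * (\<tau> j b * t k b) + \<tau> j a * (M i j b * t k b))" by (rule sum.swap)
 also have "\<dots> = (SU j. M i j a * (SU b. \<tau> j b * t k b) + \<tau> j a * (SU b. M i j b * t k b))"
  by (simp only: sum.distrib sum_distrib_left)
 also have "\<dots> = (SU j. if j = k then M i k a else 0)"
  unfolding \<tau>t Mt by (rule sum.cong) auto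
 finally show ?thesis unfolding \<psi>_bracket by simp
qed

lemma M\<rho>: "(SU c. M i k c * \<rho> $ c $ a) = (SU j. B $ i $ j * M j k a) - (SU l. A $ l $ k * M i l a) + w * M i k a"
proof -
 let ?f = "%i a b. SU \<mu>. Z (axis \<mu> 1) $ i * \<Gamma> a b $ \<mu>"
 have E: "(SU c. \<rho> $ c $ a * ?f i c b) + (SU c. \<rho> $ c $ b * ?f i a c) = (SU j. B $ i $ j * ?f j a b)" for b
  using dual_X(2)[of i "\<Gamma> a b"] unfolding sum_X_\<Gamma> .
 have 1: "(SU c. M i k c * \<rho> $ c $ a) = (SU b. (SU c. \<rho> $ c $ a * ?f i c b) * t k b)"
  unfolding M_bracket sum_distrib_right by (subst sum.swap) (simp add: sum_distrib_left sum_distrib_right mult_ac)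
 have 2: "(SU b. (SU c. \<rho> $ c $ b * ?f i a c) * t k b) = (SU l. A $ l $ k * M i l a) - w * M i k a"
 proof -
  have "(SU b. (SU c. \<rho> $ c $ b * ?f i a c) * t k b) = (SU c. ?f i a c * (SU b. \<rho> $ c $ b * t k b))"
  proof -
   have "(SU b. (SU c. R c b * F c) * T b) = (SU c. F c * (SU b. R c b * T b))" for R :: "'s => 's => complex" and F T
    unfolding sum_distrib_right sum_distrib_left by (subst sum.swap) (simp only: mult_ac)
   thus ?thesis .
  qed
  also have "\<dots> = (SU c l. A $ l $ k * (?f i a c * t l c)) - w * (SU c. ?f i a c * t k c)"
  proof -
   have "(SU c. F c * ((SU l. A l * T l c) - w * T' c)) = (SU c l. A l * (F c * T l c)) - w * (SU c. F c * T' c)"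
    for F T' :: "'s => complex" and A :: "'n => complex" and T w
    by (simp add: right_diff_distrib sum_subtractf sum_distrib_left mult_ac)
   thus ?thesis unfolding \<rho>t .
  qed
  also have "(SU c l. A $ l $ k * (?f i a c * t l c)) = (SU l. A $ l $ k * (SU c. ?f i a c * t l c))"
   by (subst sum.swap) (simp only: sum_distrib_left[of "A $ _ $ k"])
  finally show ?thesis unfolding M_bracket[symmetric] .
 qed
 have 3: "(SU b. (SU j. B $ i $ j * ?f j a b) * t k b) = (SU j. B $ i $ j * M j k a)"
 proof -
  have "(SU b. (SU j. C j * F j b) * T b) = (SU j. C j * (SU b. F j b * T b))" for C :: "'n => complex" and F and T :: "'s => complex"
   unfolding sum_distrib_right sum_distrib_left by (subst sum.swap) (simp only: mult_ac)
  thus ?thesis unfolding M_bracket .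
 qed
 have "(SU b. (SU c. \<rho> $ c $ a * ?f i c b) * t k b) + (SU b. (SU c. \<rho> $ c $ b * ?f i a c) * t k b)
   = (SU b. (SU j. B $ i $ j * ?f j a b) * t k b)"
  unfolding E[symmetric] distrib_right sum.distrib ..
 thus ?thesis unfolding 1[symmetric] 2 3 by (simp add: algebra_simps)
qed

section \<open>Invariance of the comparison map\<close>

abbreviation "ac \<equiv> act X \<rho> (- w)"

lemma Lin_form_sum: "Lin (%b. (SU j. c j * f j b) - z * g b) gen = (SU j. cst (c j) \<odot> Lin (f j) gen) - cst z \<odot> Lin g gen"
 by (simp add: Lin_gen_diff Lin_gen_sum Lin_gen_scale)

lemma linr_form_sum: "linr (%b. (SU j. c j * f j b) - z * g b) = (SU j. cst (c j) * linr (f j)) - cst z * (linr g :: ('d, 's) tpol)"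
 by (simp add: linr_def cst_diff cst_sum cst_mult left_diff_distrib sum_subtractf sum_distrib_left sum_distrib_right mult.assoc)
  (rule sum.swap)

lemma ac_basic:
 "ac th0 = - (cst w \<odot> th0)" "ac (th2 i) = - (SU j. cst (A $ i $ j) \<odot> th2 j) + cst w \<odot> th2 i"
 "ac (l2 i \<odot> 1) = - (SU j. cst (A $ i $ j) \<odot> (l2 j \<odot> 1)) + cst w \<odot> (l2 i \<odot> 1)"
 "ac (mT i k) = - (SU j. cst (B $ i $ j) \<odot> mT j k) + (SU l. cst (A $ l $ k) \<odot> mT i l) - cst w \<odot> mT i k"
 "ac (bLT i) = - (SU j. cst (A $ i $ j) \<odot> bLT j)"
 "ac (ui \<odot> x) = cst w \<odot> (ui \<odot> x) + ui \<odot> ac x"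
proof -
 show "ac th0 = - (cst w \<odot> th0)" unfolding th0_def act_Lin_gen \<kappa>\<rho> by (simp add: Lin_gen_scale)
 show "ac (th2 i) = - (SU j. cst (A $ i $ j) \<odot> th2 j) + cst w \<odot> th2 i"
  unfolding th2_def act_Lin_gen \<tau>\<rho> Lin_form_sum by simp
 show "ac (l2 i \<odot> 1) = - (SU j. cst (A $ i $ j) \<odot> (l2 j \<odot> 1)) + cst w \<odot> (l2 i \<odot> 1)"
  unfolding l2_def act_scalar actr_linr \<tau>\<rho> linr_form_sum by (simp add: scal_simps sum_scal)
 have "Lin (%b. (SU j. B $ i $ j * M j k b) - (SU l. A $ l $ k * M i l b) + w * M i k b) gen
  = (SU j. cst (B $ i $ j) \<odot> mT j k) - (SU l. cst (A $ l $ k) \<odot> mT i l) + cst w \<odot> mT i k"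
  by (simp add: Lin_gen_diff Lin_gen_add Lin_gen_sum Lin_gen_scale mT_def)
 thus "ac (mT i k) = - (SU j. cst (B $ i $ j) \<odot> mT j k) + (SU l. cst (A $ l $ k) \<odot> mT i l) - cst w \<odot> mT i k"
  unfolding mT_def act_Lin_gen M\<rho> by simp
 have "bil (%a b. SU j. A $ i $ j * \<beta> j a b) lamr gen = (SU j. cst (A $ i $ j) \<odot> bLT j)"
  unfolding bLT_def bil_def Lin_gen_sum Lin_gen_scale scal_sum by (subst sum.swap) (simp add: scal_left_commute[of "lamr _"])
 thus "ac (bLT i) = - (SU j. cst (A $ i $ j) \<odot> bLT j)"
  unfolding bLT_def act_bil_gen \<beta>\<rho> by simp
 show "ac (ui \<odot> x) = cst w \<odot> (ui \<odot> x) + ui \<odot> ac x"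
  by (subst a.scal) (simp add: act_scalar act_u cst_minus scal_mult_left scal_simps(7))
qed

lemma ac_scal_l2: "ac (l2 i \<odot> x) = - (SU j. cst (A $ i $ j) \<odot> (l2 j \<odot> x)) + cst w \<odot> (l2 i \<odot> x) + l2 i \<odot> ac x"
 by (subst a.scal) (simp add: ac_basic distrib_right left_diff_distrib sum_distrib_right scal_mult_left)

text \<open>In bLT and in l2 th0 the twists by w cancel, and the factor \<open>ui\<close> in front
  supplies the twist that th2 carries, so the three parts of \<eta> transform alike.\<close>

lemma ac_eta: "ac (\<eta> i) = - (SU j. cst (A $ i $ j) \<odot> \<eta> j) + cst w \<odot> \<eta> i"
proof -
 have "ac (\<eta> i) = - (SU j. cst (A $ i $ j) \<odot> th2 j) + cst w \<odot> th2 i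
  + (cst w \<odot> (ui \<odot> (bLT i - l2 i \<odot> th0)) + ui \<odot> (- (SU j. cst (A $ i $ j) \<odot> bLT j)
   - (- (SU j. cst (A $ i $ j) \<odot> (l2 j \<odot> th0)) + cst w \<odot> (l2 i \<odot> th0) - l2 i \<odot> (cst w \<odot> th0))))"
  unfolding \<eta>_def a.add ac_basic a.diff ac_scal_l2 by (simp add: scal_simps(5))
 also have "\<dots> = - (SU j. cst (A $ i $ j) \<odot> \<eta> j) + cst w \<odot> \<eta> i"
  unfolding \<eta>_def scal_left_commute[of "l2 i" "cst w"]
  by (simp add: scal_simps(1,3,5) scal_sum sum.distrib sum_subtractf scal_left_commute[of ui "cst _"] algebra_simps)
 finally show ?thesis .
qed

lemma ac_H_L: "ac (H_L i) = - (SU j. cst (A $ i $ j) \<odot> H_L j)"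
 unfolding H_L_def act_cst a.mult twist_simps ac_basic
 by (simp add: distrib_left right_diff_distrib sum_distrib_left scal_mult_left scal_mult_right scal_simps(1,3,5) scal_sum scal_left_commute[of "cst (- (1/2))"] sum_negf)

lemma AC_swap: "(SU j l. cst (A $ l $ j) \<odot> f l j) = (SU j l. cst (A $ j $ l) \<odot> f j l)"
 by (rule sum.swap)

text \<open>In each term the twists by w of th0, th2, l2, mT and ui add up to 0, and the index k is
  contracted between dual representations; only the action of B on i remains.\<close>

lemma ac_H_R: "ac (H_R i) = - (SU j. cst (B $ i $ j) \<odot> H_R j)"
proof -
 have B: "(SU k j. cst (B $ i $ j) \<odot> f j k) = (SU j. cst (B $ i $ j) \<odot> (SU k. f j k))" for f :: "'n => 'n => ('d, 's) tfield"
  unfolding scal_sum by (rule sum.swap)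
 have 1: "ac (SU k. mT i k * th2 k) = - (SU j. cst (B $ i $ j) \<odot> (SU k. mT j k * th2 k))"
 proof -
  have "ac (mT i k * th2 k) = - (SU j. cst (B $ i $ j) \<odot> (mT j k * th2 k)) + (SU l. cst (A $ l $ k) \<odot> (mT i l * th2 k)) - (SU l. cst (A $ k $ l) \<odot> (mT i k * th2 l))" for k
   unfolding a.mult twist_simps ac_basic
   by (simp add: distrib_left distrib_right left_diff_distrib sum_distrib_left sum_distrib_right scal_mult_left scal_mult_right algebra_simps)
  thus ?thesis unfolding a.sum by (simp add: sum.distrib sum_subtractf sum_negf B AC_swap[of "%l k. mT i l * th2 k"])
 qed
 have 2: "ac (SU k. ui \<odot> (l2 k \<odot> (th0 * mT i k))) = - (SU j. cst (B $ i $ j) \<odot> (SU k. ui \<odot> (l2 k \<odot> (th0 * mT j k))))"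
 proof -
  let ?g = "%c. ui \<odot> c" 
  have "ac (ui \<odot> (l2 k \<odot> (th0 * mT i k))) = - (SU j. cst (B $ i $ j) \<odot> (ui \<odot> (l2 k \<odot> (th0 * mT j k))))
   + (SU l. cst (A $ l $ k) \<odot> (ui \<odot> (l2 k \<odot> (th0 * mT i l)))) - (SU l. cst (A $ k $ l) \<odot> (ui \<odot> (l2 l \<odot> (th0 * mT i k))))" for k
  proof -
   have F: "ac (th0 * mT i k) = - (SU j. cst (B $ i $ j) \<odot> (th0 * mT j k)) + (SU l. cst (A $ l $ k) \<odot> (th0 * mT i l)) - cst w \<odot> (th0 * mT i k) - cst w \<odot> (th0 * mT i k)"
    unfolding a.mult twist_simps ac_basic
    by (simp add: distrib_left right_diff_distrib sum_distrib_left scal_mult_left scal_mult_right algebra_simps)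
   show ?thesis unfolding ac_basic ac_scal_l2 F
    by (simp add: scal_simps(1,3,5) scal_sum scal_left_commute[of ui "cst _"] scal_left_commute[of "l2 _" "cst _"] algebra_simps)
  qed
  thus ?thesis unfolding a.sum by (simp add: sum.distrib sum_subtractf sum_negf B AC_swap[of "%l k. ui \<odot> (l2 k \<odot> (th0 * mT i l))"])
 qed
 have 3: "ac (SU k. ui \<odot> (mT i k * bLT k)) = - (SU j. cst (B $ i $ j) \<odot> (SU k. ui \<odot> (mT j k * bLT k)))"
 proof -
  have "ac (ui \<odot> (mT i k * bLT k)) = - (SU j. cst (B $ i $ j) \<odot> (ui \<odot> (mT j k * bLT k)))
   + (SU l. cst (A $ l $ k) \<odot> (ui \<odot> (mT i l * bLT k))) - (SU l. cst (A $ k $ l) \<odot> (ui \<odot> (mT i k * bLT l)))" for k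
  proof -
   have F: "ac (mT i k * bLT k) = - (SU j. cst (B $ i $ j) \<odot> (mT j k * bLT k)) + (SU l. cst (A $ l $ k) \<odot> (mT i l * bLT k)) - cst w \<odot> (mT i k * bLT k) - (SU l. cst (A $ k $ l) \<odot> (mT i k * bLT l))"
    unfolding a.mult twist_simps ac_basic
    by (simp add: distrib_right left_diff_distrib sum_distrib_left sum_distrib_right scal_mult_left scal_mult_right algebra_simps)
   show ?thesis unfolding ac_basic F
    by (simp add: scal_simps(1,3,5) scal_sum scal_left_commute[of ui "cst _"] algebra_simps)
  qed
  thus ?thesis unfolding a.sum by (simp add: sum.distrib sum_subtractf sum_negf B AC_swap[of "%l k. ui \<odot> (mT i l * bLT k)"])
 qed
 have e: "H_R i = cst (-1/2) \<odot> (SU k. mT i k * th2 k) - ((SU k. ui \<odot> (l2 k \<odot> (th0 * mT i k))) + cst (2/3) \<odot> (SU k. ui \<odot> (mT i k * bLT k)))" for i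
  by (simp add: H_R_def scal_simps(1) scal_sum sum.distrib scal_left_commute[of ui "cst (2/3)"])
 show ?thesis unfolding e a.diff a.add act_cst 1 2 3
  by (simp add: scal_simps(1,3,5) scal_sum sum.distrib sum_subtractf scal_left_commute[of "cst (- (1/2))" "cst (B $ _ $ _)"] scal_left_commute[of "cst (2/3)" "cst (B $ _ $ _)"])
qed

lemma pdir_X: "pdir (X *v vec_zbar Z j) x = (SU i. cst (A $ i $ j) \<odot> pdir (vec_zbar Z i) x)"
 "pdir (X *v vec_z Z j) x = (SU i. cst (B $ i $ j) \<odot> pdir (vec_z Z i) x)"
 unfolding X_zbar X_z pdir_def scal_sum
 by (subst sum.swap, simp add: cst_sum cst_mult sum_scal scal_simps(7))+

text \<open>H_L and H_R transform dually to the derivatives along \<open>vec_zbar\<close> and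
  \<open>vec_z\<close> with which N contracts them.\<close>

lemma ac_N: "ac (N x) = N (ac x)"
proof -
 have N: "N y = (SU i. H_L i * pdir (vec_zbar Z i) y) + (SU i. H_R i * pdir (vec_z Z i) y)" for y
  by (simp add: N_def sum_Inl_Inr H_def evec_def)
 have p: "ac (pdir v y) = pdir v (ac y) + pdir (X *v v) y" for v y
  using act_pdir[of X \<rho> "- w" v y] by (simp add: algebra_simps)
 have s: "(SU i j. cst (C $ i $ j) \<odot> (h j * g i)) = (SU i j. cst (C $ j $ i) \<odot> (h i * g j))"
  for C :: "complex^'n^'n" and h g :: "'n => ('d, 's) tfield" by (rule sum.swap)
 have 1: "(SU i. ac (H_L i * pdir (vec_zbar Z i) x)) = (SU i. H_L i * pdir (vec_zbar Z i) (ac x))"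
  unfolding a.mult twist_simps ac_H_L p pdir_X
  using s[of A H_L "%i. pdir (vec_zbar Z i) x"]
  by (simp add: distrib_left sum.distrib sum_subtractf sum_distrib_left sum_distrib_right scal_mult_left scal_mult_right sum_negf)
 have 2: "(SU i. ac (H_R i * pdir (vec_z Z i) x)) = (SU i. H_R i * pdir (vec_z Z i) (ac x))"
  unfolding a.mult twist_simps ac_H_R p pdir_X
  using s[of B H_R "%i. pdir (vec_z Z i) x"]
  by (simp add: distrib_left sum.distrib sum_subtractf sum_distrib_left sum_distrib_right scal_mult_left scal_mult_right sum_negf)
 show ?thesis unfolding N a.add a.sum 1 2 ..
qed

lemma ac_E: "ac (E x) = E (ac x)"
proof -
 have "ac (Np k x) = Np k (ac x)" for k by (induction k) (simp_all add: act_cst ac_N)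
 thus ?thesis by (simp add: E_def a.sum)
qed

lemma ac_function: "- (SU \<mu> \<nu>. cfun (X $ \<mu> $ \<nu>) * (coordf \<nu> * pds (axis \<mu> 1) (pull Z f))) = pull Z (dfun A B w 0 f)"
proof (rule fun_of_eqI)
 fix x :: "real^'d"
 let ?x = "\<chi> \<mu>. complex_of_real (x $ \<mu>)"
 let ?g = "%\<mu>. pd (axis \<mu> 1) (fun_of (pull Z f)) x"
 have Zx: "(SU \<mu>. Z (axis \<mu> 1) $ i * ?x $ \<mu>) = Z x $ i" for i
  using linear_coordinates[OF linZ, of x i] by (simp add: mult.commute)
 have Zc: "(SU \<mu>. cnj (Z (axis \<mu> 1) $ i) * ?x $ \<mu>) = cnj (Z x $ i)" for i
  using arg_cong[OF Zx[of i], of cnj] by (simp add: cnj_sum)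
 have fs: "fun_of (sum h S) y = (\<Sum>i\<in>S. fun_of (h i) y)" for h :: "'d => (real^'d) sfun" and S y by (rule fun_of_sum)
 have dz: "(SU \<mu>. vec_zbar Z i $ \<mu> * ?g \<mu>) = d_zbar i (fun_of f) (Z x)" "(SU \<mu>. vec_z Z i $ \<mu> * ?g \<mu>) = d_z i (fun_of f) (Z x)" for i
  using arg_cong[OF vec_zbar_derivative(1)[OF linZ bijZ, of i f], of "%f. fun_of f x"] arg_cong[OF vec_zbar_derivative(2)[OF linZ bijZ, of i f], of "%f. fun_of f x"]
  by (simp_all add: fs times_sfun.rep_eq pds.rep_eq fun_of_pull[OF linZ] fun_of_szb)
 have Xx: "(X *v ?x) $ \<mu> = (SU i. (SU j. A $ i $ j * cnj (Z x $ j)) * vec_zbar Z i $ \<mu> + (SU j. B $ i $ j * Z x $ j) * vec_z Z i $ \<mu>)" for \<mu>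
 proof -
  have "(X *v ?x) $ \<mu> = (SU \<nu>. (if \<mu> = \<nu> then 1 else 0) * (X *v ?x) $ \<nu>)"
   by (simp add: if_distrib[of "%c. c * _"] cong: if_cong)
  also have "\<dots> = (SU \<nu> i. (vec_zbar Z i $ \<mu> * cnj (Z (axis \<nu> 1) $ i) + vec_z Z i $ \<mu> * Z (axis \<nu> 1) $ i) * (X *v ?x) $ \<nu>)"
   unfolding complete[symmetric] by (simp add: sum_distrib_right)
  also have "\<dots> = (SU i. vec_zbar Z i $ \<mu> * (SU \<nu>. cnj (Z (axis \<nu> 1) $ i) * (X *v ?x) $ \<nu>) + vec_z Z i $ \<mu> * (SU \<nu>. Z (axis \<nu> 1) $ i * (X *v ?x) $ \<nu>))"
   by (subst sum.swap) (simp add: distrib_right sum.distrib sum_distrib_left mult.assoc)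
  finally show ?thesis unfolding dual_X Zx Zc by (simp add: mult.commute)
 qed
 have "fun_of (- (SU \<mu> \<nu>. cfun (X $ \<mu> $ \<nu>) * (coordf \<nu> * pds (axis \<mu> 1) (pull Z f)))) x = - (SU \<mu>. (X *v ?x) $ \<mu> * ?g \<mu>)"
  by (simp add: fs uminus_sfun.rep_eq times_sfun.rep_eq pds.rep_eq fun_of_coordf matrix_vector_mult_def sum_distrib_right mult.assoc)
 also have "(SU \<mu>. (X *v ?x) $ \<mu> * ?g \<mu>) = (SU i. (SU j. A $ i $ j * cnj (Z x $ j)) * (SU \<mu>. vec_zbar Z i $ \<mu> * ?g \<mu>) + (SU j. B $ i $ j * Z x $ j) * (SU \<mu>. vec_z Z i $ \<mu> * ?g \<mu>))"
  unfolding Xx sum_distrib_right[of _ _ "?g _"] by (subst sum.swap) (simp only: distrib_right sum.distrib sum_distrib_left mult.assoc)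
 also have "- \<dots> = fun_of (pull Z (dfun A B w 0 f)) x"
 proof -
  have c: "fun_of (Sfun (%z :: complex^'n. cnj (z $ j))) = (%z. cnj (z $ j))" "fun_of (Sfun (%z :: complex^'n. z $ j)) = (%z. z $ j)" for j
   by (rule Sfun_inverse, simp, rule smooth_bounded_linear, intro bounded_linear_compose[OF bounded_linear_cnj] bounded_linear_vec_nth)+
  show ?thesis unfolding dz
   by (simp add: dfun_def fun_of_pull[OF linZ] fun_of_sum uminus_sfun.rep_eq minus_sfun.rep_eq times_sfun.rep_eq c fun_of_szb sum.distrib sum_distrib_right mult.assoc)
 qed
 finally show "fun_of (- (SU \<mu> \<nu>. cfun (X $ \<mu> $ \<nu>) * (coordf \<nu> * pds (axis \<mu> 1) (pull Z f)))) x = fun_of (pull Z (dfun A B w 0 f)) x" .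
qed

lemma actr_jD: "actr X \<rho> (- w) (jD c) = jD (dactr A B w c)"
proof (induction c rule: pm_induct)
 case (single k f)
 have s: "(\<Sum>\<mu>\<in>S. single e (h \<mu>)) = single e (sum h S)" for S e and h :: "'d => (real^'d) sfun"
  by (rule poly_mapping_eqI) (simp add: lookup_sum lookup_single when_def)
 have ci: "cfun (of_int k) = (of_int k :: (real^'d) sfun)"
 proof -
  have "cfun (of_nat n) = (of_nat n :: (real^'d) sfun)" for n by (induction n) (simp_all add: cfun_add)
  thus ?thesis by (cases k) (simp_all add: cfun_minus cfun_diff)
 qed
 have "actr X \<rho> (- w) (single (0, k) (pull Z f)) = single (0, k) (- (SU \<mu> \<nu>. cfun (X $ \<mu> $ \<nu>) * (coordf \<nu> * pds (axis \<mu> 1) (pull Z f))) + cfun (- w) * (of_int k * pull Z f))"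
  by (simp add: actr_def cst_def mult_single udeg_single s single_uminus[symmetric] single_add[symmetric])
 also have "\<dots> = single (0, k) (pull Z (dfun A B w 0 f) + pull Z (- (cfun (w * of_int k) * f)))"
 proof -
  have m: "pull Z (- g) = - pull Z g" for g by (rule fun_of_eqI) (simp add: fun_of_pull[OF linZ] uminus_sfun.rep_eq)
  show ?thesis unfolding ac_function m pull_simps(3,4)[OF linZ] by (simp add: cfun_minus cfun_mult ci mult.assoc)
 qed
 also have "pull Z (dfun A B w 0 f) + pull Z (- (cfun (w * of_int k) * f)) = pull Z (dfun A B w k f)"
  unfolding pull_simps(2)[OF linZ, symmetric] by (simp add: dfun_def)
 finally show ?case by (simp add: jD_simps dactr_single)
next
 case (add c d)
 thus ?case using derivation_actr[of X \<rho> "- w"] by (simp add: jD_simps dactr_add derivation_def)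
qed

lemma ac_\<Phi>0: "ac (\<Phi>0 x) = \<Phi>0 (dact A B w x)"
proof -
 have d: "dact A B w x = coefwise (dactr A B w) x - (SU i j. cst (A $ i $ j) \<odot> (gen j * odd_deriv i x))
  + cst w \<odot> (SU i. gen i * odd_deriv i x)" for x
 proof -
  \<comment> \<open>The twist by card J is not visibly a derivation; the number operator writes it
    as one.\<close>
  have n: "(SU i. gen i * odd_deriv i y) = Ext (%J. of_nat (card J) * coef y J)" for y :: "'n dfield"
  proof -
   have "(SU i. gen i * odd_deriv i (emono J)) = of_nat (card J) \<odot> (emono J :: 'n dfield)" for J
   proof -
    have "gen i * odd_deriv i (emono J) = (if i : J then emono J else (0 :: 'n dfield))" for i
    proof -
     have "odd_deriv i (emono J) = (if i : J then ssign {i} (J - {i}) \<odot> emono (J - {i}) else (0 :: 'n dfield))"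
      by (rule ext_eqI) (auto simp: coef_odd_deriv insert_Diff_if)
     thus ?thesis by (auto simp: scal_mult_right gen_mult_emono scal_simps(7) ssign_square insert_absorb)
    qed
    hence "(SU i. gen i * odd_deriv i (emono J)) = (SU i. if i : J then emono J else (0 :: 'n dfield))" by simp
    also have "\<dots> = (\<Sum>i\<in>J. emono J)" by (simp add: sum.If_cases)
    also have "\<dots> = of_nat (card J) \<odot> emono J" by (rule ext_eqI) (simp del: sum_constant add: coef_sum, simp)
    finally show ?thesis .
   qed
   hence "(SU i. gen i * odd_deriv i (SU J. coef y J \<odot> emono J)) = (SU J. (coef y J * of_nat (card J)) \<odot> emono J)"
    by (simp add: odd_deriv_sum sum_distrib_left scal_mult_right scal_simps(7)[symmetric] scal_sum[symmetric])
     (subst sum.swap, simp add: scal_sum[symmetric])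
   also have "\<dots> = Ext (%J. of_nat (card J) * coef y J)"
    using ext_expand[of "Ext (%J. of_nat (card J) * coef y J)"] by (simp add: mult.commute)
   finally show ?thesis unfolding ext_expand[symmetric] .
  qed
  show ?thesis unfolding n by (rule ext_eqI) (simp add: dact_def coef_sum cst_mult cst_of_nat)
 qed
 have go: "sderiv False (%x. gen j * odd_deriv i x :: 'n dfield)" for i j
  using sderiv_left_mult[OF sderiv_odd_deriv, of "gen j" True] by simp
 have "sderiv False (%x. coefwise (dactr A B w) x + - (SU i j. cst (A $ i $ j) \<odot> (gen j * odd_deriv i x)) + cst w \<odot> (SU i. gen i * odd_deriv i x))"
  by (intro sderiv_add sderiv_uminus sderiv_sum sderiv_scal sderiv_coefwise derivation_dactr go)
 hence "sderiv False (dact A B w)" unfolding d by simp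
 then interpret d: sderiv False "dact A B w" .
 have g: "dact A B w (gen k) = - (SU j. cst (A $ k $ j) \<odot> gen j) + cst w \<odot> gen k" for k
 proof -
  have "(SU i j. cst (A $ i $ j) \<odot> (gen j * odd_deriv i (gen k))) = (SU i. if i = k then SU j. cst (A $ k $ j) \<odot> gen j else (0 :: 'n dfield))"
   by (rule sum.cong) (auto simp: odd_deriv_gen)
  moreover have "(SU i. gen i * odd_deriv i (gen k)) = (SU i. if i = k then gen k else (0 :: 'n dfield))"
   by (rule sum.cong) (auto simp: odd_deriv_gen)
  ultimately show ?thesis unfolding d by (simp add: coefwise_emono[OF derivation_dactr])
 qed
 have jc: "jD (cst c) = cst c" for c by (simp add: cst_def jD_simps pull_simps[OF linZ] zero_prod_def)
 have ge: "ac (\<eta> k) = \<Phi>0 (dact A B w (gen k))" for k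
 proof -
  have m: "\<Phi>0 (- y) = - \<Phi>0 y" for y using \<Phi>0_diff[of 0 y] \<Phi>0_simps(1)[of 0 0] by simp
  show ?thesis unfolding g ac_eta by (simp add: \<Phi>0_simps \<Phi>0_diff m jc)
 qed
 show ?thesis
 proof (induction x rule: ext_induct)
  case (scalar c)
  have "dact A B w (c \<odot> 1) = dactr A B w c \<odot> 1"
   unfolding d by (simp add: coefwise_scal_one derivation_zero[OF derivation_dactr])
  thus ?case by (simp add: \<Phi>0_simps act_scalar actr_jD)
 qed (simp_all add: a.mult a.add d.mult d.add \<Phi>0_simps ge)
qed

lemma ac_\<Phi>: "ac (\<Phi> x) = \<Phi> (dact A B w x)"
 by (simp add: \<Phi>_def ac_E ac_\<Phi>0)

lemma ac_I: "x : I ==> ac x : I"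
proof (rule sderiv_I[OF sderiv_act])
 fix \<mu>
 have C: "rel \<nu> = bilr (%a b. \<Gamma> a b $ \<nu>)" for \<nu> by (simp add: rel_def)
 have e: "(SU c. \<rho> $ c $ a * \<Gamma> c b $ \<mu>) + (SU c. \<Gamma> a c $ \<mu> * \<rho> $ c $ b) = (SU \<nu>. X $ \<mu> $ \<nu> * \<Gamma> a b $ \<nu>)" for a b
  using arg_cong[OF X_\<Gamma>[of a b], of "%v. v $ \<mu>"] by (simp add: matrix_vector_mult_def mult.commute)
 have "actr X \<rho> (- w) (rel \<mu>) = - (SU \<nu>. cst (X $ \<mu> $ \<nu>) * rel \<nu>)"
 proof -
  have ll: "actr X \<rho> (- w) (lamr a) = - (SU b. cst (\<rho> $ a $ b) * lamr b)" for a
  proof -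
   have "linr (%b. if b = a then 1 else 0) = (SU b. if b = a then lamr a else (0 :: ('d, 's) tpol))"
    unfolding linr_def by (rule sum.cong) auto
   moreover have "(SU c. (if c = a then 1 else 0) * \<rho> $ c $ b) = \<rho> $ a $ b" for b
    by (simp add: if_distrib[of "%x. x * _"] cong: if_cong)
   ultimately show ?thesis using actr_linr[of X \<rho> "- w" "%b. if b = a then 1 else 0"] by (simp add: linr_def)
  qed
  have "actr X \<rho> (- w) (bilr \<gamma>) = - bilr (%a b. (SU c. \<rho> $ c $ a * \<gamma> c b) + (SU c. \<gamma> a c * \<rho> $ c $ b))" for \<gamma>
  proof -
   have "actr X \<rho> (- w) (bilr \<gamma>) = (SU a. actr X \<rho> (- w) (lamr a) * linr (\<gamma> a) + lamr a * actr X \<rho> (- w) (linr (\<gamma> a)))"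
    using derivation_actr[of X \<rho> "- w"] unfolding bilr_def derivation_sum[OF derivation_actr] by (simp add: derivation_def)
   also have "\<dots> = - ((SU a c. cst (\<rho> $ a $ c) * lamr c * linr (\<gamma> a)) + (SU a. lamr a * linr (%b. SU c. \<gamma> a c * \<rho> $ c $ b)))"
    unfolding ll actr_linr by (simp add: sum_distrib_right sum.distrib sum_negf sum_subtractf)
   also have "(SU a c. cst (\<rho> $ a $ c) * lamr c * linr (\<gamma> a)) = (SU c. lamr c * (SU a. cst (\<rho> $ a $ c) * linr (\<gamma> a)))"
    by (subst sum.swap) (simp add: sum_distrib_left mult_ac)
   finally show ?thesis unfolding linr_sum bilr_add by (simp add: bilr_def)
  qed
  thus ?thesis unfolding C bilr_sum e by (simp only: e)
 qed
 hence "ac (rel \<mu> \<odot> 1) = (- (SU \<nu>. cst (X $ \<mu> $ \<nu>) * rel \<nu>)) \<odot> 1" by (simp add: act_scalar)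
 thus "ac (rel \<mu> \<odot> 1) : I" by (simp only:) (intro I_Ir Ir_uminus Ir_sum Ir_mult Ir_rel)
qed

end

end

subsection \<open>Passage to the algebras of superfields\<close>

lemma lookup_fun_mult: "lookup (single 0 f * c) e = f * lookup c e"
 for c :: "'e::comm_monoid_add \<Rightarrow>\<^sub>0 'x::euclidean_space sfun"
 by (induction c rule: pm_induct) (auto simp: mult_single lookup_single when_def distrib_left lookup_add)

lemma fun_of_of_nat: "fun_of (of_nat n) = (%_. of_nat n)"
 by (induction n) (simp_all add: fun_of_zero plus_sfun.rep_eq one_sfun.rep_eq)

lemma fun_of_of_int: "fun_of (of_int k) = (%_. of_int k)"
 by (cases k) (simp_all add: fun_of_of_nat uminus_sfun.rep_eq minus_sfun.rep_eq one_sfun.rep_eq plus_sfun.rep_eq)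

lemma raw_fun: "raw (single 0 f \<odot> x) = (%J e z. fun_of f z * raw x J e z)"
 by (simp add: raw_def lookup_fun_mult times_sfun.rep_eq)

lemma raw_cst: "raw (cst c \<odot> x) = (%J e z. c * raw x J e z)"
 by (simp add: cst_def raw_fun cfun.rep_eq)

lemma raw_single: "raw (single e f \<odot> x) = sf_mult (mono {} e (fun_of f)) (raw x)"
proof -
 have "raw ((single e f \<odot> emono {}) * x) = sf_mult (mono {} e (fun_of f)) (raw x)"
  unfolding raw_mult raw_mono ..
 thus ?thesis by (simp add: scal_mult_left)
qed

lemma raw_gen: "raw (gen b * x) = sf_mult (mono {b} 0 (%_. 1)) (raw x)"
proof -
 have "raw ((single 0 1 \<odot> gen b) * x) = sf_mult (mono {b} 0 (fun_of 1)) (raw x)"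
  unfolding raw_mult raw_mono ..
 thus ?thesis by (simp add: one_sfun.rep_eq)
qed

lemma raw_single_one: "raw (single e f \<odot> 1) = mono {} e (fun_of f)"
 using raw_mono[of e f "{}"] by simp

lemma raw_one: "raw 1 = mono {} 0 (%_. 1)"
 using raw_single_one[of 0 1] by (simp add: one_sfun.rep_eq)

lemma superfields_ops:
 "carrier (superfields deg u d) = range raw"
 "raw x \<oplus>\<^bsub>superfields deg u d\<^esub> raw y = raw (x + y)"
 "raw x \<otimes>\<^bsub>superfields deg u d\<^esub> raw y = raw (x * y)"
 "\<one>\<^bsub>superfields deg u d\<^esub> = raw 1"
 "\<zero>\<^bsub>superfields deg u d\<^esub> = raw 0"
 "fn (superfields deg u d) (fun_of f) = raw (single 0 f \<odot> 1)"
 "par (superfields deg u d) = raw (single u 1 \<odot> 1)"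
 "dif (superfields deg u d) = d"
 by (simp_all add: superfields_def raw_add raw_mult raw_zero range_raw raw_single_one raw_one one_sfun.rep_eq)

lemma raw_graded: "raw ` graded deg A = {f : range raw. \<forall>(J, e)\<in>sf_supp f. (int (card J), deg e) : A}"
 by (auto simp: sf_supp_raw graded_def)

lemma superfields_gradings:
 "bideg (superfields deg u d) i s = raw ` graded deg {(j, i'). i' = i \<and> odd (j + i') = s}"
 "filt (superfields deg u d) k = raw ` graded deg {(i, j). i + j \<ge> k}"
 by (simp_all add: superfields_def Let_def range_raw raw_graded)

lemma ring_superfields: "ring (superfields deg u d)" (is "ring ?R")
proof (rule ringI)
 show "abelian_group ?R"
 proof (rule abelian_groupI)
  fix x assume "x : carrier ?R"
  then obtain y where "x = raw y" by (auto simp: superfields_ops)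
  thus "\<exists>z\<in>carrier ?R. z \<oplus>\<^bsub>?R\<^esub> x = \<zero>\<^bsub>?R\<^esub>"
   by (intro bexI[of _ "raw (- y)"]) (simp_all add: superfields_ops)
 qed (auto simp: superfields_ops add_ac)
 show "monoid ?R" by (rule monoidI) (auto simp: superfields_ops mult.assoc)
qed (auto simp: superfields_ops algebra_simps)

lemma dol_loc_eq: "dol_loc = superfields id 1 dol_dif" by (rule dol_loc_def)

lemma tsf_eq: "tsf \<Gamma> Q = superfields tdeg (0, 1) (tsf_dif \<Gamma> Q)"
 by (simp add: tsf_def tdeg_def)

lemma dol_dif_raw: "dol_dif (raw x) = raw (dbar (x :: 'n::finite dfield))"
proof -
 have "lookup (pzb i c) k = szb i (lookup c k)" for i and c :: "'n dpoly" and k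
  by (induction c rule: pm_induct) (auto simp: pzb_add pzb_single lookup_single when_def lookup_add szb_add szb_zero)
 hence "raw (dzb i x) = (%J k. d_zbar i (raw x J k))" for i
  by (simp add: raw_def dzb_def fun_of_szb)
 moreover have "raw (ud \<odot> (gen i * y)) = sf_mult (mono {i} 1 (%_. 1)) (raw y)" for i and y :: "'n dfield"
 proof -
  have "raw ((ud \<odot> gen i) * y) = sf_mult (mono {i} 1 (fun_of 1)) (raw y)"
   unfolding raw_mult ud_def raw_mono ..
  thus ?thesis by (simp add: scal_mult_left one_sfun.rep_eq)
 qed
 ultimately show ?thesis by (simp add: dol_dif_def dbar_def raw_sum)
qed

lemma tsf_dif_raw: "tsf_dif \<Gamma> Q (raw x) = raw (susy_dif \<Gamma> Q x)"
proof -
 let ?B = "%a. SU b \<mu>. cst (\<Gamma> a b $ \<mu>) \<odot> (gen b * partial (axis \<mu> 1) x)"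
 have pd: "tsf_pd \<mu> (raw x) = raw (partial (axis \<mu> 1) x)" for \<mu> by (simp add: tsf_pd_def raw_partial)
 have 1: "raw (?B a) = (%J e z. SU b \<mu>. \<Gamma> a b $ \<mu> * sf_mult (th b) (tsf_pd \<mu> (raw x)) J e z)" for a
  unfolding pd th_def by (simp add: raw_sum raw_cst raw_gen)
 have "vf_R \<Gamma> a (raw x) = raw (odd_deriv a x - cst (1/2) \<odot> ?B a)" "vf_L \<Gamma> a (raw x) = raw (odd_deriv a x + cst (1/2) \<odot> ?B a)" for a
  unfolding vf_R_def vf_L_def raw_diff raw_add raw_cst 1 raw_odd_deriv by simp_all
 thus ?thesis
  unfolding tsf_dif_def susy_dif_def lam_def uu_def
  by (simp add: raw_add raw_sum scal_simps(7)[symmetric] raw_cst lamr_def ur_def raw_single one_sfun.rep_eq)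
qed

lemma tsf_act_raw: "tsf_act X \<rho> w (raw x) = raw (act X \<rho> w x)"
proof -
 have e: "act X \<rho> w x = - (SU \<mu> \<nu>. cst (X $ \<mu> $ \<nu>) \<odot> (single 0 (coordf \<nu>) \<odot> partial (axis \<mu> 1) x))
  - (SU a b. cst (\<rho> $ a $ b) \<odot> (gen b * odd_deriv a x))
  - (SU a b. cst (\<rho> $ a $ b) \<odot> (lamr b \<odot> coefwise (ldp a) x)) + cst w \<odot> coefwise udeg x"
  by (rule ext_eqI) (simp add: act_def actr_def coef_sum)
 have "raw (coefwise (ldp a) x) = lam_deriv a (raw x)" for a
  by (auto simp: raw_def lam_deriv_def fun_eq_iff lookup_ldp times_sfun.rep_eq plus_sfun.rep_eq one_sfun.rep_eq fun_of_of_nat algebra_simps)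
 moreover have "raw (coefwise udeg x) = (%J e z. of_int (snd e) * raw x J e z)"
  by (simp add: raw_def lookup_udeg times_sfun.rep_eq fun_of_of_int)
 ultimately show ?thesis
  unfolding e tsf_act_def tsf_pd_def th_def lam_def raw_add raw_diff raw_uminus raw_sum raw_cst raw_fun
  by (simp add: raw_gen raw_partial raw_odd_deriv fun_of_coordf lamr_def raw_single one_sfun.rep_eq mult.assoc)
qed

lemma dol_act_raw: "dol_act a b (raw x) = raw (dact a b (trace a / 2) (x :: 'n::finite dfield))"
proof -
 have c: "fun_of (Sfun (%z :: complex^'n. cnj (z $ j))) = (%z. cnj (z $ j))" "fun_of (Sfun (%z :: complex^'n. z $ j)) = (%z. z $ j)" for j :: 'n
  by (rule Sfun_inverse, simp, rule smooth_bounded_linear, intro bounded_linear_compose[OF bounded_linear_cnj] bounded_linear_vec_nth)+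
 have "lookup (cst z * p) k = cfun z * lookup p k" for z and p :: "'n dpoly" and k by (simp add: cst_def lookup_fun_mult)
 moreover have "fun_of (lookup (coef (gen j * odd_deriv i x) J) k) z = sf_mult (mono {j} 0 (%_. 1)) (sf_odd_deriv i (raw x)) J k z" for i j J k z
  unfolding raw_odd_deriv[symmetric] raw_gen[symmetric] by (simp add: raw_def)
 ultimately show ?thesis
  unfolding dol_act_def
  by (simp add: fun_eq_iff raw_def dact_def coef_inverse lookup_add lookup_minus lookup_dactr dfun_def lookup_sum fun_of_sum
   uminus_sfun.rep_eq minus_sfun.rep_eq plus_sfun.rep_eq times_sfun.rep_eq cfun.rep_eq c fun_of_szb mult.assoc)
   (simp add: algebra_simps)
qed

subsection \<open>Cohomology of presented complexes\<close>

definition sg :: "'q::ab_group_add set => bool" where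
 "sg A \<longleftrightarrow> 0 : A \<and> (\<forall>x\<in>A. \<forall>y\<in>A. x - y : A)"

text \<open>A complex given by representatives: pr has kernel N. It serves for \<open>raw\<close>
  with kernel 0 and for the cosets of I, so that both cohomologies are computed without leaving the
  abstract algebras.\<close>

locale presented =
 fixes R :: "('x, 'a, 'm) cdgsa_scheme" and pr :: "'q::ab_group_add => 'a" and N :: "'q set" and d :: "'q => 'q"
 assumes carrier: "carrier R = range pr" and eq: "pr x = pr y \<longleftrightarrow> x - y : N"
  and add: "pr x \<oplus>\<^bsub>R\<^esub> pr y = pr (x + y)" and zero: "\<zero>\<^bsub>R\<^esub> = pr 0"
  and dif: "dif R (pr x) = pr (d x)" and d_diff: "d (x - y) = d x - d y" and sgN: "sg N"
begin

lemma minus: "pr x \<ominus>\<^bsub>R\<^esub> pr y = pr (x - y)"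
proof -
 have "\<ominus>\<^bsub>R\<^esub> pr y = pr (- y)"
  unfolding a_inv_def m_inv_def by (rule the_equality) (auto simp: carrier add zero eq add.commute)
 thus ?thesis by (simp add: a_minus_def add)
qed

definition "cob P P0 = {b. \<exists>p\<in>P. \<exists>q\<in>P0. b - d p - q : N}"
definition "cls P P0 x = pr ` {y. y - x : cob P P0}"

lemma N_add: "x : N ==> y : N ==> x + y : N"
 using sgN unfolding sg_def by (metis diff_0 diff_minus_eq_add)

lemma cob_shift: "b : cob P P0 ==> b' - b : N ==> b' : cob P P0"
proof -
 assume "b : cob P P0" "b' - b : N"
 then obtain p q where "p : P" "q : P0" "b - d p - q : N" unfolding cob_def by auto
 moreover have "b' - d p - q = (b' - b) + (b - d p - q)" by simp
 ultimately show ?thesis using \<open>b' - b : N\<close> N_add unfolding cob_def by (metis (mono_tags, lifting) mem_Collect_eq)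
qed

lemma coboundaries_pr: "coboundaries R (pr ` P) (pr ` P0) = pr ` cob P P0"
proof (intro equalityI subsetI)
 fix z assume "z : coboundaries R (pr ` P) (pr ` P0)"
 then obtain p q where "p : P" "q : P0" "z = pr (d p + q)" unfolding coboundaries_def set_add_defs by (auto simp: dif add)
 moreover from this have "d p + q : cob P P0" unfolding cob_def by (intro CollectI bexI[of _ p] bexI[of _ q]) (use sgN in \<open>simp_all add: sg_def\<close>)
 ultimately show "z : pr ` cob P P0" by blast
next
 fix z assume "z : pr ` cob P P0"
 then obtain b p q where b: "z = pr b" "p : P" "q : P0" "b - d p - q : N" unfolding cob_def by auto
 hence "z = pr (d p) \<oplus>\<^bsub>R\<^esub> pr q" by (simp add: add eq algebra_simps)
 thus "z : coboundaries R (pr ` P) (pr ` P0)" unfolding coboundaries_def set_add_defs using b by (force simp: dif)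
qed

lemma sg_cob: assumes "sg P" "sg P0" shows "sg (cob P P0)"
proof -
 have d0: "d 0 = 0" using d_diff[of 0 0] by simp
 have "0 : cob P P0" unfolding cob_def using assms sgN d0 by (auto simp: sg_def intro!: bexI[of _ 0])
 moreover have "b - b' : cob P P0" if "b : cob P P0" "b' : cob P P0" for b b'
 proof -
  from that obtain p q p' q' where h: "p : P" "q : P0" "b - d p - q : N" "p' : P" "q' : P0" "b' - d p' - q' : N"
   unfolding cob_def by auto
  hence "(b - d p - q) - (b' - d p' - q') : N" using sgN by (simp add: sg_def)
  hence "(b - b') - d (p - p') - (q - q') : N" by (simp add: d_diff algebra_simps)
  moreover have "p - p' : P" "q - q' : P0" using h assms by (simp_all add: sg_def)
  ultimately show ?thesis unfolding cob_def by blast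
 qed
 ultimately show ?thesis by (simp add: sg_def)
qed

lemma coset_pr: "coboundaries R (pr ` P) (pr ` P0) +>\<^bsub>R\<^esub> pr x = cls P P0 x"
proof -
 have "pr ` cob P P0 +>\<^bsub>R\<^esub> pr x = pr ` ((%b. b + x) ` cob P P0)"
  unfolding a_r_coset_def r_coset_def by (auto simp: add)
 also have "(%b. b + x) ` cob P P0 = {y. y - x : cob P P0}" by (force intro: rev_image_eqI)
 finally show ?thesis unfolding coboundaries_pr cls_def .
qed

lemma cls_eq: assumes "sg P" "sg P0" shows "cls P P0 x = cls P P0 y \<longleftrightarrow> x - y : cob P P0"
proof
 note s = sg_cob[OF assms]
 assume "cls P P0 x = cls P P0 y"
 moreover have "pr x : cls P P0 x" unfolding cls_def using s by (auto simp: sg_def)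
 ultimately obtain z where "pr x = pr z" "z - y : cob P P0" unfolding cls_def by auto
 thus "x - y : cob P P0" using cob_shift[of "z - y" P P0 "x - y"] by (simp add: eq)
next
 note s = sg_cob[OF assms]
 assume xy: "x - y : cob P P0"
 have "z - x : cob P P0 \<longleftrightarrow> z - y : cob P P0" for z
 proof
  have s': "a - b : cob P P0" if "a : cob P P0" "b : cob P P0" for a b using s that by (simp add: sg_def)
  have "- (x - y) : cob P P0" using s'[of 0 "x - y"] s xy by (simp add: sg_def)
  thus "z - x : cob P P0 ==> z - y : cob P P0" using s'[of "z - x" "- (x - y)"] by simp
  show "z - y : cob P P0 ==> z - x : cob P P0" using s'[of "z - y" "x - y"] xy by simp
 qed
 thus "cls P P0 x = cls P P0 y" by (simp add: cls_def)
qed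

lemma cohomology_pr: "cohomology R (pr ` P) (pr ` P0) = cls P P0 ` {x : P. \<exists>q\<in>P0. d x - q : N}"
proof -
 have "cocycles R (pr ` P) (pr ` P0) = pr ` {x : P. \<exists>q\<in>P0. d x - q : N}"
 proof (intro equalityI subsetI)
  fix z assume "z : cocycles R (pr ` P) (pr ` P0)"
  then obtain x q where "z = pr x" "x : P" "q : P0" "pr (d x) = pr q" unfolding cocycles_def by (auto simp: dif)
  thus "z : pr ` {x : P. \<exists>q\<in>P0. d x - q : N}" unfolding eq by blast
 next
  fix z assume "z : pr ` {x : P. \<exists>q\<in>P0. d x - q : N}"
  then obtain x q where "z = pr x" "x : P" "q : P0" "pr (d x) = pr q" unfolding eq by blast
  thus "z : cocycles R (pr ` P) (pr ` P0)" unfolding cocycles_def by (simp add: dif)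
 qed
 thus ?thesis unfolding cohomology_def by (simp add: image_image coset_pr)
qed

end

text \<open>Reduces the bijection between sets of cosets to injectivity and surjectivity on
  representatives, with equations up to N and N'. The hypothesis \<open>inj\<close> is asked of all
  p, in the form in which the one-sided inverse r provides it.\<close>

lemma cohomology_isoI:
 assumes R: "presented R pr N d" and S: "presented S pr' N' d'"
  and sg: "sg P" "sg P0" "sg Q" "sg Q0"
  and \<Phi>: "!!x. \<Phi> (pr x) = pr' (\<phi> x)" and \<phi>_add: "!!x y. \<phi> (x + y) = \<phi> x + \<phi> y"
  and d\<phi>: "!!x. d' (\<phi> x) - \<phi> (d x) : N'"
  and PQ: "!!x. x : P ==> \<phi> x : Q" "!!x. x : P0 ==> \<phi> x : Q0"
  and inj: "!!p q q0. p : P ==> q : Q ==> q0 : Q0 ==> \<phi> p - d' q - q0 : N' ==> \<exists>a\<in>P. \<exists>b\<in>P0. p - d a - b : N"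
  and surj: "!!q z. q : Q ==> z : Q0 ==> d' q - z : N' ==>
   \<exists>p\<in>P. (\<exists>p0\<in>P0. d p - p0 : N) \<and> (\<exists>a\<in>Q. \<exists>b\<in>Q0. q - \<phi> p - d' a - b : N')"
 shows "cohomology_iso R (pr ` P) (pr ` P0) S (pr' ` Q) (pr' ` Q0) \<Phi>"
proof -
 interpret R: presented R pr N d by (rule R)
 interpret S: presented S pr' N' d' by (rule S)
 have \<phi>0: "\<phi> 0 = 0" using \<phi>_add[of 0 0] by simp
 have \<phi>_diff: "\<phi> (x - y) = \<phi> x - \<phi> y" for x y using \<phi>_add[of "x - y" y] by (simp add: algebra_simps)
 have \<phi>N: "\<phi> x : N'" if "x : N" for x
 proof -
  have "pr x = pr 0" using that R.eq by simp
  hence "pr' (\<phi> x) = pr' (\<phi> 0)" unfolding \<Phi>[symmetric] by simp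
  thus ?thesis by (simp add: S.eq \<phi>0)
 qed
 have \<phi>c: "\<phi> c : S.cob Q Q0" if c: "c : R.cob P P0" for c
 proof -
  from c obtain p q where pq: "p : P" "q : P0" "c - d p - q : N" unfolding R.cob_def by auto
  have "\<phi> c - d' (\<phi> p) - \<phi> q = \<phi> (c - d p - q) - (d' (\<phi> p) - \<phi> (d p))" by (simp add: \<phi>_diff)
  hence "\<phi> c - d' (\<phi> p) - \<phi> q : N'" using \<phi>N[OF pq(3)] d\<phi>[of p] S.sgN unfolding sg_def by metis
  thus ?thesis unfolding S.cob_def using PQ pq by blast
 qed
 have key: "coboundaries S (pr' ` Q) (pr' ` Q0) <+>\<^bsub>S\<^esub> \<Phi> ` R.cls P P0 x = S.cls Q Q0 (\<phi> x)" for x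
 proof (intro equalityI subsetI)
  fix z assume "z : coboundaries S (pr' ` Q) (pr' ` Q0) <+>\<^bsub>S\<^esub> \<Phi> ` R.cls P P0 x"
  then obtain b y where z: "b : S.cob Q Q0" "y - x : R.cob P P0" "z = pr' (b + \<phi> y)"
   unfolding S.coboundaries_pr set_add_defs R.cls_def by (auto simp: \<Phi> S.add)
  have s: "sg (S.cob Q Q0)" by (rule S.sg_cob[OF sg(3,4)])
  have "\<phi> x - \<phi> y = 0 - \<phi> (y - x)" by (simp add: \<phi>_diff)
  hence "\<phi> x - \<phi> y : S.cob Q Q0" using s \<phi>c[OF z(2)] unfolding sg_def by metis
  moreover have "b + \<phi> y - \<phi> x = b - (\<phi> x - \<phi> y)" by simp
  ultimately have "b + \<phi> y - \<phi> x : S.cob Q Q0" using s z(1) unfolding sg_def by metis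
  thus "z : S.cls Q Q0 (\<phi> x)" unfolding S.cls_def z(3) by blast
 next
  fix z assume "z : S.cls Q Q0 (\<phi> x)"
  then obtain y where "z = pr' y" "y - \<phi> x : S.cob Q Q0" unfolding S.cls_def by auto
  hence z: "z = pr' (y - \<phi> x) \<oplus>\<^bsub>S\<^esub> \<Phi> (pr x)" "pr' (y - \<phi> x) : pr' ` S.cob Q Q0" by (auto simp: \<Phi> S.add)
  have m: "pr x : R.cls P P0 x" unfolding R.cls_def using R.sg_cob[OF sg(1,2)] by (auto simp: sg_def)
  show "z : coboundaries S (pr' ` Q) (pr' ` Q0) <+>\<^bsub>S\<^esub> \<Phi> ` R.cls P P0 x"
   unfolding S.coboundaries_pr set_add_defs
   by (rule UN_I[OF z(2)], rule UN_I[OF imageI[OF m]]) (simp add: z(1))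
 qed
 show ?thesis
  unfolding cohomology_iso_def R.cohomology_pr S.cohomology_pr bij_betw_def
 proof
  show "inj_on (%c. coboundaries S (pr' ` Q) (pr' ` Q0) <+>\<^bsub>S\<^esub> \<Phi> ` c) (R.cls P P0 ` {x : P. \<exists>q\<in>P0. d x - q : N})"
  proof (rule inj_onI, clarify)
   fix x y assume x: "x : P" and y: "y : P"
    and "coboundaries S (pr' ` Q) (pr' ` Q0) <+>\<^bsub>S\<^esub> \<Phi> ` R.cls P P0 x = coboundaries S (pr' ` Q) (pr' ` Q0) <+>\<^bsub>S\<^esub> \<Phi> ` R.cls P P0 y"
   hence "\<phi> (x - y) : S.cob Q Q0" unfolding key S.cls_eq[OF sg(3,4)] by (simp add: \<phi>_diff)
   then obtain q q0 where "q : Q" "q0 : Q0" "\<phi> (x - y) - d' q - q0 : N'" unfolding S.cob_def by auto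
   moreover have "x - y : P" using x y sg by (simp add: sg_def)
   ultimately have "x - y : R.cob P P0" unfolding R.cob_def using inj by blast
   thus "R.cls P P0 x = R.cls P P0 y" by (simp add: R.cls_eq[OF sg(1,2)])
  qed
  show "(%c. coboundaries S (pr' ` Q) (pr' ` Q0) <+>\<^bsub>S\<^esub> \<Phi> ` c) ` R.cls P P0 ` {x : P. \<exists>q\<in>P0. d x - q : N}
    = S.cls Q Q0 ` {x : Q. \<exists>q\<in>Q0. d' x - q : N'}" (is "?l = ?r")
  proof (intro equalityI subsetI)
   fix c assume "c : ?l"
   then obtain x p0 where x: "x : P" "p0 : P0" "d x - p0 : N" "c = S.cls Q Q0 (\<phi> x)" unfolding image_image key by auto
   have "d' (\<phi> x) - \<phi> p0 = (d' (\<phi> x) - \<phi> (d x)) + \<phi> (d x - p0)" by (simp add: \<phi>_diff)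
   hence "d' (\<phi> x) - \<phi> p0 : N'" using d\<phi>[of x] \<phi>N[OF x(3)] S.N_add by metis
   thus "c : ?r" using x PQ by blast
  next
   fix c assume "c : ?r"
   then obtain q z where q: "q : Q" "z : Q0" "d' q - z : N'" "c = S.cls Q Q0 q" by auto
   from surj[OF q(1-3)] obtain p p0 where p: "p : P" "p0 : P0" "d p - p0 : N" "q - \<phi> p : S.cob Q Q0"
    unfolding S.cob_def by auto
   hence "c = S.cls Q Q0 (\<phi> p)" unfolding q(4) S.cls_eq[OF sg(3,4)] by simp
   thus "c : ?l" unfolding image_image key using p by blast
  qed
 qed
qed

subsection \<open>The quasi-isomorphism\<close>

lemma inv_raw [simp]: "inv_into UNIV raw (raw x) = x"
 using inj_raw by (intro inv_into_f_f injI) auto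

lemma dbar_diff: "dbar (x - y) = dbar x - dbar (y :: 'n::finite dfield)"
proof -
 have "dzb i (x - y) = dzb i x - dzb i y" for i
 proof -
  interpret s: sderiv False "dzb i" by (rule sderiv_dzb)
  show ?thesis by (rule s.diff)
 qed
 thus ?thesis by (simp add: dbar_def right_diff_distrib scal_simps(3) sum_subtractf)
qed

lemma sg_graded: "sg (graded deg A)" by (simp add: sg_def graded_diff)

context holo
begin

section \<open>The quotient by the ideal of the variety\<close>

definition cl :: "('d, 's) tfield => ('d, 's) tsf set" where "cl x = raw ` {y. y - x : I}"

definition \<Phi>r :: "'n dol => ('d, 's) tsf set" where "\<Phi>r f = cl (\<Phi> (inv_into UNIV raw f))"

lemma \<Phi>r_raw: "\<Phi>r (raw x) = cl (\<Phi> x)" by (simp add: \<Phi>r_def)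

lemma I_zero: "0 : I" by (simp add: I_def)

lemma pure_rel_raw: "pure_rel \<Gamma> \<mu> = raw (rel \<mu> \<odot> 1)"
proof -
 have "raw (lamr a \<odot> (lamr b \<odot> 1)) = sf_mult (lam a) (lam b :: ('d, 's) tsf)" for a b
  by (simp only: lamr_def raw_single[of _ _ "single e f \<odot> 1" for e f] raw_single_one lam_def one_sfun.rep_eq)
 moreover have "rel \<mu> \<odot> (1 :: ('d, 's) tfield) = (SU a b. cst (\<Gamma> a b $ \<mu>) \<odot> (lamr a \<odot> (lamr b \<odot> 1)))"
  by (simp add: rel_def bilr_def linr_def sum_distrib_left sum_scal scal_simps(7) mult_ac)
 ultimately show ?thesis by (simp add: pure_rel_def raw_sum raw_cst)
qed

lemma pure_ideal_eq: "pure_ideal \<Gamma> Q = raw ` I"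
proof -
 let ?R = "tsf \<Gamma> Q"
 have R: "ring ?R" unfolding tsf_eq by (rule ring_superfields)
 have "ideal (raw ` I) ?R"
 proof (rule idealI[OF R])
  have "a_inv ?R (raw x) = raw (- x)" for x
   using abelian_group.minus_equality[OF ring.is_abelian_group[OF R], of "raw (- x)" "raw x"]
   unfolding tsf_eq by (simp add: superfields_ops)
  hence m: "inv\<^bsub>add_monoid ?R\<^esub> raw x = raw (- x)" for x by (simp add: a_inv_def)
  show "subgroup (raw ` I) (add_monoid ?R)"
   by (rule subgroup.intro) (auto simp: m, auto simp: tsf_eq superfields_ops I_zero intro: I_add I_uminus)
 qed (auto simp: tsf_eq superfields_ops intro: I_left I_right)
 moreover have "range (pure_rel \<Gamma>) \<subseteq> raw ` I" by (auto simp: pure_rel_raw intro: I_Ir Ir_rel)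
 moreover have "raw ` I \<subseteq> J" if J: "ideal J ?R" "range (pure_rel \<Gamma>) \<subseteq> J" for J
 proof clarify
  fix x assume "x : I"
  then obtain g where x: "x = (SU \<mu>. rel \<mu> \<odot> g \<mu>)" unfolding I_expand by auto
  have "raw (rel \<mu> \<odot> g \<mu>) : J" for \<mu>
  proof -
   have "raw (rel \<mu> \<odot> 1) \<otimes>\<^bsub>?R\<^esub> raw (g \<mu>) : J"
    by (rule ideal.I_r_closed[OF J(1)]) (use J(2) pure_rel_raw in \<open>auto simp: tsf_eq superfields_ops\<close>)
   thus ?thesis by (simp add: tsf_eq superfields_ops scal_mult_left)
  qed
  moreover have "raw 0 : J" using additive_subgroup.zero_closed[OF ideal.axioms(1)[OF J(1)]] by (simp add: tsf_eq superfields_ops)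
  moreover have "raw (a + b) : J" if "raw a : J" "raw b : J" for a b
   using additive_subgroup.a_closed[OF ideal.axioms(1)[OF J(1)] that] by (simp add: tsf_eq superfields_ops)
  ultimately have "raw (\<Sum>\<mu>\<in>A. rel \<mu> \<odot> g \<mu>) : J" for A by (induction A rule: infinite_finite_induct) auto
  thus "raw x : J" by (simp add: x)
 qed
 ultimately show ?thesis unfolding pure_ideal_def genideal_def by blast
qed

lemma coset_cl: "pure_ideal \<Gamma> Q +>\<^bsub>tsf \<Gamma> Q\<^esub> raw x = cl x"
proof -
 have "pure_ideal \<Gamma> Q +>\<^bsub>tsf \<Gamma> Q\<^esub> raw x = raw ` ((%b. b + x) ` I)"
  unfolding a_r_coset_def r_coset_def pure_ideal_eq by (auto simp: tsf_eq superfields_ops)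
 also have "(%b. b + x) ` I = {y. y - x : I}" by (force intro: rev_image_eqI)
 finally show ?thesis by (simp add: cl_def)
qed

lemma cl_eq: "cl x = cl y \<longleftrightarrow> x - y : I"
proof
 assume "cl x = cl y"
 moreover have "raw x : cl x" by (simp add: cl_def I_zero)
 ultimately obtain z where "raw x = raw z" "z - y : I" unfolding cl_def by auto
 thus "x - y : I" using inj_raw by blast
next
 assume xy: "x - y : I"
 have "z - x : I \<longleftrightarrow> z - y : I" for z
  using I_add[of "z - x" "x - y"] I_diff[of "z - y" "x - y"] xy by auto
 thus "cl x = cl y" by (simp add: cl_def)
qed

lemma on_cosets_cl:
 assumes F: "!!x. F (raw x) = raw (f x)" and f: "!!x y. f (x - y) = f x - f y" "!!x. x : I ==> f x : I"
 shows "on_cosets (tsf \<Gamma> Q) (pure_ideal \<Gamma> Q) F (cl x) = cl (f x)"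
proof -
 have "on_cosets (tsf \<Gamma> Q) (pure_ideal \<Gamma> Q) F (cl x) = (\<Union>y\<in>{y. y - x : I}. cl (f y))"
  unfolding on_cosets_def by (simp add: cl_def[of x] F coset_cl)
 also have "\<dots> = (\<Union>y\<in>{y. y - x : I}. cl (f x))"
  by (rule SUP_cong[OF refl]) (use f in \<open>simp add: cl_eq flip: f(1)\<close>)
 also have "\<dots> = cl (f x)"
 proof -
  have "x - x : I" using I_zero by simp
  thus ?thesis by blast
 qed
 finally show ?thesis .
qed

abbreviation "T \<equiv> taut_loc \<Gamma> Q"

lemma cl_ops:
 "carrier T = range cl" "cl x \<oplus>\<^bsub>T\<^esub> cl y = cl (x + y)" "cl x \<otimes>\<^bsub>T\<^esub> cl y = cl (x * y)" "\<one>\<^bsub>T\<^esub> = cl 1" "\<zero>\<^bsub>T\<^esub> = cl 0"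
 "fn T (fun_of f) = cl (single 0 f \<odot> 1)" "par T = cl (ur \<odot> 1)" "dif T (cl x) = cl (D x)"
 "bideg T i s = cl ` graded tdeg {(j, i'). i' = i \<and> odd (j + i') = s}" "filt T k = cl ` graded tdeg {(i, j). i + j \<ge> k}"
proof -
 note q = taut_loc_def quotient_cdgsa_def ring.defs FactRing_def cdgsa.defs
 note u = superfields_ops[of tdeg "(0, 1)" "tsf_dif \<Gamma> Q", folded tsf_eq]
 show "carrier T = range cl"
  unfolding q by (simp add: A_RCOSETS_def' u coset_cl) blast
 show "cl x \<oplus>\<^bsub>T\<^esub> cl y = cl (x + y)"
 proof -
  have "cl x <+>\<^bsub>tsf \<Gamma> Q\<^esub> cl y = cl (x + y)"
  proof (intro equalityI subsetI)
   fix z assume "z : cl x <+>\<^bsub>tsf \<Gamma> Q\<^esub> cl y"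
   then obtain a b where z: "z = raw (a + b)" "a - x : I" "b - y : I" unfolding set_add_defs cl_def by (auto simp: u)
   have "a + b - (x + y) : I" using I_add[OF z(2,3)] by (simp add: algebra_simps)
   thus "z : cl (x + y)" unfolding cl_def z(1) by blast
  next
   fix z assume "z : cl (x + y)"
   then obtain a where z: "z = raw a" "a - (x + y) : I" unfolding cl_def by auto
   have m: "raw (a - y) : cl x" "raw y : cl y"
    using z(2) I_zero unfolding cl_def by (auto intro!: imageI simp: diff_diff_eq add.commute)
   show "z : cl x <+>\<^bsub>tsf \<Gamma> Q\<^esub> cl y" unfolding set_add_defs
    by (rule UN_I[OF m(1)], rule UN_I[OF m(2)]) (simp add: u z(1))
  qed
  thus ?thesis unfolding q by simp
 qed
 show "cl x \<otimes>\<^bsub>T\<^esub> cl y = cl (x * y)"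
 proof -
  have m: "cl (a * b) = cl (x * y)" if "a - x : I" "b - y : I" for a b
  proof -
   have "a * b - x * y = (a - x) * b + x * (b - y)" by (simp add: algebra_simps)
   thus ?thesis unfolding cl_eq using that by (simp add: I_add I_left I_right)
  qed
  have "rcoset_mult (tsf \<Gamma> Q) (pure_ideal \<Gamma> Q) (cl x) (cl y) = (\<Union>a\<in>{a. a - x : I}. \<Union>b\<in>{b. b - y : I}. cl (a * b))"
   unfolding rcoset_mult_def by (simp add: cl_def[of x] cl_def[of y] u coset_cl)
  also have "\<dots> = (\<Union>a\<in>{a. a - x : I}. \<Union>b\<in>{b. b - y : I}. cl (x * y))"
   by (intro SUP_cong refl) (rule m; simp)
  also have "\<dots> = cl (x * y)"
  proof -
   have "x - x : I" "y - y : I" using I_zero by simp_all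
   thus ?thesis by blast
  qed
  finally show ?thesis unfolding q by simp
 qed
 show "\<one>\<^bsub>T\<^esub> = cl 1" unfolding q by (simp add: u coset_cl)
 show "\<zero>\<^bsub>T\<^esub> = cl 0" unfolding q by (simp add: pure_ideal_eq cl_def)
 show "fn T (fun_of f) = cl (single 0 f \<odot> 1)" unfolding q by (simp add: u coset_cl)
 show "par T = cl (ur \<odot> 1)" unfolding q ur_def by (simp add: u coset_cl)
 show "dif T (cl x) = cl (D x)"
  unfolding q by (simp add: u) (rule on_cosets_cl[OF tsf_dif_raw D_diff D_I])
 show "bideg T i s = cl ` graded tdeg {(j, i'). i' = i \<and> odd (j + i') = s}" "filt T k = cl ` graded tdeg {(i, j). i + j \<ge> k}"
  unfolding q by (simp_all add: tsf_eq superfields_gradings image_image coset_cl[unfolded tsf_eq])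
qed

lemmas dol_ops = superfields_ops[of id 1 dol_dif, folded dol_loc_eq]
lemmas dol_gradings = superfields_gradings[of id 1 dol_dif, folded dol_loc_eq]

lemma presented_dol: "presented dol_loc raw {0 :: 'n dfield} dbar"
 by unfold_locales (auto simp: dol_ops dol_dif_raw dbar_diff sg_def dest: inj_raw)

lemma sg_I: "sg I" by (simp add: sg_def I_zero I_diff)

lemma presented_taut: "presented T cl I D"
 by unfold_locales (simp_all add: cl_ops cl_eq D_diff sg_I)

lemma fun_of_Sfun: "smooth g ==> fun_of (Sfun g) = g" by (rule Sfun_inverse) simp

text \<open>
  A commutator of \<open>c \<cdot> \<Phi>\<close> with a function multiplies \<open>c\<close> by a nilpotent element, because
  \<open>\<Phi>\<close> is linear over functions up to terms with at least one anticommuting generator.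
\<close>

lemma diff_op_\<Phi>:
 assumes "c : graded tdeg {(i, j). i \<ge> int CARD('s) + 1 - int k}" "!!x. F (raw x) = cl (c * \<Phi> x)"
 shows "diff_op (%g. g \<circ> Z) dol_loc T k F"
 using assms
proof (induction k arbitrary: c F)
 case 0
 \<comment> \<open>An exterior degree above CARD('s) does not occur, so c is 0.\<close>
 have "c = gproj tdeg {(i, j). i \<ge> int CARD('s) + 1} c" using 0(1) by (subst gproj_id) simp_all
 also have "\<dots> = 0"
 proof (rule gproj_disjoint[of c tdeg "{(i, j). i \<le> int CARD('s)}"])
  show "c : graded tdeg {(i, j). i \<le> int CARD('s)}" by (simp add: graded_def card_mono)
 qed auto
 finally have "F (raw x) = cl 0" for x using 0(2) by simp
 note F = this
 show ?case unfolding diff_op.simps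
 proof (intro allI impI ballI)
  fix g :: "complex^'n => complex" and y :: "'n dol" assume g: "smooth g" and "y : carrier dol_loc"
  then obtain x where y: "y = raw x" by (auto simp: dol_ops)
  have "fn T (g \<circ> Z) = cl (single 0 (pull Z (Sfun g)) \<odot> 1)"
   using cl_ops(6)[of "pull Z (Sfun g)"] by (simp add: fun_of_pull[OF linZ] fun_of_Sfun[OF g])
  moreover have "fn dol_loc g = raw (single 0 (Sfun g) \<odot> 1)" using dol_ops(6)[of "Sfun g"] by (simp add: fun_of_Sfun[OF g])
  ultimately show "F (fn dol_loc g \<otimes>\<^bsub>dol_loc\<^esub> y) = fn T (g \<circ> Z) \<otimes>\<^bsub>T\<^esub> F y"
   by (simp add: y dol_ops(3) F cl_ops(3))
 qed
next
 case (Suc k)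
 show ?case unfolding diff_op.simps
 proof (intro allI impI)
  fix g :: "complex^'n => complex" assume g: "smooth g"
  let ?f = "Sfun g" and ?c = "c * (single 0 (pull Z (Sfun g)) \<odot> 1 - \<Phi> (single 0 (Sfun g) \<odot> 1))"
  have 1: "fn T (g \<circ> Z) = cl (single 0 (pull Z ?f) \<odot> 1)"
   using cl_ops(6)[of "pull Z ?f"] by (simp add: fun_of_pull[OF linZ] fun_of_Sfun[OF g])
  have 2: "fn dol_loc g = raw (single 0 ?f \<odot> 1)" using dol_ops(6)[of ?f] by (simp add: fun_of_Sfun[OF g])
  show "diff_op (%g. g \<circ> Z) dol_loc T k (%x. (fn T (g \<circ> Z) \<otimes>\<^bsub>T\<^esub> F x) \<ominus>\<^bsub>T\<^esub> F (fn dol_loc g \<otimes>\<^bsub>dol_loc\<^esub> x))"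
  proof (rule Suc.IH)
   show "?c : graded tdeg {(i, j). i \<ge> int CARD('s) + 1 - int k}"
    by (rule graded_mult[OF Suc.prems(1) \<Phi>_function tdeg_add]) auto
   fix x
   have "?c * \<Phi> x = single 0 (pull Z ?f) \<odot> 1 * (c * \<Phi> x) - c * \<Phi> (single 0 ?f \<odot> 1 * x)"
    unfolding \<Phi>_simps(2) by (simp add: right_diff_distrib left_diff_distrib scal_mult_left scal_mult_right mult.assoc)
   thus "(fn T (g \<circ> Z) \<otimes>\<^bsub>T\<^esub> F (raw x)) \<ominus>\<^bsub>T\<^esub> F (fn dol_loc g \<otimes>\<^bsub>dol_loc\<^esub> raw x) = cl (?c * \<Phi> x)"
    by (simp add: 1 2 Suc.prems(2) dol_ops(3) cl_ops(3) presented.minus[OF presented_taut])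
  qed
 qed
qed

lemma \<Phi>r_hom: "filtered_local_cdgsa_hom (%g. g \<circ> Z) dol_loc T \<Phi>r"
 unfolding filtered_local_cdgsa_hom_def
proof (intro conjI allI ballI)
 show "\<Phi>r : ring_hom dol_loc T"
  by (rule ring_hom_memI) (auto simp: dol_ops cl_ops \<Phi>r_raw \<Phi>_simps \<Phi>_one)
 show "\<Phi>r (fn dol_loc (%_. c)) = fn T (%_. c)" for c
  using dol_ops(6)[of "cfun c :: (complex^'n) sfun"] cl_ops(6)[of "cfun c"] \<Phi>_constant[of c] by (simp add: \<Phi>r_raw cst_def)
 show "\<Phi>r (par dol_loc) = par T"
  using \<Phi>_ud by (simp add: dol_ops(7) cl_ops(7) \<Phi>r_raw ud_def)
 fix f :: "'n dol" assume "f : carrier dol_loc"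
 then obtain x where "f = raw x" by (auto simp: dol_ops)
 thus "\<Phi>r (dif dol_loc f) = dif T (\<Phi>r f)"
  using I_uminus[OF D_\<Phi>[of x]] by (simp add: dol_ops(8) dol_dif_raw \<Phi>r_raw cl_ops(8) cl_eq)
next
 show "\<Phi>r ` bideg dol_loc i s \<subseteq> bideg T i s" for i s
  unfolding dol_gradings cl_ops by (auto simp: \<Phi>r_raw intro!: imageI graded_\<Phi>)
 show "\<Phi>r ` filt dol_loc k \<subseteq> filt T k" for k
  unfolding dol_gradings cl_ops by (auto simp: \<Phi>r_raw intro!: imageI graded_\<Phi>)
 \<comment> \<open>For c = 1 the exterior degree is at least 0, which is the bound for k = CARD('s)
   + 1.\<close>
 have "diff_op (%g. g \<circ> Z) dol_loc T (CARD('s) + 1) \<Phi>r"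
  by (rule diff_op_\<Phi>[of 1]) (auto simp: \<Phi>r_raw graded_def split: if_splits)
 thus "\<exists>k. diff_op (%g. g \<circ> Z) dol_loc T k \<Phi>r" ..
qed

theorem quasi_iso: "filtered_local_quasi_iso (%g. g \<circ> Z) dol_loc T \<Phi>r"
 unfolding filtered_local_quasi_iso_def
proof (intro conjI allI)
 show "filtered_local_cdgsa_hom (%g. g \<circ> Z) dol_loc T \<Phi>r" by (rule \<Phi>r_hom)
 \<comment> \<open>Applying r solves for p explicitly; r also respects the filtration, so the same
   formula gives injectivity on the graded complexes.\<close>
 have inj: "p = dbar (r q) + r q0" if "\<Phi> p - D q - q0 : I" for p q q0
  using r_I[OF that] by (simp add: r_diff r_\<Phi> r_D diff_eq_eq add.commute)
 have z: "\<Phi> 0 = 0" "r 0 = 0" using \<Phi>_simps(1)[of 0 0] r_simps(1)[of 0 0] by simp_all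
 have s: "sg (UNIV :: 'n dfield set)" "sg {0 :: 'n dfield}" "sg (UNIV :: ('d, 's) tfield set)" "sg {0 :: ('d, 's) tfield}"
  by (simp_all add: sg_def)
 have "cohomology_iso dol_loc (raw ` (UNIV :: 'n dfield set)) (raw ` {0}) T (cl ` UNIV) (cl ` {0}) \<Phi>r"
 proof (rule cohomology_isoI[where \<phi> = \<Phi> and \<Phi> = \<Phi>r and pr = raw and pr' = cl and d = dbar and d' = D, OF presented_dol presented_taut s \<Phi>r_raw \<Phi>_simps(1) D_\<Phi>])
  fix q z assume "z : {0}" "D q - z : I"
  hence Dq: "D q : I" by simp
  obtain y where "q - \<Phi> (r q) - D y : I" using exact_total[OF Dq] by auto
  moreover have "dbar (r q) = 0" using r_I[OF Dq] by (simp add: r_D)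
  ultimately show "\<exists>p\<in>UNIV. (\<exists>p0\<in>{0}. dbar p - p0 : {0}) \<and> (\<exists>a\<in>UNIV. \<exists>b\<in>{0}. q - \<Phi> p - D a - b : I)"
   by (intro bexI[of _ "r q"]) auto
 next
  fix p q q0 assume "q0 : {0}" "\<Phi> p - D q - q0 : I"
  from inj[OF this(2)] this(1) show "\<exists>a\<in>UNIV. \<exists>b\<in>{0}. p - dbar a - b : {0}" by (auto simp: z)
 qed (simp_all add: z)
 thus "cohomology_iso dol_loc (carrier dol_loc) {\<zero>\<^bsub>dol_loc\<^esub> :: 'n dol} T (carrier T) {\<zero>\<^bsub>T\<^esub>} \<Phi>r"
  by (simp add: dol_ops cl_ops)
 fix k
 let ?F = "%k. {(i, j :: int). i + j \<ge> (k :: int)}"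
 have g1: "dbar x : graded id (?F (k + 1))" if "x : graded id (?F k)" for x :: "'n dfield" and k
  by (rule graded_dbar[OF that]) auto
 have "cohomology_iso dol_loc (raw ` graded id (?F k)) (raw ` (graded id (?F (k + 1)) :: 'n dfield set)) T
   (cl ` graded tdeg (?F k)) (cl ` graded tdeg (?F (k + 1))) \<Phi>r"
 proof (rule cohomology_isoI[where \<phi> = \<Phi> and \<Phi> = \<Phi>r and pr = raw and pr' = cl and d = dbar and d' = D, OF presented_dol presented_taut sg_graded sg_graded sg_graded sg_graded \<Phi>r_raw \<Phi>_simps(1) D_\<Phi>])
  show "x : graded id (?F k) ==> \<Phi> x : graded tdeg (?F k)" "x : graded id (?F (k + 1)) ==> \<Phi> x : graded tdeg (?F (k + 1))" for x
   by (erule graded_\<Phi>, force)+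
 next
  fix p q q0 assume "p : graded id (?F k)" "q : graded tdeg (?F k)" "q0 : graded tdeg (?F (k + 1))" "\<Phi> p - D q - q0 : I"
  thus "\<exists>a\<in>graded id (?F k). \<exists>b\<in>graded id (?F (k + 1)). p - dbar a - b : {0}"
   by (intro bexI[of _ "r q"] bexI[of _ "r q0"] graded_r) (auto dest: inj)
 next
  fix q z assume q: "q : graded tdeg (?F k)" "z : graded tdeg (?F (k + 1))" "D q - z : I"
  from exact_graded[OF this] obtain p a b
   where p: "p : graded id (?F k)" "a : graded tdeg (?F k)" "b : graded tdeg (?F (k + 1))" "q - \<Phi> p - D a - b : I" by auto
  have "dbar p : graded id (?F (k + 1))" by (rule g1[OF p(1)])
  hence "\<exists>p0\<in>graded id (?F (k + 1)). dbar p - p0 : {0}" by (intro bexI[of _ "dbar p"]) auto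
  thus "\<exists>p\<in>graded id (?F k). (\<exists>p0\<in>graded id (?F (k + 1)). dbar p - p0 : {0}) \<and>
    (\<exists>a\<in>graded tdeg (?F k). \<exists>b\<in>graded tdeg (?F (k + 1)). q - \<Phi> p - D a - b : I)"
   using p by blast
 qed
 thus "cohomology_iso dol_loc (filt dol_loc k) (filt (dol_loc :: (complex^'n, 'n dol) cdgsa) (k + 1)) T (filt T k) (filt T (k + 1)) \<Phi>r"
  by (simp add: dol_gradings cl_ops)
qed

theorem equivariant:
 assumes "!!X a b. gl_stab Z X a b ==>
   (\<forall>c e. X *v \<Gamma> c e = (SU f. \<rho> X $ f $ c *s \<Gamma> f e) + (SU f. \<rho> X $ f $ e *s \<Gamma> c f)) \<and>
   (\<forall>e. (SU c. \<kappa> c * \<rho> X $ c $ e) = trace a / 2 * \<kappa> e) \<and>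
   (\<forall>i e. (SU c. \<tau> i c * \<rho> X $ c $ e) = (SU j. a $ i $ j * \<tau> j e) - trace a / 2 * \<tau> i e) \<and>
   (\<forall>k c. (SU e. \<rho> X $ c $ e * t k e) = (SU l. a $ l $ k * t l c) - trace a / 2 * t k c)"
 shows "gl_equivariant \<Gamma> \<rho> Q Z \<Phi>r"
 unfolding gl_equivariant_def
proof (intro allI impI ballI)
 fix X a b and f :: "'n dol" assume X: "gl_stab Z X a b" and "f : carrier dol_loc"
 then obtain x where f: "f = raw x" by (auto simp: dol_ops)
 note h = assms[OF X]
 note p = X[unfolded gl_stab_def, THEN conjunct2, THEN conjunct1, rule_format] X[unfolded gl_stab_def, THEN conjunct2, THEN conjunct2, rule_format]
  h[THEN conjunct1, rule_format] h[THEN conjunct2, THEN conjunct1, rule_format]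
  h[THEN conjunct2, THEN conjunct2, THEN conjunct1, rule_format] h[THEN conjunct2, THEN conjunct2, THEN conjunct2, rule_format]
 interpret s: sderiv False "act X (\<rho> X) (- (trace a / 2)) :: ('d, 's) tfield => _" by (rule sderiv_act)
 have "on_cosets (tsf \<Gamma> Q) (pure_ideal \<Gamma> Q) (tsf_act X (\<rho> X) (- (trace a / 2))) (\<Phi>r f) = cl (act X (\<rho> X) (- (trace a / 2)) (\<Phi> x))"
  unfolding f \<Phi>r_raw by (rule on_cosets_cl[OF tsf_act_raw s.diff ac_I[OF p]])
 thus "\<Phi>r (dol_act a b f) = on_cosets (tsf \<Gamma> Q) (pure_ideal \<Gamma> Q) (tsf_act X (\<rho> X) (- trace a / 2)) (\<Phi>r f)"
  by (simp add: f dol_act_raw \<Phi>r_raw ac_\<Phi>[OF p])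
qed

end

subsection \<open>Adapted decompositions\<close>

definition gb :: "('p::finite => 'q::finite => complex^'d) => complex^'p => complex^'q => complex^'d" where
 "gb G a b = (SU i j. (a $ i * b $ j) *s G i j)"

lemma bracket_gb: "bracket \<Gamma> = gb \<Gamma>" by (simp add: fun_eq_iff bracket_def gb_def)

lemma gb_simps:
 "gb G (a + a') b = gb G a b + gb G a' b" "gb G a (b + b') = gb G a b + gb G a b'"
 "gb G (c *s a) b = c *s gb G a b" "gb G a (c *s b) = c *s gb G a b"
 by (simp_all add: gb_def vec_eq_iff sum.distrib sum_distrib_left algebra_simps)

lemma gb_more:
 "gb G 0 b = 0" "gb G a 0 = 0" "gb G (- a) b = - gb G a b" "gb G a (- b) = - gb G a b"
 "gb G (a - a') b = gb G a b - gb G a' b" "gb G a (b - b') = gb G a b - gb G a b'"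
 by (simp_all add: gb_def vec_eq_iff sum_negf sum_subtractf algebra_simps)

lemma gb_sum: "gb G (sum f A) b = (\<Sum>i\<in>A. gb G (f i) b)" "gb G a (sum g A) = (\<Sum>i\<in>A. gb G a (g i))"
 by (induction A rule: infinite_finite_induct) (simp_all add: gb_simps gb_more)

lemma gb_axis: "gb G (axis i 1) (axis j 1) = G i j"
proof -
 have "(axis i 1 $ k * axis j 1 $ l) *s G k l = (if k = i then if l = j then G i j else 0 else 0)" for k l
  by (auto simp: axis_def)
 hence "gb G (axis i 1) (axis j 1) = (SU k l. if k = i then if l = j then G i j else 0 else 0)"
  by (simp only: gb_def)
 also have "\<dots> = (SU k. if k = i then SU l. if l = j then G i j else 0 else 0)"
  by (rule sum.cong) auto
 finally show ?thesis by simp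
qed

lemma mult_sum: "A *v (\<Sum>j\<in>S. f j) = (\<Sum>j\<in>S. A *v f j)" for A :: "complex^'a^'b"
 by (induction S rule: infinite_finite_induct) (simp_all add: matrix_vector_right_distrib)

lemma mult_axis_nth: "(A *v axis c 1) $ f = A $ f $ c" for A :: "complex^'a^'b"
 by (simp add: matrix_vector_mult_def axis_def if_distrib cong: if_cong)

lemma mult_axis: "A *v axis c 1 = (SU f. A $ f $ c *s axis f 1)" for A :: "complex^'a^'b"
proof (rule vec_eq_iff[THEN iffD2], intro allI)
 show "(A *v axis c 1) $ i = (SU f. A $ f $ c *s axis f 1) $ i" for i
  unfolding mult_axis_nth by (simp add: axis_def if_distrib cong: if_cong)
qed

lemma gb_equivariant:
 assumes "!!a b. X *v G a b = (SU c. A $ c $ a *s G c b) + (SU c. B $ c $ b *s G a c)"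
 shows "X *v gb G s t = gb G (A *v s) t + gb G s (B *v t)"
proof -
 have "X *v G c e = gb G (A *v axis c 1) (axis e 1) + gb G (axis c 1) (B *v axis e 1)" for c e
  unfolding mult_axis by (simp add: assms gb_sum gb_simps gb_axis)
 note ax = this
 have "X *v gb G (SU c. s $ c *s axis c 1) (SU e. t $ e *s axis e 1)
  = gb G (A *v (SU c. s $ c *s axis c 1)) (SU e. t $ e *s axis e 1) + gb G (SU c. s $ c *s axis c 1) (B *v (SU e. t $ e *s axis e 1))"
  unfolding gb_sum mult_sum gb_simps vector_scalar_commute gb_axis ax
  by (simp add: vec.scale_right_distrib sum.distrib)
 thus ?thesis unfolding basis_expansion .
qed

lemma gb_commute: "(!!i j. G i j = c *s H j i) ==> gb G a b = c *s gb H b a"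
 unfolding gb_def by (subst sum.swap) (simp add: vec.scale_sum_right mult_ac)

definition dot :: "complex^'d::finite => complex^'d => complex" where
 "dot v w = (SU \<mu>. v $ \<mu> * w $ \<mu>)"

lemma dot_simps:
 "dot (v + v') w = dot v w + dot v' w" "dot v (w + w') = dot v w + dot v w'"
 "dot (c *s v) w = c * dot v w" "dot v (c *s w) = c * dot v w"
 "dot 0 w = 0" "dot v 0 = 0" "dot (- v) w = - dot v w" "dot v (- w) = - dot v w"
 "dot (v - v') w = dot v w - dot v' w" "dot v (w - w') = dot v w - dot v w'"
 by (simp_all add: dot_def sum.distrib sum_distrib_left sum_negf sum_subtractf algebra_simps)

lemma dot_sum: "dot (sum f A) w = (\<Sum>i\<in>A. dot (f i) w)" "dot v (sum g A) = (\<Sum>i\<in>A. dot v (g i))"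
 by (induction A rule: infinite_finite_induct) (simp_all add: dot_simps)

lemma dot_commute: "dot v w = dot w v" by (simp add: dot_def mult.commute)

text \<open>This and \<open>ps\<close> are the forms dual to \<open>vec_zbar\<close> and
  \<open>vec_z\<close>, written as vectors for the bilinear pairing \<open>dot\<close>.\<close>

definition fs :: "(real^'d => complex^'n) => 'n => complex^'d::finite" where
 "fs Z i = (\<chi> \<mu>. cnj (Z (axis \<mu> 1) $ i))"

definition ps :: "(real^'d => complex^'n) => 'n => complex^'d::finite" where
 "ps Z i = (\<chi> \<mu>. Z (axis \<mu> 1) $ i)"

lemma coordinates_complete:
 fixes Z :: "real^'d::finite => complex^'n::finite"
 assumes "linear Z" "bij Z"
 shows "(SU i. vec_zbar Z i $ \<mu> * cnj (Z (axis \<nu> 1) $ i) + vec_z Z i $ \<mu> * Z (axis \<nu> 1) $ i) = (if \<mu> = \<nu> then 1 else 0)"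
proof -
 let ?Y = "inv_into UNIV Z"
 have Z: "Z (?Y z) = z" "?Y (Z x) = x" for z x using assms(2) by (simp_all add: bij_is_surj surj_f_inv_f bij_is_inj)
 have Y: "?Y (x + y) = ?Y x + ?Y y" "?Y (c *\<^sub>R x) = c *\<^sub>R ?Y x" for x y c
  using Z(2)[of "?Y x + ?Y y"] Z(2)[of "c *\<^sub>R ?Y x"] by (simp_all only: linear_add[OF assms(1)] linear_cmul[OF assms(1)] Z(1))
 have lY: "linear ?Y" by (rule linearI) (rule Y)+
 let ?z = "Z (axis \<nu> 1)"
 have "?z = (SU i. Re (?z $ i) *\<^sub>R axis i 1 + Im (?z $ i) *\<^sub>R axis i \<i>)"
 proof -
  have "(Re (?z $ i) *\<^sub>R axis i 1 + Im (?z $ i) *\<^sub>R axis i \<i>) $ k = (if k = i then ?z $ i else 0)" for i k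
   by (simp add: axis_def complex_eq_iff)
  thus ?thesis by (simp only: vec_eq_iff sum_component) simp
 qed
 hence "?Y ?z = (SU i. Re (?z $ i) *\<^sub>R ?Y (axis i 1) + Im (?z $ i) *\<^sub>R ?Y (axis i \<i>))"
  by (metis (no_types, lifting) Y linear_sum[OF lY] sum.cong)
 from arg_cong[OF this, of "%v. v $ \<mu>"] have "axis \<nu> 1 $ \<mu> = (SU i. Re (?z $ i) * ?Y (axis i 1) $ \<mu> + Im (?z $ i) * ?Y (axis i \<i>) $ \<mu>)"
  by (simp add: Z sum_component)
 hence "complex_of_real (axis \<nu> 1 $ \<mu>) = (SU i. of_real (Re (?z $ i)) * of_real (?Y (axis i 1) $ \<mu>) + of_real (Im (?z $ i)) * of_real (?Y (axis i \<i>) $ \<mu>))"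
  by simp
 also have "\<dots> = (SU i. vec_zbar Z i $ \<mu> * cnj (?z $ i) + vec_z Z i $ \<mu> * ?z $ i)"
  by (rule sum.cong[OF refl]) (simp add: vec_zbar_def vec_z_def complex_eq_iff, simp add: field_simps)
 finally show ?thesis by (simp add: axis_def split: if_splits)
qed

context
 fixes Z :: "real^'d::finite => complex^'n::finite"
 assumes Z: "linear Z" "bij Z"
begin

lemma dot_dual:
 "dot (fs Z i) (vec_zbar Z j) = (if i = j then 1 else 0)" "dot (fs Z i) (vec_z Z j) = 0"
 "dot (ps Z i) (vec_zbar Z j) = 0" "dot (ps Z i) (vec_z Z j) = (if i = j then 1 else 0)"
 using dual_bases[OF Z, of i j] by (simp_all add: dot_def fs_def ps_def)

lemma dual_expand: "v = (SU i. dot (fs Z i) v *s vec_zbar Z i) + (SU i. dot (ps Z i) v *s vec_z Z i)"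
proof (rule vec_eq_iff[THEN iffD2], intro allI)
 fix \<mu>
 have "((SU i. dot (fs Z i) v *s vec_zbar Z i) + (SU i. dot (ps Z i) v *s vec_z Z i)) $ \<mu>
  = (SU i \<nu>. (vec_zbar Z i $ \<mu> * cnj (Z (axis \<nu> 1) $ i) + vec_z Z i $ \<mu> * Z (axis \<nu> 1) $ i) * v $ \<nu>)"
  by (simp add: dot_def fs_def ps_def sum_distrib_left sum_distrib_right sum.distrib algebra_simps)
 also have "\<dots> = (SU \<nu>. (SU i. vec_zbar Z i $ \<mu> * cnj (Z (axis \<nu> 1) $ i) + vec_z Z i $ \<mu> * Z (axis \<nu> 1) $ i) * v $ \<nu>)"
  unfolding sum_distrib_right by (rule sum.swap)
 also have "\<dots> = (SU \<nu>. if \<nu> = \<mu> then v $ \<mu> else 0)"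
  unfolding coordinates_complete[OF Z] by (rule sum.cong) auto
 finally show "v $ \<mu> = ((SU i. dot (fs Z i) v *s vec_zbar Z i) + (SU i. dot (ps Z i) v *s vec_z Z i)) $ \<mu>" by simp
qed

lemma dual_zero: "(!!i. dot (fs Z i) v = 0) ==> (!!i. dot (ps Z i) v = 0) ==> v = 0"
 by (subst dual_expand) simp

end

lemma functional_expand:
 fixes f :: "complex^'s::finite => complex"
 assumes "!!x y. f (x + y) = f x + f y" "!!c x. f (c *s x) = c * f x"
 shows "(SU a. f (axis a 1) * s $ a) = f s"
proof -
 have "f (\<Sum>a\<in>A. s $ a *s axis a 1) = (\<Sum>a\<in>A. f (axis a 1) * s $ a)" for A
  using assms(2)[of 0 0] by (induction A rule: infinite_finite_induct) (simp_all add: assms)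
 from this[of UNIV] show ?thesis by (simp only: basis_expansion)
qed

locale decomposition =
 fixes \<Gamma> :: "'s::finite => 's => complex^'d::finite" and Q :: "complex^'s" and Z :: "real^'d => complex^'n::finite"
  and S1 S2 :: "(complex^'s) set"
 assumes Z: "linear Z" "bij Z" and sym: "\<Gamma> a b = \<Gamma> b a"
  and S1: "vec.subspace S1" and S2: "vec.subspace S2"
  and dec: "!!s. \<exists>c. \<exists>x\<in>S1. \<exists>y\<in>S2. s = c *s Q + x + y"
  and QQ: "gb \<Gamma> Q Q = 0" and Q1: "!!x. x : S1 ==> gb \<Gamma> Q x = 0"
  and \<psi>Q: "!!i s. dot (ps Z i) (gb \<Gamma> Q s) = 0" and onto: "!!i. \<exists>s. gb \<Gamma> Q s = vec_zbar Z i"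
  and \<psi>11: "!!i x x'. x : S1 ==> x' : S1 ==> dot (ps Z i) (gb \<Gamma> x x') = 0"
  and \<phi>12: "!!i x y. x : S1 ==> y : S2 ==> dot (fs Z i) (gb \<Gamma> x y) = 0"
  and G22: "!!y y'. y : S2 ==> y' : S2 ==> gb \<Gamma> y y' = 0"
  and inj: "!!y. y : S2 ==> gb \<Gamma> Q y = 0 ==> y = 0"
  and cyc: "!!x y. x : S1 ==> y : S2 ==> gb \<Gamma> x x = gb \<Gamma> Q y ==> gb \<Gamma> x y = 0"
begin

lemma gb_sym: "gb \<Gamma> s t = gb \<Gamma> t s"
 using gb_commute[of \<Gamma> 1 \<Gamma> s t] sym by simp

definition "\<tau>v i s = dot (fs Z i) (gb \<Gamma> Q s)"
definition "tv j = (SOME y. y : S2 \<and> gb \<Gamma> Q y = vec_zbar Z j)"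
definition "tsum s = (SU j. \<tau>v j s *s tv j)"
definition "\<kappa>v s = (SOME c. s - c *s Q - tsum s : S1)"
definition "p1 s = s - \<kappa>v s *s Q - tsum s"
text \<open>Sign and factor match the term - 2 \<beta> in \<open>adapted\<close>, that is, the
  normalization l0 l2 = \<beta>(\<lambda>, \<lambda>) of the relations.\<close>

definition "\<beta>v i s s' = - (dot (fs Z i) (gb \<Gamma> (p1 s) (p1 s')) / 2)"
definition "Mv i j s = dot (ps Z i) (gb \<Gamma> (p1 s) (tv j))"

lemma \<tau>v_simps: "\<tau>v i (s + s') = \<tau>v i s + \<tau>v i s'" "\<tau>v i (c *s s) = c * \<tau>v i s" "\<tau>v i Q = 0" "x : S1 ==> \<tau>v i x = 0"
 by (simp_all add: \<tau>v_def gb_simps dot_simps QQ Q1)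

lemma tv: "tv j : S2 \<and> gb \<Gamma> Q (tv j) = vec_zbar Z j"
 unfolding tv_def
proof (rule someI_ex)
 obtain s where s: "gb \<Gamma> Q s = vec_zbar Z j" using onto by auto
 obtain c x y where "x : S1" "y : S2" "s = c *s Q + x + y" using dec by blast
 thus "\<exists>y. y : S2 \<and> gb \<Gamma> Q y = vec_zbar Z j" using s by (auto simp: gb_simps QQ Q1)
qed

lemma \<tau>v_tv: "\<tau>v i (tv j) = (if i = j then 1 else 0)"
 using tv[of j] by (simp add: \<tau>v_def dot_dual[OF Z])

lemma tsum_S2: "tsum s : S2"
 unfolding tsum_def using tv by (intro vec.subspace_sum[OF S2] vec.subspace_scale[OF S2]) auto

lemma gb_Q: "gb \<Gamma> Q s = (SU j. \<tau>v j s *s vec_zbar Z j)"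
 by (subst dual_expand[OF Z]) (simp add: \<tau>v_def \<psi>Q)

lemma gb_Q_tsum: "gb \<Gamma> Q (tsum s) = gb \<Gamma> Q s"
 unfolding gb_Q[of s] using tv by (simp add: tsum_def gb_sum gb_simps)

lemma tsum_id: "y : S2 ==> tsum y = y"
 using inj[of "y - tsum y"] gb_Q_tsum[of y] vec.subspace_diff[OF S2 _ tsum_S2] by (simp add: gb_more)

lemma tsum_simps: "tsum (s + s') = tsum s + tsum s'" "tsum (c *s s) = c *s tsum s" "tsum Q = 0" "x : S1 ==> tsum x = 0"
 by (simp_all add: tsum_def \<tau>v_simps vec.scale_left_distrib sum.distrib vec.scale_sum_right)

text \<open>[Q, tv j] = \<open>vec_zbar Z j\<close> has a nonzero \<phi> component, which
  \<open>\<phi>12\<close> forbids for elements of S1.\<close>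

lemma Q_S1: assumes "c *s Q : S1" shows "c = 0"
proof (rule ccontr)
 assume c: "c ~= 0"
 hence "inverse c *s (c *s Q) : S1" using assms vec.subspace_scale[OF S1] by blast
 hence "Q : S1" using c by simp
 from \<phi>12[OF this, of "tv undefined" undefined] tv[of undefined] show False by (simp add: dot_dual[OF Z])
qed

lemma p1: "p1 s : S1"
 unfolding p1_def \<kappa>v_def
proof (rule someI_ex)
 obtain c x y where h: "x : S1" "y : S2" "s = c *s Q + x + y" using dec by blast
 hence "tsum s = y" by (simp add: tsum_simps tsum_id)
 hence "s - c *s Q - tsum s = x" using h by simp
 thus "\<exists>c. s - c *s Q - tsum s : S1" using h(1) by blast
qed

lemma \<kappa>_unique: assumes "s - c *s Q - tsum s : S1" shows "\<kappa>v s = c"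
proof -
 have "(c - \<kappa>v s) *s Q = p1 s - (s - c *s Q - tsum s)" by (simp add: p1_def vec.scale_left_diff_distrib)
 moreover have "p1 s - (s - c *s Q - tsum s) : S1" by (rule vec.subspace_diff[OF S1 p1 assms])
 ultimately have "(c - \<kappa>v s) *s Q : S1" by (simp only:)
 thus ?thesis using Q_S1 by fastforce
qed

lemma \<kappa>v_simps: "\<kappa>v (s + s') = \<kappa>v s + \<kappa>v s'" "\<kappa>v (c *s s) = c * \<kappa>v s" "\<kappa>v Q = 1" "x : S1 ==> \<kappa>v x = 0" "y : S2 ==> \<kappa>v y = 0"
proof -
 have "(s + s') - (\<kappa>v s + \<kappa>v s') *s Q - tsum (s + s') = p1 s + p1 s'"
  by (simp add: p1_def tsum_simps vec.scale_left_distrib)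
 thus "\<kappa>v (s + s') = \<kappa>v s + \<kappa>v s'" using vec.subspace_add[OF S1 p1 p1] by (intro \<kappa>_unique) simp
 have "c *s s - (c * \<kappa>v s) *s Q - tsum (c *s s) = c *s p1 s"
  by (simp add: p1_def tsum_simps vec.scale_right_diff_distrib)
 thus "\<kappa>v (c *s s) = c * \<kappa>v s" using vec.subspace_scale[OF S1 p1] by (intro \<kappa>_unique) simp
 show "\<kappa>v Q = 1" "x : S1 ==> \<kappa>v x = 0" "y : S2 ==> \<kappa>v y = 0"
  by (rule \<kappa>_unique; simp add: tsum_simps tsum_id vec.subspace_0[OF S1])+
qed

lemma p1_simps: "p1 (s + s') = p1 s + p1 s'" "p1 (c *s s) = c *s p1 s" "p1 Q = 0" "p1 (tv j) = 0"
 using tv by (simp_all add: p1_def \<kappa>v_simps tsum_simps tsum_id vec.scale_left_distrib vec.scale_right_diff_distrib)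

lemma \<beta>v_simps: "\<beta>v i (s + s') t = \<beta>v i s t + \<beta>v i s' t" "\<beta>v i t (s + s') = \<beta>v i t s + \<beta>v i t s'" "\<beta>v i t (c *s s) = c * \<beta>v i t s"
 "\<beta>v i s Q = 0" "\<beta>v i s (tv j) = 0"
 by (simp_all add: \<beta>v_def p1_simps gb_simps gb_more dot_simps add_divide_distrib)

lemma \<beta>v_sym: "\<beta>v i s t = \<beta>v i t s" by (simp add: \<beta>v_def gb_sym)

lemma Mv_simps: "Mv i j (s + s') = Mv i j s + Mv i j s'" "Mv i j (c *s s) = c * Mv i j s" "Mv i j Q = 0" "Mv i j (tv k) = 0"
 by (simp_all add: Mv_def p1_simps gb_simps gb_more dot_simps)

lemma gb_decompose: "gb \<Gamma> s s' = \<kappa>v s *s gb \<Gamma> Q s' + \<kappa>v s' *s gb \<Gamma> Q s + gb \<Gamma> (p1 s) (p1 s') + gb \<Gamma> (p1 s) (tsum s') + gb \<Gamma> (p1 s') (tsum s)"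
proof -
 have e: "s = \<kappa>v s *s Q + p1 s + tsum s" for s by (simp add: p1_def)
 have "gb \<Gamma> s s' = gb \<Gamma> (\<kappa>v s *s Q + p1 s + tsum s) (\<kappa>v s' *s Q + p1 s' + tsum s')" using e by simp
 also have "\<dots> = \<kappa>v s *s gb \<Gamma> Q s' + \<kappa>v s' *s gb \<Gamma> Q s + gb \<Gamma> (p1 s) (p1 s') + gb \<Gamma> (p1 s) (tsum s') + gb \<Gamma> (p1 s') (tsum s)"
  by (simp add: gb_simps QQ Q1[OF p1] gb_Q_tsum gb_sym[of "p1 _" Q] gb_sym[of "tsum _" Q] G22[OF tsum_S2 tsum_S2] gb_sym[of "tsum s" "p1 s'"])
 finally show ?thesis .
qed

lemma fs_gb: "dot (fs Z i) (gb \<Gamma> s s') = \<kappa>v s * \<tau>v i s' + \<tau>v i s * \<kappa>v s' - 2 * \<beta>v i s s'"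
 by (subst gb_decompose) (simp add: dot_simps \<tau>v_def \<beta>v_def \<phi>12[OF p1 tsum_S2])

lemma ps_gb: "dot (ps Z i) (gb \<Gamma> s s') = (SU j. Mv i j s * \<tau>v j s' + \<tau>v j s * Mv i j s')"
proof -
 have "dot (ps Z i) (gb \<Gamma> (p1 s) (tsum s')) = (SU j. Mv i j s * \<tau>v j s')" for s s'
  unfolding tsum_def by (simp add: gb_sum gb_simps dot_sum dot_simps Mv_def mult.commute)
 thus ?thesis by (subst gb_decompose) (simp add: dot_simps \<psi>Q \<psi>11[OF p1 p1] sum.distrib mult.commute)
qed

text \<open>[p1 s, p1 s] lies in L, so it equals [Q, y] for a y in S2, and \<open>cyc\<close> gives
  [p1 s, y] = 0; the \<psi> components of this equation are the claim.\<close>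

lemma cubic: "(SU j. Mv i j s * \<beta>v j s s) = 0"
proof -
 let ?g = "gb \<Gamma> (p1 s) (p1 s)" and ?y = "SU j. dot (fs Z j) (gb \<Gamma> (p1 s) (p1 s)) *s tv j"
 have "gb \<Gamma> Q ?y = ?g"
  using tv by (subst (3) dual_expand[OF Z]) (simp add: gb_sum gb_simps \<psi>11[OF p1 p1])
 moreover have "?y : S2" using tv by (intro vec.subspace_sum[OF S2] vec.subspace_scale[OF S2]) auto
 ultimately have "gb \<Gamma> (p1 s) ?y = 0" using cyc[OF p1] by simp
 hence "dot (ps Z i) (gb \<Gamma> (p1 s) ?y) = 0" by (simp add: dot_simps)
 hence "(SU j. dot (fs Z j) ?g * Mv i j s) = 0" by (simp add: gb_sum gb_simps dot_sum dot_simps Mv_def)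
 hence "- (SU j. dot (fs Z j) ?g * Mv i j s) / 2 = 0" by simp
 thus ?thesis by (simp add: \<beta>v_def sum_negf sum_divide_distrib mult.commute)
qed

text \<open>Polarization of a cubic form by inclusion and exclusion. The six permutations give each
  of the three terms twice, as \<beta> is symmetric.\<close>

lemma cubic_polarized: "(SU j. Mv i j a * \<beta>v j b c + Mv i j b * \<beta>v j c a + Mv i j c * \<beta>v j a b) = 0"
proof -
 let ?F = "%s. SU j. Mv i j s * \<beta>v j s s"
 have "2 * (SU j. Mv i j a * \<beta>v j b c + Mv i j b * \<beta>v j c a + Mv i j c * \<beta>v j a b)
   = ?F (a + b + c) - ?F (a + b) - ?F (a + c) - ?F (b + c) + ?F a + ?F b + ?F c"
  unfolding sum_subtractf[symmetric] sum.distrib[symmetric] sum_distrib_left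
  by (rule sum.cong[OF refl])
   (simp add: Mv_simps \<beta>v_simps \<beta>v_sym[of _ b a] \<beta>v_sym[of _ c a] \<beta>v_sym[of _ c b] algebra_simps)
 thus ?thesis unfolding cubic by simp
qed

lemma holo: "holo \<Gamma> Q Z (%a. \<kappa>v (axis a 1)) (%i a. \<tau>v i (axis a 1)) (%j a. tv j $ a)
 (%i a b. \<beta>v i (axis a 1) (axis b 1)) (%i j a. Mv i j (axis a 1))"
proof -
 note e = functional_expand
 have k: "(SU a. \<kappa>v (axis a 1) * s $ a) = \<kappa>v s" for s by (rule e) (simp_all add: \<kappa>v_simps)
 have t: "(SU a. \<tau>v i (axis a 1) * s $ a) = \<tau>v i s" for s i by (rule e) (simp_all add: \<tau>v_simps)
 have b: "(SU a. \<beta>v i u (axis a 1) * s $ a) = \<beta>v i u s" for s u i by (rule e) (simp_all add: \<beta>v_simps)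
 have m: "(SU a. Mv i j (axis a 1) * s $ a) = Mv i j s" for s i j by (rule e) (simp_all add: Mv_simps)
 have f: "(SU \<mu>. cnj (Z (axis \<mu> 1) $ i) * \<Gamma> a c $ \<mu>) = dot (fs Z i) (gb \<Gamma> (axis a 1) (axis c 1))"
  "(SU \<mu>. Z (axis \<mu> 1) $ i * \<Gamma> a c $ \<mu>) = dot (ps Z i) (gb \<Gamma> (axis a 1) (axis c 1))" for i a c
  by (simp_all add: dot_def fs_def ps_def gb_axis)
 show ?thesis
  using tv by unfold_locales
   (simp_all add: k t b m f fs_gb ps_gb \<kappa>v_simps \<tau>v_simps \<tau>v_tv \<beta>v_simps Mv_simps cubic_polarized
    coordinates_complete[OF Z] Z linear_add[OF Z(1)] linear_cmul[OF Z(1)], rule \<beta>v_sym)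
qed

theorem equivariant_quasi_iso:
 assumes \<rho>: "!!X a b. gl_stab Z X a b ==>
   (\<forall>c e. X *v \<Gamma> c e = (SU f. \<rho> X $ f $ c *s \<Gamma> f e) + (SU f. \<rho> X $ f $ e *s \<Gamma> c f)) \<and>
   \<rho> X *v Q = (trace a / 2) *s Q \<and> (\<forall>x\<in>S1. \<rho> X *v x : S1) \<and> (\<forall>y\<in>S2. \<rho> X *v y : S2)"
 shows "\<exists>\<Phi>. filtered_local_quasi_iso (%g. g \<circ> Z) dol_loc (taut_loc \<Gamma> Q) \<Phi> \<and> gl_equivariant \<Gamma> \<rho> Q Z \<Phi>"
proof -
 interpret holo \<Gamma> Q Z "%a. \<kappa>v (axis a 1)" "%i a. \<tau>v i (axis a 1)" "%j a. tv j $ a"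
  "%i a b. \<beta>v i (axis a 1) (axis b 1)" "%i j a. Mv i j (axis a 1)" by (rule holo)
 have "gl_equivariant \<Gamma> \<rho> Q Z \<Phi>r"
 proof (rule equivariant)
  fix X :: "complex^'d^'d" and a b assume X: "gl_stab Z X a b"
  define w where "w = trace a / 2"
  note h = \<rho>[OF X, folded w_def]
  have eq: "X *v gb \<Gamma> s s' = gb \<Gamma> (\<rho> X *v s) s' + gb \<Gamma> s (\<rho> X *v s')" for s s'
   by (rule gb_equivariant) (rule h[THEN conjunct1, rule_format])
  have \<tau>: "\<tau>v i (\<rho> X *v s) = (SU j. a $ i $ j * \<tau>v j s) - w * \<tau>v i s" for i s
  proof -
   have "gb \<Gamma> Q (\<rho> X *v s) = X *v gb \<Gamma> Q s - w *s gb \<Gamma> Q s" using eq[of Q s] h[THEN conjunct2, THEN conjunct1] by (simp add: gb_simps)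
   moreover have "X *v gb \<Gamma> Q s = (SU j. \<tau>v j s *s (SU i. a $ i $ j *s vec_zbar Z i))"
   proof -
    have "X *v (\<Sum>j\<in>S. \<tau>v j s *s vec_zbar Z j) = (\<Sum>j\<in>S. \<tau>v j s *s (X *v vec_zbar Z j))" for S
     by (induction S rule: infinite_finite_induct) (simp_all add: matrix_vector_right_distrib vector_scalar_commute)
    thus ?thesis unfolding gb_Q[of s] using X by (simp add: gl_stab_def)
   qed
   ultimately show ?thesis unfolding \<tau>v_def[of i "\<rho> X *v s"]
    by (simp add: dot_simps dot_sum dot_dual[OF Z] \<tau>v_def[of i s] if_distrib mult.commute cong: if_cong)
  qed
  have \<kappa>: "\<kappa>v (\<rho> X *v s) = w * \<kappa>v s" for s
  proof -
   have "s = \<kappa>v s *s Q + p1 s + tsum s" by (simp add: p1_def)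
   from arg_cong[OF this, of "%s. \<rho> X *v s"] have "\<rho> X *v s = (w * \<kappa>v s) *s Q + \<rho> X *v p1 s + \<rho> X *v tsum s"
    by (simp add: matrix_vector_right_distrib vector_scalar_commute h[THEN conjunct2, THEN conjunct1] mult.commute)
   moreover have "\<kappa>v (\<rho> X *v p1 s) = 0" "\<kappa>v (\<rho> X *v tsum s) = 0" using h[THEN conjunct2, THEN conjunct2] p1[of s] tsum_S2[of s] by (simp_all add: \<kappa>v_simps)
   ultimately show ?thesis by (simp add: \<kappa>v_simps)
  qed
  have t: "\<rho> X *v tv k = (SU l. a $ l $ k *s tv l) - w *s tv k" for k
  proof -
   have "\<rho> X *v tv k = tsum (\<rho> X *v tv k)" using h[THEN conjunct2, THEN conjunct2] tv tsum_id by simp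
   also have "\<dots> = (SU l. (a $ l $ k) *s tv l - (if l = k then w *s tv k else 0))"
    unfolding tsum_def \<tau> by (rule sum.cong) (auto simp: \<tau>v_tv if_distrib vec.scale_left_diff_distrib cong: if_cong)
   finally show ?thesis by (simp add: sum_subtractf)
  qed
  have c: "(SU c. f (axis c 1) * \<rho> X $ c $ e) = f (\<rho> X *v axis e 1)"
   if "!!x y. f (x + y) = f x + f y" "!!c x. f (c *s x) = c * f x" for f e
   using functional_expand[OF that, of "\<rho> X *v axis e 1"] by (simp add: mult_axis_nth)
  show "(\<forall>c e. X *v \<Gamma> c e = (SU f. \<rho> X $ f $ c *s \<Gamma> f e) + (SU f. \<rho> X $ f $ e *s \<Gamma> c f)) \<and>
   (\<forall>e. (SU c. \<kappa>v (axis c 1) * \<rho> X $ c $ e) = trace a / 2 * \<kappa>v (axis e 1)) \<and>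
   (\<forall>i e. (SU c. \<tau>v i (axis c 1) * \<rho> X $ c $ e) = (SU j. a $ i $ j * \<tau>v j (axis e 1)) - trace a / 2 * \<tau>v i (axis e 1)) \<and>
   (\<forall>k c. (SU e. \<rho> X $ c $ e * tv k $ e) = (SU l. a $ l $ k * tv l $ c) - trace a / 2 * tv k $ c)"
  proof (intro conjI allI)
   show "X *v \<Gamma> c e = (SU f. \<rho> X $ f $ c *s \<Gamma> f e) + (SU f. \<rho> X $ f $ e *s \<Gamma> c f)" for c e
    by (rule h[THEN conjunct1, rule_format])
   show "(SU c. \<kappa>v (axis c 1) * \<rho> X $ c $ e) = trace a / 2 * \<kappa>v (axis e 1)" for e
    unfolding c[OF \<kappa>v_simps(1,2)] \<kappa> w_def ..
   show "(SU c. \<tau>v i (axis c 1) * \<rho> X $ c $ e) = (SU j. a $ i $ j * \<tau>v j (axis e 1)) - trace a / 2 * \<tau>v i (axis e 1)" for i e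
    unfolding c[of "\<tau>v i", OF \<tau>v_simps(1,2)] \<tau> w_def ..
   show "(SU e. \<rho> X $ c $ e * tv k $ e) = (SU l. a $ l $ k * tv l $ c) - trace a / 2 * tv k $ c" for k c
    using arg_cong[OF t[of k], of "%v. v $ c"] by (simp add: matrix_vector_mult_def w_def)
  qed
 qed
 thus ?thesis using quasi_iso by blast
qed

end

subsection \<open>Spin representations\<close>

definition cm :: "('d::finite => complex^'p^'m) => complex^'d => complex^'p::finite => complex^'m::finite" where
 "cm g v s = (SU \<mu>. v $ \<mu> *s (g \<mu> *v s))"

lemma cm_simps:
 "cm g (v + w) s = cm g v s + cm g w s" "cm g v (s + t) = cm g v s + cm g v t"
 "cm g (c *s v) s = c *s cm g v s" "cm g v (c *s s) = c *s cm g v s"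
 "cm g 0 s = 0" "cm g v 0 = 0"
 by (simp_all add: cm_def vec.scale_left_distrib vec.scale_right_distrib sum.distrib matrix_vector_right_distrib
   vector_scalar_commute vec.scale_sum_right mult.commute)

lemma cm_more: "cm g (- v) s = - cm g v s" "cm g v (- s) = - cm g v s" "cm g (v - w) s = cm g v s - cm g w s" "cm g v (s - t) = cm g v s - cm g v t"
 using cm_simps(3)[of g "-1" v s] cm_simps(3)[of g "-1" w s] cm_simps(4)[of g v "-1" s] cm_simps(4)[of g v "-1" t]
  cm_simps(1)[of g v "-w" s] cm_simps(2)[of g v s "-t"] by simp_all

lemma cm_sum: "cm g (sum f A) s = (\<Sum>i\<in>A. cm g (f i) s)" "cm g v (sum h A) = (\<Sum>i\<in>A. cm g v (h i))"
 by (induction A rule: infinite_finite_induct) (simp_all add: cm_simps)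

lemma cm_axis: "cm g (axis \<mu> 1) s = g \<mu> *v s"
proof -
 have "cm g (axis \<mu> 1) s = (SU \<nu>. if \<nu> = \<mu> then g \<mu> *v s else 0)"
  unfolding cm_def by (rule sum.cong) (auto simp: axis_def)
 thus ?thesis by simp
qed

lemma subspace_cm: "vec.subspace W ==> vec.subspace {s. cm g v s : W}"
 by (simp add: vec.subspace_def cm_simps)

lemma spin_vec: "spin g g' X *v s = (1/4) *s (SU \<mu> \<nu>. X $ \<mu> $ \<nu> *s (g \<mu> *v (g' \<nu> *v s)))"
proof (rule vec_eq_iff[THEN iffD2], intro allI)
 fix i
 have "(spin g g' X *v s) $ i = (SU j \<mu> \<nu>. X $ \<mu> $ \<nu> * ((g \<mu> ** g' \<nu>) $ i $ j * s $ j)) / 4"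
  by (simp add: matrix_vector_mult_def spin_def sum_distrib_right sum_divide_distrib mult.assoc)
 also have "(SU j \<mu> \<nu>. X $ \<mu> $ \<nu> * ((g \<mu> ** g' \<nu>) $ i $ j * s $ j)) = (SU \<mu> \<nu> j. X $ \<mu> $ \<nu> * ((g \<mu> ** g' \<nu>) $ i $ j * s $ j))"
  by (subst sum.swap, rule sum.cong[OF refl], rule sum.swap)
 also have "\<dots> = (SU \<mu> \<nu>. X $ \<mu> $ \<nu> * ((g \<mu> ** g' \<nu>) *v s) $ i)"
  by (simp add: matrix_vector_mult_def sum_distrib_left)
 finally show "(spin g g' X *v s) $ i = ((1/4) *s (SU \<mu> \<nu>. X $ \<mu> $ \<nu> *s (g \<mu> *v (g' \<nu> *v s)))) $ i"
  by (simp add: matrix_vector_mul_assoc)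
qed

lemma spin_add: "spin g g' (X + Y) *v s = spin g g' X *v s + spin g g' Y *v s"
 by (simp add: spin_vec vec.scale_left_distrib sum.distrib vec.scale_right_distrib)

lemma spin_sum: "spin g g' (\<Sum>i\<in>A. X i) *v s = (\<Sum>i\<in>A. spin g g' (X i) *v s)"
proof (induction A rule: infinite_finite_induct)
 have "spin g g' 0 *v s = 0" by (simp add: spin_vec)
 thus "spin g g' (\<Sum>i\<in>{}. X i) *v s = (\<Sum>i\<in>{}. spin g g' (X i) *v s)" by simp
 thus "!!A. infinite A ==> spin g g' (\<Sum>i\<in>A. X i) *v s = (\<Sum>i\<in>A. spin g g' (X i) *v s)" by simp
qed (simp add: spin_add)

definition outer :: "complex^'d::finite => complex^'d => complex^'d^'d" where
 "outer v w = (\<chi> \<mu> \<nu>. v $ \<mu> * w $ \<nu>)"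

lemma cm_cm: "cm g v (cm g' w s) = (SU \<mu> \<nu>. (v $ \<mu> * w $ \<nu>) *s (g \<mu> *v (g' \<nu> *v s)))"
 unfolding cm_def by (simp only: mult_sum vector_scalar_commute vec.scale_sum_right vec.scale_scale)

lemma spin_outer: "spin g g' (outer v w) *v s = (1/4) *s cm g v (cm g' w s)"
 by (simp only: spin_vec outer_def vec_lambda_beta cm_cm)

lemma outer_mult: "outer v w *v x = dot w x *s v"
 by (simp add: vec_eq_iff outer_def matrix_vector_mult_def dot_def sum_distrib_left mult_ac)

lemma so_iff: "X : so \<longleftrightarrow> (\<forall>\<mu> \<nu>. X $ \<nu> $ \<mu> = - X $ \<mu> $ \<nu>)"
 by (simp add: so_def transpose_def vec_eq_iff)

lemma so_add: assumes "X : so" "Y : so" shows "X + Y : so"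
 unfolding so_iff
proof (intro allI)
 fix \<mu> \<nu>
 have "X $ \<nu> $ \<mu> = - X $ \<mu> $ \<nu>" "Y $ \<nu> $ \<mu> = - Y $ \<mu> $ \<nu>" using assms so_iff by blast+
 thus "(X + Y) $ \<nu> $ \<mu> = - (X + Y) $ \<mu> $ \<nu>" by simp
qed

lemma so_outer: "outer v w - outer w v : so"
 by (simp add: so_iff outer_def)

locale weyl_pair =
 fixes gp :: "'d::finite => complex^'p::finite^'m::finite" and gm :: "'d => complex^'m^'p"
 assumes weyl: "weyl_matrices gp gm"
begin

section \<open>Clifford relations and irreducibility\<close>

lemma weyl_swap: "weyl_pair gm gp"
 using weyl by unfold_locales (simp add: weyl_matrices_def)

lemma clifford_basis: "gm \<mu> *v (gp \<nu> *v s) + gm \<nu> *v (gp \<mu> *v s) = (if \<mu> = \<nu> then 2 *s s else 0)"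
proof -
 have "(gm \<mu> ** gp \<nu> + gm \<nu> ** gp \<mu>) *v s = mat (if \<mu> = \<nu> then 2 else 0) *v s" using weyl by (simp add: weyl_matrices_def)
 moreover have "mat c *v s = c *s s" for c
  by (simp add: vec_eq_iff mat_def matrix_vector_mult_def if_distrib[of "%x. x * _"] cong: if_cong)
 ultimately show ?thesis by (simp add: matrix_vector_mul_assoc matrix_vector_mult_add_rdistrib)
qed

lemma anti: "\<mu> ~= \<nu> ==> gm \<mu> *v (gp \<nu> *v s) = - (gm \<nu> *v (gp \<mu> *v s))"
 using clifford_basis[of \<mu> \<nu> s] by (simp add: eq_neg_iff_add_eq_0)

lemma sq: "gm \<mu> *v (gp \<mu> *v s) = s"
proof -
 have "gm \<mu> *v (gp \<mu> *v s) + gm \<mu> *v (gp \<mu> *v s) = 2 *s (gm \<mu> *v (gp \<mu> *v s))"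
  using vec.scale_left_distrib[of 1 1 "gm \<mu> *v (gp \<mu> *v s)"] by (simp only: vec.scale_one one_add_one)
 hence "2 *s (gm \<mu> *v (gp \<mu> *v s)) = 2 *s s" unfolding clifford_basis by simp
 thus ?thesis by (simp only: vec.scale_cancel_left) simp
qed

lemma clifford: "cm gm v (cm gp w s) + cm gm w (cm gp v s) = (2 * dot v w) *s s"
proof -
 have "cm gm w (cm gp v s) = (SU \<mu> \<nu>. (v $ \<mu> * w $ \<nu>) *s (gm \<nu> *v (gp \<mu> *v s)))"
  unfolding cm_cm by (subst sum.swap) (simp only: mult.commute)
 note that = this
 have "cm gm v (cm gp w s) + cm gm w (cm gp v s) = (SU \<mu> \<nu>. if \<nu> = \<mu> then (v $ \<mu> * w $ \<mu>) *s (2 *s s) else 0)"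
 proof -
  have "(v $ \<mu> * w $ \<nu>) *s (gm \<mu> *v (gp \<nu> *v s)) + (v $ \<mu> * w $ \<nu>) *s (gm \<nu> *v (gp \<mu> *v s))
   = (if \<nu> = \<mu> then (v $ \<mu> * w $ \<mu>) *s (2 *s s) else 0)" for \<mu> \<nu>
   unfolding vec.scale_right_distrib[symmetric] clifford_basis by simp
  thus ?thesis using that unfolding cm_cm[of _ v _ w] by (simp only: sum.distrib[symmetric])
 qed
 thus ?thesis by (simp add: dot_def vec.scale_sum_left sum_distrib_left mult.commute)
qed

text \<open>For distinct p, q, r in I the involution T made from p and q splits W into eigenspaces,
  and the product of the matrices of q and r exchanges them, so they have equal dimension. Products
  of pairs from I without p and q commute with T, and the argument repeats with two indices
  less.\<close>

lemma stable_halving: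
 assumes "vec.subspace W" "finite I" "!!a b s. a : I ==> b : I ==> s : W ==> gm a *v (gp b *v s) : W" "2 * k + 1 \<le> card I"
 shows "2 ^ k dvd vec.dim W"
 using assms
proof (induction k arbitrary: W I)
 case (Suc k)
 have "card I ~= 0" using Suc.prems(4) by linarith
 then obtain p where pI: "p : I" by (metis card.empty ex_in_conv)
 define I1 where "I1 = I - {p}"
 have p: "I = insert p I1" "p \<notin> I1" "2 * k + 2 \<le> card I1" using pI Suc.prems(4) by (auto simp: I1_def)
 hence "card I1 ~= 0" by linarith
 then obtain q where qI: "q : I1" by (metis card.empty ex_in_conv)
 define I2 where "I2 = I1 - {q}"
 have q: "I1 = insert q I2" "q \<notin> I2" "2 * k + 1 \<le> card I2" "finite I2"
  using qI p(3) Suc.prems(2) by (auto simp: I2_def I1_def)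
 hence "card I2 ~= 0" by linarith
 then obtain r where r: "r : I2" by (metis card.empty ex_in_conv)
 have d: "p ~= q" "p ~= r" "q ~= r" using p q r by auto
 \<comment> \<open>The product of two different gamma matrices squares to -1, hence the factor
   \<i>.\<close>
 define T where "T s = \<i> *s (gm p *v (gp q *v s))" for s
 define U where "U s = (gm q ** gp r) *v s" for s
 interpret w: weyl_pair gm gp by (rule weyl_swap)
 have neg: "A *v (- x) = - (A *v x)" for A :: "complex^'a::finite^'b::finite" and x by (rule vec.neg)
 have Tadd: "T (x + y) = T x + T y" "T (c *s x) = c *s T x" for x y c
  by (simp_all add: T_def matrix_vector_right_distrib vec.scale_right_distrib vector_scalar_commute mult.commute)
 have Uv: "U s = gm q *v (gp r *v s)" for s by (simp add: U_def matrix_vector_mul_assoc)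
 have TT: "T (T s) = s" for s
 proof -
  have "gm p *v (gp q *v (gm p *v (gp q *v s))) = - s"
   by (simp add: w.anti[of q p] d d[symmetric] neg sq)
  thus ?thesis by (simp add: T_def vector_scalar_commute)
 qed
 have UU: "U (U s) = - s" for s
  unfolding Uv by (simp add: w.anti[of r q] d d[symmetric] neg sq)
 have TU: "T (U s) = - U (T s)" for s
 proof -
  have "gm p *v (gp q *v (gm q *v (gp r *v s))) = - (gm q *v (gp r *v (gm p *v (gp q *v s))))"
   by (simp add: w.sq w.anti[of r p] anti[of q p] anti[of r q] d d[symmetric] neg sq)
  thus ?thesis by (simp add: T_def Uv vector_scalar_commute)
 qed
 have UT: "U s : W" "T s : W" if "s : W" for s
 proof -
  have "gm q *v (gp r *v s) : W" by (rule Suc.prems(3)[OF _ _ that]) (simp_all add: p(1) q(1) r)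
  thus "U s : W" by (simp add: Uv)
  have "gm p *v (gp q *v s) : W" by (rule Suc.prems(3)[OF _ _ that]) (simp_all add: p(1) q(1))
  thus "T s : W" unfolding T_def by (rule vec.subspace_scale[OF Suc.prems(1)])
 qed
 define A where "A = {s : W. T s = s}"
 define B where "B = {s : W. T s = - s}"
 have T0: "T 0 = 0" using Tadd(2)[of 0 0] by simp
 have sA: "vec.subspace A" and sB: "vec.subspace B"
  using Suc.prems(1) by (auto simp: A_def B_def vec.subspace_def Tadd T0)
 have "{x + y |x y. x : A \<and> y : B} = W"
 proof (intro equalityI subsetI)
  fix s assume s: "s : W"
  have Tm: "T (x - y) = T x - T y" for x y using Tadd(1)[of "x - y" y] by (simp add: eq_diff_eq)
  have "T ((1/2) *s (s + T s)) = (1/2) *s (s + T s)" unfolding Tadd TT by (simp only: add.commute)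
  moreover have "T ((1/2) *s (s - T s)) = - ((1/2) *s (s - T s))"
   unfolding Tadd(2) Tm TT vec.scale_minus_right[symmetric] minus_diff_eq ..
  ultimately have "(1/2) *s (s + T s) : A" "(1/2) *s (s - T s) : B"
   using s UT(2)[OF s] Suc.prems(1) unfolding A_def B_def
   by (simp_all only: mem_Collect_eq vec.subspace_scale vec.subspace_add vec.subspace_diff simp_thms)
  moreover have "s = (1/2) *s (s + T s) + (1/2) *s (s - T s)" by (simp add: vec_eq_iff field_simps)
  ultimately show "s : {x + y |x y. x : A \<and> y : B}" by blast
 qed (auto simp: A_def B_def vec.subspace_add[OF Suc.prems(1)])
 moreover have "A \<inter> B = {0}"
 proof -
  have "s = 0" if "T s = s" "T s = - s" for s :: "complex^'p"
   using that by (simp add: vec_eq_iff)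
  thus ?thesis using sA sB vec.subspace_0 by (auto simp: A_def B_def)
 qed
 ultimately have "vec.dim W = vec.dim A + vec.dim B" using vec.dim_sums_Int[OF sA sB] by simp
 moreover have "vec.dim B = vec.dim A"
 proof -
  have "U ` A = B"
  proof (intro equalityI subsetI)
   show "s : B" if "s : U ` A" for s using that UT TU by (auto simp: A_def B_def)
   show "s : U ` A" if s: "s : B" for s
   proof -
    have Um: "U (- x) = - U x" for x unfolding U_def by (rule neg)
    have "T (- U s) = - U s" using s TU[of s] Tadd(2)[of "-1" "U s"] by (simp add: B_def Um)
    hence "- U s : A" using s UT(1)[of s] vec.subspace_neg[OF Suc.prems(1)] by (simp add: A_def B_def)
    moreover have "s = U (- U s)" by (simp add: Um UU)
    ultimately show ?thesis by blast
   qed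
  qed
  moreover have "inj U"
  proof (rule injI)
   fix x y assume "U x = U y"
   hence "U (U x) = U (U y)" by simp
   thus "x = y" by (simp add: UU)
  qed
  moreover have "Vector_Spaces.linear (*s) (*s) U" unfolding U_def[abs_def] by (rule matrix_vector_mul_linear_gen)
  ultimately show ?thesis using vec.dim_image_eq[of U A] by (metis inj_on_subset subset_UNIV)
 qed
 moreover have "2 ^ k dvd vec.dim A"
 proof (rule Suc.IH[OF sA q(4) _ q(3)])
  fix a b s assume ab: "a : I2" "b : I2" and s: "s : A"
  have n: "p ~= a" "p ~= b" "q ~= a" "q ~= b" using ab p q by auto
  have "gm p *v (gp q *v (gm a *v (gp b *v s))) = gm a *v (gp b *v (gm p *v (gp q *v s)))"
   by (simp add: w.anti[of q a] anti[of q b] anti[of p a] w.anti[of p b] n n[symmetric] neg)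
  hence "T (gm a *v (gp b *v s)) = gm a *v (gp b *v T s)" by (simp add: T_def vector_scalar_commute)
  moreover have "gm a *v (gp b *v s) : W" by (rule Suc.prems(3)) (use ab s p q in \<open>auto simp: A_def\<close>)
  ultimately show "gm a *v (gp b *v s) : A" using s by (simp add: A_def)
 qed
 ultimately show ?case by (simp add: mult_2[symmetric])
qed simp

text \<open>By repeated halving the dimension of W is divisible by the power of 2 that is the
  dimension of the whole module.\<close>

lemma irreducible:
 assumes W: "vec.subspace W" and st: "!!a b s. s : W ==> gm a *v (gp b *v s) : W" and s: "s : W" "s ~= 0"
 shows "W = UNIV"
proof -
 have "even CARD('d)" "CARD('d) > 0" using weyl by (auto simp: weyl_matrices_def)
 hence "2 * (CARD('d) div 2 - 1) + 1 \<le> CARD('d)" by (cases "CARD('d) div 2") auto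
 hence "2 ^ (CARD('d) div 2 - 1) dvd vec.dim W"
  by (intro stable_halving[OF W, of UNIV]) (auto intro: st)
 hence "CARD('p) dvd vec.dim W" using weyl by (simp add: weyl_matrices_def)
 moreover have "vec.dim W ~= 0" using s by auto
 ultimately have "CARD('p) \<le> vec.dim W" by (intro dvd_imp_le) auto
 moreover have "vec.dim (UNIV :: (complex^'p) set) = CARD('p)" by (rule vec_dim_card)
 ultimately show ?thesis using vec.subspace_dim_equal[OF W vec.subspace_UNIV] by simp
qed

text \<open>Clifford multiplication is equivariant. Moving v past two gamma matrices leaves two
  contraction terms, which coincide by the antisymmetry of X.\<close>

lemma spin_cm:
 assumes X: "X : so"
 shows "spin gp gm X *v cm gp v s = cm gp v (spin gm gp X *v s) + cm gp (X *v v) s"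
proof -
 interpret w: weyl_pair gm gp by (rule weyl_swap)
 have a: "X $ \<nu> $ \<mu> = - X $ \<mu> $ \<nu>" for \<mu> \<nu>
  using X unfolding so_iff by blast
 have e: "gp \<mu> *v (gm \<nu> *v cm gp v s) = (2 * v $ \<nu>) *s (gp \<mu> *v s) - (2 * v $ \<mu>) *s (gp \<nu> *v s) + cm gp v (gm \<mu> *v (gp \<nu> *v s))" for \<mu> \<nu>
 proof -
  have d: "dot (axis \<mu> 1) v = v $ \<mu>" for \<mu>
   by (simp add: dot_def axis_def if_distrib[of "%x. x * _"] cong: if_cong)
  have 1: "gm \<nu> *v cm gp v s = (2 * v $ \<nu>) *s s - cm gm v (gp \<nu> *v s)"
   using clifford[of "axis \<nu> 1" v s] by (simp add: cm_axis d eq_diff_eq)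
  have 2: "gp \<mu> *v cm gm v t = (2 * v $ \<mu>) *s t - cm gp v (gm \<mu> *v t)" for t
   using w.clifford[of "axis \<mu> 1" v t] by (simp add: cm_axis d eq_diff_eq)
  show ?thesis unfolding 1 matrix_vector_mult_diff_distrib 2 by (simp add: vector_scalar_commute)
 qed
 have "(SU \<mu> \<nu>. X $ \<mu> $ \<nu> *s (gp \<mu> *v (gm \<nu> *v cm gp v s)))
  = 2 *s (SU \<mu> \<nu>. (X $ \<mu> $ \<nu> * v $ \<nu>) *s (gp \<mu> *v s)) - 2 *s (SU \<mu> \<nu>. (X $ \<mu> $ \<nu> * v $ \<mu>) *s (gp \<nu> *v s))
   + cm gp v (SU \<mu> \<nu>. X $ \<mu> $ \<nu> *s (gm \<mu> *v (gp \<nu> *v s)))"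
  unfolding e cm_sum cm_simps by (simp add: vec.scale_right_distrib vec.scale_right_diff_distrib sum.distrib sum_subtractf vec.scale_sum_right mult_ac)
 also have "(SU \<mu> \<nu>. (X $ \<mu> $ \<nu> * v $ \<mu>) *s (gp \<nu> *v s)) = (SU \<nu> \<mu>. (X $ \<mu> $ \<nu> * v $ \<mu>) *s (gp \<nu> *v s))"
  by (rule sum.swap)
 also have "\<dots> = - (SU \<mu> \<nu>. (X $ \<mu> $ \<nu> * v $ \<nu>) *s (gp \<mu> *v s))"
  by (subst a) (simp add: sum_negf)
 also have "(SU \<mu> \<nu>. (X $ \<mu> $ \<nu> * v $ \<nu>) *s (gp \<mu> *v s)) = cm gp (X *v v) s"
  by (simp add: cm_def matrix_vector_mult_def vec.scale_sum_left)
 finally show ?thesis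
  unfolding spin_vec by (simp add: cm_simps vec.scale_right_distrib vec_eq_iff)
qed

end

section \<open>Equivariant pairings of spinors with values in V\<close>

locale equivariant_pair = weyl_pair gp gm + right: weyl_pair dp dm
 for gp :: "'d::finite => complex^'p::finite^'m::finite" and gm :: "'d => complex^'m^'p"
  and dp :: "'d => complex^'q::finite^'r::finite" and dm :: "'d => complex^'r^'q" +
 fixes G :: "'p => 'q => complex^'d"
 assumes G: "equivariant_onto (spin gm gp) (spin dm dp) G"
begin

lemma gb_so: "X : so ==> X *v gb G s t = gb G (spin gm gp X *v s) t + gb G s (spin dm dp X *v t)"
 by (rule gb_equivariant) (use G in \<open>simp add: equivariant_onto_def\<close>)

text \<open>The rotation in the plane of \<mu> and \<nu> expresses one component as the mean of two
  rotated values of the other. The bivector squares to -1 on both modules, which makes the two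
  values equal.\<close>

lemma gb_rotate:
 "gb G s t $ \<nu> = gb G (gm \<mu> *v (gp \<nu> *v s)) t $ \<mu>" (is ?A)
 "gb G s t $ \<nu> = gb G s (dm \<mu> *v (dp \<nu> *v t)) $ \<mu>" (is ?B)
proof -
 have "?A \<and> ?B"
 proof (cases "\<mu> = \<nu>")
  case True
  thus ?thesis by (simp add: sq right.sq)
 next
  case ne: False
  have half: "spin g g' (outer (axis \<mu> 1) (axis \<nu> 1) - outer (axis \<nu> 1) (axis \<mu> 1)) *v u = (1/2) *s (g \<mu> *v (g' \<nu> *v u))"
   if "g \<nu> *v (g' \<mu> *v u) = - (g \<mu> *v (g' \<nu> *v u))" for g :: "'d => complex^'b::finite^'a::finite" and g' and u \<mu> \<nu>
  proof -
   have e: "outer (axis \<mu> 1) (axis \<nu> 1) - outer (axis \<nu> 1) (axis \<mu> 1) = outer (axis \<mu> 1) (axis \<nu> 1) + outer (- axis \<nu> 1) (axis \<mu> (1::complex))"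
    by (simp add: vec_eq_iff outer_def)
   show ?thesis unfolding e spin_add spin_outer cm_more cm_axis that by (simp add: vec_eq_iff)
  qed
  have rot: "gb G s t $ \<nu> = (gb G (gm \<mu> *v (gp \<nu> *v s)) t $ \<mu> + gb G s (dm \<mu> *v (dp \<nu> *v t)) $ \<mu>) / 2" if ne: "\<mu> ~= \<nu>" for \<mu> \<nu> s t
  proof -
   let ?X = "outer (axis \<mu> 1) (axis \<nu> 1) - outer (axis \<nu> 1) (axis \<mu> (1::complex))"
   have d: "dot (axis \<nu> 1) v = v $ \<nu>" for \<nu> and v :: "complex^'d"
    by (simp add: dot_def axis_def if_distrib[of "%x. x * _"] cong: if_cong)
   have "(?X *v gb G s t) $ \<mu> = gb G s t $ \<nu>"
    using ne unfolding matrix_vector_mult_diff_rdistrib outer_mult d by (simp add: axis_def)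
   moreover have "?X *v gb G s t = gb G ((1/2) *s (gm \<mu> *v (gp \<nu> *v s))) t + gb G s ((1/2) *s (dm \<mu> *v (dp \<nu> *v t)))"
    using gb_so[OF so_outer, of "axis \<mu> 1" "axis \<nu> 1" s t] half[of gm \<nu> gp \<mu> s, OF anti[OF ne[symmetric]]] half[of dm \<nu> dp \<mu> t, OF right.anti[OF ne[symmetric]]] by simp
   ultimately show ?thesis by (simp add: gb_simps field_simps)
  qed
  let ?A = "%s. gm \<mu> *v (gp \<nu> *v s)" and ?B = "%t. dm \<mu> *v (dp \<nu> *v t)"
  interpret w: weyl_pair gm gp by (rule weyl_swap)
  interpret w': weyl_pair dm dp by (rule right.weyl_swap)
  have AA: "?A (?A s) = - s" for s using ne ne[symmetric] by (simp add: w.anti[of \<nu> \<mu>] vec.neg sq)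
  have BB: "?B (?B t) = - t" for t using ne ne[symmetric] by (simp add: w'.anti[of \<nu> \<mu>] vec.neg right.sq)
  have 1: "gb G s t $ \<nu> = (gb G (?A s) t $ \<mu> + gb G s (?B t) $ \<mu>) / 2" for s t by (rule rot[OF ne])
  have 2: "gb G s t $ \<mu> = - (gb G (?A s) t $ \<nu> + gb G s (?B t) $ \<nu>) / 2" for s t
   using rot[OF ne[symmetric], of s t] anti[OF ne[symmetric], of s] right.anti[OF ne[symmetric], of t] by (simp add: gb_more)
  have 3: "gb G (?A s) t $ \<nu> = gb G s (?B t) $ \<nu>" for s t
   unfolding 1[of "?A s" t] 1[of s "?B t"] AA BB gb_more by (simp only: vector_uminus_component add.commute)
  have 4: "gb G s t $ \<mu> = - (gb G (?A s) t $ \<nu>)" for s t using 2[of s t] 3[of s t] by simp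
  have A: "gb G s t $ \<nu> = gb G (?A s) t $ \<mu>" using 4[of "?A s" t] by (simp add: AA gb_more)
  moreover have "gb G s t $ \<nu> = gb G s (?B t) $ \<mu>" using 1[of s t] A by simp
  ultimately show ?thesis by simp
 qed
 thus ?A ?B by auto
qed

lemma G_nonzero: "\<exists>s t. gb G s t ~= 0"
proof (rule ccontr)
 assume "\<nexists>s t. gb G s t ~= 0"
 hence "G a b = 0" for a b using gb_axis[of G a b] by metis
 hence "vec.span {G a b |a b. True} \<subseteq> {0}" by (intro vec.span_minimal) auto
 moreover have "(1 :: complex^'d) ~= 0" by (simp add: vec_eq_iff)
 ultimately show False using G unfolding equivariant_onto_def by blast
qed

text \<open>By \<open>gb_rotate\<close> the kernel is stable under products of two gamma matrices,
  so by irreducibility it is 0 or everything, and G is not zero.\<close>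

lemma left_kernel: assumes "!!t. gb G s t = 0" shows "s = 0"
proof (rule ccontr)
 assume s: "s ~= 0"
 have "{s. \<forall>t. gb G s t = 0} = UNIV"
 proof (rule irreducible)
  show "vec.subspace {s. \<forall>t. gb G s t = 0}" by (simp add: vec.subspace_def gb_simps gb_more)
  fix a b u assume u: "u : {s. \<forall>t. gb G s t = 0}"
  have "gb G (gm a *v (gp b *v u)) t $ c = 0" for c t
  proof -
   have "gb G (gm a *v (gp b *v u)) t $ c = gb G (gm a *v (gp b *v u)) (dm a *v (dp c *v t)) $ a" by (rule gb_rotate)
   also have "\<dots> = 0" using gb_rotate(1)[of u _ b a] u by simp
   finally show ?thesis .
  qed
  thus "gm a *v (gp b *v u) : {s. \<forall>t. gb G s t = 0}" by (simp add: vec_eq_iff)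
 qed (use assms s in auto)
 thus False using G_nonzero by blast
qed

lemma right_kernel: assumes "!!s. gb G s t = 0" shows "t = 0"
proof (rule ccontr)
 assume s: "t ~= 0"
 have "{t. \<forall>s. gb G s t = 0} = UNIV"
 proof (rule right.irreducible)
  show "vec.subspace {t. \<forall>s. gb G s t = 0}" by (simp add: vec.subspace_def gb_simps gb_more)
  fix a b u assume u: "u : {t. \<forall>s. gb G s t = 0}"
  have "gb G s (dm a *v (dp b *v u)) $ c = 0" for c s
  proof -
   have "gb G s (dm a *v (dp b *v u)) $ c = gb G (gm a *v (gp c *v s)) (dm a *v (dp b *v u)) $ a" by (rule gb_rotate)
   also have "\<dots> = 0" using gb_rotate(2)[of _ u b a] u by simp
   finally show ?thesis .
  qed
  thus "dm a *v (dp b *v u) : {t. \<forall>s. gb G s t = 0}" by (simp add: vec_eq_iff)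
 qed (use assms s in auto)
 thus False using G_nonzero by blast
qed

text \<open>G is Clifford multiplication followed by a scalar pairing C that is nondegenerate on the
  left. This moves a form v from the value of the bracket to the spinor s.\<close>

lemma pairing:
 fixes \<mu> defines "C \<equiv> %s t. gb G (gm \<mu> *v s) t $ \<mu>"
 shows "dot v (gb G s t) = C (cm gp v s) t" "(!!t. C s' t = 0) ==> s' = 0"
proof -
 have "C (cm gp v s) t = (SU \<nu>. v $ \<nu> * gb G (gm \<mu> *v (gp \<nu> *v s)) t $ \<mu>)"
  by (simp add: C_def cm_def mult_sum vector_scalar_commute gb_sum gb_simps)
 thus "dot v (gb G s t) = C (cm gp v s) t" by (simp add: dot_def gb_rotate(1)[symmetric])
 assume 0: "!!t. C s' t = 0"
 have "gb G (gm \<mu> *v s') t $ \<nu> = 0" for t \<nu>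
  using gb_rotate(2)[of "gm \<mu> *v s'" t \<nu> \<mu>] 0 by (simp add: C_def)
 hence 1: "gm \<mu> *v s' = 0" by (intro left_kernel) (simp add: vec_eq_iff)
 interpret w: weyl_pair gm gp by (rule weyl_swap)
 from 1 show "s' = 0" using w.sq[of \<mu> s'] by simp
qed

end

subsection \<open>The Fock space of a holomorphic supercharge\<close>

lemma span_cm:
 assumes "vec.subspace W" "!!x. x : A ==> cm g v x : W" "s : vec.span A" shows "cm g v s : W"
 using vec.span_minimal[of A "{s. cm g v s : W}"] assms subspace_cm[OF assms(1)] by blast

lemma matrix_sum_mult: "(\<Sum>j\<in>S. F j) *v x = (\<Sum>j\<in>S. F j *v x)" for F :: "'j => complex^'a^'b"
 by (induction S rule: infinite_finite_induct) (simp_all add: matrix_vector_mult_add_rdistrib)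

definition up :: "('d::finite => complex^'p::finite^'m::finite) => (complex^'d) set => (complex^'p) set => (complex^'m) set" where
 "up g B W = vec.span {cm g w s |w s. w : B \<and> s : W}"

lemma up_mem: "w : B ==> s : W ==> cm g w s : up g B W"
 unfolding up_def by (rule vec.span_base) blast

lemma subspace_up: "vec.subspace (up g B W)" unfolding up_def by (rule vec.subspace_span)

lemma up_minimal: "vec.subspace S ==> (!!w s. w : B ==> s : W ==> cm g w s : S) ==> x : up g B W ==> x : S"
 unfolding up_def using vec.span_minimal[of "{cm g w s |w s. w : B \<and> s : W}" S] by blast

text \<open>q is the vacuum of a Fock space: the vectors \<open>ps\<close>, which will be seen to
  span L, are its annihilation operators.\<close>

locale polarized = weyl_pair gp gm for gp :: "'d::finite => complex^'p::finite^'m::finite" and gm :: "'d => complex^'m^'p" +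
 fixes Z :: "real^'d => complex^'n::finite" and q :: "complex^'p"
 assumes Z: "linear Z" "bij Z" and q: "q ~= 0" and vacuum: "!!i. cm gp (ps Z i) q = 0"
begin

sublocale sw: weyl_pair gm gp by (rule weyl_swap)

lemma annihilator_isotropic: assumes "cm gp l q = 0" "cm gp l' q = 0" shows "dot l l' = 0"
proof -
 have "(2 * dot l l') *s q = 0" using clifford[of l l' q] assms by (simp add: cm_simps)
 thus ?thesis using q by (simp add: vec.scale_eq_0_iff)
qed

text \<open>The annihilator of q is isotropic, so the \<open>ps\<close> have no component along
  \<open>vec_z\<close> and lie in the span of the \<open>vec_zbar\<close>. Being dual to the
  \<open>vec_z\<close> they are independent, so the matrix H of this expansion is
  invertible.\<close>

lemma vec_zbar_ps: "\<exists>k. \<forall>i. vec_zbar Z i = (SU j. (k :: complex^'n^'n) $ j $ i *s ps Z j)"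
proof -
 define H where "H = (\<chi> i j. dot (fs Z i) (ps Z j))"
 have ps: "ps Z j = (SU i. H $ i $ j *s vec_zbar Z i)" for j
  by (subst dual_expand[OF Z]) (simp add: annihilator_isotropic vacuum H_def)
 have cps: "(SU j. c $ j *s ps Z j) = (SU i. (H *v c) $ i *s vec_zbar Z i)" for c :: "complex^'n"
 proof -
  have "(SU j. c $ j *s ps Z j) = (SU j i. (H $ i $ j * c $ j) *s vec_zbar Z i)"
   by (subst ps) (simp add: vec.scale_sum_right mult.commute)
  also have "\<dots> = (SU i j. (H $ i $ j * c $ j) *s vec_zbar Z i)" by (rule sum.swap)
  finally show ?thesis by (simp add: matrix_vector_mult_def vec.scale_sum_left)
 qed
 have "c = 0" if "H *v c = 0" for c
 proof (rule vec_eq_iff[THEN iffD2], intro allI)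
  fix k
  have "dot (SU j. c $ j *s ps Z j) (vec_z Z k) = 0" unfolding cps that by (simp add: dot_simps)
  thus "c $ k = 0 $ k" by (simp add: dot_sum dot_simps dot_dual[OF Z] if_distrib cong: if_cong)
 qed
 then obtain B where "B ** H = mat 1" using matrix_left_invertible_ker[of H] by auto
 hence B: "H ** B = mat 1" by (simp add: matrix_left_right_inverse)
 have "vec_zbar Z i = (SU j. B $ j $ i *s ps Z j)" for i
 proof -
  have "H *v (\<chi> j. B $ j $ i) = (\<chi> l. if l = i then 1 else 0)"
  proof (rule vec_eq_iff[THEN iffD2], intro allI)
   fix l
   have "(H *v (\<chi> j. B $ j $ i)) $ l = (H ** B) $ l $ i" by (simp add: matrix_vector_mult_def matrix_matrix_mult_def)
   thus "(H *v (\<chi> j. B $ j $ i)) $ l = (\<chi> l. if l = i then 1 else 0) $ l" unfolding B by (simp add: mat_def)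
  qed
  hence "(SU j. B $ j $ i *s ps Z j) = (SU l. (if l = i then 1 else 0) *s vec_zbar Z l)"
   using cps[of "\<chi> j. B $ j $ i"] by simp
  also have "\<dots> = (SU l. if l = i then vec_zbar Z i else 0)" by (rule sum.cong) auto
  finally show ?thesis by simp
 qed
 thus ?thesis by blast
qed

lemma vacuum_zbar: "(!!j. cm gp (ps Z j) s = 0) ==> cm gp (vec_zbar Z i) s = 0"
proof -
 assume s: "!!j. cm gp (ps Z j) s = 0"
 obtain k :: "complex^'n^'n" where "vec_zbar Z i = (SU j. k $ j $ i *s ps Z j)" using vec_zbar_ps by blast
 thus ?thesis by (simp add: cm_sum cm_simps s)
qed

lemma isotropic: "dot (vec_zbar Z i) (vec_zbar Z j) = 0" "dot (vec_z Z i) (vec_z Z j) = 0"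
proof -
 show 1: "dot (vec_zbar Z i) (vec_zbar Z j) = 0" by (intro annihilator_isotropic vacuum_zbar vacuum)
 \<comment> \<open>The complement of L is its complex conjugate, and \<open>dot\<close> has real
   coefficients.\<close>
 have "vec_z Z i $ \<mu> = cnj (vec_zbar Z i $ \<mu>)" for i \<mu> by (simp add: vec_z_def vec_zbar_def)
 hence "dot (vec_z Z i) (vec_z Z j) = cnj (dot (vec_zbar Z i) (vec_zbar Z j))" by (simp add: dot_def cnj_sum)
 thus "dot (vec_z Z i) (vec_z Z j) = 0" by (simp add: 1)
qed

lemma matrix_outer: "X = (SU j. outer (X *v vec_zbar Z j) (fs Z j)) + (SU j. outer (X *v vec_z Z j) (ps Z j))"
proof -
 have "X *v v = ((SU j. outer (X *v vec_zbar Z j) (fs Z j)) + (SU j. outer (X *v vec_z Z j) (ps Z j))) *v v" for v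
  by (subst dual_expand[OF Z, of v])
   (simp add: matrix_vector_mult_add_rdistrib matrix_sum_mult outer_mult matrix_vector_right_distrib mult_sum vector_scalar_commute)
 thus ?thesis using matrix_eq by blast
qed

text \<open>After expanding X in dual bases only the terms in which a \<open>vec_zbar\<close>
  multiplies its dual form act on the vacuum, each by half a diagonal entry of a. The resulting
  weight is that of a square root of the determinant of L.\<close>

lemma spin_vacuum:
 assumes X: "!!j. X *v vec_zbar Z j = (SU i. (a $ i $ j) *s vec_zbar Z i)" and s: "!!j. cm gp (ps Z j) s = 0"
 shows "spin gm gp X *v s = (trace a / 2) *s s"
proof -
 have 1: "cm gm (vec_zbar Z i) (cm gp (fs Z j) s) = (if j = i then 2 *s s else 0)" for i j
 proof -
  have "cm gm (vec_zbar Z i) (cm gp (fs Z j) s) = (2 * dot (vec_zbar Z i) (fs Z j)) *s s"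
   using clifford[of "vec_zbar Z i" "fs Z j" s] vacuum_zbar[OF s] by (simp add: cm_simps)
  thus ?thesis by (simp add: dot_commute[of "vec_zbar Z i"] dot_dual[OF Z])
 qed
 have 2: "cm gm (X *v vec_zbar Z j) (cm gp (fs Z j) s) = (2 * a $ j $ j) *s s" for j
 proof -
  have "cm gm (X *v vec_zbar Z j) (cm gp (fs Z j) s) = (SU i. if i = j then (2 * a $ j $ j) *s s else 0)"
   unfolding X cm_sum cm_simps 1 by (rule sum.cong) auto
  thus ?thesis by simp
 qed
 have "spin gm gp X *v s = (SU j. (1/4) *s ((2 * a $ j $ j) *s s))"
  by (subst matrix_outer[of X]) (simp only: spin_add spin_sum spin_outer 2 s cm_simps vec.scale_zero_right sum.neutral_const add_0_right)
 thus ?thesis by (simp add: trace_def vec.scale_sum_left sum_divide_distrib)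
qed

text \<open>The central element of gl(n), acting as 1 on L and as -1 on the complement; its
  eigenvalues grade the spinors.\<close>

definition "X0 = (SU j. outer (vec_zbar Z j) (fs Z j)) - (SU j. outer (vec_z Z j) (ps Z j))"

lemma X0_mult: "X0 *v v = (SU j. dot (fs Z j) v *s vec_zbar Z j) - (SU j. dot (ps Z j) v *s vec_z Z j)"
 by (simp add: X0_def matrix_vector_mult_diff_rdistrib matrix_sum_mult outer_mult)

lemma X0_dual: "dot (fs Z i) (X0 *v v) = dot (fs Z i) v" "dot (ps Z i) (X0 *v v) = - dot (ps Z i) v"
 by (simp_all add: X0_mult dot_simps dot_sum dot_dual[OF Z] if_distrib cong: if_cong)

lemma X0_vec: "X0 *v vec_zbar Z j = vec_zbar Z j" "X0 *v vec_z Z j = - vec_z Z j"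
 by (simp_all add: X0_mult dot_dual[OF Z] if_distrib[of "%x. x *s _"] cong: if_cong)

lemma X0_so: "X0 : so"
proof -
 let ?L = "%v. SU j. dot (fs Z j) v *s vec_zbar Z j" and ?B = "%v. SU j. dot (ps Z j) v *s vec_z Z j"
 have z: "dot (?L v) (?L w) = 0" "dot (?B v) (?B w) = 0" for v w
  by (simp_all add: dot_sum dot_simps isotropic)
 have "dot v (X0 *v w) = - dot (X0 *v v) w" for v w
 proof -
  have "dot (?L v + ?B v) (?L w - ?B w) = - dot (?L v - ?B v) (?L w + ?B w)" by (simp add: dot_simps z)
  thus ?thesis unfolding X0_mult dual_expand[OF Z, symmetric] .
 qed
 from this[of "axis _ 1" "axis _ 1"] have "X0 $ \<nu> $ \<mu> = - X0 $ \<mu> $ \<nu>" for \<mu> \<nu>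
 proof -
  have d: "dot (axis \<nu> 1) v = v $ \<nu>" for \<nu> and v :: "complex^'d"
   by (simp add: dot_def axis_def if_distrib[of "%x. x * _"] cong: if_cong)
  show ?thesis
   using \<open>dot (axis \<nu> 1) (X0 *v axis \<mu> 1) = - dot (X0 *v axis \<nu> 1) (axis \<mu> 1)\<close>
   unfolding dot_commute[of _ "axis \<mu> 1"] d mult_axis_nth .
 qed
 thus ?thesis unfolding so_iff by blast
qed

text \<open>The index m is twice the eigenvalue of X0; it is an integer that drops by 2 with every
  creation operator.\<close>

definition "lev m s \<longleftrightarrow> spin gm gp X0 *v s = (of_int m / 2) *s s"
definition "lev' m s \<longleftrightarrow> spin gp gm X0 *v s = (of_int m / 2) *s s"

lemma lev_vacuum: "(!!j. cm gp (ps Z j) s = 0) ==> lev (int CARD('n)) s"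
proof -
 have "X0 *v vec_zbar Z j = (SU i. (mat 1 :: complex^'n^'n) $ i $ j *s vec_zbar Z i)" for j
  by (simp add: X0_vec mat_def if_distrib[of "%x. x *s _"] cong: if_cong)
 from spin_vacuum[OF this] show "(!!j. cm gp (ps Z j) s = 0) ==> lev (int CARD('n)) s"
  by (simp add: lev_def trace_I)
qed

section \<open>Creation operators and levels\<close>

definition "Lb = vec.span (range (vec_z Z))"

lemma Lb_X0: "w : Lb ==> X0 *v w = - w"
proof -
 have "Lb \<subseteq> {w. X0 *v w = - w}"
  unfolding Lb_def by (rule vec.span_minimal)
   (auto simp: X0_vec vec.subspace_def matrix_vector_right_distrib vector_scalar_commute)
 thus "w : Lb ==> X0 *v w = - w" by blast
qed

lemma Lb_isotropic: assumes "v : Lb" "w : Lb" shows "dot v w = 0"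
proof -
 have s: "vec.subspace {v. dot v w = 0}" for w :: "complex^'d" by (simp add: vec.subspace_def dot_simps)
 have 1: "Lb \<subseteq> {v. dot v (vec_z Z j) = 0}" for j unfolding Lb_def
  by (rule vec.span_minimal[OF _ s]) (auto simp: isotropic)
 have "dot (vec_z Z j) v = 0" for j using 1[of j] assms(1) by (auto simp: dot_commute[of "vec_z Z j"])
 hence "Lb \<subseteq> {w. dot w v = 0}" unfolding Lb_def
  by (intro vec.span_minimal[OF _ s]) auto
 thus ?thesis using assms(2) dot_commute[of v w] by auto
qed

text \<open>\<open>We k\<close> is spanned by 2 k creation operators applied to q, and
  \<open>Wo k\<close> below by 2 k + 1: the even and odd exterior powers of the complement of
  L.\<close>

primrec We :: "nat => (complex^'p) set" where
 "We 0 = vec.span {q}"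
| "We (Suc k) = up gm Lb (up gp Lb (We k))"

definition "Wo k = up gp Lb (We k)"

lemma We_Suc: "We (Suc k) = up gm Lb (Wo k)" by (simp add: Wo_def)

lemma subspace_We: "vec.subspace (We k)" by (cases k) (simp_all add: subspace_up)
lemma subspace_Wo: "vec.subspace (Wo k)" by (simp add: Wo_def subspace_up)

lemma lev_W: "s : We k ==> lev (int CARD('n) - 4 * int k) s" "t : Wo k ==> lev' (int CARD('n) - 4 * int k - 2) t"
proof -
 have sub: "vec.subspace {s. lev m s}" "vec.subspace {t. lev' m t}" for m
  by (simp_all add: vec.subspace_def lev_def lev'_def matrix_vector_right_distrib vector_scalar_commute vec.scale_right_distrib mult.commute)
 have up1: "lev' (m - 2) (cm gp w s)" if "w : Lb" "lev m s" for m w s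
  using that spin_cm[OF X0_so, of w s] by (simp add: lev_def lev'_def Lb_X0 cm_simps cm_more vec.scale_left_diff_distrib diff_divide_distrib)
 have up2: "lev (m - 2) (cm gm w t)" if "w : Lb" "lev' m t" for m w t
  using that sw.spin_cm[OF X0_so, of w t] by (simp add: lev_def lev'_def Lb_X0 cm_simps cm_more vec.scale_left_diff_distrib diff_divide_distrib)
 have o: "t : Wo k ==> lev' (int CARD('n) - 4 * int k - 2) t" if "!!s. s : We k ==> lev (int CARD('n) - 4 * int k) s" for k t
  unfolding Wo_def using up_minimal[OF sub(2)] up1 that by (smt (verit, best) mem_Collect_eq)
 have e: "s : We k ==> lev (int CARD('n) - 4 * int k) s" for s k
 proof (induction k arbitrary: s)
  case 0
  have "vec.span {q} \<subseteq> {s. lev (int CARD('n)) s}" by (rule vec.span_minimal[OF _ sub(1)]) (simp add: lev_vacuum vacuum)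
  thus ?case using 0 by auto
 next
  case (Suc k)
  have "s : {s. lev (int CARD('n) - 4 * int k - 2 - 2) s}"
   using Suc.prems unfolding We_Suc by (rule up_minimal[OF sub(1), rotated]) (use up2 o[OF Suc.IH] in blast)
  thus ?case by (simp add: algebra_simps)
 qed
 show "s : We k ==> lev (int CARD('n) - 4 * int k) s" "t : Wo k ==> lev' (int CARD('n) - 4 * int k - 2) t"
  using e o by blast+
qed

text \<open>An annihilation operator is moved past the creation operators by the Clifford relation,
  losing one of them at each contraction, until it reaches q, which it kills.\<close>

lemma lower:
 assumes l: "cm gp l q = 0"
 shows "s : We 0 ==> cm gp l s = 0" "s : We (Suc k) ==> cm gp l s : Wo k" "t : Wo k ==> cm gm l t : We k"
proof -
 have z: "cm gp l s = 0" if "s : We 0" for s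
  using span_cm[of "{0}" "{q}" gp l s] that l by (simp add: vec.subspace_def)
 have o: "cm gm l t : We k" if t: "t : Wo k" and s: "!!w s. w : Lb ==> s : We k ==> cm gm w (cm gp l s) : We k" for t k
 proof -
  have "t : {t. cm gm l t : We k}"
  proof (rule up_minimal[OF subspace_cm[OF subspace_We] _ t[unfolded Wo_def]])
   fix w s assume w: "w : Lb" and sk: "s : We k"
   have "cm gm l (cm gp w s) = (2 * dot l w) *s s - cm gm w (cm gp l s)" using clifford[of l w s] by (simp add: eq_diff_eq)
   thus "cm gp w s : {t. cm gm l t : We k}"
    using s[OF w sk] sk subspace_We by (simp add: vec.subspace_diff vec.subspace_scale)
  qed
  thus ?thesis by simp
 qed
 have e: "cm gp l s : Wo k" if s: "s : We (Suc k)" and t: "!!t. t : Wo k ==> cm gm l t : We k" for s k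
 proof -
  have "s : {s. cm gp l s : Wo k}"
  proof (rule up_minimal[OF subspace_cm[OF subspace_Wo] _ s[unfolded We_Suc]])
   fix w t' assume w: "w : Lb" and tk: "t' : Wo k"
   have "cm gp l (cm gm w t') = (2 * dot l w) *s t' - cm gp w (cm gm l t')" using sw.clifford[of l w t'] by (simp add: eq_diff_eq)
   moreover have "cm gp w (cm gm l t') : Wo k" unfolding Wo_def by (rule up_mem[OF w t[OF tk]])
   ultimately show "cm gm w t' : {s. cm gp l s : Wo k}"
    using tk subspace_Wo by (simp add: vec.subspace_diff vec.subspace_scale)
  qed
  thus ?thesis by simp
 qed
 have both: "(\<forall>t\<in>Wo k. cm gm l t : We k)" for k
 proof (induction k)
  case 0
  show ?case
  proof
   fix t assume "t : Wo 0"
   thus "cm gm l t : We 0" by (rule o) (simp add: z[simplified] cm_simps vec.span_zero)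
  qed
 next
  case (Suc k)
  show ?case
  proof
   fix t assume "t : Wo (Suc k)"
   thus "cm gm l t : We (Suc k)"
   proof (rule o)
    fix w s assume "w : Lb" "s : We (Suc k)"
    moreover from this have "cm gp l s : Wo k" using Suc.IH by (intro e) blast+
    ultimately show "cm gm w (cm gp l s) : We (Suc k)" unfolding We_Suc by (intro up_mem)
   qed
  qed
 qed
 show "s : We 0 ==> cm gp l s = 0" by (rule z)
 show "s : We (Suc k) ==> cm gp l s : Wo k" using both by (intro e) auto
 show "t : Wo k ==> cm gm l t : We k" using both by auto
qed

lemma split_L: "\<exists>l w. v = l + w \<and> cm gp l q = 0 \<and> w : Lb"
proof -
 let ?l = "SU j. dot (fs Z j) v *s vec_zbar Z j" and ?w = "SU j. dot (ps Z j) v *s vec_z Z j"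
 have "cm gp ?l q = 0" by (simp add: cm_sum cm_simps vacuum_zbar vacuum)
 moreover have "?w : Lb" unfolding Lb_def by (intro vec.span_sum vec.span_scale vec.span_base) simp
 ultimately show ?thesis using dual_expand[OF Z, of v] by blast
qed

text \<open>The span of the levels is stable under creation and annihilation operators, hence under
  all of V, and irreducibility applies.\<close>

lemma total: "vec.span (\<Union>k. We k) = UNIV" "vec.span (\<Union>k. Wo k) = UNIV"
proof -
 let ?E = "vec.span (\<Union>k. We k)" and ?O = "vec.span (\<Union>k. Wo k)"
 have o: "cm gp v s : ?O" if s: "s : ?E" for v s
 proof (rule span_cm[OF vec.subspace_span _ s])
  fix s assume "s : (\<Union>k. We k)"
  then obtain k where k: "s : We k" by auto
  obtain l w where v: "v = l + w" "cm gp l q = 0" "w : Lb" using split_L by blast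
  have "cm gp w s : ?O" using up_mem[OF v(3) k, of gp] by (intro vec.span_base) (auto simp: Wo_def)
  moreover have "cm gp l s : ?O"
  proof (cases k)
   case 0
   thus ?thesis using lower(1)[OF v(2)] k vec.span_zero by simp
  next
   case (Suc j)
   thus ?thesis using lower(2)[OF v(2)] k by (intro vec.span_base) blast
  qed
  ultimately show "cm gp v s : ?O" unfolding v(1) cm_simps by (intro vec.span_add)
 qed
 have e: "cm gm v t : ?E" if t: "t : ?O" for v t
 proof (rule span_cm[OF vec.subspace_span _ t])
  fix t assume "t : (\<Union>k. Wo k)"
  then obtain k where k: "t : Wo k" by auto
  obtain l w where v: "v = l + w" "cm gp l q = 0" "w : Lb" using split_L by blast
  have "cm gm w t : We (Suc k)" unfolding We_Suc by (rule up_mem[OF v(3) k])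
  hence "cm gm w t : ?E" by (intro vec.span_base) blast
  moreover have "cm gm l t : ?E" using lower(3)[OF v(2) k] by (intro vec.span_base) blast
  ultimately show "cm gm v t : ?E" unfolding v(1) cm_simps by (intro vec.span_add)
 qed
 have qE: "q : ?E" by (rule vec.span_base) (auto intro!: exI[of _ 0] vec.span_base)
 show "?E = UNIV"
  by (rule irreducible[OF vec.subspace_span _ qE q]) (use o[of _ "axis _ 1"] e[of _ "axis _ 1"] in \<open>auto simp: cm_axis\<close>)
 have "gp undefined *v q : ?O" using o[OF qE, of "axis undefined 1"] by (simp add: cm_axis)
 moreover have "gp undefined *v q ~= 0" using sq[of undefined q] q by auto
 ultimately show "?O = UNIV"
  by (rule sw.irreducible[OF vec.subspace_span, rotated]) (use o[of _ "axis _ 1"] e[of _ "axis _ 1"] in \<open>auto simp: cm_axis\<close>)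
qed

text \<open>The stabilizer scales q and preserves the space of creation operators, so by
  \<open>spin_cm\<close> it preserves each level.\<close>

lemma spin_We:
 assumes X: "gl_stab Z X a b" and s: "s : We k" shows "spin gm gp X *v s : We k"
proof -
 have so: "X : so" using X by (simp add: gl_stab_def)
 have Lb: "X *v w : Lb" if "w : Lb" for w
 proof -
  have "Lb \<subseteq> {w. X *v w : Lb}"
   unfolding Lb_def
  proof (rule vec.span_minimal)
   show "range (vec_z Z) \<subseteq> {w. X *v w : vec.span (range (vec_z Z))}"
   proof clarify
    fix j
    have "X *v vec_z Z j = (SU i. (b $ i $ j) *s vec_z Z i)" using X by (simp add: gl_stab_def)
    thus "X *v vec_z Z j : vec.span (range (vec_z Z))"
     by (simp only:) (intro vec.span_sum vec.span_scale vec.span_base rangeI)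
   qed
   show "vec.subspace {w. X *v w : vec.span (range (vec_z Z))}"
    by (simp add: vec.subspace_def matrix_vector_right_distrib vector_scalar_commute vec.span_add vec.span_scale vec.span_zero)
  qed
  thus ?thesis using that by blast
 qed
 have sub: "vec.subspace {s. A *v s : W}" if "vec.subspace W" for A :: "complex^'x::finite^'y::finite" and W
  using that by (simp add: vec.subspace_def matrix_vector_right_distrib vector_scalar_commute)
 show ?thesis using s
 proof (induction k arbitrary: s)
  case 0
  have "spin gm gp X *v q = (trace a / 2) *s q" by (rule spin_vacuum) (use X vacuum in \<open>auto simp: gl_stab_def\<close>)
  hence "vec.span {q} \<subseteq> {s. spin gm gp X *v s : vec.span {q}}"
   by (intro vec.span_minimal sub vec.subspace_span) (simp add: vec.span_scale vec.span_base)
  thus ?case using 0 by auto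
 next
  case (Suc k)
  have o: "spin gp gm X *v t : Wo k" if "t : Wo k" for t
  proof -
   have "t : {t. spin gp gm X *v t : Wo k}"
   proof (rule up_minimal[OF sub[OF subspace_Wo] _ that[unfolded Wo_def]])
    fix w s assume "w : Lb" "s : We k"
    thus "cm gp w s : {t. spin gp gm X *v t : Wo k}"
     unfolding mem_Collect_eq spin_cm[OF so] Wo_def using Suc.IH Lb
     by (intro vec.subspace_add[OF subspace_up] up_mem)
   qed
   thus ?thesis by simp
  qed
  have "s : {s. spin gm gp X *v s : We (Suc k)}"
  proof (rule up_minimal[OF sub[OF subspace_We] _ Suc.prems[unfolded We_Suc]])
   fix w t assume "w : Lb" "t : Wo k"
   thus "cm gm w t : {s. spin gm gp X *v s : We (Suc k)}"
    unfolding mem_Collect_eq sw.spin_cm[OF so] We_Suc using o Lb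
    by (intro vec.subspace_add[OF subspace_up] up_mem)
  qed
  thus ?case by simp
 qed
qed

text \<open>The bivector of two creation operators acts on spinors as a multiple of their product,
  so it moves q to a prescribed element of \<open>We 1\<close> and raises every level. Such
  rotations differentiate the equation [q, q] = 0 in dimension ten.\<close>

lemma We1_so:
 assumes "x : We 1"
 shows "\<exists>X\<in>so. spin gm gp X *v q = x \<and> (\<forall>k. \<forall>s\<in>We k. spin gm gp X *v s : We (Suc k))"
proof -
 define S where "S = {x. \<exists>X\<in>so. spin gm gp X *v q = x \<and> (\<forall>k. \<forall>s\<in>We k. spin gm gp X *v s : We (Suc k))}"
 have S: "vec.subspace S"
  unfolding vec.subspace_def
 proof (intro conjI ballI allI)
  have "spin gm gp 0 *v s = 0" for s by (simp add: spin_vec)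
  moreover have "0 : (so :: (complex^'d^'d) set)" by (simp add: so_iff)
  ultimately show "0 : S" unfolding S_def mem_Collect_eq
   by (intro bexI[of _ 0]) (simp_all only: vec.subspace_0[OF subspace_We], simp_all)
  show "x + y : S" if "x : S" "y : S" for x y
  proof -
   from that obtain X Y where XY: "X : so" "spin gm gp X *v q = x" "!!k s. s : We k ==> spin gm gp X *v s : We (Suc k)"
    "Y : so" "spin gm gp Y *v q = y" "!!k s. s : We k ==> spin gm gp Y *v s : We (Suc k)" unfolding S_def by blast
   show ?thesis unfolding S_def mem_Collect_eq
   proof (intro bexI[of _ "X + Y"] conjI allI ballI)
    show "spin gm gp (X + Y) *v q = x + y" unfolding spin_add XY ..
    show "spin gm gp (X + Y) *v s : We (Suc k)" if "s : We k" for k s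
     unfolding spin_add by (rule vec.subspace_add[OF subspace_We XY(3)[OF that] XY(6)[OF that]])
   qed (rule so_add[OF XY(1,4)])
  qed
  show "c *s x : S" if "x : S" for c x
  proof -
   from that obtain X where X: "X : so" "spin gm gp X *v q = x" "!!k s. s : We k ==> spin gm gp X *v s : We (Suc k)" unfolding S_def by blast
   have c: "spin gm gp (\<chi> i j. c * X $ i $ j) *v s = c *s (spin gm gp X *v s)" for s
    unfolding spin_vec by (simp add: vec.scale_sum_right mult_ac)
   have "(\<chi> i j. c * X $ i $ j) : so"
    unfolding so_iff
   proof (intro allI)
    fix \<mu> \<nu>
    have "X $ \<nu> $ \<mu> = - X $ \<mu> $ \<nu>" using X(1) so_iff by blast
    thus "(\<chi> i j. c * X $ i $ j) $ \<nu> $ \<mu> = - (\<chi> i j. c * X $ i $ j) $ \<mu> $ \<nu>" by simp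
   qed
   note cs = this
   show ?thesis unfolding S_def mem_Collect_eq
   proof (intro bexI[OF _ cs] conjI allI ballI)
    show "spin gm gp (\<chi> i j. c * X $ i $ j) *v q = c *s x" unfolding c X ..
    show "spin gm gp (\<chi> i j. c * X $ i $ j) *v s : We (Suc k)" if "s : We k" for k s
     unfolding c by (rule vec.subspace_scale[OF subspace_We X(3)[OF that]])
   qed
  qed
 qed
 have "x : S"
 proof (rule up_minimal[OF S])
  show "x : up gm Lb (Wo 0)" using assms unfolding One_nat_def We_Suc .
  fix v t assume v: "v : Lb" and t: "t : Wo 0"
  have "t : {t. cm gm v t : S}"
  proof (rule up_minimal[OF subspace_cm[OF S] _ t[unfolded Wo_def]])
   fix w s assume w: "w : Lb" and "s : We 0"
   then obtain c where s: "s = c *s q" by (auto simp: vec.span_singleton)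
   \<comment> \<open>The bivector of v and w acts as (v w - w v) / 4, which is v w / 2 because v and
     w anticommute; hence the factor 2 c.\<close>
   let ?X = "outer ((2 * c) *s v) w - outer w ((2 * c) *s v)"
   have Xe: "?X = outer ((2 * c) *s v) w + outer (- w) ((2 * c) *s v)" by (simp add: vec_eq_iff outer_def)
   have cw: "cm gm w (cm gp v u) = - cm gm v (cm gp w u)" for u
    using clifford[of v w u] Lb_isotropic[OF v w] by (simp add: add_eq_0_iff)
   have X: "spin gm gp ?X *v u = c *s cm gm v (cm gp w u)" for u
    unfolding Xe spin_add spin_outer cm_simps cm_more cw by (simp add: vec_eq_iff)
   have "spin gm gp ?X *v u : We (Suc k)" if "u : We k" for u k
    unfolding X We_Suc Wo_def by (intro vec.subspace_scale[OF subspace_up] up_mem v w that)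
   moreover have "spin gm gp ?X *v q = cm gm v (cm gp w s)" unfolding X s by (simp add: cm_simps)
   ultimately show "cm gp w s : {t. cm gm v t : S}" unfolding S_def mem_Collect_eq using so_outer by blast
  qed
  thus "cm gm v t : S" by simp
 qed
 thus ?thesis by (simp add: S_def)
qed

end

section \<open>Weights of the bracket\<close>

locale fock = equivariant_pair gp gm dp dm G
 for gp :: "'d::finite => complex^'p::finite^'m::finite" and gm :: "'d => complex^'m^'p"
  and dp :: "'d => complex^'q::finite^'r::finite" and dm :: "'d => complex^'r^'q" and G +
 fixes Z :: "real^'d => complex^'n::finite" and q :: "complex^'p"
 assumes Z: "linear Z" "bij Z" and q0: "q ~= 0" and gq: "!!i t. dot (ps Z i) (gb G q t) = 0"
begin

lemma vacuum_iff: "(!!t. dot l (gb G s t) = 0) ==> cm gp l s = 0"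
 by (rule pairing(2)[of undefined]) (simp add: pairing(1)[symmetric])

sublocale polarized gp gm Z q
 using Z q0 by unfold_locales (auto intro: vacuum_iff gq simp: linear_add linear_cmul)

definition "levd m t \<longleftrightarrow> spin dm dp X0 *v t = (of_int m / 2) *s t"

text \<open>The bracket adds weights, and X0 is 1 on L and -1 on the complement; with doubled
  weights these are 2 and -2.\<close>

lemma weight:
 assumes "lev m s" "levd m' t"
 shows "m + m' ~= 2 ==> dot (fs Z i) (gb G s t) = 0" "m + m' ~= - 2 ==> dot (ps Z i) (gb G s t) = 0"
proof -
 have X: "X0 *v gb G s t = (of_int (m + m') / 2) *s gb G s t"
  using assms unfolding gb_so[OF X0_so, of s t] lev_def levd_def
  by (simp only: gb_simps) (simp add: vec.scale_left_distrib add_divide_distrib)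
 have "dot (fs Z i) (gb G s t) = (of_int (m + m') / 2) * dot (fs Z i) (gb G s t)"
  "- dot (ps Z i) (gb G s t) = (of_int (m + m') / 2) * dot (ps Z i) (gb G s t)"
  using X0_dual[of i "gb G s t"] unfolding X by (simp_all add: dot_simps)
 moreover have "(2 - c) * x = 0" if "x = (c / 2) * x" for c x :: complex using that by (simp add: field_simps)
 moreover have "(2 + c) * x = 0" if "- x = (c / 2) * x" for c x :: complex
 proof -
  have "(2 + c) * x = 2 * (x + (c / 2) * x)" by (simp add: field_simps)
  thus ?thesis unfolding that[symmetric] by simp
 qed
 ultimately have "(2 - of_int (m + m')) * dot (fs Z i) (gb G s t) = 0" "(2 + of_int (m + m')) * dot (ps Z i) (gb G s t) = 0"
  by blast+
 moreover have "(2 :: complex) - of_int (m + m') = of_int (2 - (m + m'))" "(2 :: complex) + of_int (m + m') = of_int (2 + (m + m'))" by simp_all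
 ultimately show "m + m' ~= 2 ==> dot (fs Z i) (gb G s t) = 0" "m + m' ~= - 2 ==> dot (ps Z i) (gb G s t) = 0"
  by (simp_all only: mult_eq_0_iff of_int_eq_0_iff) linarith+
qed

lemma weight_zero: "lev m s ==> levd m' t ==> m + m' ~= 2 ==> m + m' ~= - 2 ==> gb G s t = 0"
 by (intro dual_zero[OF Z] weight)

lemma gb_We_zero: assumes "!!k s. s : We k ==> gb G s t = 0" shows "t = 0"
proof (rule right_kernel)
 have "vec.span (\<Union>k. We k) \<subseteq> {s. gb G s t = 0}"
  by (rule vec.span_minimal) (use assms in \<open>auto simp: vec.subspace_def gb_simps gb_more\<close>)
 thus "gb G s t = 0" for s using total by auto
qed

lemma gb_q_span: "s : We 0 ==> gb G q t = 0 ==> gb G s t = 0"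
 by (auto simp: vec.span_singleton gb_simps)

text \<open>A weight that matches no level forces the bracket with each \<open>We k\<close> to
  vanish, and the right kernel is 0. For the level of q only the value 2 has to be excluded, because
  [q, -] lies in L.\<close>

lemma right_zero:
 assumes t: "levd m t" and m: "int CARD('n) + m ~= 2" "!!i. i \<ge> 1 ==> int CARD('n) - 4 * i + m ~= 2 \<and> int CARD('n) - 4 * i + m ~= - 2"
 shows "t = 0"
proof (rule gb_We_zero)
 fix k s assume s: "s : We k"
 show "gb G s t = 0"
 proof (cases k)
  case 0
  have "gb G q t = 0"
   by (rule dual_zero[OF Z weight(1)[OF lev_vacuum[OF vacuum] t m(1)] gq])
  thus ?thesis using s 0 gb_q_span by blast
 next
  case (Suc j)
  thus ?thesis using weight_zero[OF lev_W(1)[OF s] t] m(2)[of "int k"] by simp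
 qed
qed

text \<open>The level 1 part of the right kernel condition reduces to that of q: the \<psi>
  component of [a, y] is the pairing of \<open>ps\<close> a with y; \<open>ps\<close> a consists of
  terms w q with a creation operator w, and these pair with y through the components of [q, y] =
  0.\<close>

lemma top_injective:
 assumes q: "gb G q y = 0" and x: "!!x i. x : We 1 ==> dot (fs Z i) (gb G x y) = 0" and s: "!!k s. k \<ge> 2 ==> s : We k ==> gb G s y = 0"
 shows "y = 0"
proof (rule gb_We_zero)
 fix k a assume a: "a : We k"
 consider "k = 0" | "k = 1" | "k \<ge> 2" by linarith
 thus "gb G a y = 0"
 proof cases
  case 1 thus ?thesis using a gb_q_span q by blast
 next
  case 2
  have "dot (ps Z i) (gb G a y) = 0" for i
  proof -
   let ?C = "%s. gb G (gm undefined *v s) y $ undefined"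
   have "cm gp (ps Z i) a : Wo 0" using lower(2)[OF vacuum] a 2 by simp
   moreover have "Wo 0 \<subseteq> {s. ?C s = 0}"
   proof
    fix s assume "s : Wo 0"
    thus "s : {s. ?C s = 0}" unfolding Wo_def
    proof (rule up_minimal[rotated 2])
     show "vec.subspace {s. ?C s = 0}"
      by (simp add: vec.subspace_def matrix_vector_right_distrib vector_scalar_commute gb_simps gb_more)
     fix w s assume "s : We 0"
     thus "cm gp w s : {s. ?C s = 0}"
      using pairing(1)[of w s y undefined] gb_q_span[OF _ q] by (simp add: dot_simps)
    qed
   qed
   ultimately show ?thesis unfolding pairing(1)[of _ _ _ undefined] by blast
  qed
  thus ?thesis using dual_zero[OF Z] x a 2 by blast
 next
  case 3 thus ?thesis using s a by blast
 qed
qed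

lemma S_split:
 assumes "!!k s. k \<ge> m ==> s : We k ==> s = 0" "m \<le> 3"
 shows "\<exists>c. \<exists>x\<in>We 1. \<exists>y\<in>We 2. s = c *s q + x + y"
proof -
 let ?T = "{u + y |u y. u : {a + x |a x. a : We 0 \<and> x : We 1} \<and> y : We 2}"
 have z: "0 : We k" for k by (rule vec.subspace_0[OF subspace_We])
 have "vec.span (\<Union>k. We k) \<subseteq> ?T"
 proof (rule vec.span_minimal)
  show "vec.subspace ?T" by (intro vec.subspace_sums subspace_We)
  have mem: "a + x + y : ?T" if "a : We 0" "x : We 1" "y : We 2" for a x y using that by blast
  show "(\<Union>k. We k) \<subseteq> ?T"
  proof
   fix s assume "s : (\<Union>k. We k)"
   then obtain k where s: "s : We k" by blast
   consider "k = 0" | "k = 1" | "k = 2" | "k \<ge> 3" by linarith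
   thus "s : ?T"
   proof cases
    case 1 thus ?thesis using mem[OF _ z z, of s] s by (simp only: add_0_right)
   next
    case 2 thus ?thesis using mem[OF z _ z, of s] s by (simp only: add_0_right add_0_left)
   next
    case 3 thus ?thesis using mem[OF z z, of s] s by (simp only: add_0_right add_0_left)
   next
    case 4
    hence "s = 0" using assms(1)[OF _ s] assms(2) by linarith
    thus ?thesis using mem[OF z z z] by (simp only: add_0_right)
   qed
  qed
 qed
 hence "s : ?T" using total by blast
 then obtain a x y where "a : We 0" "x : We 1" "y : We 2" "s = a + x + y" by blast
 thus ?thesis by (auto simp: vec.span_singleton)
qed

end

subsection \<open>The three cases\<close>

lemma card_coordinates:
 fixes Z :: "real^'d::finite => complex^'n::finite"
 assumes "linear Z" "bij Z" shows "CARD('d) = 2 * CARD('n)"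
proof -
 have "dim (range Z) = dim (UNIV :: (real^'d) set)"
  by (rule dim_image_eq[OF assms(1)]) (use bij_is_inj[OF assms(2)] in simp)
 moreover have "range Z = UNIV" by (rule bij_is_surj[OF assms(2)])
 ultimately show ?thesis by simp
qed

lemma coordinates_bracket:
 fixes Z :: "real^'d::finite => complex^'n::finite"
 assumes "holomorphic_coordinates \<Gamma> Q Z"
 shows "linear Z" "bij Z" "dot (ps Z i) (gb \<Gamma> Q s) = 0" "\<exists>s. gb \<Gamma> Q s = vec_zbar Z i"
proof -
 show Z: "linear Z" "bij Z" using assms by (simp_all add: holomorphic_coordinates_def)
 have r: "vec.span (range (vec_zbar Z)) = range (gb \<Gamma> Q)" using assms by (simp add: holomorphic_coordinates_def bracket_gb)
 have "vec.span (range (vec_zbar Z)) \<subseteq> {v. dot (ps Z i) v = 0}"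
  by (rule vec.span_minimal) (auto simp: dot_dual[OF Z] vec.subspace_def dot_simps)
 thus "dot (ps Z i) (gb \<Gamma> Q s) = 0" unfolding r by blast
 have "vec_zbar Z i : range (gb \<Gamma> Q)" unfolding r[symmetric] by (rule vec.span_base) simp
 thus "\<exists>s. gb \<Gamma> Q s = vec_zbar Z i" by auto
qed

text \<open>The three levels have doubled weights 5, 1, -3, and a bracket is nonzero only if the
  weights add up to 2 or -2. This gives the vanishing conditions of \<open>decomposition\<close>
  except \<open>inj\<close> and \<open>cyc\<close>.\<close>

theorem susy10_case:
 fixes gp :: "'d::finite => complex^'p::finite^'m::finite" and gm :: "'d => complex^'m^'p" and Z :: "real^'d => complex^'n::finite"
 assumes s10: "susy10 gp gm \<Gamma>" and Q: "holomorphic \<Gamma> Q" and hc: "holomorphic_coordinates \<Gamma> Q Z"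
 shows "\<exists>\<Phi>. filtered_local_quasi_iso (%g. g \<circ> Z) dol_loc (taut_loc \<Gamma> Q) \<Phi> \<and> gl_equivariant \<Gamma> (rep10 gp gm) Q Z \<Phi>"
proof -
 note Zc = coordinates_bracket[OF hc]
 have h: "CARD('d) = 10" "weyl_matrices gp gm" "equivariant_onto (spin gm gp) (spin gm gp) \<Gamma>" "!!a b. \<Gamma> a b = \<Gamma> b a"
  using s10 unfolding susy10_def by blast+
 have n: "int CARD('n) = 5" using card_coordinates[OF Zc(1,2)] h(1) by simp
 interpret fock gp gm gp gm \<Gamma> Z Q
  using h Zc Q by unfold_locales (auto simp: holomorphic_def linear_add linear_cmul)
 have lv: "levd m t \<longleftrightarrow> lev m t" for m t by (simp add: levd_def lev_def)
 have lW: "lev (5 - 4 * int k) s" if "s : We k" for k s using lev_W(1)[OF that] by (simp only: n)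
 have lQ: "lev 5 Q" using lev_vacuum[OF vacuum] by (simp only: n)
 have sym: "gb \<Gamma> s t = gb \<Gamma> t s" for s t using gb_commute[of \<Gamma> 1 \<Gamma> s t] h(4) by simp
 \<comment> \<open>The weight 5 - 4 k is then at most -7, too low to be balanced by any
   level.\<close>
 have z: "s = 0" if "k \<ge> 3" "s : We k" for k s
  by (rule right_zero[of "5 - 4 * int k"]) (use lW[OF that(2)] that(1) in \<open>auto simp: lv n\<close>)
 have wz: "gb \<Gamma> s t = 0" if "lev m s" "lev m' t" "m + m' ~= 2" "m + m' ~= -2" for m m' s t
  using weight_zero[of m s m' t] that by (simp add: lv)
 have \<phi>12: "dot (fs Z i) (gb \<Gamma> x y) = 0" if "x : We 1" "y : We 2" for x y i
  using weight(1)[of "5 - 4 * int 1" x "5 - 4 * int 2" y i] lW[OF that(1)] lW[OF that(2)] by (simp add: lv)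
 have G22: "gb \<Gamma> x y = 0" if "x : We 2" "y : We 2" for x y
  using wz[OF lW[OF that(1)] lW[OF that(2)]] by simp
 have Q1: "gb \<Gamma> Q x = 0" if "x : We 1" for x using wz[OF lQ lW[OF that]] by simp
 have inj: "y = 0" if y: "y : We 2" "gb \<Gamma> Q y = 0" for y
 proof (rule top_injective[OF y(2)])
  show "dot (fs Z i) (gb \<Gamma> x y) = 0" if "x : We 1" for x i by (rule \<phi>12[OF that y(1)])
  show "gb \<Gamma> s y = 0" if "k \<ge> 2" "s : We k" for k s
  proof (cases "k = 2")
   case True
   thus ?thesis using G22 that y by blast
  next
   case False
   hence "k \<ge> 3" using that by linarith
   hence "s = 0" using z that by blast
   thus ?thesis by (simp add: gb_more)
  qed
 qed
 have cyc: "gb \<Gamma> x y = 0" if x: "x : We 1" and y: "y : We 2" and e: "gb \<Gamma> x x = gb \<Gamma> Q y" for x y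
 proof -
  \<comment> \<open>Equations are differentiated along a rotation X with X Q = x. From [Q, x] = 0
    follows [Q, X x] = - [x, x], hence X x = - y; then [x, x] = [Q, y] yields -2 [x, y] = [x, y],
    since X y = 0 for reasons of level.\<close>
  obtain X where X: "X : so" "spin gm gp X *v Q = x" "!!k s. s : We k ==> spin gm gp X *v s : We (Suc k)"
   using We1_so[OF x] by blast
  let ?X = "%s. spin gm gp X *v s"
  have x2: "?X x : We 2" using X(3)[OF x] by (simp add: numeral_2_eq_2)
  have y3: "?X y = 0" by (rule z[of 3]) (use X(3)[OF y] in \<open>simp_all add: numeral_3_eq_3\<close>)
  have "0 = gb \<Gamma> x x + gb \<Gamma> Q (?X x)" using gb_so[OF X(1), of Q x] by (simp add: X(2) Q1[OF x])
  hence "gb \<Gamma> Q (y + ?X x) = 0" by (simp add: gb_simps e)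
  hence "y + ?X x = 0" by (intro inj vec.subspace_add[OF subspace_We y x2])
  hence Xx: "?X x = - y" by (simp add: add_eq_0_iff)
  have "X *v gb \<Gamma> x x = - gb \<Gamma> x y - gb \<Gamma> x y" using gb_so[OF X(1), of x x] by (simp add: Xx gb_more sym[of y x])
  moreover have "X *v gb \<Gamma> Q y = gb \<Gamma> x y" using gb_so[OF X(1), of Q y] by (simp add: X(2) y3 gb_more)
  ultimately have "- gb \<Gamma> x y - gb \<Gamma> x y = gb \<Gamma> x y" by (simp add: e)
  hence "- (gb \<Gamma> x y $ i) - gb \<Gamma> x y $ i = gb \<Gamma> x y $ i" for i by (metis vector_minus_component vector_uminus_component)
  hence "3 * gb \<Gamma> x y $ i = 0" for i by (simp add: algebra_simps)
  thus ?thesis by (simp add: vec_eq_iff)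
 qed
 interpret decomposition \<Gamma> Q Z "We 1" "We 2"
 proof unfold_locales
  show "\<exists>c. \<exists>x\<in>We 1. \<exists>y\<in>We 2. s = c *s Q + x + y" for s by (rule S_split[of 3]) (use z in auto)
  show "gb \<Gamma> Q Q = 0" using wz[OF lQ lQ] by simp
  show "dot (ps Z i) (gb \<Gamma> x x') = 0" if "x : We 1" "x' : We 1" for i x x'
   using weight(2)[of "5 - 4 * int 1" x "5 - 4 * int 1" x' i] lW[OF that(1)] lW[OF that(2)] by (simp add: lv)
 qed (use Zc h(4) \<phi>12 G22 Q1 inj cyc subspace_We in \<open>auto simp: linear_add linear_cmul simp del: We.simps\<close>)
 show ?thesis
 proof (rule equivariant_quasi_iso)
  fix X :: "complex^'d^'d" and a b assume X: "gl_stab Z X a b"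
  hence "spin gm gp X *v Q = (trace a / 2) *s Q" by (intro spin_vacuum vacuum) (simp add: gl_stab_def)
  moreover have "X : so" using X by (simp add: gl_stab_def)
  ultimately show "(\<forall>c e. X *v \<Gamma> c e = (SU f. rep10 gp gm X $ f $ c *s \<Gamma> f e) + (SU f. rep10 gp gm X $ f $ e *s \<Gamma> c f)) \<and>
   rep10 gp gm X *v Q = (trace a / 2) *s Q \<and> (\<forall>x\<in>We 1. rep10 gp gm X *v x : We 1) \<and> (\<forall>y\<in>We 2. rep10 gp gm X *v y : We 2)"
   using h(3) spin_We[OF X] unfolding rep10_def equivariant_onto_def by blast
 qed
qed

lemma sum_pair: "(SU x. f x) = (SU a i. f (a, i))" for f :: "'a::finite \<times> 'b::finite => 'z::comm_monoid_add"
 unfolding sum.cartesian_product by simp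

text \<open>The spinors have two levels, of doubled weights 3 and -1, and Q is q tensored with a
  vector of R. In a basis of R starting with that vector, S2 is the lower level in the second
  direction.\<close>

theorem susy6_case:
 fixes gp :: "'d::finite => complex^'p::finite^'m::finite" and gm :: "'d => complex^'m^'p" and Z :: "real^'d => complex^'n::finite"
 assumes s6: "susy6 gp gm \<Gamma>" and Q: "holomorphic \<Gamma> Q" and hc: "holomorphic_coordinates \<Gamma> Q Z"
 shows "\<exists>\<Phi>. filtered_local_quasi_iso (%g. g \<circ> Z) dol_loc (taut_loc \<Gamma> Q) \<Phi> \<and> gl_equivariant \<Gamma> (rep6 gp gm) Q Z \<Phi>"
proof -
 note Zc = coordinates_bracket[OF hc]
 obtain G and \<omega> :: "complex^2^2" where h: "CARD('d) = 6" "weyl_matrices gp gm" "equivariant_onto (spin gm gp) (spin gm gp) G"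
  "!!a b. G a b = - G b a" "transpose \<omega> = - \<omega>" "invertible \<omega>" "!!a i b j. \<Gamma> (a, i) (b, j) = (\<omega> $ i $ j) *s G a b"
  using s6 unfolding susy6_def by blast
 have n: "int CARD('n) = 3" using card_coordinates[OF Zc(1,2)] h(1) by simp
 define part where "part i B = (\<chi> a. B $ (a, i))" for i :: 2 and B :: "complex^('p \<times> 2)"
 have "\<exists>i. part i Q ~= 0"
 proof (rule ccontr)
  assume "\<nexists>i. part i Q ~= 0"
  hence p: "part i Q = 0" for i by blast
  have "Q $ (a, i) = part i Q $ a" for a i by (simp add: part_def)
  hence "Q $ (a, i) = 0" for a i by (simp add: p)
  hence "Q = 0" by (simp add: vec_eq_iff)
  thus False using Q by (simp add: holomorphic_def)
 qed
 then obtain i0 where q0: "part i0 Q ~= 0" by blast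
 define i1 :: 2 where "i1 = (if i0 = 1 then 2 else 1)"
 have alt: "i ~= i0 \<longleftrightarrow> i = i1" for i :: 2 using exhaust_2[of i] exhaust_2[of i0] by (auto simp: i1_def)
 have U: "UNIV = {i0, i1}" using alt by blast
 have ne: "i0 ~= i1" "i1 ~= i0" using alt[of i1] by auto
 have a: "\<omega> $ j $ i = - \<omega> $ i $ j" for i j using arg_cong[OF h(5), of "%M. M $ i $ j"] by (simp add: transpose_def)
 define w where "w = \<omega> $ i0 $ i1"
 have \<omega>: "\<omega> $ i $ i = 0" "\<omega> $ i1 $ i0 = - w" "\<omega> $ i0 $ i1 = w" for i using a[of i i] a[of i1 i0] by (simp_all add: w_def)
 have w0: "w ~= 0"
 proof
  assume "w = 0"
  hence "\<omega> $ i $ j = 0" for i j using \<omega> alt[of i] alt[of j] by (cases "i = i0"; cases "j = i0") auto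
  hence "\<omega> = 0" by (simp add: vec_eq_iff)
  moreover obtain B where "\<omega> ** B = mat 1" using h(6) invertible_right_inverse by blast
  ultimately have "(mat 1 :: complex^2^2) = 0 ** B" by simp
  hence "(mat 1 :: complex^2^2) $ i0 $ i0 = (0 ** B) $ i0 $ i0" by simp
  hence "(mat 1 :: complex^2^2) $ i0 $ i0 = 0" by (simp add: matrix_matrix_mult_def)
  thus False by (simp add: mat_def)
 qed
 have gb\<Gamma>: "gb \<Gamma> A B = w *s (gb G (part i0 A) (part i1 B) - gb G (part i1 A) (part i0 B))" for A B
 proof -
  let ?T = "%a i b j. (A $ (a, i) * B $ (b, j)) *s (\<omega> $ i $ j *s G a b)"
  have "gb \<Gamma> A B = (SU a i. SU b j. ?T a i b j)"
   by (simp add: gb_def sum_pair h(7))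
  also have "\<dots> = (SU i a. SU b j. ?T a i b j)" by (rule sum.swap)
  also have "\<dots> = (SU i a. SU j b. ?T a i b j)" by (intro sum.cong refl) (rule sum.swap)
  also have "\<dots> = (SU i j. SU a b. ?T a i b j)" by (rule sum.cong[OF refl]) (rule sum.swap)
  also have "\<dots> = (SU i j. \<omega> $ i $ j *s gb G (part i A) (part j B))"
   by (simp add: gb_def part_def vec.scale_sum_right mult_ac)
  also have "\<dots> = w *s (gb G (part i0 A) (part i1 B) - gb G (part i1 A) (part i0 B))"
   unfolding U using ne by (simp add: \<omega> vec.scale_right_diff_distrib)
  finally show ?thesis .
 qed
 \<comment> \<open>Test spinors supported on one basis vector of R are paired by \<omega> with the
   other one, which isolates each part of Q.\<close>
 have \<psi>G: "dot (ps Z k) (gb G (part j Q) b) = 0" for k j b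
 proof -
  define B where "B l = (\<chi> x. if snd x = l then b $ fst x else 0)" for l :: 2
  have p: "part i (B l) = (if i = l then b else 0)" for i l by (simp add: part_def B_def vec_eq_iff)
  show ?thesis
  proof (cases "j = i0")
   case True
   thus ?thesis using Zc(3)[of k "B i1"] w0 ne by (simp add: gb\<Gamma> p dot_simps gb_more)
  next
   case False
   hence "j = i1" using alt by blast
   thus ?thesis using Zc(3)[of k "B i0"] w0 ne by (simp add: gb\<Gamma> p dot_simps gb_more)
  qed
 qed
 define q where "q = part i0 Q"
 interpret fock gp gm gp gm G Z q
  using h(2,3) Zc(1,2) q0 \<psi>G
  unfolding fock_def fock_axioms_def equivariant_pair_def equivariant_pair_axioms_def weyl_pair_def q_def by blast
 have lv: "levd m t \<longleftrightarrow> lev m t" for m t by (simp add: levd_def lev_def)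
 have lW: "lev (3 - 4 * int k) s" if "s : We k" for k s using lev_W(1)[OF that] by (simp only: n)
 have z: "s = 0" if "k \<ge> 2" "s : We k" for k s
  by (rule right_zero[of "3 - 4 * int k"]) (use lW[OF that(2)] that(1) in \<open>auto simp: lv n\<close>)
 have split: "\<exists>c. \<exists>x\<in>We 1. s = c *s q + x" for s
 proof -
  obtain c x y where "x : We 1" "y : We 2" "s = c *s q + x + y" using S_split[of 2 s] z by auto
  moreover from this have "y = 0" using z[of 2 y] by simp
  ultimately show ?thesis by auto
 qed
 have "G a b = (-1) *s G b a" for a b using h(4)[of a b] by (simp add: vec_eq_iff)
 from gb_commute[OF this] have anti: "gb G s t = - gb G t s" for s t by (simp add: vec_eq_iff)
 have self: "gb G s s = 0" for s
 proof -
  have "gb G s s $ i = - gb G s s $ i" for i using anti[of s s] by (metis vector_uminus_component)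
  thus ?thesis by (simp add: vec_eq_iff)
 qed
 have \<phi>11: "dot (fs Z i) (gb G x y) = 0" if "x : We 1" "y : We 1" for x y i
  using weight(1)[of "3 - 4 * int 1" x "3 - 4 * int 1" y i] lW[OF that(1)] lW[OF that(2)] by (simp add: lv)
 have inj: "y = 0" if y: "y : We 1" "gb G q y = 0" for y
 proof (rule top_injective[OF y(2)])
  show "dot (fs Z i) (gb G x y) = 0" if "x : We 1" for x i by (rule \<phi>11[OF that y(1)])
  show "gb G s y = 0" if "k \<ge> 2" "s : We k" for k s using z[OF that] by (simp add: gb_more)
 qed
 \<comment> \<open>Both parts of Q are annihilated by the \<open>ps\<close>, so both have weight 3;
   a component in \<open>We 1\<close> would have weight -1. Hence the parts are proportional and Q
   has rank one.\<close>
 obtain r1 where r1: "part i1 Q = r1 *s q"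
 proof -
  obtain c x where c: "x : We 1" "part i1 Q = c *s q + x" using split by blast
  have "lev 3 (part i1 Q)" using lev_vacuum[of "part i1 Q"] vacuum_iff[OF \<psi>G] by (simp only: n)
  moreover have "lev 3 q" using lev_vacuum[OF vacuum] by (simp only: n)
  moreover have "lev (-1) x" using lW[OF c(1)] by simp
  ultimately have "(3/2) *s (c *s q + x) = c *s ((3/2) *s q) + (-1/2) *s x"
   unfolding lev_def c(2) by (simp add: matrix_vector_right_distrib vector_scalar_commute)
  hence "(3/2) * x $ i = (-1/2) * x $ i" for i by (simp add: vec_eq_iff algebra_simps)
  hence "x = 0" by (simp add: vec_eq_iff)
  thus ?thesis using c(2) by (intro that[of c]) simp
 qed
 \<comment> \<open>The spinors b and b' are coordinates in the basis of R made of the direction of Q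
   and the vector i1; this gives Q = mk q 0.\<close>
 define mk where "mk b b' = (\<chi> x. if snd x = i0 then b $ fst x else r1 * b $ fst x + b' $ fst x)" for b b' :: "complex^'p"
 have pm: "part i0 (mk b b') = b" "part i1 (mk b b') = r1 *s b + b'" for b b'
  using ne by (simp_all add: part_def mk_def vec_eq_iff)
 have gbmk: "gb \<Gamma> (mk s s') (mk t t') = w *s (gb G s t' - gb G s' t)" for s s' t t'
  by (simp add: gb\<Gamma> pm gb_simps)
 have mk_split: "B = mk (part i0 B) (part i1 B - r1 *s part i0 B)" for B
 proof -
  have "B $ (k, i) = mk (part i0 B) (part i1 B - r1 *s part i0 B) $ (k, i)" for k i
   using alt[of i] by (cases "i = i0") (simp_all add: mk_def part_def)
  thus ?thesis by (simp add: vec_eq_iff)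
 qed
 have Qmk: "Q = mk q 0" using mk_split[of Q] by (simp add: r1 q_def[symmetric])
 have mk_lin: "c *s mk b b' = mk (c *s b) (c *s b')" "mk b b' + mk t t' = mk (b + t) (b' + t')" "mk 0 0 = 0" for c b b' t t'
  by (simp_all add: mk_def vec_eq_iff algebra_simps)
 \<comment> \<open>[Q, -] vanishes on the first direction because \<omega> is alternating, and on q
   in the second direction because G is; together with \<open>We 1\<close> in the first direction,
   the multiples of q therefore belong to the middle summand.\<close>
 define S1 where "S1 = {mk x (c *s q) |x c. x : We 1}"
 define S2 where "S2 = {mk 0 y |y. y : We 1}"
 interpret decomposition \<Gamma> Q Z S1 S2
 proof unfold_locales
  show "Z (x + y) = Z x + Z y" "Z (c *\<^sub>R x) = c *\<^sub>R Z x" for x y c using Zc by (simp_all add: linear_add linear_cmul)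
  show "bij Z" by (rule Zc)
  show "\<Gamma> s t = \<Gamma> t s" for s t
  proof -
   have "\<Gamma> (fst s, snd s) (fst t, snd t) = \<Gamma> (fst t, snd t) (fst s, snd s)"
    unfolding h(7) by (subst a, subst h(4)) simp
   thus ?thesis by simp
  qed
  have z1: "0 : We 1" by (rule vec.subspace_0[OF subspace_We])
  show "vec.subspace S1"
   unfolding vec.subspace_def
  proof (intro conjI ballI allI)
   show "0 : S1" unfolding S1_def using z1 mk_lin(3) by (auto intro!: exI[of _ 0] simp del: We.simps)
   show "x + y : S1" if "x : S1" "y : S1" for x y
    using that vec.subspace_add[OF subspace_We[of 1]] unfolding S1_def
    by (clarsimp simp: mk_lin simp del: We.simps One_nat_def) (metis vec.scale_left_distrib)
   show "c *s x : S1" if "x : S1" for c x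
    using that vec.subspace_scale[OF subspace_We[of 1]] unfolding S1_def
    by (clarsimp simp: mk_lin simp del: We.simps One_nat_def) blast
  qed
  show "vec.subspace S2"
   unfolding vec.subspace_def
  proof (intro conjI ballI allI)
   show "0 : S2" unfolding S2_def using z1 mk_lin(3) by (auto intro!: exI[of _ 0] simp del: We.simps)
   show "x + y : S2" if "x : S2" "y : S2" for x y
    using that vec.subspace_add[OF subspace_We[of 1]] unfolding S2_def
    by (clarsimp simp: mk_lin simp del: We.simps One_nat_def) blast
   show "c *s x : S2" if "x : S2" for c x
    using that vec.subspace_scale[OF subspace_We[of 1]] unfolding S2_def
    by (clarsimp simp: mk_lin simp del: We.simps One_nat_def) blast
  qed
  show "\<exists>c. \<exists>x\<in>S1. \<exists>y\<in>S2. s = c *s Q + x + y" for s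
  proof -
   obtain c x where x: "x : We 1" "part i0 s = c *s q + x" using split by blast
   obtain c' y where y: "y : We 1" "part i1 s - r1 *s part i0 s = c' *s q + y" using split by blast
   have "s = c *s Q + mk x (c' *s q) + mk 0 y" by (subst mk_split) (simp add: Qmk mk_lin x(2)[symmetric] y(2)[symmetric])
   thus ?thesis unfolding S1_def S2_def using x(1) y(1) by blast
  qed
  show "gb \<Gamma> Q Q = 0" unfolding Qmk gbmk by (simp add: gb_more)
  show "gb \<Gamma> Q x = 0" if "x : S1" for x using that by (auto simp: S1_def Qmk gbmk gb_more gb_simps self)
  show "dot (ps Z i) (gb \<Gamma> Q s) = 0" for i s by (rule Zc)
  show "\<exists>s. gb \<Gamma> Q s = vec_zbar Z i" for i by (rule Zc)
  show "dot (ps Z i) (gb \<Gamma> x x') = 0" if "x : S1" "x' : S1" for i x x'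
   using that by (auto simp: S1_def gbmk gb_simps dot_simps gq anti[of _ q])
  show "dot (fs Z i) (gb \<Gamma> x y) = 0" if "x : S1" "y : S2" for i x y
   using that \<phi>11 by (auto simp: S1_def S2_def gbmk gb_more dot_simps simp del: We.simps One_nat_def)
  show "gb \<Gamma> y y' = 0" if "y : S2" "y' : S2" for y y' using that by (auto simp: S2_def gbmk gb_more)
  show "y = 0" if "y : S2" "gb \<Gamma> Q y = 0" for y
  proof -
   from that(1) obtain t where y: "t : We 1" "y = mk 0 t" unfolding S2_def by blast
   have "w *s gb G q t = 0" using that(2) by (simp add: y(2) Qmk gbmk gb_more)
   hence "gb G q t = 0" using w0 by (simp only: vec.scale_eq_0_iff) simp
   hence "t = 0" by (rule inj[OF y(1)])
   thus ?thesis by (simp add: y(2) mk_lin(3))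
  qed
  show "gb \<Gamma> x y = 0" if "x : S1" "y : S2" and e: "gb \<Gamma> x x = gb \<Gamma> Q y" for x y
  proof -
   from that obtain x' c y' where xy: "x' : We 1" "x = mk x' (c *s q)" "y' : We 1" "y = mk 0 y'" unfolding S1_def S2_def by blast
   have "w *s (gb G x' (c *s q) - gb G (c *s q) x') = w *s gb G q y'" using e by (simp add: xy Qmk gbmk gb_more)
   hence "gb G x' (c *s q) - gb G (c *s q) x' = gb G q y'" using w0 by (simp only: vec.scale_cancel_left) simp
   hence y': "gb G q y' = gb G x' (c *s q) - gb G (c *s q) x'" by (rule HOL.sym)
   \<comment> \<open>Injectivity makes y' a multiple of x', so that [x, y] becomes a multiple of G
     x' x', which is 0.\<close>
   have "gb G q (y' + (2 * c) *s x') = 0"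
    unfolding gb_simps(2) y' by (simp add: gb_simps anti[of x' q] vec_eq_iff algebra_simps)
   moreover have "y' + (2 * c) *s x' : We 1" by (intro vec.subspace_add[OF subspace_We] vec.subspace_scale[OF subspace_We] xy)
   ultimately have "y' + (2 * c) *s x' = 0" using inj by blast
   hence "y' = (- (2 * c)) *s x'" by (simp add: eq_neg_iff_add_eq_0)
   thus ?thesis unfolding xy gbmk by (simp add: gb_simps gb_more self)
  qed
 qed
 show ?thesis
 proof (rule equivariant_quasi_iso)
  fix X :: "complex^'d^'d" and a b assume X: "gl_stab Z X a b"
  let ?r = "spin gm gp X"
  have vq: "?r *v q = (trace a / 2) *s q" by (intro spin_vacuum vacuum) (use X in \<open>simp add: gl_stab_def\<close>)
  have so: "X : so" using X by (simp add: gl_stab_def)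
  have rmk: "rep6 gp gm X *v mk b b' = mk (?r *v b) (?r *v b')" for b b'
  proof -
   have "(rep6 gp gm X *v mk b b') $ (k, i) = mk (?r *v b) (?r *v b') $ (k, i)" for k i
   proof -
    have "(rep6 gp gm X *v mk b b') $ (k, i) = (SU l j. if j = i then ?r $ k $ l * mk b b' $ (l, i) else 0)"
     unfolding matrix_vector_mult_def rep6_def sum_pair vec_lambda_beta by (intro sum.cong refl) auto
    thus ?thesis by (simp add: mk_def matrix_vector_mult_def sum.distrib distrib_left sum_distrib_left mult_ac)
   qed
   thus ?thesis by (simp add: vec_eq_iff)
  qed
  have eq: "X *v \<Gamma> c e = (SU f. rep6 gp gm X $ f $ c *s \<Gamma> f e) + (SU f. rep6 gp gm X $ f $ e *s \<Gamma> c f)" for c e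
  proof -
   obtain c1 c2 e1 e2 where ce: "c = (c1, c2)" "e = (e1, e2)" by (cases c; cases e)
   have 1: "(SU f. rep6 gp gm X $ f $ (c1, c2) *s \<Gamma> f (e1, e2)) = \<omega> $ c2 $ e2 *s (SU f. ?r $ f $ c1 *s G f e1)"
   proof -
    have "(SU f. rep6 gp gm X $ f $ (c1, c2) *s \<Gamma> f (e1, e2)) = (SU f j. if j = c2 then (\<omega> $ c2 $ e2) *s (?r $ f $ c1 *s G f e1) else 0)"
     unfolding sum_pair h(7) rep6_def by (intro sum.cong refl) (auto simp: mult.commute)
    thus ?thesis by (simp add: vec.scale_sum_right)
   qed
   have 2: "(SU f. rep6 gp gm X $ f $ (e1, e2) *s \<Gamma> (c1, c2) f) = \<omega> $ c2 $ e2 *s (SU f. ?r $ f $ e1 *s G c1 f)"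
   proof -
    have "(SU f. rep6 gp gm X $ f $ (e1, e2) *s \<Gamma> (c1, c2) f) = (SU f j. if j = e2 then (\<omega> $ c2 $ e2) *s (?r $ f $ e1 *s G c1 f) else 0)"
     unfolding sum_pair h(7) rep6_def by (intro sum.cong refl) (auto simp: mult.commute)
    thus ?thesis by (simp add: vec.scale_sum_right)
   qed
   have g: "X *v G c1 e1 = (SU f. ?r $ f $ c1 *s G f e1) + (SU f. ?r $ f $ e1 *s G c1 f)"
    using h(3) so unfolding equivariant_onto_def by blast
   show ?thesis unfolding ce h(7) 1 2 vector_scalar_commute g vec.scale_right_distrib ..
  qed
  have "rep6 gp gm X *v Q = (trace a / 2) *s Q" by (simp add: Qmk rmk vq mk_lin)
  moreover have "rep6 gp gm X *v x : S1" if "x : S1" for x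
  proof -
   from that obtain x' c where x: "x' : We 1" "x = mk x' (c *s q)" unfolding S1_def by blast
   have "rep6 gp gm X *v x = mk (?r *v x') ((c * (trace a / 2)) *s q)" by (simp add: x(2) rmk vector_scalar_commute vq)
   thus ?thesis unfolding S1_def using spin_We[OF X x(1)] by blast
  qed
  moreover have "rep6 gp gm X *v y : S2" if "y : S2" for y
  proof -
   from that obtain y' where y: "y' : We 1" "y = mk 0 y'" unfolding S2_def by blast
   have "rep6 gp gm X *v y = mk 0 (?r *v y')" by (simp add: y(2) rmk)
   thus ?thesis unfolding S2_def using spin_We[OF X y(1)] by blast
  qed
  ultimately show "(\<forall>c e. X *v \<Gamma> c e = (SU f. rep6 gp gm X $ f $ c *s \<Gamma> f e) + (SU f. rep6 gp gm X $ f $ e *s \<Gamma> c f)) \<and>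
   rep6 gp gm X *v Q = (trace a / 2) *s Q \<and> (\<forall>x\<in>S1. rep6 gp gm X *v x : S1) \<and> (\<forall>y\<in>S2. rep6 gp gm X *v y : S2)"
   using eq by blast
 qed
qed

lemma sum_sum_type: "(SU x. f x) = (SU a. f (Inl a)) + (SU b. f (Inr b))" for f :: "'a::finite + 'b::finite => 'z::comm_monoid_add"
 by (subst UNIV_Plus_UNIV[symmetric], subst sum.Plus) simp_all

text \<open>The levels of the first chirality have doubled weights 2 and -2, and the second
  chirality is entirely of weight 0 and serves as S2. As [S1, S1] = 0, the condition
  \<open>cyc\<close> concerns only y = 0.\<close>

theorem susy4_case:
 fixes gp :: "'d::finite => complex^'p::finite^'m::finite" and gm :: "'d => complex^'m^'p" and Z :: "real^'d => complex^'n::finite"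
 assumes s4: "susy4 gp gm \<Gamma>" and Q: "holomorphic4 Q" and hc: "holomorphic_coordinates \<Gamma> Q Z"
 shows "\<exists>\<Phi>. filtered_local_quasi_iso (%g. g \<circ> Z) dol_loc (taut_loc \<Gamma> Q) \<Phi> \<and> gl_equivariant \<Gamma> (rep4 gp gm) Q Z \<Phi>"
proof -
 note Zc = coordinates_bracket[OF hc]
 obtain G where h: "CARD('d) = 4" "weyl_matrices gp gm" "equivariant_onto (spin gm gp) (spin gp gm) G"
  "!!a b. \<Gamma> (Inl a) (Inr b) = G a b" "!!a b. \<Gamma> (Inr b) (Inl a) = G a b" "!!a b. \<Gamma> (Inl a) (Inl b) = 0" "!!a b. \<Gamma> (Inr a) (Inr b) = 0"
  using s4 unfolding susy4_def by blast
 have n: "int CARD('n) = 2" using card_coordinates[OF Zc(1,2)] h(1) by simp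
 have wp: "weyl_pair gp gm" "weyl_pair gm gp" using h(2) weyl_pair.weyl_swap[of gp gm] by (simp_all add: weyl_pair_def)
 define mk where "mk s t = (\<chi> x. case x of Inl i => s $ i | Inr j => t $ j)" for s :: "complex^'p" and t :: "complex^'m"
 have mk_ex: "\<exists>s t. B = mk s t" for B
  by (rule exI[of _ "\<chi> a. B $ Inl a"], rule exI[of _ "\<chi> b. B $ Inr b"]) (simp add: mk_def vec_eq_iff split: sum.split)
 have mk_lin: "c *s mk b b' = mk (c *s b) (c *s b')" "mk b b' + mk t t' = mk (b + t) (b' + t')" "mk 0 0 = 0" for c b b' t t'
  by (simp_all add: mk_def vec_eq_iff split: sum.split)
 have gbmk: "gb \<Gamma> (mk s t) (mk s' t') = gb G s t' + gb G s' t" for s t s' t'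
 proof -
  have "gb \<Gamma> (mk s t) (mk s' t') = (SU a b. (s $ a * t' $ b) *s G a b) + (SU b a. (t $ b * s' $ a) *s G a b)"
   by (simp add: gb_def sum_sum_type mk_def h)
  also have "(SU b a. (t $ b * s' $ a) *s G a b) = (SU a b. (s' $ a * t $ b) *s G a b)"
   by (subst sum.swap) (simp add: mult.commute)
  finally show ?thesis by (simp add: gb_def)
 qed
 define q where "q = (\<chi> a. Q $ Inl a)"
 have Qmk: "Q = mk q 0" using Q by (simp add: mk_def q_def vec_eq_iff holomorphic4_def split: sum.split)
 have q0: "q ~= 0" using Q Qmk mk_lin(3) by (auto simp: holomorphic4_def)
 have \<psi>G: "dot (ps Z k) (gb G q b) = 0" for k b using Zc(3)[of k "mk 0 b"] by (simp add: Qmk gbmk gb_more)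
 interpret fock gp gm gm gp G Z q
  using h Zc q0 \<psi>G wp unfolding fock_def fock_axioms_def equivariant_pair_def equivariant_pair_axioms_def by blast
 have lv: "levd m t \<longleftrightarrow> lev' m t" for m t by (simp add: levd_def lev'_def)
 have lW: "lev (2 - 4 * int k) s" if "s : We k" for k s using lev_W(1)[OF that] by (simp only: n)
 have lO: "levd (- 4 * int k) t" if "t : Wo k" for k t using lev_W(2)[OF that] unfolding n lv by simp
 have zo: "t = 0" if "k \<ge> 1" "t : Wo k" for k t
  by (rule right_zero[of "- 4 * int k"]) (use lO[OF that(2)] that(1) in \<open>auto simp: n\<close>)
 \<comment> \<open>The odd levels above \<open>Wo 0\<close> vanish for reasons of weight, and all
   odd levels together span the second chirality.\<close>
 have l0: "levd 0 t" for t
 proof -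
  have "vec.span (\<Union>k. Wo k) \<subseteq> Wo 0"
  proof (rule vec.span_minimal[OF _ subspace_Wo])
   have "t : Wo 0" if "t : Wo k" for k t
    using that zo[of k t] vec.subspace_0[OF subspace_Wo[of 0]] by (cases k) auto
   thus "(\<Union>k. Wo k) \<subseteq> Wo 0" by blast
  qed
  hence "t : Wo 0" using total by blast
  from lO[OF this] show ?thesis by simp
 qed
 have z: "s = 0" if "k \<ge> 2" "s : We k" for k s
 proof (rule left_kernel)
  show "gb G s t = 0" for t by (rule weight_zero[OF lW[OF that(2)] l0]) (use that(1) in auto)
 qed
 have split: "\<exists>c. \<exists>x\<in>We 1. s = c *s q + x" for s
 proof -
  obtain c x y where "x : We 1" "y : We 2" "s = c *s q + x + y" using S_split[of 2 s] z by auto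
  moreover from this have "y = 0" using z[of 2 y] by simp
  ultimately show ?thesis by auto
 qed
 have \<phi>1: "dot (fs Z i) (gb G x y) = 0" if "x : We 1" for x y i
  using weight(1)[of "2 - 4 * int 1" x 0 y i] lW[OF that] l0 by simp
 have inj: "y = 0" if y: "gb G q y = 0" for y
 proof (rule top_injective[OF y])
  show "dot (fs Z i) (gb G x y) = 0" if "x : We 1" for x i by (rule \<phi>1[OF that])
  show "gb G s y = 0" if "k \<ge> 2" "s : We k" for k s using z[OF that] by (simp add: gb_more)
 qed
 define S1 where "S1 = {mk x 0 |x. x : We 1}"
 define S2 where "S2 = range (mk 0)"
 interpret decomposition \<Gamma> Q Z S1 S2
 proof unfold_locales
  show "Z (x + y) = Z x + Z y" "Z (c *\<^sub>R x) = c *\<^sub>R Z x" for x y c using Zc by (simp_all add: linear_add linear_cmul)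
  show "bij Z" by (rule Zc)
  show "\<Gamma> s t = \<Gamma> t s" for s t by (cases s; cases t) (simp_all add: h)
  have z1: "0 : We 1" by (rule vec.subspace_0[OF subspace_We])
  show "vec.subspace S1"
   unfolding vec.subspace_def
  proof (intro conjI ballI allI)
   show "0 : S1" unfolding S1_def using z1 mk_lin(3) by (auto intro!: exI[of _ 0] simp del: We.simps)
   show "x + y : S1" if "x : S1" "y : S1" for x y
    using that vec.subspace_add[OF subspace_We[of 1]] unfolding S1_def
    by (clarsimp simp: mk_lin simp del: We.simps One_nat_def) blast
   show "c *s x : S1" if "x : S1" for c x
    using that vec.subspace_scale[OF subspace_We[of 1]] unfolding S1_def
    by (clarsimp simp: mk_lin simp del: We.simps One_nat_def) blast
  qed
  have "0 : range (mk 0)" using rangeI[of "mk 0" 0] by (simp only: mk_lin(3))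
  thus "vec.subspace S2" unfolding vec.subspace_def S2_def by (auto simp: mk_lin)
  show "\<exists>c. \<exists>x\<in>S1. \<exists>y\<in>S2. s = c *s Q + x + y" for s
  proof -
   obtain u t where s: "s = mk u t" using mk_ex by blast
   obtain c x where x: "x : We 1" "u = c *s q + x" using split by blast
   have "s = c *s Q + mk x 0 + mk 0 t" by (simp add: s Qmk mk_lin x(2))
   thus ?thesis unfolding S1_def S2_def using x(1) by blast
  qed
  show "gb \<Gamma> Q Q = 0" unfolding Qmk gbmk by (simp add: gb_more)
  show "gb \<Gamma> Q x = 0" if "x : S1" for x using that by (auto simp: S1_def Qmk gbmk gb_more)
  show "dot (ps Z i) (gb \<Gamma> Q s) = 0" for i s by (rule Zc)
  show "\<exists>s. gb \<Gamma> Q s = vec_zbar Z i" for i by (rule Zc)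
  show "dot (ps Z i) (gb \<Gamma> x x') = 0" if "x : S1" "x' : S1" for i x x'
   using that by (auto simp: S1_def gbmk gb_more dot_simps)
  show "dot (fs Z i) (gb \<Gamma> x y) = 0" if "x : S1" "y : S2" for i x y
   using that \<phi>1 by (auto simp: S1_def S2_def gbmk gb_more simp del: We.simps One_nat_def)
  show "gb \<Gamma> y y' = 0" if "y : S2" "y' : S2" for y y' using that by (auto simp: S2_def gbmk gb_more)
  show i: "y = 0" if "y : S2" "gb \<Gamma> Q y = 0" for y
  proof -
   from that(1) obtain t where y: "y = mk 0 t" unfolding S2_def by blast
   have "t = 0" using that(2) by (intro inj) (simp add: y Qmk gbmk gb_more)
   thus ?thesis by (simp add: y mk_lin(3))
  qed
  show "gb \<Gamma> x y = 0" if "x : S1" "y : S2" and e: "gb \<Gamma> x x = gb \<Gamma> Q y" for x y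
  proof -
   have "gb \<Gamma> x x = 0" using that(1) by (auto simp: S1_def gbmk gb_more)
   hence "y = 0" using i[OF that(2)] e by simp
   thus ?thesis by (simp add: gb_more)
  qed
 qed
 show ?thesis
 proof (rule equivariant_quasi_iso)
  fix X :: "complex^'d^'d" and a b assume X: "gl_stab Z X a b"
  let ?r = "spin gm gp X" and ?r' = "spin gp gm X"
  have vq: "?r *v q = (trace a / 2) *s q" by (intro spin_vacuum vacuum) (use X in \<open>simp add: gl_stab_def\<close>)
  have so: "X : so" using X by (simp add: gl_stab_def)
  have rmk: "rep4 gp gm X *v mk s t = mk (?r *v s) (?r' *v t)" for s t
   unfolding vec_eq_iff
  proof
   fix i show "(rep4 gp gm X *v mk s t) $ i = mk (?r *v s) (?r' *v t) $ i"
    by (cases i) (simp_all add: matrix_vector_mult_def rep4_def sum_sum_type mk_def)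
  qed
  have g: "X *v G c e = (SU f. ?r $ f $ c *s G f e) + (SU f. ?r' $ f $ e *s G c f)" for c e
   using h(3) so unfolding equivariant_onto_def by blast
  have eq: "X *v \<Gamma> c e = (SU f. rep4 gp gm X $ f $ c *s \<Gamma> f e) + (SU f. rep4 gp gm X $ f $ e *s \<Gamma> c f)" for c e
   by (cases c; cases e) (simp_all add: sum_sum_type rep4_def h g add.commute)
  have "rep4 gp gm X *v Q = (trace a / 2) *s Q" by (simp add: Qmk rmk vq mk_lin)
  moreover have "rep4 gp gm X *v x : S1" if "x : S1" for x
  proof -
   from that obtain x' where x: "x' : We 1" "x = mk x' 0" unfolding S1_def by blast
   have "rep4 gp gm X *v x = mk (?r *v x') 0" by (simp add: x(2) rmk)
   thus ?thesis unfolding S1_def using spin_We[OF X x(1)] by blast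
  qed
  moreover have "rep4 gp gm X *v y : S2" if "y : S2" for y using that by (auto simp: S2_def rmk)
  ultimately show "(\<forall>c e. X *v \<Gamma> c e = (SU f. rep4 gp gm X $ f $ c *s \<Gamma> f e) + (SU f. rep4 gp gm X $ f $ e *s \<Gamma> c f)) \<and>
   rep4 gp gm X *v Q = (trace a / 2) *s Q \<and> (\<forall>x\<in>S1. rep4 gp gm X *v x : S1) \<and> (\<forall>y\<in>S2. rep4 gp gm X *v y : S2)"
   using eq by blast
 qed
qed

theorem theoremA:
  fixes \<gamma>p :: "'d::finite \<Rightarrow> complex^'p::finite^'m::finite"
    and \<gamma>m :: "'d \<Rightarrow> complex^'m^'p"
    and Z :: "real^'d \<Rightarrow> complex^'n::finite"
  shows
    "(\<forall>\<Gamma> Q. susy4 \<gamma>p \<gamma>m \<Gamma> \<and> holomorphic4 Q \<and> holomorphic_coordinates \<Gamma> Q Z \<longrightarrow>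
       (\<exists>\<Phi>. filtered_local_quasi_iso (\<lambda>g. g \<circ> Z) dol_loc (taut_loc \<Gamma> Q) \<Phi> \<and>
            gl_equivariant \<Gamma> (rep4 \<gamma>p \<gamma>m) Q Z \<Phi>)) \<and>
     (\<forall>\<Gamma> Q. susy6 \<gamma>p \<gamma>m \<Gamma> \<and> holomorphic \<Gamma> Q \<and> holomorphic_coordinates \<Gamma> Q Z \<longrightarrow>
       (\<exists>\<Phi>. filtered_local_quasi_iso (\<lambda>g. g \<circ> Z) dol_loc (taut_loc \<Gamma> Q) \<Phi> \<and>
            gl_equivariant \<Gamma> (rep6 \<gamma>p \<gamma>m) Q Z \<Phi>)) \<and>
     (\<forall>\<Gamma> Q. susy10 \<gamma>p \<gamma>m \<Gamma> \<and> holomorphic \<Gamma> Q \<and> holomorphic_coordinates \<Gamma> Q Z \<longrightarrow>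
       (\<exists>\<Phi>. filtered_local_quasi_iso (\<lambda>g. g \<circ> Z) dol_loc (taut_loc \<Gamma> Q) \<Phi> \<and>
            gl_equivariant \<Gamma> (rep10 \<gamma>p \<gamma>m) Q Z \<Phi>))"
  using susy4_case susy6_case susy10_case by blast

end
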